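(* Consider the system $$\ddot\psi(x,t)=\Delta\psi(x,t)+\zeta(t)\delta(x),\qquad \lim_{x\to0}\big(\psi(x,t)-\zeta(t)G(x)\big)=F(\zeta(t)),\qquad x\in\mathbb R^3,$$ where $G(x)=\frac1{4\pi|x|}$, $F=U'$ with $U\in C^2(\mathbb R)$ real and $U(\zeta)\to\infty$ as $\zeta\to\pm\infty$. Then: 1. For every $\Psi_0=(\psi_0,\pi_0)\in\mathcal D$ the system has a unique solution $\Psi(t)=(\psi(t),\dot\psi(t))\in C(\mathbb R,\mathcal D)$ with $\Psi(0)=\Psi_0$. 2. The energy $\mathcal H(\Psi(t)):=\frac12(\|\dot\psi(t)\|^2+\|\nabla\psi_{reg}(t)\|^2)+U(\zeta(t))$ is constant in $t\in\mathbb R$. 3. $|\zeta(t)|\le C(\Psi_0)$ for all $t\in\mathbb R$.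
   Context: $\|\cdot\|$ is the $L^2(\mathbb R^3)$ norm. $\dot H^1$ is the completion of $C_0^\infty(\mathbb R^3)$ in $\|\nabla\psi\|$, and $\dot H^2=\{f\in\dot H^1:\Delta f\in L^2\}$. $D$ is the set of $\psi\in L^2(\mathbb R^3)$ of the form $\psi=\psi_{reg}+\zeta G$ with $\psi_{reg}\in\dot H^2$, $\zeta\in\mathbb R$ and $\lim_{x\to0}\psi_{reg}(x)=F(\zeta)$. $\dot D$ is the set of $\pi\in L^2(\mathbb R^3)$ of the form $\pi=\pi_{reg}+\eta G$ with $\pi_{reg}\in\dot H^1$, $\eta\in\mathbb R$. $\mathcal D$ is the set of pairs $(\psi,\pi)\in D\times\dot D$. A solution is $\Psi(t)=(\psi(t),\dot\psi(t))\in\mathcal D$ for all $t$, with $\psi(t)=\psi_{reg}(t)+\zeta(t)G$, satisfying the first equation in the sense of distributions and the second (boundary) condition for all $t$. *)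

theory Defs
  imports "HOL-Analysis.Analysis"
begin

definition dder :: "'a::euclidean_space \<Rightarrow> ('a \<Rightarrow> real) \<Rightarrow> 'a \<Rightarrow> real" where
  "dder v f x = frechet_derivative f (at x) v"

fun ddirs :: "'a::euclidean_space list \<Rightarrow> ('a \<Rightarrow> real) \<Rightarrow> 'a \<Rightarrow> real" where
  "ddirs [] f = f"
| "ddirs (v # vs) f = dder v (ddirs vs f)"

text \<open>C_0^infinity: all iterated derivatives exist everywhere (hence C^infinity),
  and the support is compact.\<close>
definition test_fn :: "('a::euclidean_space \<Rightarrow> real) \<Rightarrow> bool" where
  "test_fn \<phi> \<longleftrightarrow> (\<forall>vs x. ddirs vs \<phi> differentiable (at x))
                   \<and> compact (closure {x. \<phi> x \<noteq> 0})"

type_synonym R3 = "real ^ 3"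

definition gradf :: "(R3 \<Rightarrow> real) \<Rightarrow> R3 \<Rightarrow> R3" where
  "gradf \<phi> x = (\<chi> i. dder (axis i 1) \<phi> x)"

definition lapf :: "(R3 \<Rightarrow> real) \<Rightarrow> R3 \<Rightarrow> real" where
  "lapf \<phi> x = (\<Sum>i\<in>UNIV. dder (axis i 1) (dder (axis i 1) \<phi>) x)"

definition Gr :: "R3 \<Rightarrow> real" where
  "Gr x = 1 / (4 * pi * norm x)"

definition L2 :: "(R3 \<Rightarrow> real) \<Rightarrow> bool" where
  "L2 f \<longleftrightarrow> f \<in> borel_measurable lborel \<and> integrable lborel (\<lambda>x. (f x)\<^sup>2)"

definition L2norm :: "(R3 \<Rightarrow> real) \<Rightarrow> real" where
  "L2norm f = sqrt (LINT x|lborel. (f x)\<^sup>2)"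

definition loc_int :: "(R3 \<Rightarrow> real) \<Rightarrow> bool" where
  "loc_int f \<longleftrightarrow> (\<forall>K. compact K \<longrightarrow> set_integrable lborel K f)"

definition is_wgrad :: "(R3 \<Rightarrow> real) \<Rightarrow> (R3 \<Rightarrow> R3) \<Rightarrow> bool" where
  "is_wgrad f g \<longleftrightarrow> (\<forall>i. L2 (\<lambda>x. g x $ i)) \<and>
     (\<forall>\<phi>. test_fn \<phi> \<longrightarrow> (\<forall>i. (LINT x|lborel. f x * dder (axis i 1) \<phi> x)
                                = - (LINT x|lborel. g x $ i * \<phi> x)))"

text \<open>dot H^1: completion of C_0^infinity in the norm of the gradient, realised as the
  distributional limits of sequences of test functions whose gradients converge in L^2.\<close>
definition Hdot1 :: "(R3 \<Rightarrow> real) \<Rightarrow> bool" where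
  "Hdot1 f \<longleftrightarrow> loc_int f \<and>
     (\<exists>g \<phi>s. is_wgrad f g \<and> (\<forall>n. test_fn (\<phi>s n)) \<and>
        (\<lambda>n. LINT x|lborel. (norm (gradf (\<phi>s n) x - g x))\<^sup>2) \<longlonglongrightarrow> 0 \<and>
        (\<forall>\<theta>. test_fn \<theta> \<longrightarrow>
           (\<lambda>n. LINT x|lborel. \<phi>s n x * \<theta> x) \<longlonglongrightarrow> (LINT x|lborel. f x * \<theta> x)))"

definition grad_norm :: "(R3 \<Rightarrow> real) \<Rightarrow> real" where
  "grad_norm f = L2norm (\<lambda>x. norm ((SOME g. is_wgrad f g) x))"

definition is_wlap :: "(R3 \<Rightarrow> real) \<Rightarrow> (R3 \<Rightarrow> real) \<Rightarrow> bool" where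
  "is_wlap f h \<longleftrightarrow> L2 h \<and>
     (\<forall>\<phi>. test_fn \<phi> \<longrightarrow> (LINT x|lborel. f x * lapf \<phi> x) = (LINT x|lborel. h x * \<phi> x))"

definition Hdot2 :: "(R3 \<Rightarrow> real) \<Rightarrow> bool" where
  "Hdot2 f \<longleftrightarrow> Hdot1 f \<and> (\<exists>h. is_wlap f h)"

definition lap_norm :: "(R3 \<Rightarrow> real) \<Rightarrow> real" where
  "lap_norm f = L2norm (SOME h. is_wlap f h)"

definition lim0 :: "(R3 \<Rightarrow> real) \<Rightarrow> real \<Rightarrow> bool" where
  "lim0 f c \<longleftrightarrow> (\<exists>h. (AE x in lborel. h x = f x) \<and> (h \<longlongrightarrow> c) (at 0))"

definition inD :: "(real \<Rightarrow> real) \<Rightarrow> (R3 \<Rightarrow> real) \<Rightarrow> bool" where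
  "inD F \<psi> \<longleftrightarrow> L2 \<psi> \<and> (\<exists>r \<zeta>. Hdot2 r \<and> (AE x in lborel. \<psi> x = r x + \<zeta> * Gr x) \<and> lim0 r (F \<zeta>))"

definition inDdot :: "(R3 \<Rightarrow> real) \<Rightarrow> bool" where
  "inDdot \<pi> \<longleftrightarrow> L2 \<pi> \<and> (\<exists>r \<eta>. Hdot1 r \<and> (AE x in lborel. \<pi> x = r x + \<eta> * Gr x))"

definition coef :: "(R3 \<Rightarrow> real) \<Rightarrow> real" where
  "coef f = (THE \<zeta>. \<exists>r. Hdot1 r \<and> (AE x in lborel. f x = r x + \<zeta> * Gr x))"

definition regp :: "(R3 \<Rightarrow> real) \<Rightarrow> R3 \<Rightarrow> real" where
  "regp f x = f x - coef f * Gr x"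

definition Ddist :: "(R3 \<Rightarrow> real) \<times> (R3 \<Rightarrow> real) \<Rightarrow> (R3 \<Rightarrow> real) \<times> (R3 \<Rightarrow> real) \<Rightarrow> real" where
  "Ddist P Q = (let (\<psi>1, \<pi>1) = P; (\<psi>2, \<pi>2) = Q in
      L2norm (\<lambda>x. \<psi>1 x - \<psi>2 x)
    + grad_norm (\<lambda>x. regp \<psi>1 x - regp \<psi>2 x)
    + lap_norm (\<lambda>x. regp \<psi>1 x - regp \<psi>2 x)
    + \<bar>coef \<psi>1 - coef \<psi>2\<bar>
    + L2norm (\<lambda>x. \<pi>1 x - \<pi>2 x)
    + grad_norm (\<lambda>x. regp \<pi>1 x - regp \<pi>2 x)
    + \<bar>coef \<pi>1 - coef \<pi>2\<bar>)"

definition dtt :: "(R3 \<times> real \<Rightarrow> real) \<Rightarrow> R3 \<times> real \<Rightarrow> real" where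
  "dtt \<phi> = dder (0, 1) (dder (0, 1) \<phi>)"

definition dt :: "(R3 \<times> real \<Rightarrow> real) \<Rightarrow> R3 \<times> real \<Rightarrow> real" where
  "dt \<phi> = dder (0, 1) \<phi>"

definition lapx :: "(R3 \<times> real \<Rightarrow> real) \<Rightarrow> R3 \<times> real \<Rightarrow> real" where
  "lapx \<phi> p = (\<Sum>i\<in>UNIV. dder (axis i 1, 0) (dder (axis i 1, 0) \<phi>) p)"

definition is_solution :: "(real \<Rightarrow> real) \<Rightarrow> (real \<Rightarrow> R3 \<Rightarrow> real) \<Rightarrow> (real \<Rightarrow> R3 \<Rightarrow> real) \<Rightarrow> bool" where
  "is_solution F \<psi> \<pi> \<longleftrightarrow>
     (\<forall>t. inD F (\<psi> t) \<and> inDdot (\<pi> t))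
   \<and> (\<forall>t0. ((\<lambda>t. Ddist (\<psi> t, \<pi> t) (\<psi> t0, \<pi> t0)) \<longlongrightarrow> 0) (at t0))
   \<and> (\<forall>\<phi>. test_fn \<phi> \<longrightarrow>
        (LINT t|lborel. LINT x|lborel. \<psi> t x * dt \<phi> (x, t))
        = - (LINT t|lborel. LINT x|lborel. \<pi> t x * \<phi> (x, t)))
   \<and> (\<forall>\<phi>. test_fn \<phi> \<longrightarrow>
        (LINT t|lborel. LINT x|lborel. \<psi> t x * (dtt \<phi> (x, t) - lapx \<phi> (x, t)))
        = (LINT t|lborel. coef (\<psi> t) * \<phi> (0, t)))"

definition energy :: "(real \<Rightarrow> real) \<Rightarrow> (R3 \<Rightarrow> real) \<Rightarrow> (R3 \<Rightarrow> real) \<Rightarrow> real" where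
  "energy U \<psi> \<pi> = (L2norm \<pi>)\<^sup>2 / 2 + (grad_norm (regp \<psi>))\<^sup>2 / 2 + U (coef \<psi>)"

end

theory Submission
 imports Defs "HOL-Analysis.Analysis"
begin

text \<open>The solution is sought as a free wave \<open>u\<close> plus the retarded potential \<open>a(t - |x|) / (4 \<pi> |x|)\<close> of the
  charge, continued to negative times by a smooth history. Subtracting \<open>\<zeta> G\<close> from the retarded potential leaves the
  value \<open>- \<zeta>' / (4 \<pi>)\<close> at the origin, so the boundary condition becomes the ordinary differential equation
  \<open>\<zeta>' = 4 \<pi> (lam - F \<zeta>)\<close> with \<open>lam\<close> the trace of \<open>u\<close> at the origin. By Kirchhoff's formula \<open>lam\<close> is square
  integrable on the half-line, and \<open>(U \<circ> \<zeta>)' \<le> \<pi> lam\<^sup>2\<close> keeps \<open>\<zeta>\<close> bounded, hence global; negative times follow by time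
  reversal. For uniqueness, duality with backward free waves identifies the difference of two solutions with the
  retarded potential of the difference of their charges, which therefore obeys a Lipschitz differential
  inequality. Energy conservation follows from \<open>\<zeta>' = \<eta>\<close> and Green's formula for the regular parts.\<close>

text \<open>In general neither G nor \<psi>_reg is square integrable, because G decays too slowly at
  infinity, so the splitting \<psi> = \<psi>_reg + \<zeta> G leaves L2. The proof keeps \<psi>
  itself in L2 and expresses its regular part by the identities \<open>wgr\<close> and
  \<open>wlp\<close>; \<open>Gam\<close>, which is G minus a smooth function with the same decay, is
  square integrable and removes the charge whenever a result on uncharged fields is to be applied.
  Regularity is the obstacle: the trace \<open>lam\<close> of a free wave has one weak derivative in
  L2, so the charge has a weak second derivative \<open>Q\<close>, and this is just what
  \<open>E\<close> turns into the L2 Laplacian of the radiated field. For this to survive at time 0,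
  the artificial past of the charge must match the charges of both initial fields; the boundary
  condition then makes the differential equation start with the right slope. The factor pi in the a
  priori bound comes from completing a square: 4 pi F (lam - F) = pi lam^2 - pi (lam - 2
  F)^2.\<close>

abbreviation (input) lborel_integral (binder "LI " 10) where "lborel_integral f \<equiv> integral\<^sup>L lborel f"

abbreviation (input) seq_tendsto (infixr "---->" 60) where "X ----> L \<equiv> X \<longlonglongrightarrow> L"

abbreviation (input) lborel_nn_integral (binder "NI " 10) where "lborel_nn_integral f \<equiv> integral\<^sup>N lborel f"

abbreviation pd where "pd i \<equiv> dder (axis i 1 :: real ^ 3)"

notation (input) tendsto (infixr "--->" 55)

notation (input) scaleR (infixr "*R" 75)

lemma DERIV_cont: "(!!x. (f has_real_derivative f' x) (at x)) ==> continuous_on A f"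
 by (intro continuous_at_imp_continuous_on ballI DERIV_isCont)

section \<open>The Hilbert space of square integrable functions\<close>

text \<open>The condition \<open>L2\<close> over any Euclidean space: fields live on
  \<open>R3\<close>, but charges, histories and traces live on the real line.\<close>

definition sqi :: "('a::euclidean_space => real) => bool" where
 "sqi f \<longleftrightarrow> f \<in> borel_measurable lborel \<and> integrable lborel (%x. (f x)^2)"

lemma sqi_borel [measurable_dest]: "sqi f ==> f \<in> borel_measurable borel"
 by (simp add: sqi_def)

lemma sqi_mult_integrable:
 assumes "sqi f" "sqi g"
 shows "integrable lborel (%x. f x * g x)"
proof (rule Bochner_Integration.integrable_bound)
 show "integrable lborel (%x. (f x)^2 + (g x)^2)"
  using assms by (simp add: sqi_def)
 show "(%x. f x * g x) \<in> borel_measurable lborel"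
  using assms[measurable] by measurable
 show "AE x in lborel. norm (f x * g x) \<le> norm ((f x)^2 + (g x)^2)"
 proof (rule AE_I2)
  fix x
  have "2 * \<bar>f x * g x\<bar> \<le> (f x)^2 + (g x)^2"
   using sum_squares_bound[of "\<bar>f x\<bar>" "\<bar>g x\<bar>"] by (simp add: abs_mult)
  then show "norm (f x * g x) \<le> norm ((f x)^2 + (g x)^2)" by simp
 qed
qed

lemma sqi_scale: "sqi f ==> sqi (%x. c * f x)"
 unfolding sqi_def by (auto simp: power_mult_distrib)

lemma sqi_add:
 assumes "sqi f" "sqi g" shows "sqi (%x. f x + g x)"
proof -
 have "integrable lborel (%x. (f x)^2 + (g x)^2 + 2 * (f x * g x))"
  using assms sqi_mult_integrable[OF assms] by (simp add: sqi_def)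
 then show ?thesis
  using assms unfolding sqi_def by (auto simp: power2_sum mult.assoc)
qed

lemma sqi_zero [simp]: "sqi (%x. 0)" by (simp add: sqi_def)

lemma sqi_uminus: "sqi f ==> sqi (%x. - f x)"
 by (simp add: sqi_def)

lemma sqi_diff: "sqi f ==> sqi g ==> sqi (%x. f x - g x)"
 using sqi_add[of f "%x. - g x"] sqi_uminus[of g] by simp

lemma sqi_bound:
 assumes "sqi g" "f \<in> borel_measurable lborel" "AE x in lborel. \<bar>f x\<bar> \<le> \<bar>g x\<bar>"
 shows "sqi f"
 unfolding sqi_def
proof
 show "integrable lborel (%x. (f x)^2)"
  by (rule Bochner_Integration.integrable_bound[of lborel "%x. (g x)^2"])
   (use assms in "auto simp: sqi_def abs_le_square_iff")
qed (rule assms)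

\<comment> \<open>As a type, square integrable functions modulo null sets inherit limits, closures,
  derivatives of curves and products such as \<open>(R3 l2)^3\<close> from type classes. The
  relation is partial because functions that are not square integrable have no class.\<close>
quotient_type (overloaded) 'a l2 = "'a::euclidean_space => real" / partial:
 "%f g. sqi f \<and> sqi g \<and> (AE x in lborel. f x = g x)"
proof (rule part_equivpI)
 show "\<exists>x::'a => real. sqi x \<and> sqi x \<and> (AE xa in lborel. x xa = x xa)"
  using sqi_zero by blast
 show "transp (%f g :: 'a => real. sqi f \<and> sqi g \<and> (AE x in lborel. f x = g x))"
  by (rule transpI) (auto elim: AE_mp)
qed (auto simp: symp_def eq_commute)

text \<open>\<open>cls\<close> is meaningful only on functions with \<open>sqi\<close>;
  \<open>fn\<close> picks an arbitrary representative, so identities about it hold only almost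
  everywhere.\<close>

definition cls :: "('a::euclidean_space => real) => 'a l2" where "cls = abs_l2"
definition fn :: "'a::euclidean_space l2 => 'a => real" where "fn = rep_l2"

lemma sqi_fn [simp]: "sqi (fn u)"
 using Quotient_rel_rep[OF Quotient_l2, of u u] by (simp add: fn_def)

lemma cls_fn [simp]: "cls (fn u) = u"
 using Quotient_abs_rep[OF Quotient_l2] by (simp add: cls_def fn_def)

lemma cls_eq_iff: "sqi f ==> sqi g ==> cls f = cls g \<longleftrightarrow> (AE x in lborel. f x = g x)"
 using Quotient_rel[OF Quotient_l2, of f g] by (auto simp: cls_def)

lemma fn_cls: "sqi f ==> AE x in lborel. fn (cls f) x = f x"
 using cls_eq_iff[of "fn (cls f)" f] by simp

instantiation l2 :: (euclidean_space) real_inner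
begin

lift_definition zero_l2 :: "'a l2" is "%x. 0" by simp
lift_definition plus_l2 :: "'a l2 => 'a l2 => 'a l2" is "%f g x. f x + g x"
 by (auto intro: sqi_add)
lift_definition minus_l2 :: "'a l2 => 'a l2 => 'a l2" is "%f g x. f x - g x"
 by (auto intro: sqi_diff)
lift_definition uminus_l2 :: "'a l2 => 'a l2" is "%f x. - f x"
 by (auto intro: sqi_uminus)
lift_definition scaleR_l2 :: "real => 'a l2 => 'a l2" is "%c f x. c * f x"
 by (auto intro: sqi_scale)
lift_definition inner_l2 :: "'a l2 => 'a l2 => real" is "%f g. LI x. f x * g x"
 by (auto intro!: integral_cong_AE simp: sqi_def)

definition norm_l2 :: "'a l2 => real" where "norm_l2 u = sqrt (inner u u)"
definition dist_l2 :: "'a l2 => 'a l2 => real" where "dist_l2 u v = norm (u - v)"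
definition sgn_l2 :: "'a l2 => 'a l2" where "sgn_l2 u = inverse (norm u) *R u"
definition uniformity_l2 :: "('a l2 \<times> 'a l2) filter" where
 "uniformity_l2 = (INF e\<in>{0<..}. principal {(x, y). dist x y < e})"
definition open_l2 :: "'a l2 set => bool" where
 "open_l2 S \<longleftrightarrow> (\<forall>x\<in>S. \<forall>\<^sub>F (x', y) in uniformity. x' = x --> y \<in> S)"

instance
proof
 fix a b c :: "'a l2" and r s :: real
 show "dist a b = norm (a - b)" by (rule dist_l2_def)
 show "sgn a = scaleR (inverse (norm a)) a" by (rule sgn_l2_def)
 show "uniformity = (INF e\<in>{0<..}. principal {(x, y::'a l2). dist x y < e})"
  by (rule uniformity_l2_def)
 show "open U \<longleftrightarrow> (\<forall>x\<in>U. \<forall>\<^sub>F (x', y) in uniformity. x' = x --> y \<in> U)" for U :: "'a l2 set"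
  by (rule open_l2_def)
 show "norm a = sqrt (inner a a)" by (rule norm_l2_def)
 show "a + b + c = a + (b + c)" "a + b = b + a" "0 + a = a" "- a + a = 0" "a - b = a + - b"
  by (transfer; auto intro: sqi_add sqi_diff sqi_uminus simp: algebra_simps)+
 show "r *R (a + b) = r *R a + r *R b" "(r + s) *R a = r *R a + s *R a"
  "r *R s *R a = (r * s) *R a" "1 *R a = a"
  by (transfer; auto intro: sqi_add sqi_scale simp: algebra_simps)+
 show "inner a b = inner b a" by transfer (simp add: mult.commute)
 show "inner (a + b) c = inner a c + inner b c"
  by transfer (simp add: distrib_right sqi_mult_integrable)
 show "inner (r *R a) b = r * inner a b"
  by transfer (simp add: mult.assoc)
 show "0 \<le> inner a a" by transfer simp
 show "inner a a = 0 \<longleftrightarrow> a = 0"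
 proof transfer
  fix f :: "'a => real"
  assume f: "sqi f \<and> sqi f \<and> (AE x in lborel. f x = f x)"
  have "(LI x. f x * f x) = 0 \<longleftrightarrow> (AE x in lborel. f x * f x = 0)"
   by (rule integral_nonneg_eq_0_iff_AE) (use f sqi_mult_integrable in auto)
  then show "(LI x. f x * f x) = 0 \<longleftrightarrow> sqi f \<and> sqi (%x. 0::real) \<and> (AE x in lborel. f x = 0)"
   using f by simp
 qed
qed

end

lemma cls_zero: "cls (%x. 0) = 0" by (simp add: cls_def zero_l2_def)

lemma cls_add: "sqi f ==> sqi g ==> cls (%x. f x + g x) = cls f + cls g"
 unfolding cls_def by (rule plus_l2.abs_eq[symmetric]) auto
lemma cls_diff: "sqi f ==> sqi g ==> cls (%x. f x - g x) = cls f - cls g"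
 unfolding cls_def by (rule minus_l2.abs_eq[symmetric]) auto
lemma cls_scale: "sqi f ==> cls (%x. c * f x) = c *R cls f"
 unfolding cls_def by (rule scaleR_l2.abs_eq[symmetric]) auto
lemma inner_cls: "sqi f ==> sqi g ==> inner (cls f) (cls g) = (LI x. f x * g x)"
 unfolding cls_def by (rule inner_l2.abs_eq) auto
lemma norm_cls_sq: "sqi f ==> (norm (cls f))^2 = (LI x. (f x)^2)"
 by (simp add: power2_norm_eq_inner inner_cls) (simp add: power2_eq_square)
lemma norm_cls: "sqi f ==> norm (cls f) = sqrt (LI x. (f x)^2)"
 by (metis norm_cls_sq norm_ge_zero real_sqrt_unique)
lemma inner_fn: "sqi f ==> inner u (cls f) = (LI x. fn u x * f x)"
 using inner_cls[of "fn u" f] by simp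

lemma fn_add: "AE x in lborel. fn (u + v) x = fn u x + fn v x"
 using fn_cls[of "%x. fn u x + fn v x"] by (simp add: cls_add sqi_add)
lemma fn_diff: "AE x in lborel. fn (u - v) x = fn u x - fn v x"
 using fn_cls[of "%x. fn u x - fn v x"] by (simp add: cls_diff sqi_diff)
lemma fn_scale: "AE x in lborel. fn (c *R v) x = c * fn v x"
 using fn_cls[of "%x. c * fn v x"] by (simp add: cls_scale sqi_scale)

lemma norm_cls_le:
 assumes "sqi g" "f \<in> borel_measurable lborel" "AE x in lborel. \<bar>f x\<bar> \<le> \<bar>g x\<bar>"
 shows "norm (cls f) \<le> norm (cls g)"
proof -
 have f: "sqi f" by (rule sqi_bound[OF assms])
 have "(LI x. (f x)^2) \<le> (LI x. (g x)^2)"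
  by (rule integral_mono_AE) (use f assms in "auto simp: sqi_def abs_le_square_iff")
 then show ?thesis by (simp add: norm_cls f assms(1))
qed

text \<open>Riesz--Fischer: a rapidly Cauchy sequence converges pointwise almost everywhere, and Fatou's lemma
  bounds its distance to the pointwise limit.\<close>

lemma rapidly_Cauchy_l2_convergent:
 fixes u :: "nat => 'a::euclidean_space l2"
 assumes rapid: "!!m n. n \<le> m ==> norm (u m - u n) \<le> (1/2)^n"
 shows "convergent u"
proof -
 define f where "f n = fn (u n)" for n
 have sf: "sqi (f n)" for n by (simp add: f_def)
 note [measurable] = sqi_borel[OF sf]
 have uf: "cls (f n) = u n" for n by (simp add: f_def)
 have I: "(NI x. ennreal ((f m x - f n x)^2)) \<le> ennreal ((1/4)^n)" if "n \<le> m" for m n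
 proof -
  have "(NI x. ennreal ((f m x - f n x)^2)) = ennreal ((norm (u m - u n))^2)"
   using norm_cls_sq[OF sqi_diff[OF sf[of m] sf[of n]], unfolded cls_diff[OF sf sf] uf] sqi_diff[OF sf[of m] sf[of n]]
   by (simp add: nn_integral_eq_integral sqi_def)
  also have "... \<le> ennreal (((1/2)^n)^2)" by (intro ennreal_leI power_mono rapid that) simp
  also have "((1/2)^n)^2 = (1/4::real)^n" by (simp add: power2_eq_square flip: power_mult_distrib)
  finally show ?thesis .
 qed
 \<comment> \<open>The squared increments have integral at most (1/4)^n, so the weight 2^n leaves a
   summable series; where the weighted series is finite, the increments themselves decay
   geometrically.\<close>
 let ?t = "%n x. ennreal (2^n) * ennreal ((f (Suc n) x - f n x)^2)"
 have "(NI x. (\<Sum>n. ?t n x)) = (\<Sum>n. NI x. ?t n x)" by (rule nn_integral_suminf) measurable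
 also have "... \<le> (\<Sum>n. ennreal ((1/2)^n))"
 proof (rule suminf_le)
  fix n
  have "(NI x. ?t n x) \<le> ennreal (2^n) * ennreal ((1/4)^n)"
   using I[of n "Suc n"] by (simp add: nn_integral_cmult mult_left_mono)
  also have "... = ennreal ((1/2)^n)" by (simp flip: ennreal_mult power_mult_distrib)
  finally show "(NI x. ?t n x) \<le> ennreal ((1/2)^n)" .
 qed auto
 also have "... = ennreal 2" by (rule suminf_ennreal_eq) (use geometric_sums[of "1/2::real"] in auto)
 finally have "(NI x. (\<Sum>n. ?t n x)) \<noteq> \<infinity>" by (auto simp: top_unique)
 then have "AE x in lborel. (\<Sum>n. ?t n x) \<noteq> \<infinity>" by (intro nn_integral_PInf_AE) auto
 then have ae: "AE x in lborel. (%n. f n x) ----> lim (%n. f n x)"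
 proof eventually_elim
  case (elim x)
  then obtain C where C: "(\<Sum>n. ?t n x) = ennreal C" "0 \<le> C" by (cases "\<Sum>n. ?t n x") auto
  have "norm (f (Suc n) x - f n x) \<le> sqrt C * sqrt (1/2) ^ n" for n
  proof -
   have "?t n x \<le> ennreal C" using sum_le_suminf[of "%n. ?t n x" "{n}"] by (simp add: C(1))
   then have "2^n * (f (Suc n) x - f n x)^2 \<le> C" using C(2) by (simp flip: ennreal_mult)
   then have "(f (Suc n) x - f n x)^2 \<le> C * (1/2)^n" by (simp add: field_simps power_divide)
   then have "sqrt ((f (Suc n) x - f n x)^2) \<le> sqrt (C * (1/2)^n)" by (rule real_sqrt_le_mono)
   then show ?thesis by (simp add: real_sqrt_mult flip: real_sqrt_power)
  qed
  then have "summable (%n. f (Suc n) x - f n x)"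
   by (intro summable_comparison_test'[OF summable_mult[OF summable_geometric], of "sqrt (1/2)" 0]) auto
  from tendsto_add[OF summable_LIMSEQ[OF this] tendsto_const[of "f 0 x"]]
  have "convergent (%n. f n x)" by (auto simp: convergent_def sum_lessThan_telescope[of "%n. f n x"])
  then show ?case by (simp add: convergent_LIMSEQ_iff)
 qed
 define L where "L x = lim (%n. f n x)" for x
 have [measurable]: "L \<in> borel_measurable borel" unfolding L_def[abs_def] by (intro borel_measurable_lim_metric) measurable
 have N: "(NI x. ennreal ((f n x - L x)^2)) \<le> ennreal ((1/4)^n)" for n
 proof -
  have "(NI x. ennreal ((f n x - L x)^2)) = (NI x. liminf (%m. ennreal ((f m x - f n x)^2)))"
  proof (rule nn_integral_cong_AE, use ae in eventually_elim)
   case (elim x)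
   then have "(%m. ennreal ((f m x - f n x)^2)) ----> ennreal ((L x - f n x)^2)" unfolding L_def by (intro tendsto_intros tendsto_ennrealI)
   then show ?case using lim_imp_Liminf[OF sequentially_bot] by (fastforce simp: power2_commute)
  qed
  also have "... \<le> liminf (%m. NI x. ennreal ((f m x - f n x)^2))" by (rule nn_integral_liminf) measurable
  also have "... \<le> liminf (%m. ennreal ((1/4)^n))" by (rule Liminf_mono) (use I in "auto simp: eventually_sequentially")
  finally show ?thesis by (simp add: Liminf_const)
 qed
 have s: "sqi (%x. f n x - L x)" for n
  using N[of n] by (auto simp: sqi_def intro!: integrableI_bounded intro: le_less_trans)
 have sL: "sqi L" using sqi_diff[OF sf[of 0] s[of 0]] by simp
 have nb: "norm (u n - cls L) \<le> (1/2)^n" for n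
 proof (rule power2_le_imp_le)
  have "ennreal ((norm (u n - cls L))^2) \<le> ennreal ((1/4)^n)"
   using N[of n] norm_cls_sq[OF s[of n], unfolded cls_diff[OF sf sL] uf] s[of n] by (simp add: nn_integral_eq_integral sqi_def)
  then show "(norm (u n - cls L))^2 \<le> ((1/2)^n)^2" by (simp add: power2_eq_square flip: power_mult_distrib)
 qed simp
 have "(%n. u n - cls L) ----> 0"
  by (rule Lim_null_comparison[OF always_eventually[OF allI[OF nb]] LIMSEQ_power_zero]) simp
 then show ?thesis by (rule convergentI[OF LIM_zero_cancel])
qed

instance l2 :: (euclidean_space) complete_space
proof
 fix X :: "nat => 'a l2" assume C: "Cauchy X"
 define e :: "nat => real" where "e n = (1/2)^n" for n
 have "\<exists>M. \<forall>m\<ge>M. \<forall>n\<ge>M. norm (X m - X n) < e k" for k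
  using CauchyD[OF C, of "e k"] by (auto simp: e_def)
 then obtain M where M: "!!k m n. m \<ge> M k ==> n \<ge> M k ==> norm (X m - X n) < e k" by metis
 define r where "r k = (\<Sum>j\<le>k. M j) + k" for k
 have rM: "M k \<le> r k" for k unfolding r_def using member_le_sum[of k "{..k}" M] by auto
 have sr: "strict_mono r" by (rule strict_mono_Suc_iff[THEN iffD2]) (simp add: r_def)
 have "norm (X (r m) - X (r k)) \<le> (1/2)^k" if "k \<le> m" for m k
  using M[of k "r m" "r k"] rM[of k] strict_mono_leD[OF sr that] by (simp add: e_def less_imp_le)
 then have "convergent (X \<circ> r)" using rapidly_Cauchy_l2_convergent[of "X \<circ> r"] by simp
 then obtain l where "(X \<circ> r) ----> l" by (auto simp: convergent_def)
 then have "X ----> l" by (rule Cauchy_converges_subseq[OF C sr])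
 then show "convergent X" by (rule convergentI)
qed

instance l2 :: (euclidean_space) banach ..

section \<open>Orthogonal projection and density\<close>

text \<open>The midpoint of two elements of a minimising sequence lies in \<open>S\<close>, so the
  parallelogram identity makes the sequence Cauchy; at its limit the first variation of the distance
  vanishes.\<close>

lemma closest_point_subspace:
 fixes S :: "'b::{real_inner,complete_space} set"
 assumes S: "subspace S"
 obtains p where "p \<in> closure S" "!!s. s \<in> S ==> inner (x - p) s = 0"
proof -
 define d where "d = Inf ((%s. (norm (x - s))^2) ` S)"
 have ne: "S \<noteq> {}" using S subspace_0 by blast
 have bb: "bdd_below ((%s. (norm (x - s))^2) ` S)" by (rule bdd_belowI[of _ 0]) auto
 have dle: "d \<le> (norm (x - s))^2" if "s \<in> S" for s
  unfolding d_def by (rule cInf_lower[OF _ bb]) (use that in auto)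
 have "\<exists>s\<in>S. (norm (x - s))^2 < d + 1 / real (Suc n)" for n
  using cInf_lessD[of "(%s. (norm (x - s))^2) ` S" "d + 1 / real (Suc n)"] ne
  unfolding d_def[symmetric] by auto
 then obtain s where s: "!!n. s n \<in> S" and sd: "!!n. (norm (x - s n))^2 < d + 1 / real (Suc n)"
  by metis
 have par: "(norm (s m - s n))^2 \<le> 2 / real (Suc m) + 2 / real (Suc n)" for m n
 proof -
  have mid: "(1/2) *R (s m + s n) \<in> S"
   by (intro subspace_scale[OF S] subspace_add[OF S] s)
  have "(norm (s m - s n))^2 = 2 * (norm (x - s m))^2 + 2 * (norm (x - s n))^2 - 4 * (norm (x - (1/2) *R (s m + s n)))^2"
   unfolding power2_norm_eq_inner
   by (simp add: inner_diff_left inner_diff_right inner_add_left inner_add_right inner_commute algebra_simps)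
  then show ?thesis using dle[OF mid] sd[of m] sd[of n] by simp
 qed
 have "Cauchy s"
 proof (rule CauchyI)
  fix e :: real assume e: "0 < e"
  obtain N where N: "inverse (real (Suc N)) < e^2 / 4" using reals_Archimedean[of "e^2/4"] e by auto
  have "norm (s m - s n) < e" if "m \<ge> N" "n \<ge> N" for m n
  proof -
   have "1 / real (Suc m) \<le> inverse (real (Suc N))" "1 / real (Suc n) \<le> inverse (real (Suc N))"
    using that by (auto simp: field_simps)
   then have "(norm (s m - s n))^2 < e^2" using par[of m n] N by simp
   then show ?thesis using e by (simp add: power_less_imp_less_base)
  qed
  then show "\<exists>M. \<forall>m\<ge>M. \<forall>n\<ge>M. norm (s m - s n) < e" by blast
 qed
 then obtain p where p: "s ----> p" using Cauchy_convergent convergent_def by blast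
 have pc: "p \<in> closure S" using s p closure_sequential by blast
 have pd: "(norm (x - p))^2 \<le> d"
 proof (rule LIMSEQ_le)
  show "(%n. (norm (x - s n))^2) ----> (norm (x - p))^2" by (intro tendsto_intros p)
  show "(%n. d + 1 / real (Suc n)) ----> d"
   using tendsto_add[OF tendsto_const LIMSEQ_inverse_real_of_nat, of d] by (simp add: inverse_eq_divide)
  show "\<exists>N. \<forall>n\<ge>N. (norm (x - s n))^2 \<le> d + 1 / real (Suc n)" using sd less_imp_le by blast
 qed
 have "inner (x - p) t = 0" if t: "t \<in> S" for t
 proof -
  have key: "(norm (x - p))^2 \<le> (norm (x - p - c *R t))^2" for c
  proof (rule order_trans[OF pd], rule LIMSEQ_le_const)
   show "(%n. (norm (x - (s n + c *R t)))^2) ----> (norm (x - p - c *R t))^2"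
    unfolding diff_diff_eq by (intro tendsto_intros p)
   show "\<exists>N. \<forall>n\<ge>N. d \<le> (norm (x - (s n + c *R t)))^2"
    by (intro exI[of _ 0] allI impI dle subspace_add[OF S] subspace_scale[OF S] s t)
  qed
  have q: "2 * c * inner (x - p) t \<le> c^2 * inner t t" for c
   using key[of c] unfolding power2_norm_eq_inner
   by (simp add: inner_diff_left inner_diff_right inner_commute algebra_simps power2_eq_square)
  show ?thesis
  proof (cases "t = 0")
   case False
   then have tt: "inner t t > 0" by simp
   \<comment> \<open>This \<open>c\<close> minimises \<open>norm (x - p - c *R t)\<close>, so the
     inequality \<open>q\<close> is sharpest here.\<close>
   define c where "c = inner (x - p) t / inner t t"
   have "2 * c * (c * inner t t) \<le> c^2 * inner t t" using q[of c] tt by (simp add: c_def)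
   then have "c^2 * inner t t \<le> 0" by (simp add: power2_eq_square algebra_simps)
   then have "c = 0" using tt by (simp add: mult_le_0_iff)
   then show ?thesis using tt by (simp add: c_def)
  qed auto
 qed
 then show ?thesis using that pc by blast
qed

text \<open>The source of all density statements below. Instead of mollifying, one shows that an
  element of \<open>V\<close> orthogonal to \<open>S\<close> vanishes, which in each case is a
  uniqueness statement about distributions.\<close>

lemma dense_subspace_if_orthogonal_trivial:
 fixes S V :: "'b::{real_inner,complete_space} set"
 assumes S: "subspace S" and V: "subspace V" "closed V" and sub: "S \<subseteq> V"
  and triv: "!!v. v \<in> V ==> (!!s. s \<in> S ==> inner v s = 0) ==> v = 0"
  and x: "x \<in> V"
 shows "x \<in> closure S"
proof -
 obtain p where p: "p \<in> closure S" "!!s. s \<in> S ==> inner (x - p) s = 0"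
  using closest_point_subspace[OF S] by blast
 have "p \<in> V" using p(1) closure_minimal[OF sub V(2)] by blast
 then have "x - p = 0" using triv[OF subspace_diff[OF V(1) x] p(2)] by blast
 then show ?thesis using p(1) by simp
qed

section \<open>Smooth functions\<close>

definition smooth :: "('a::euclidean_space => real) => bool" where
 "smooth f \<longleftrightarrow> (\<forall>vs x. ddirs vs f differentiable (at x))"

lemma smooth_coinduct:
 assumes "f \<in> A" and "!!g x. g \<in> A ==> g differentiable (at x)"
  and "!!g v. g \<in> A ==> dder v g \<in> A"
 shows "smooth f"
proof -
 have "ddirs vs f \<in> A" for vs by (induction vs) (auto intro: assms)
 then show ?thesis using assms(2) by (auto simp: smooth_def)
qed

lemma smooth_differentiable: "smooth f ==> f differentiable (at x)"
 unfolding smooth_def by (metis ddirs.simps(1))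

lemma ddirs_append: "ddirs (vs @ ws) f = ddirs vs (ddirs ws f)"
 by (induction vs) auto

lemma smooth_dder: "smooth f ==> smooth (dder v f)"
 unfolding smooth_def by (metis ddirs.simps ddirs_append)

lemma dder_eq: "(f has_derivative f') (at x) ==> dder v f x = f' v"
 unfolding dder_def using frechet_derivative_at by metis

lemma dder_real: "(f has_real_derivative D) (at x) ==> dder v f x = D * v"
 using dder_eq[of f "(*) D"] by (simp add: has_field_derivative_def)

lemma has_derivative_dder:
 assumes "f differentiable (at x)" shows "(f has_derivative (%v. dder v f x)) (at x)"
 using assms unfolding dder_def frechet_derivative_works by simp

lemma linear_dder: "f differentiable (at x) ==> linear (%v. dder v f x)"
 using has_derivative_dder has_derivative_linear by blast

lemma dder_line:
 assumes "f differentiable (at (x + s *R v))"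
 shows "((%s. f (x + s *R v)) has_real_derivative dder v f (x + s *R v)) (at s)"
proof -
 have "((%s. f (x + s *R v)) has_derivative (%h. dder (h *R v) f (x + s *R v))) (at s)"
  by (rule has_derivative_compose[where g=f and f="%s. x + s *R v", OF _ has_derivative_dder[OF assms]])
   (auto intro!: derivative_eq_intros)
 then show ?thesis
  unfolding has_field_derivative_def
  by (rule has_derivative_eq_rhs)
   (simp add: linear_cmul[OF linear_dder[OF assms], unfolded real_scaleR_def] fun_eq_iff mult.commute)
qed

lemma dder_add:
 "f differentiable (at x) ==> g differentiable (at x) ==>
 dder v (%x. f x + g x) x = dder v f x + dder v g x"
 by (rule dder_eq[OF has_derivative_add]) (auto intro: has_derivative_dder)

lemma dder_diff:
 "f differentiable (at x) ==> g differentiable (at x) ==>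
 dder v (%x. f x - g x) x = dder v f x - dder v g x"
 by (rule dder_eq[OF has_derivative_diff]) (auto intro: has_derivative_dder)

lemma dder_const [simp]: "dder v (%x. c) = (%x. 0)"
 by (rule ext, rule dder_eq[of _ "%x. 0"]) simp

lemma dder_cmult:
 "f differentiable (at x) ==> dder v (%x. c * f x) x = c * dder v f x"
 by (rule dder_eq[OF has_derivative_mult_right]) (auto intro: has_derivative_dder)

lemma dder_mult:
 assumes "f differentiable (at x)" "g differentiable (at x)"
 shows "dder v (%x. f x * g x) x = f x * dder v g x + dder v f x * g x"
 by (rule dder_eq[OF has_derivative_mult]) (auto intro: has_derivative_dder assms)

lemma dder_affine:
 assumes "bounded_linear l" "f differentiable (at (l x + a))"
 shows "(%x. f (l x + a)) differentiable (at x)"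
  and "dder v (%x. f (l x + a)) x = dder (l v) f (l x + a)"
proof -
 have "((%x. f (l x + a)) has_derivative (%v. dder (l v) f (l x + a))) (at x)"
  by (rule has_derivative_compose[where g=f and f="%x. l x + a", OF _ has_derivative_dder[OF assms(2)]])
   (auto intro!: derivative_eq_intros bounded_linear.has_derivative[OF assms(1)])
 then show "(%x. f (l x + a)) differentiable (at x)"
  "dder v (%x. f (l x + a)) x = dder (l v) f (l x + a)"
  by (auto simp: differentiable_def intro: dder_eq)
qed

inductive_set gen_alg :: "('a::euclidean_space => real) set => ('a => real) set"
 for B where
 base: "f \<in> B ==> f \<in> gen_alg B"
| const: "(%x. c) \<in> gen_alg B"
| add: "f \<in> gen_alg B ==> g \<in> gen_alg B ==> (%x. f x + g x) \<in> gen_alg B"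
| mult: "f \<in> gen_alg B ==> g \<in> gen_alg B ==> (%x. f x * g x) \<in> gen_alg B"

text \<open>Coinduction up to sums and products: the sum and product rules carry closure under
  derivatives from the generators to the whole algebra, so the derivative of a generator need only
  be a polynomial in the generators.\<close>

lemma smooth_gen_alg:
 assumes d: "!!f x. f \<in> B ==> f differentiable (at x)"
  and dd: "!!f v. f \<in> B ==> dder v f \<in> gen_alg B"
  and f: "f \<in> gen_alg B"
 shows "smooth f"
proof (rule smooth_coinduct[OF f])
 have diff: "g differentiable (at x)" if "g \<in> gen_alg B" for g x
  using that by induction (auto intro: d)
 show "g differentiable (at x)" if "g \<in> gen_alg B" for g x using that by (rule diff)
 show "dder v g \<in> gen_alg B" if "g \<in> gen_alg B" for g v
  using that
 proof induction
  case (add f g)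
  have "dder v (%x. f x + g x) = (%x. dder v f x + dder v g x)"
   by (rule ext, rule dder_add) (auto intro: diff add)
  then show ?case using add by (simp add: gen_alg.add)
 next
  case (mult f g)
  have "dder v (%x. f x * g x) = (%x. f x * dder v g x + dder v f x * g x)"
   by (rule ext, rule dder_mult) (auto intro: diff mult)
  then show ?case using mult by (simp add: gen_alg.add gen_alg.mult)
 qed (auto intro: dd gen_alg.const)
qed

lemma smooth_closed:
 assumes "smooth f" "smooth g"
 shows smooth_add: "smooth (%x. f x + g x)" and smooth_mult: "smooth (%x. f x * g x)"
 by (rule smooth_gen_alg[of "Collect smooth"];
   auto intro: gen_alg.intros smooth_dder smooth_differentiable assms)+

lemma smooth_const [simp]: "smooth (%x. c)"
 by (rule smooth_gen_alg[of "{}"]) (auto intro: gen_alg.intros)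

lemma smooth_cmult: "smooth f ==> smooth (%x. c * f x)"
 by (rule smooth_mult) auto

lemma smooth_sum: "(!!i. i \<in> I ==> smooth (f i)) ==> smooth (%x. \<Sum>i\<in>I. f i x)"
 by (induction I rule: infinite_finite_induct) (auto intro: smooth_add)

lemma smooth_prod: "(!!i. i \<in> I ==> smooth (f i)) ==> smooth (%x. \<Prod>i\<in>I. f i x)"
 by (induction I rule: infinite_finite_induct) (auto intro: smooth_mult)

lemma smooth_affine:
 assumes l: "bounded_linear l" and f: "smooth f"
 shows "smooth (%x. f (l x + a))"
proof (rule smooth_coinduct[where A="{%x. g (l x + a) | g. smooth g}"])
 show "(%x. f (l x + a)) \<in> {%x. g (l x + a) |g. smooth g}" using f by blast
 show "h differentiable (at x)" if "h \<in> {%x. g (l x + a) |g. smooth g}" for h x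
  using that by (auto simp: dder_affine(1)[OF l smooth_differentiable])
 show "dder v h \<in> {%x. g (l x + a) |g. smooth g}" if "h \<in> {%x. g (l x + a) |g. smooth g}" for h v
 proof -
  have "\<exists>g. h = (%x. g (l x + a)) \<and> smooth g" using that by (simp only: mem_Collect_eq)
  then obtain g where gg: "h = (%x. g (l x + a)) \<and> smooth g" ..
  then have g: "smooth g" "h = (%x. g (l x + a))" by auto
  have "dder v h = (%x. dder (l v) g (l x + a))"
   unfolding g(2) by (rule ext, rule dder_affine(2)[OF l smooth_differentiable[OF g(1)]])
  then show ?thesis using smooth_dder[OF g(1)] by auto
 qed
qed

lemma smooth_continuous: "smooth f ==> continuous_on A f"
 by (simp add: continuous_at_imp_continuous_on differentiable_imp_continuous_within smooth_differentiable)

lemma smooth_borel [measurable_dest]: "smooth f ==> f \<in> borel_measurable borel"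
 by (intro borel_measurable_continuous_onI smooth_continuous)

lemma smooth_inner: "smooth (%x. x \<bullet> v)"
proof (rule smooth_gen_alg[of "{%x. x \<bullet> v}"])
 have d: "((%x. x \<bullet> v) has_derivative (%w. w \<bullet> v)) (at x)" for x
  by (auto intro!: derivative_eq_intros)
 show "f differentiable (at x)" if "f \<in> {%x. x \<bullet> v}" for f x
  using that d by (auto simp: differentiable_def)
 have "dder w (%x. x \<bullet> v) = (%x. w \<bullet> v)" for w
  by (rule ext, rule dder_eq[OF d])
 then show "dder w f \<in> gen_alg {%x. x \<bullet> v}" if "f \<in> {%x. x \<bullet> v}" for f w
  using that by (auto intro: gen_alg.const)
qed (auto intro: gen_alg.base)

text \<open>\<open>flat 0\<close> is the classical function exp (-1/s). The powers of 1/s are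
  included so that the linear span of the family is closed under differentiation.\<close>

definition flat :: "nat => real => real" where
 "flat n s = (if 0 < s then (1/s)^n * exp (- (1/s)) else 0)"

lemma flat_deriv:
 "(flat n has_real_derivative (flat (n+2) s - real n * flat (n+1) s)) (at s)"
proof -
 consider "s < 0" | "s > 0" | "s = 0" by linarith
 then show ?thesis
 proof cases
  case 1
  have "(flat n has_real_derivative 0) (at s)"
   by (rule has_field_derivative_transform_within_open[of "%x. 0" 0 s "{..<0}"])
    (use 1 in "auto simp: flat_def")
  then show ?thesis using 1 by (simp add: flat_def)
 next
  case 2
  have "((%s. (1/s)^n * exp (- (1/s))) has_real_derivative (flat (n+2) s - real n * flat (n+1) s)) (at s)"
  proof -
   have i: "((%s. 1 / s) has_real_derivative - (1 / s^2)) (at s)"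
    using 2 by (auto intro!: derivative_eq_intros simp: power2_eq_square)
   show ?thesis
    by (rule DERIV_cong[OF DERIV_mult[OF DERIV_power[OF i, of n] DERIV_chain2[OF DERIV_exp DERIV_minus[OF i]]]])
     (use 2 in "cases n; simp add: flat_def field_simps power2_eq_square")
  qed
  then show ?thesis
   by (rule has_field_derivative_transform_within_open[where S="{0<..}"])
    (use 2 in "auto simp: flat_def")
 next
  case 3
  have "((%y. flat n y / y) ---> 0) (at 0)"
  proof -
   have l: "((%y. flat n y / y) ---> 0) (at_left 0)"
    by (rule tendsto_eventually) (auto simp: eventually_at_filter flat_def)
   have "((%u::real. u^(n+1) / exp u) ---> 0) at_top"
    by (rule tendsto_power_div_exp_0)
   from filterlim_compose[OF this filterlim_inverse_at_top_right]
   have "((%y::real. (inverse y)^(n+1) / exp (inverse y)) ---> 0) (at_right 0)" .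
   then have r: "((%y. flat n y / y) ---> 0) (at_right 0)"
    by (rule Lim_transform_eventually)
     (auto simp: eventually_at_filter flat_def exp_minus field_simps)
   show ?thesis using l r by (simp add: filterlim_split_at)
  qed
  then show ?thesis using 3 by (simp add: has_field_derivative_iff flat_def)
 qed
qed

lemma smooth_flat: "smooth (flat n)"
proof (rule smooth_gen_alg[of "range flat"])
 show "f differentiable (at x)" if "f \<in> range flat" for f x
  using that flat_deriv by (auto simp: real_differentiable_def)
 show "dder v f \<in> gen_alg (range flat)" if f: "f \<in> range flat" for f v
 proof -
  obtain n where n: "f = flat n" using f by blast
  have "dder v f = (%s. (flat (n+2) s + (- real n) * flat (n+1) s) * v)"
   unfolding n by (rule ext) (simp add: dder_real[OF flat_deriv])
  moreover have "(%s. (flat (n+2) s + (- real n) * flat (n+1) s) * v) \<in> gen_alg (range flat)"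
   by (intro gen_alg.mult gen_alg.add gen_alg.const gen_alg.base rangeI)
  ultimately show ?thesis by (simp only:)
 qed
qed (auto intro: gen_alg.base)

lemma flat_bounds: "0 \<le> flat 0 s" "flat 0 s \<le> 1" "flat 0 s = 0 \<longleftrightarrow> s \<le> 0"
 by (auto simp: flat_def)

text \<open>Approximates the indicator of the positive half-line from below; products over the
  coordinates then approximate indicators of open boxes by test functions.\<close>

lemma flat_scaled_limit: "(%n. flat 0 (real n * s)) ----> (if 0 < s then 1 else 0)"
proof (cases "0 < s")
 case True
 have "(%n. exp (- ((1/s) * inverse (real n)))) ----> exp (- ((1/s) * 0))"
  by (intro tendsto_intros LIMSEQ_inverse_real_of_nat[THEN LIMSEQ_imp_Suc])
 then have "(%n. exp (- ((1/s) * inverse (real n)))) ----> 1" by simp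
 then have "(%n. flat 0 (real n * s)) ----> 1"
  by (rule Lim_transform_eventually)
   (use True in "auto simp: flat_def field_simps intro!: eventually_sequentiallyI[of 1]")
 then show ?thesis using True by simp
next
 case False
 then have "flat 0 (real n * s) = 0" for n by (simp add: flat_bounds mult_nonneg_nonpos)
 then show ?thesis using False by simp
qed

subsection \<open>Test functions\<close>

lemma test_fnI:
 assumes "smooth f" "!!x. f x \<noteq> 0 ==> norm x \<le> r"
 shows "test_fn f"
proof -
 have "closure {x. f x \<noteq> 0} \<subseteq> cball 0 r"
  by (rule closure_minimal) (use assms(2) in auto)
 then have "compact (closure {x. f x \<noteq> 0})"
  by (meson bounded_cball bounded_subset closed_closure compact_eq_bounded_closed)
 then show ?thesis using assms(1) by (simp add: test_fn_def smooth_def)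
qed

lemma test_smooth: "test_fn f ==> smooth f"
 by (simp add: test_fn_def smooth_def)

lemma test_differentiable: "test_fn f ==> f differentiable (at x)"
 by (intro smooth_differentiable test_smooth)

lemma test_support:
 fixes f :: "'a::euclidean_space => real"
 assumes "test_fn f" obtains r where "r > 0" "!!x. r < norm x ==> f x = 0"
proof -
 have "bounded (closure {x. f x \<noteq> 0})" using assms by (simp add: test_fn_def compact_imp_bounded)
 then obtain r where r: "r > 0" "\<forall>x\<in>closure {x. f x \<noteq> 0}. norm x \<le> r" by (auto simp: bounded_pos)
 show thesis
 proof (rule that[OF r(1)])
  fix x :: 'a assume "r < norm x"
  then have "x \<notin> closure {x. f x \<noteq> 0}" using r(2) by auto
  then show "f x = 0" using closure_subset[of "{x. f x \<noteq> 0}"] by auto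
 qed
qed

lemma dder_support:
 assumes "!!x. r < norm x ==> f x = 0" "r < norm x"
 shows "dder v f x = 0"
proof -
 have "(f has_derivative (%x. 0)) (at x)"
  by (rule has_derivative_transform_within_open[of "%x. 0" _ _ _ "{x. r < norm x}"])
   (use assms in "auto intro: open_Collect_less continuous_intros")
 then show ?thesis using dder_eq by metis
qed

lemma test_mult: assumes "test_fn f" "smooth g" shows "test_fn (%x. f x * g x)"
proof -
 obtain r where r: "!!x. r < norm x ==> f x = 0" using test_support[OF assms(1)] by metis
 show ?thesis
  by (rule test_fnI[OF smooth_mult[OF test_smooth[OF assms(1)] assms(2)], where r=r]) (use r in "metis mult_zero_left not_le")
qed

lemma test_mult2: "smooth g ==> test_fn f ==> test_fn (%x. g x * f x)"
 using test_mult[of f g] by (simp add: mult.commute)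

lemma test_dder: assumes "test_fn f" shows "test_fn (dder v f)"
proof -
 obtain r where r: "!!x. r < norm x ==> f x = 0" using test_support[OF assms(1)] by metis
 show ?thesis
  by (rule test_fnI[OF smooth_dder[OF test_smooth[OF assms]], where r=r]) (use dder_support[of r f, OF r] in "meson not_le")
qed

lemma test_add: assumes "test_fn f" "test_fn g" shows "test_fn (%x. f x + g x)"
proof -
 obtain r where r: "!!x. r < norm x ==> f x = 0" using test_support[OF assms(1)] by metis
 obtain r' where r': "!!x. r' < norm x ==> g x = 0" using test_support[OF assms(2)] by metis
 show ?thesis
 proof (rule test_fnI[OF smooth_add[OF assms[THEN test_smooth]], where r="max r r'"])
  fix x assume "f x + g x \<noteq> 0"
  then have "\<not> (r < norm x \<and> r' < norm x)" using r r' by auto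
  then show "norm x \<le> max r r'" by auto
 qed
qed

lemma test_cmult: "test_fn f ==> test_fn (%x. c * f x)"
 by (rule test_mult2) auto

lemma test_zero [simp]: "test_fn (%x. 0)"
 by (rule test_fnI[of _ 0]) auto

lemma test_diff: "test_fn f ==> test_fn g ==> test_fn (%x. f x - g x)"
 using test_add[of f "%x. (-1) * g x"] test_cmult[of g "-1"] by simp

lemma test_sum: "(!!i. i \<in> I ==> test_fn (f i)) ==> test_fn (%x. \<Sum>i\<in>I. f i x)"
 by (induction I rule: infinite_finite_induct) (auto intro: test_add)

lemma test_translate:
 assumes "test_fn f" shows "test_fn (%x. f (x + a))"
proof -
 obtain r where r: "!!x. r < norm x ==> f x = 0" using test_support[OF assms] by metis
 show ?thesis
 proof (rule test_fnI[of _ "r + norm a"])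
  show "smooth (%x. f (x + a))"
   using smooth_affine[OF bounded_linear_ident test_smooth[OF assms]] by simp
  show "norm x \<le> r + norm a" if "f (x + a) \<noteq> 0" for x
  proof -
   have "norm (x + a) \<le> r" using r[of "x + a"] that by (meson not_le)
   then show ?thesis using norm_triangle_ineq4[of "x + a" a] by simp
  qed
 qed
qed

lemma test_bounded:
 assumes "test_fn f" obtains C where "C > 0" "!!x. \<bar>f x\<bar> \<le> C"
proof -
 have "compact (closure {x. f x \<noteq> 0})" using assms by (simp add: test_fn_def)
 then have "bounded (f ` closure {x. f x \<noteq> 0})"
  by (intro compact_imp_bounded compact_continuous_image smooth_continuous test_smooth assms)
 then obtain C where C: "C > 0" "\<forall>x\<in>closure {x. f x \<noteq> 0}. \<bar>f x\<bar> \<le> C" by (auto simp: bounded_pos)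
 have "\<bar>f x\<bar> \<le> C" for x
  using C closure_subset[of "{x. f x \<noteq> 0}"] by (cases "f x = 0") auto
 then show ?thesis using that C(1) by blast
qed

lemma integrable_continuous_support:
 fixes f :: "'a::euclidean_space => real"
 assumes "continuous_on UNIV f" "!!x. r < norm x ==> f x = 0"
 shows "integrable lborel f"
proof -
 have "integrable lborel (%x. indicator (cball 0 r) x *R f x)"
  by (rule borel_integrable_compact) (auto intro: continuous_on_subset[OF assms(1)])
 moreover have "(%x. indicator (cball 0 r) x *R f x) = f"
  using assms(2) by (force simp: indicator_def)
 ultimately show ?thesis by simp
qed

lemma test_integrable: assumes "test_fn f" shows "integrable lborel f"
proof -
 obtain r where r: "!!x. r < norm x ==> f x = 0" using test_support[OF assms] by metis
 show ?thesis
  by (rule integrable_continuous_support[OF smooth_continuous[OF test_smooth[OF assms]] r])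
qed

lemma test_sqi [simp]: "test_fn f ==> sqi f"
 unfolding sqi_def using test_integrable[OF test_mult[of f f]]
 by (auto simp: power2_eq_square test_smooth intro: smooth_borel)

lemma test_borel [measurable_dest]: "test_fn f ==> f \<in> borel_measurable borel"
 by (intro smooth_borel test_smooth)

lemma exists_bump: "\<exists>f::'a::euclidean_space => real. test_fn f \<and> f 0 = 1"
proof -
 define f :: "'a => real" where "f x = (\<Prod>b\<in>Basis. flat 0 (x \<bullet> b + 1) * flat 0 (x \<bullet> (- b) + 1))" for x
 have sl: "smooth (%x::'a. flat 0 (x \<bullet> b + 1))" for b
  by (rule smooth_affine[OF _ smooth_flat]) (rule bounded_linear_inner_left)
 have sm: "smooth f" unfolding f_def[abs_def] by (intro smooth_prod smooth_mult sl)
 have t: "test_fn f"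
 proof (rule test_fnI[OF sm])
  fix x assume "f x \<noteq> 0"
  then have "\<bar>x \<bullet> b\<bar> \<le> 1" if "b \<in> Basis" for b
   using that by (auto simp: f_def flat_bounds not_le)
  then have "(\<Sum>b\<in>Basis. \<bar>x \<bullet> b\<bar>) \<le> (\<Sum>b\<in>(Basis::'a set). 1)" by (rule sum_mono)
  then show "norm x \<le> (\<Sum>b\<in>(Basis::'a set). 1)" using norm_le_l1[of x] by linarith
 qed
 have "f 0 \<noteq> 0" by (simp add: f_def flat_def)
 then show ?thesis using test_cmult[OF t, of "1 / f 0"] by (intro exI[of _ "%x. 1 / f 0 * f x"]) auto
qed

text \<open>Products of scaled \<open>flat 0\<close> are test functions that converge boundedly to
  indicators of boxes, so the integral of \<open>u\<close> over every box vanishes. The measures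
  with the positive and the negative part of \<open>u\<close> as densities then agree on boxes,
  hence on all Borel sets, and the two parts coincide almost everywhere.\<close>

lemma l2_eq_0_if_orthogonal_test:
 fixes u :: "'a::euclidean_space l2"
 assumes "!!ph. test_fn ph ==> inner u (cls ph) = 0"
 shows "u = 0"
proof -
 define f where "f = fn u"
 have sf: "sqi f" by (simp add: f_def)
 note [measurable] = sqi_borel[OF sf]
 have ibox: "integrable lborel (%x. indicator (box a c) x * f x)" for a c :: 'a
 proof (rule sqi_mult_integrable[OF _ sf])
  have "(indicator (box a c) x :: real)^2 = indicator (box a c) x" for x by (simp add: indicator_def)
  then show "sqi (indicator (box a c) :: 'a => real)"
   unfolding sqi_def by (auto intro!: integrable_real_indicator emeasure_bounded_finite bounded_box simp del: infinity_ennreal_def)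
 qed
 have box0: "(LI x. indicator (box a c) x * f x) = 0" for a c :: 'a
 proof -
  define g where "g n x = (\<Prod>b\<in>Basis. flat 0 (x \<bullet> (real n *R b) + - (real n * (a \<bullet> b)))
    * flat 0 (x \<bullet> (- (real n *R b)) + real n * (c \<bullet> b)))" for n and x :: 'a
  have sl: "smooth (%x::'a. flat 0 (x \<bullet> b + k))" for b k
   by (rule smooth_affine[OF _ smooth_flat]) (rule bounded_linear_inner_left)
  have sm: "smooth (g n)" for n unfolding g_def[abs_def] by (intro smooth_prod smooth_mult sl)
  have g_eq: "g n x = (\<Prod>b\<in>Basis. flat 0 (real n * (x \<bullet> b - a \<bullet> b)) * flat 0 (real n * (c \<bullet> b - x \<bullet> b)))" for n x
   unfolding g_def by (simp add: algebra_simps)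
  have supp: "x \<in> box a c" if "g n x \<noteq> 0" for n x
   unfolding mem_box
  proof
   fix b :: 'a assume b: "b \<in> Basis"
   then have "flat 0 (real n * (x \<bullet> b - a \<bullet> b)) \<noteq> 0" "flat 0 (real n * (c \<bullet> b - x \<bullet> b)) \<noteq> 0"
    using that by (auto simp: g_eq)
   then show "a \<bullet> b < x \<bullet> b \<and> x \<bullet> b < c \<bullet> b"
    by (auto simp: flat_bounds not_le zero_less_mult_iff)
  qed
  obtain r where r: "!!x. x \<in> box a c ==> norm x \<le> r"
   using bounded_box[of a c] by (auto simp: bounded_iff)
  have tg: "test_fn (g n)" for n by (rule test_fnI[OF sm]) (use supp r in blast)
  have lim: "(%n. g n x) ----> indicator (box a c) x" for x
  proof -
   have "(%n. g n x) ----> (\<Prod>b\<in>Basis. (if 0 < x \<bullet> b - a \<bullet> b then 1 else 0) * (if 0 < c \<bullet> b - x \<bullet> b then 1 else 0))"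
    unfolding g_eq by (intro tendsto_prod tendsto_mult flat_scaled_limit)
   also have "(\<Prod>b\<in>Basis. (if 0 < x \<bullet> b - a \<bullet> b then 1 else 0) * (if 0 < c \<bullet> b - x \<bullet> b then 1 else 0)) = (indicator (box a c) x :: real)"
    by (cases "x \<in> box a c") (auto simp: mem_box prod_zero_iff)
   finally show ?thesis .
  qed
  have bd: "\<bar>g n x\<bar> \<le> indicator (box a c) x" for n x
  proof (cases "g n x = 0")
   case False
   have "\<bar>g n x\<bar> \<le> (\<Prod>b\<in>(Basis::'a set). 1)"
    unfolding g_eq abs_prod by (rule prod_mono) (auto simp: abs_mult flat_bounds intro!: mult_le_one)
   then show ?thesis using supp[OF False] by simp
  qed simp
  have "(%n. LI x. g n x * f x) ----> (LI x. indicator (box a c) x * f x)"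
  proof (rule integral_dominated_convergence[where w="%x. \<bar>indicator (box a c) x * f x\<bar>"])
   show "(%x. g n x * f x) \<in> borel_measurable lborel" for n using sm[of n] by measurable
   show "integrable lborel (%x. \<bar>indicator (box a c) x * f x\<bar>)" using ibox by (rule integrable_abs)
   show "AE x in lborel. (%i. g i x * f x) ----> indicator (box a c) x * f x"
    by (intro AE_I2 tendsto_intros lim)
   show "AE x in lborel. norm (g n x * f x) \<le> \<bar>indicator (box a c) x * f x\<bar>" for n
    using bd by (intro AE_I2) (auto simp: abs_mult intro!: mult_right_mono)
  qed measurable
  moreover have "(LI x. g n x * f x) = 0" for n
   using assms[OF tg, of n] by (simp add: inner_fn tg f_def mult.commute)
  ultimately show ?thesis by (simp add: LIMSEQ_const_iff)
 qed
 define P where "P = density lborel (%x. ennreal (f x))"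
 define N where "N = density lborel (%x. ennreal (- f x))"
 have em: "emeasure P (box a c) = (NI x. ennreal (indicator (box a c) x * f x))"
  "emeasure N (box a c) = (NI x. ennreal (- (indicator (box a c) x * f x)))" for a c
  unfolding P_def N_def
  by (simp_all add: emeasure_density) (auto intro!: nn_integral_cong simp: indicator_def)
 have PN: "emeasure P (box a c) = emeasure N (box a c)" and fin: "emeasure P (box a c) \<noteq> \<infinity>" for a c
 proof -
  note i = integrableD[OF ibox[of a c]]
  have "enn2real (emeasure P (box a c)) - enn2real (emeasure N (box a c)) = 0"
   using box0[of a c] unfolding em real_lebesgue_integral_def[OF ibox] .
  moreover show "emeasure P (box a c) \<noteq> \<infinity>" using i(2) by (simp add: em)
  moreover have "emeasure N (box a c) \<noteq> \<infinity>" using i(3) by (simp add: em)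
  ultimately show "emeasure P (box a c) = emeasure N (box a c)"
   by (metis diff_eq_eq add_0 ennreal_enn2real_if infinity_ennreal_def)
 qed
 have "P = N"
 proof (rule measure_eqI_generator_eq)
  let ?E = "range (%(a, c). box a c::'a set)"
  show "Int_stable ?E"
   by (auto simp: Int_stable_def box_Int_box)
  show "?E \<subseteq> Pow UNIV" "sets P = sigma_sets UNIV ?E" "sets N = sigma_sets UNIV ?E"
   by (auto simp: P_def N_def borel_eq_box)
  let ?A = "%n::nat. box (- (real n *R One)) (real n *R One) :: 'a set"
  show "range ?A \<subseteq> ?E" "(\<Union>i. ?A i) = UNIV"
   unfolding UN_box_eq_UNIV by auto
  show "emeasure P (?A i) \<noteq> \<infinity>" for i by (rule fin)
  show "emeasure P X = emeasure N X" if "X \<in> ?E" for X using that PN by auto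
 qed
 then have "AE x in lborel. ennreal (f x) = ennreal (- f x)"
  unfolding P_def N_def by (intro sigma_finite_measure.density_unique[OF sigma_finite_lborel]) auto
 then have "AE x in lborel. f x = 0"
 proof eventually_elim
  case (elim x)
  then show ?case by (cases "f x \<ge> 0") (auto simp: ennreal_neg ennreal_eq_0_iff dest: sym)
 qed
 then have "cls f = cls (%x. 0)" using cls_eq_iff[OF sf sqi_zero] by blast
 then show ?thesis by (simp add: f_def cls_zero)
qed

lemma subspace_test: "subspace (cls ` Collect test_fn)"
proof (rule subspaceI)
 show "0 \<in> cls ` Collect test_fn" using cls_zero[symmetric] by (intro image_eqI) auto
 fix u v :: "'a l2" and c assume u: "u \<in> cls ` Collect test_fn"
 then show "c *R u \<in> cls ` Collect test_fn"
  by (auto simp: cls_scale[symmetric] intro: test_cmult)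
 assume "v \<in> cls ` Collect test_fn"
 with u show "u + v \<in> cls ` Collect test_fn"
  by (auto simp: cls_add[symmetric] intro: test_add)
qed

lemma test_dense: "closure (cls ` Collect test_fn) = (UNIV :: 'a::euclidean_space l2 set)"
proof -
 have "u \<in> closure (cls ` Collect test_fn)" for u :: "'a l2"
  by (rule dense_subspace_if_orthogonal_trivial[OF subspace_test subspace_UNIV])
   (auto intro: l2_eq_0_if_orthogonal_test)
 then show ?thesis by blast
qed

lemma l2_eqI_test:
 assumes "!!ph. test_fn ph ==> inner u (cls ph) = inner v (cls ph)"
 shows "u = v"
 using l2_eq_0_if_orthogonal_test[of "u - v"] assms by (simp add: inner_diff_left)

section \<open>Taylor remainders and integration by parts\<close>

lemma Taylor_bound:
 fixes g g' g'' :: "real => real"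
 assumes g: "!!s. \<bar>s\<bar> \<le> \<bar>h\<bar> ==> (g has_real_derivative g' s) (at s)"
  and g': "!!s. \<bar>s\<bar> \<le> \<bar>h\<bar> ==> (g' has_real_derivative g'' s) (at s)"
  and C: "!!s. \<bar>s\<bar> \<le> \<bar>h\<bar> ==> \<bar>g'' s\<bar> \<le> C"
 shows "\<bar>g h - g 0 - h * g' 0\<bar> \<le> C * h^2"
proof -
 have b1: "norm (g' s - g' 0) \<le> C * norm (s - 0)" if "s \<in> cball 0 \<bar>h\<bar>" for s
  by (rule field_differentiable_bound[of "cball 0 \<bar>h\<bar>" g' g''])
   (use g' C that in "auto intro: has_field_derivative_at_within")
 have "norm ((g h - g' 0 * h) - (g 0 - g' 0 * 0)) \<le> (C * \<bar>h\<bar>) * norm (h - 0)"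
 proof (rule field_differentiable_bound[of "cball 0 \<bar>h\<bar>" "%s. g s - g' 0 * s" "%s. g' s - g' 0"])
  show "((%s. g s - g' 0 * s) has_real_derivative g' s - g' 0) (at s within cball 0 \<bar>h\<bar>)" if "s \<in> cball 0 \<bar>h\<bar>" for s
  proof -
   have "(g has_real_derivative g' s) (at s)" using g that by simp
   then have "((%s. g s - g' 0 * s) has_real_derivative g' s - g' 0) (at s)"
    by (auto intro!: derivative_eq_intros)
   then show ?thesis by (rule has_field_derivative_at_within)
  qed
  show "norm (g' s - g' 0) \<le> C * \<bar>h\<bar>" if s: "s \<in> cball 0 \<bar>h\<bar>" for s
  proof -
   have "0 \<le> C" using C[of 0] by simp
   then show ?thesis using b1[OF s] s by (auto intro: order_trans[OF _ mult_left_mono])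
  qed
 qed auto
 then show ?thesis by (simp add: power2_eq_square algebra_simps)
qed

text \<open>The indicator on the right makes the remainder of order h^2 in every integral norm at
  once. This one bound yields both integration by parts and the differentiability of curves in
  L2.\<close>

lemma test_Taylor:
 fixes ph :: "'a::euclidean_space => real"
 assumes ph: "test_fn ph"
 obtains C r where "C \<ge> 0" "r > 0" "!!x v h. [|norm v \<le> 1; \<bar>h\<bar> \<le> 1|] ==>
  \<bar>ph (x + h *R v) - ph x - h * dder v ph x\<bar> \<le> C * h^2 * indicator (cball 0 r) x"
proof -
 obtain r where r: "r > 0" "!!x. r < norm x ==> ph x = 0" using test_support[OF ph] by metis
 have "\<exists>C. \<forall>x. \<bar>dder b (dder b' ph) x\<bar> \<le> C" for b b'
  using test_bounded[OF test_dder[OF test_dder[OF ph]]] by metis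
 then obtain M where M: "!!b b' x. \<bar>dder b (dder b' ph) x\<bar> \<le> M b b'" by metis
 define C where "C = (\<Sum>b\<in>Basis. \<Sum>b'\<in>Basis. \<bar>M b b'\<bar>)"
 have dph: "dder v ph x = (\<Sum>b\<in>Basis. (v \<bullet> b) * dder b ph x)" for v x
  using linear_sum[OF linear_dder[OF test_differentiable[OF ph]], of "%b. (v \<bullet> b) *R b" Basis x]
   linear_cmul[OF linear_dder[OF test_differentiable[OF ph]]]
  by (simp add: euclidean_representation)
 have e2: "dder v (dder v ph) x = (\<Sum>b\<in>Basis. \<Sum>b'\<in>Basis. (v \<bullet> b) * ((v \<bullet> b') * dder b (dder b' ph) x))" for v x
 proof -
  have ext: "dder v ph = (%x. \<Sum>b\<in>Basis. (v \<bullet> b) * dder b ph x)" using dph by blast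
  have "((%x. \<Sum>b'\<in>Basis. (v \<bullet> b') * dder b' ph x) has_derivative
   (%w. \<Sum>b'\<in>Basis. (v \<bullet> b') * dder w (dder b' ph) x)) (at x)"
   by (intro has_derivative_sum has_derivative_mult_right has_derivative_dder test_differentiable test_dder ph)
  then have 1: "dder v (dder v ph) x = (\<Sum>b'\<in>Basis. (v \<bullet> b') * dder v (dder b' ph) x)"
   unfolding ext[symmetric] by (rule dder_eq)
  have 2: "dder v (dder b' ph) x = (\<Sum>b\<in>Basis. (v \<bullet> b) * dder b (dder b' ph) x)" for b'
   using linear_sum[OF linear_dder[OF test_differentiable[OF test_dder[OF ph]]], of "%b. (v \<bullet> b) *R b" Basis b' x]
    linear_cmul[OF linear_dder[OF test_differentiable[OF test_dder[OF ph]]]]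
   by (simp add: euclidean_representation)
  have "dder v (dder v ph) x = (\<Sum>b'\<in>Basis. (v \<bullet> b') * (\<Sum>b\<in>Basis. (v \<bullet> b) * dder b (dder b' ph) x))"
   unfolding 1 by (rule sum.cong[OF refl]) (simp only: 2)
  then show ?thesis unfolding sum_distrib_left by (subst sum.swap) (simp add: mult_ac)
 qed
 have bd: "\<bar>dder v (dder v ph) x\<bar> \<le> C" if v: "norm v \<le> 1" for v x
 proof -
  have vb: "\<bar>v \<bullet> b\<bar> \<le> 1" if "b \<in> Basis" for b using Basis_le_norm[OF that, of v] v by linarith
  have "\<bar>dder v (dder v ph) x\<bar> \<le> (\<Sum>b\<in>Basis. \<Sum>b'\<in>Basis. \<bar>(v \<bullet> b) * ((v \<bullet> b') * dder b (dder b' ph) x)\<bar>)"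
   unfolding e2 by (intro order_trans[OF sum_abs] sum_mono order_trans[OF sum_abs] order_refl)
  also have "... \<le> C" unfolding C_def
  proof (intro sum_mono)
   fix b b' :: 'a assume b: "b \<in> Basis" "b' \<in> Basis"
   have "\<bar>(v \<bullet> b) * ((v \<bullet> b') * dder b (dder b' ph) x)\<bar> \<le> 1 * (1 * \<bar>M b b'\<bar>)"
    unfolding abs_mult by (intro mult_mono vb b) (use M[of b b' x] in auto)
   then show "\<bar>(v \<bullet> b) * ((v \<bullet> b') * dder b (dder b' ph) x)\<bar> \<le> \<bar>M b b'\<bar>" by simp
  qed
  finally show ?thesis .
 qed
 have C0: "C \<ge> 0" unfolding C_def by (intro sum_nonneg) auto
 show thesis
 \<comment> \<open>The shift \<open>h *R v\<close> has length at most 1, so all three terms vanish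
   beyond \<open>r + 1\<close>.\<close>
 proof (rule that[of C "r + 1"])
  fix x v :: 'a and h :: real assume v: "norm v \<le> 1" and h: "\<bar>h\<bar> \<le> 1"
  show "\<bar>ph (x + h *R v) - ph x - h * dder v ph x\<bar> \<le> C * h^2 * indicator (cball 0 (r + 1)) x"
  proof (cases "norm x \<le> r + 1")
   case True
   have "\<bar>ph (x + h *R v) - ph (x + 0 *R v) - h * dder v ph (x + 0 *R v)\<bar> \<le> C * h^2"
    by (rule Taylor_bound[where g''="%s. dder v (dder v ph) (x + s *R v)"])
     (auto intro!: dder_line test_differentiable test_dder ph bd v)
   then show ?thesis using True by simp
  next
   case False
   have "norm x \<le> norm (x + h *R v) + norm (h *R v)"
    using norm_triangle_ineq4[of "x + h *R v" "h *R v"] by simp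
   moreover have "norm (h *R v) \<le> 1" using v h by (simp add: mult_le_one)
   ultimately have "ph (x + h *R v) = 0" "ph x = 0" "dder v ph x = 0"
    using False r dder_support[of r ph, OF r(2)] by auto
   then show ?thesis using C0 by simp
  qed
 qed (use r C0 in auto)
qed

lemma lborel_integral_translate:
 fixes f :: "'a::euclidean_space => real"
 assumes [measurable]: "f \<in> borel_measurable borel"
 shows "(LI x. f (x + a)) = (LI x. f x)"
  and "integrable lborel (%x. f (x + a)) \<longleftrightarrow> integrable lborel f"
proof -
 have "(LINT x|distr lborel borel ((+) a). f x) = (LI x. f (a + x))"
  by (rule integral_distr) auto
 then show "(LI x. f (x + a)) = (LI x. f x)"
  unfolding lborel_distr_plus by (simp add: add.commute)
 have "integrable (distr lborel borel ((+) a)) f \<longleftrightarrow> integrable lborel (%x. f (a + x))"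
  by (rule integrable_distr_eq) auto
 then show "integrable lborel (%x. f (x + a)) \<longleftrightarrow> integrable lborel f"
  unfolding lborel_distr_plus by (simp add: add.commute)
qed

text \<open>By translation invariance the difference quotients have integral 0, and the remainder of
  \<open>test_Taylor\<close> contributes only order h after division by h.\<close>

lemma integral_dder_eq_0:
 fixes ph :: "'a::euclidean_space => real"
 assumes ph: "test_fn ph"
 shows "(LI x. dder v ph x) = 0"
proof -
 \<comment> \<open>Scales \<open>v\<close> into the unit ball, where \<open>test_Taylor\<close>
   applies; the factor is divided out at the end.\<close>
 define c where "c = 1 / (1 + norm v)"
 have c: "c > 0" by (simp add: c_def add_pos_nonneg)
 have nv: "norm (c *R v) \<le> 1" by (simp add: c_def field_simps add_pos_nonneg)
 have dc: "dder (c *R v) ph x = c * dder v ph x" for x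
  using linear_cmul[OF linear_dder[OF test_differentiable[OF ph]]] by simp
 obtain C r where C: "C \<ge> 0" "r > 0" "!!x v h. [|norm v \<le> 1; \<bar>h\<bar> \<le> 1|] ==>
  \<bar>ph (x + h *R v) - ph x - h * dder v ph x\<bar> \<le> C * h^2 * indicator (cball 0 r) x"
  using test_Taylor[OF ph] by blast
 define I where "I = (LI x. dder (c *R v) ph x)"
 define K where "K = measure lborel (cball (0::'a) r)"
 have ind: "integrable lborel (%x. C * h^2 * indicator (cball (0::'a) r) x)" for h
  by (intro integrable_mult_right integrable_real_indicator emeasure_bounded_finite bounded_cball) auto
 have it: "integrable lborel (%x. ph (x + h *R (c *R v)))" for h
  by (intro test_integrable test_translate ph)
 have hI: "\<bar>h * I\<bar> \<le> C * h^2 * K" if h: "\<bar>h\<bar> \<le> 1" for h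
 proof -
  have "(LI x. ph (x + h *R (c *R v)) - ph x - h * dder (c *R v) ph x) = - (h * I)"
   using it test_integrable[OF ph] test_integrable[OF test_dder[OF ph]] ph
   by (simp add: I_def lborel_integral_translate test_borel del: scaleR_scaleR)
  moreover have "norm (LI x. ph (x + h *R (c *R v)) - ph x - h * dder (c *R v) ph x)
   \<le> (LI x. C * h^2 * indicator (cball (0::'a) r) x)"
   by (rule Bochner_Integration.integral_norm_bound_integral) (use C(3)[OF nv h] it test_integrable[OF ph] test_integrable[OF test_dder[OF ph]] ind
     in "auto simp del: scaleR_scaleR")
  ultimately show ?thesis by (simp add: K_def)
 qed
 have Ib: "\<bar>I\<bar> * h \<le> (C * K * h) * h" if "0 < h" "h \<le> 1" for h
 proof -
  have "\<bar>h * I\<bar> = \<bar>I\<bar> * h" using that by (simp add: abs_mult)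
  moreover have "C * h^2 * K = (C * K * h) * h" by (simp add: power2_eq_square)
  ultimately show ?thesis using hI[of h] that by linarith
 qed
 have b: "\<bar>I\<bar> \<le> C * K * h" if "0 < h" "h \<le> 1" for h
  by (rule mult_right_le_imp_le[OF Ib[OF that] that(1)])
 have "((%h. C * K * h) ---> C * K * 0) (at_right 0)" by (intro tendsto_intros)
 moreover have "eventually (%h. \<bar>I\<bar> \<le> C * K * h) (at_right 0)"
  unfolding eventually_at_right_field using b by (intro exI[of _ 1]) auto
 ultimately have "\<bar>I\<bar> \<le> C * K * 0" by (rule tendsto_lowerbound) simp
 then show ?thesis using c by (simp add: I_def dc)
qed

lemma integral_by_parts_test:
 assumes ph: "test_fn ph" and f: "smooth f"
 shows "(LI x. f x * dder v ph x) = - (LI x. dder v f x * ph x)"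
proof -
 have "dder v (%x. f x * ph x) = (%x. f x * dder v ph x + dder v f x * ph x)"
  by (rule ext, rule dder_mult) (auto intro: smooth_differentiable test_smooth f ph)
 then have "(LI x. f x * dder v ph x + dder v f x * ph x) = 0"
  using integral_dder_eq_0[OF test_mult2[OF f ph], of v] by simp
 moreover have "integrable lborel (%x. f x * dder v ph x)" "integrable lborel (%x. dder v f x * ph x)"
  by (intro test_integrable test_mult2 test_dder f ph smooth_dder)+
 ultimately show ?thesis by simp
qed

lemma inner_dder_test:
 assumes "test_fn ph" "test_fn th"
 shows "inner (cls (dder v ph)) (cls th) = - inner (cls ph) (cls (dder v th))"
 using integral_by_parts_test[OF assms(2) test_smooth[OF assms(1)], of v]
 by (simp add: inner_cls test_dder assms)

lemma norm_indicator_cball: "norm (cls (%x. c * indicator (cball (0::'a::euclidean_space) r) x)) = \<bar>c\<bar> * sqrt (measure lborel (cball (0::'a) r))"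
 and sqi_indicator_cball: "sqi (%x. c * indicator (cball (0::'a) r) x)"
proof -
 have i: "integrable lborel (indicator (cball (0::'a) r) :: _ => real)"
  by (intro integrable_real_indicator emeasure_bounded_finite bounded_cball) auto
 have sq: "(c * indicator (cball (0::'a) r) x)^2 = c^2 * indicator (cball 0 r) x" for x
  by (simp add: indicator_def)
 show s: "sqi (%x. c * indicator (cball (0::'a) r) x)"
  unfolding sqi_def sq using i by auto
 show "norm (cls (%x. c * indicator (cball (0::'a) r) x)) = \<bar>c\<bar> * sqrt (measure lborel (cball (0::'a) r))"
  by (simp add: norm_cls[OF s] sq real_sqrt_mult)
qed

lemma norm_cls_le_cball:
 fixes f :: "'a::euclidean_space => real"
 assumes "f \<in> borel_measurable borel" "!!x. \<bar>f x\<bar> \<le> c * indicator (cball 0 r) x" "0 \<le> c"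
 shows "norm (cls f) \<le> c * sqrt (measure lborel (cball (0::'a) r))"
 using norm_cls_le[OF sqi_indicator_cball, of f c r] assms by (simp add: norm_indicator_cball)

lemma has_vector_derivative_cls:
 fixes \<Phi> :: "real => 'a::euclidean_space => real"
 assumes s: "!!t. sqi (\<Phi> t)" and s': "sqi \<Phi>'" and d: "\<delta> > 0" and C: "C \<ge> 0"
  and b: "!!h x. \<bar>h\<bar> < \<delta> ==> \<bar>\<Phi> (t + h) x - \<Phi> t x - h * \<Phi>' x\<bar> \<le> C * h^2 * indicator (cball 0 r) x"
 shows "((%t. cls (\<Phi> t)) has_vector_derivative cls \<Phi>') (at t)"
proof -
 define K where "K = C * sqrt (measure lborel (cball (0::'a) r))"
 have K0: "K \<ge> 0" using C by (simp add: K_def)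
 have bound: "norm (cls (\<Phi> (t + h)) - cls (\<Phi> t) - h *R cls \<Phi>') \<le> K * h^2" if h: "\<bar>h\<bar> < \<delta>" for h
 proof -
  have e: "cls (\<Phi> (t + h)) - cls (\<Phi> t) - h *R cls \<Phi>' = cls (%x. \<Phi> (t + h) x - \<Phi> t x - h * \<Phi>' x)"
   by (simp add: cls_diff cls_scale sqi_diff sqi_scale s s')
  have sq: "sqi (%x. \<Phi> (t + h) x - \<Phi> t x - h * \<Phi>' x)" by (intro sqi_diff sqi_scale s s')
  show ?thesis unfolding e K_def
   using norm_cls_le_cball[of "%x. \<Phi> (t + h) x - \<Phi> t x - h * \<Phi>' x" "C * h^2" r] b[OF h] C
   by (auto simp: sqi_borel[OF sq] mult_ac)
 qed
 show ?thesis
  unfolding has_vector_derivative_def has_derivative_iff_norm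
 proof
  show "bounded_linear (%x. x *R cls \<Phi>')" by (rule bounded_linear_scaleR_left)
  show "((%y. norm (cls (\<Phi> y) - cls (\<Phi> t) - (y - t) *R cls \<Phi>') / norm (y - t)) ---> 0) (at t)"
  proof (rule Lim_null_comparison)
   show "\<forall>\<^sub>F y in at t. norm (norm (cls (\<Phi> y) - cls (\<Phi> t) - (y - t) *R cls \<Phi>') / norm (y - t)) \<le> K * \<bar>y - t\<bar>"
    unfolding eventually_at
   proof (intro exI[of _ \<delta>] conjI ballI impI d)
    fix y assume y: "y \<noteq> t \<and> dist y t < \<delta>"
    then show "norm (norm (cls (\<Phi> y) - cls (\<Phi> t) - (y - t) *R cls \<Phi>') / norm (y - t)) \<le> K * \<bar>y - t\<bar>"
     using bound[of "y - t"] by (simp add: dist_real_def divide_le_eq power2_eq_square mult_ac abs_mult[symmetric])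
   qed
   have "((%y. K * \<bar>y - t\<bar>) ---> K * \<bar>t - t\<bar>) (at t)" by (intro tendsto_intros)
   then show "((%y. K * \<bar>y - t\<bar>) ---> 0) (at t)" by simp
  qed
 qed
qed

subsection \<open>Translations\<close>

definition tr :: "'a::euclidean_space => 'a l2 => 'a l2" where
 "tr h u = cls (%x. fn u (x + h))"

lemma sqi_translate: "sqi f ==> sqi (%x. f (x + h))"
 using lborel_integral_translate(2)[of "%x. (f x)^2" h] by (auto simp: sqi_def)

lemma AE_translate:
 fixes h :: "'a::euclidean_space"
 assumes "AE x in lborel. P x" shows "AE x in lborel. P (x + h)"
proof -
 obtain N where N0: "{x \<in> space lborel. \<not> P x} \<subseteq> N" "emeasure lborel N = 0" "N \<in> sets lborel"
  by (rule AE_E[OF assms])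
 then have N: "N \<in> null_sets lborel" "{x. \<not> P x} \<subseteq> N" by (auto intro: null_setsI)
 have [measurable]: "N \<in> sets borel" using N by auto
 have "AE x in lborel. x \<notin> N" using N by (simp add: AE_not_in)
 then have "AE x in distr lborel borel ((+) h). x \<notin> N" by (subst lborel_distr_plus)
 then have "AE x in lborel. h + x \<notin> N"
  by (subst (asm) AE_distr_iff) auto
 then show ?thesis by eventually_elim (use N(2) in "auto simp: add.commute")
qed

lemma tr_cls: "sqi f ==> tr h (cls f) = cls (%x. f (x + h))"
 unfolding tr_def
 by (subst cls_eq_iff) (auto intro: sqi_translate AE_translate fn_cls)

lemma inner_tr: "inner (tr h u) (tr h v) = inner u v"
proof -
 have "(LI x. fn u (x + h) * fn v (x + h)) = (LI x. fn u x * fn v x)"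
  using sqi_borel[OF sqi_fn[of u]] sqi_borel[OF sqi_fn[of v]]
  by (intro lborel_integral_translate(1)[of "%x. fn u x * fn v x"]) measurable
 then show ?thesis
  using inner_cls[of "fn u" "fn v"] by (simp add: tr_def inner_cls sqi_translate)
qed

lemma norm_tr [simp]: "norm (tr h u) = norm u"
 by (simp add: norm_eq_sqrt_inner inner_tr)

lemma tr_add: "tr h (u + v) = tr h u + tr h v"
proof -
 have "tr h (cls (%x. fn u x + fn v x)) = cls (%x. fn u (x + h)) + cls (%x. fn v (x + h))"
  unfolding tr_cls[OF sqi_add[OF sqi_fn sqi_fn]] by (rule cls_add) (auto intro: sqi_translate)
 then show ?thesis by (simp add: cls_add flip: tr_def)
qed

lemma tr_scaleR: "tr h (c *R u) = c *R tr h u"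
proof -
 have "tr h (cls (%x. c * fn u x)) = c *R cls (%x. fn u (x + h))"
  unfolding tr_cls[OF sqi_scale[OF sqi_fn]] by (rule cls_scale) (auto intro: sqi_translate)
 then show ?thesis by (simp add: cls_scale flip: tr_def)
qed

lemma bounded_linear_tr: "bounded_linear (tr h)"
 by (rule bounded_linear_intro[of _ 1]) (auto simp: tr_add tr_scaleR)

lemma tr_diff: "tr h (u - v) = tr h u - tr h v"
 by (simp add: linear_diff bounded_linear.linear bounded_linear_tr)

lemma tr_tr: "tr h (tr k u) = tr (h + k) u"
proof -
 have "tr h (tr k (cls (fn u))) = tr (h + k) (cls (fn u))"
  by (simp only: tr_cls sqi_fn sqi_translate add.assoc)
 then show ?thesis by simp
qed

lemma tr_0 [simp]: "tr 0 u = u"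
 by (simp add: tr_def)

lemma inner_tr_left: "inner (tr h u) v = inner u (tr (- h) v)"
 using inner_tr[of h u "tr (- h) v"] by (simp add: tr_tr)

text \<open>Translations are isometries, so \<open>u\<close> may be replaced by a nearby test
  function, which moves little by uniform continuity and only inside a fixed ball.\<close>

lemma tr_continuous_0: "((%h. tr h u) ---> u) (at (0::'a::euclidean_space))"
proof (rule tendstoI)
 fix e :: real assume e: "0 < e"
 have "u \<in> closure (cls ` Collect test_fn)" using test_dense by blast
 then obtain ph where ph: "test_fn ph" "dist (cls ph) u < e/3"
  unfolding closure_approachable using e by (auto dest!: spec[of _ "e/3"])
 obtain r where r: "r > 0" "!!x. r < norm x ==> ph x = 0" using test_support[OF ph(1)] by metis
 define K where "K = sqrt (measure lborel (cball (0::'a) (r + 1))) + 1"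
 have K: "K > 0" by (simp add: K_def add_nonneg_pos)
 have "uniformly_continuous_on (cball 0 (r+2)) ph"
  by (intro compact_uniformly_continuous smooth_continuous test_smooth ph) auto
 then obtain d where d: "d > 0" "!!x y. [|x \<in> cball 0 (r+2); y \<in> cball 0 (r+2); dist y x < d|] ==> dist (ph y) (ph x) < e / (3 * K)"
  unfolding uniformly_continuous_on_def using e K by (metis divide_pos_pos mult_pos_pos zero_less_numeral)
 have "dist (tr h u) u < e" if h: "norm h < min d 1" for h :: 'a
 proof -
  have "\<bar>ph (x + h) - ph x\<bar> \<le> e / (3 * K) * indicator (cball 0 (r+1)) x" for x
  proof (cases "norm x \<le> r + 1")
   case True
   then have "x \<in> cball 0 (r+2)" "x + h \<in> cball 0 (r+2)" "dist (x + h) x < d"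
    using h norm_triangle_ineq[of x h] by (auto simp: dist_norm mem_cball_0 simp del: mem_cball)
   then show ?thesis using d(2)[of x "x + h"] True by (simp add: dist_real_def)
  next
   case False
   have "norm x \<le> norm (x + h) + norm h"
    using norm_triangle_ineq4[of "x + h" h] by simp
   then have "ph (x + h) = 0" "ph x = 0" using False h r by auto
   then show ?thesis using e K by simp
  qed
  then have "norm (cls (%x. ph (x + h) - ph x)) \<le> e / (3 * K) * sqrt (measure lborel (cball (0::'a) (r+1)))"
   using e K test_borel[OF ph(1)] by (intro norm_cls_le_cball) auto
  also have "... \<le> e / (3 * K) * K" using e K by (intro mult_left_mono) (auto simp: K_def)
  finally have "norm (tr h (cls ph) - cls ph) \<le> e / 3"
   using K ph by (simp add: tr_cls cls_diff sqi_translate)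
  moreover have "norm (tr h (u - cls ph)) < e/3" "norm (cls ph - u) < e/3" using ph(2) by (simp_all add: dist_norm norm_minus_commute)
  moreover have "tr h u - u = tr h (u - cls ph) + (tr h (cls ph) - cls ph) + (cls ph - u)" by (simp add: tr_diff)
  ultimately show ?thesis
   unfolding dist_norm
   using norm_triangle_ineq[of "tr h (u - cls ph) + (tr h (cls ph) - cls ph)" "cls ph - u"]
    norm_triangle_ineq[of "tr h (u - cls ph)" "tr h (cls ph) - cls ph"] by simp
 qed
 then show "\<forall>\<^sub>F h in at 0. dist (tr h u) u < e"
  unfolding eventually_at using d(1) by (intro exI[of _ "min d 1"]) auto
qed

lemma continuous_on_tr: "continuous_on A (%h. tr h u)"
proof (rule continuous_at_imp_continuous_on, rule ballI)
 fix h
 have "((%k. tr h (tr k u)) ---> tr h u) (at 0)"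
  using bounded_linear.tendsto[OF bounded_linear_tr tr_continuous_0] .
 then have "((%k. tr (h + k) u) ---> tr h u) (at 0)" by (simp add: tr_tr)
 then show "isCont (%h. tr h u) h" by (simp add: isCont_iff)
qed

lemma has_derivativeI_quadratic:
 fixes f :: "'a::euclidean_space => real"
 assumes L: "linear L" and d: "\<delta> > 0"
  and b: "!!h. norm h \<le> \<delta> ==> \<bar>f (x + h) - f x - L h\<bar> \<le> C * (norm h)^2"
 shows "(f has_derivative L) (at x)"
 unfolding has_derivative_at
proof
 show "bounded_linear L" by (rule linear_conv_bounded_linear[THEN iffD1, OF L])
 show "(%h. norm (f (x + h) - f x - L h) / norm h) \<midarrow>0\<rightarrow> 0"
 proof (rule Lim_null_comparison)
  show "\<forall>\<^sub>F h in at 0. norm (norm (f (x + h) - f x - L h) / norm h) \<le> C * norm h"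
   unfolding eventually_at
  proof (intro exI[of _ \<delta>] conjI ballI impI d)
   fix h :: 'a assume h: "h \<noteq> 0 \<and> dist h 0 < \<delta>"
   then have "\<bar>f (x + h) - f x - L h\<bar> \<le> (C * norm h) * norm h"
    using b[of h] by (simp add: power2_eq_square mult.assoc)
   then show "norm (norm (f (x + h) - f x - L h) / norm h) \<le> C * norm h"
    using h by (simp add: divide_le_eq)
  qed
  have "((%h::'a. C * norm h) ---> C * norm (0::'a)) (at 0)" by (intro tendsto_intros)
  then show "((%h::'a. C * norm h) ---> 0) (at 0)" by simp
 qed
qed

lemma DERIV_quadratic:
 fixes f :: "real => real"
 assumes b: "!!h. \<bar>h\<bar> \<le> 1 ==> \<bar>f (x + h) - f x - h * D\<bar> \<le> C * h^2"
 shows "(f has_real_derivative D) (at x)"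
proof -
 have "(f has_derivative (%h. h * D)) (at x)"
  by (rule has_derivativeI_quadratic[where \<delta>=1 and C=C])
   (use b in "auto intro!: linearI simp: algebra_simps")
 then show ?thesis
  unfolding has_field_derivative_def by (rule has_derivative_eq_rhs) (simp add: fun_eq_iff mult.commute)
qed

lemma test_Taylor_vec:
 fixes ph :: "'a::euclidean_space => real"
 assumes ph: "test_fn ph"
 obtains C where "C \<ge> 0" "!!x h. norm h \<le> 1 ==> \<bar>ph (x + h) - ph x - dder h ph x\<bar> \<le> C * (norm h)^2"
  "!!x v h. norm v \<le> 1 ==> \<bar>h\<bar> \<le> 1 ==> \<bar>ph (x + h *R v) - ph x - h * dder v ph x\<bar> \<le> C * h^2"
proof -
 obtain C r where C: "C \<ge> 0" "!!x v h. [|norm v \<le> 1; \<bar>h\<bar> \<le> 1|] ==>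
  \<bar>ph (x + h *R v) - ph x - h * dder v ph x\<bar> \<le> C * h^2 * indicator (cball 0 r) x"
  using test_Taylor[OF ph] by metis
 have t: "\<bar>ph (x + h *R v) - ph x - h * dder v ph x\<bar> \<le> C * h^2" if "norm v \<le> 1" "\<bar>h\<bar> \<le> 1" for x v h
 proof -
  have "C * h^2 * indicator (cball 0 r) x \<le> C * h^2 * 1" by (intro mult_left_mono) (use C in "auto simp: indicator_def")
  then show ?thesis using C(2)[OF that, of x] by linarith
 qed
 show thesis
 proof (rule that[OF C(1) _ t])
  fix x h :: 'a assume h: "norm h \<le> 1"
  show "\<bar>ph (x + h) - ph x - dder h ph x\<bar> \<le> C * (norm h)^2"
  proof (cases "h = 0")
   case True
   then show ?thesis using linear_0[OF linear_dder[OF test_differentiable[OF ph]]] by simp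
  next
   case False
   define v where "v = (1 / norm h) *R h"
   have hv: "h = norm h *R v" "norm v \<le> 1" using False by (auto simp: v_def)
   have "dder h ph x = norm h * dder v ph x"
    using linear_cmul[OF linear_dder[OF test_differentiable[OF ph, of x]], of "norm h" v] hv(1) by simp
   then show ?thesis using t[OF hv(2), of "norm h" x] h hv(1) by simp
  qed
 qed auto
qed

lemma AE_zero_continuous:
 fixes g :: "'a::euclidean_space => real"
 assumes "AE x in lborel. x \<in> S --> g x = 0" "continuous_on S g" "open S" "x \<in> S"
 shows "g x = 0"
proof (rule ccontr)
 assume "g x \<noteq> 0"
 define U where "U = S \<inter> g -` (- {0})"
 have U: "open U" "x \<in> U"
  using assms \<open>g x \<noteq> 0\<close> by (auto simp: U_def intro!: continuous_open_preimage)
 have "AE x in lborel. x \<notin> U" using assms(1) by eventually_elim (auto simp: U_def)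
 then have "U \<in> null_sets lborel" using U(1) by (subst (asm) AE_iff_null_sets[symmetric]) auto
 then have "negligible U" using null_sets_completionI negligible_iff_null_sets by blast
 then show False using open_not_negligible U by blast
qed

text \<open>A continuous \<open>g\<close> need not be square integrable; multiplication by a bump
  that is 1 at \<open>p\<close> brings it into L2 without changing the value at
  \<open>p\<close>.\<close>

lemma continuous_eq_0_if_orthogonal_test:
 fixes g :: "'a::euclidean_space => real"
 assumes c: "continuous_on UNIV g" and o: "!!\<rho>. test_fn \<rho> ==> (LI x. g x * \<rho> x) = 0"
 shows "g p = 0"
proof -
 obtain ch0 :: "'a => real" where "test_fn ch0" "ch0 0 = 1" using exists_bump by blast
 then have ch: "test_fn (%x. ch0 (x + (- p)))" "ch0 (p + (- p)) = 1"
  using test_translate[of ch0 "- p"] by simp_all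
 define ch where "ch = (%x. ch0 (x + (- p)))"
 have t: "test_fn ch" "ch p = 1" using ch by (auto simp: ch_def)
 obtain r where r: "!!x. r < norm x ==> ch x = 0" using test_support[OF t(1)] by metis
 have cc: "continuous_on UNIV (%x. g x * ch x)"
  by (intro continuous_intros c smooth_continuous test_smooth t)
 have s: "sqi (%x. g x * ch x)"
  unfolding sqi_def
 proof
  show "(%x. g x * ch x) \<in> borel_measurable lborel" using borel_measurable_continuous_onI[OF cc] by simp
  show "integrable lborel (%x. (g x * ch x)^2)"
   by (rule integrable_continuous_support[of _ r]) (use r in "auto intro: continuous_on_power cc")
 qed
 have "cls (%x. g x * ch x) = 0"
 proof (rule l2_eq_0_if_orthogonal_test)
  fix ph :: "'a => real" assume ph: "test_fn ph"
  show "inner (cls (%x. g x * ch x)) (cls ph) = 0"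
   using o[OF test_mult[OF t(1) test_smooth[OF ph]]] by (simp add: inner_cls s ph mult.assoc)
 qed
 then have "AE x in lborel. g x * ch x = 0"
  using cls_eq_iff[OF s sqi_zero] by (simp add: cls_zero)
 then have "g p * ch p = 0"
  by (intro AE_zero_continuous[of UNIV "%x. g x * ch x"] cc) auto
 then show ?thesis using t by simp
qed

subsection \<open>The lemma of du Bois-Reymond\<close>

lemma smooth_if_derivs_smooth:
 assumes "!!x. K differentiable (at x)" "!!v. smooth (dder v K)"
 shows "smooth K"
 unfolding smooth_def
proof (intro allI)
 fix vs x
 show "ddirs vs K differentiable (at x)"
 proof (cases vs rule: rev_cases)
  case Nil then show ?thesis using assms(1) by simp
 next
  case (snoc ws v)
  then show ?thesis using assms(2)[of v] by (simp add: ddirs_append smooth_def)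
 qed
qed

lemma smooth_antiderivative:
 fixes th :: "real => real"
 assumes th: "smooth th"
 obtains K where "smooth K" "!!s. (K has_real_derivative th s) (at s)" "K a = 0"
proof -
 have "\<exists>F. \<forall>x. -\<infinity> < ereal x --> ereal x < \<infinity> --> (F has_vector_derivative th x) (at x)"
  by (rule einterval_antiderivative) (use smooth_continuous[OF th, of UNIV] in "auto simp: continuous_on_eq_continuous_at")
 then obtain F where F: "!!x. (F has_real_derivative th x) (at x)"
  by (auto simp: has_real_derivative_iff_has_vector_derivative)
 define K where "K s = F s - F a" for s
 have K: "(K has_real_derivative th s) (at s)" for s
  unfolding K_def[abs_def] using F[of s] by (auto intro!: derivative_eq_intros)
 have "smooth K"
 proof (rule smooth_if_derivs_smooth)
  show "K differentiable (at x)" for x using K by (auto simp: real_differentiable_def)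
  have "dder v K = (%s. th s * v)" for v by (rule ext, rule dder_real[OF K])
  then show "smooth (dder v K)" for v using smooth_mult[OF th, of "%x. v"] by simp
 qed
 then show ?thesis using that K by (simp add: K_def)
qed

lemma LBINT_continuous_support:
 fixes f F :: "real => real"
 assumes F: "!!x. a \<le> x ==> x \<le> b ==> (F has_real_derivative f x) (at x)"
  and c: "continuous_on {a..b} f" and ab: "a \<le> b"
  and z: "AE x in lborel. x \<notin> {a..b} --> g x = 0" and eq: "AE x in lborel. x \<in> {a..b} --> g x = f x"
  and g: "g \<in> borel_measurable borel"
 shows "(LI x. g x) = F b - F a" "integrable lborel g"
proof -
 let ?f = "%x. indicator {a..b} x *R f x"
 have d: "(F has_vector_derivative f x) (at x within {a..b})" if "a \<le> x" "x \<le> b" for x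
  by (rule has_vector_derivative_at_within[OF F[OF that, unfolded has_real_derivative_iff_has_vector_derivative]])
 have "has_bochner_integral lborel ?f (F b - F a)"
  by (rule has_bochner_integral_FTC_Icc[OF ab d c])
 then have hb: "integrable lborel ?f" "(LI x. ?f x) = F b - F a"
  by (auto simp: has_bochner_integral_iff)
 have ae: "AE x in lborel. g x = ?f x"
  using z eq by eventually_elim (auto simp: indicator_def)
 have m: "?f \<in> borel_measurable lborel" "g \<in> borel_measurable lborel" using hb(1) g by auto
 show "(LI x. g x) = F b - F a"
  using integral_cong_AE[OF m(2,1) ae] hb(2) by simp
 show "integrable lborel g"
  using integrable_cong_AE[OF m(2,1) ae] hb(1) by simp
qed

text \<open>For a test function \<rho>, a translate of \<rho> minus \<rho> has integral 0, so its
  antiderivative \<open>K\<close> is again a test function. Testing with \<open>K\<close> and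
  translating back shows that \<open>f (s + (a - b)) - f s\<close> is orthogonal to \<rho>.\<close>

lemma du_Bois_Reymond:
 fixes f :: "real => real"
 assumes c: "continuous_on UNIV f"
  and o: "!!K. test_fn K ==> (LI s. f s * deriv K s) = 0"
 shows "f a = f b"
proof -
 have "f (b + (a - b)) - f b = 0"
 proof (rule continuous_eq_0_if_orthogonal_test[where g="%s. f (s + (a - b)) - f s"])
  show "continuous_on UNIV (%s. f (s + (a - b)) - f s)"
   by (intro continuous_intros continuous_on_compose2[OF c]) auto
  fix \<rho> :: "real => real" assume \<rho>: "test_fn \<rho>"
  define th where "th s = \<rho> (s + (b - a)) - \<rho> s" for s
  have th: "test_fn th" unfolding th_def[abs_def] by (intro test_diff test_translate \<rho>)
  obtain r0 where r0: "r0 > 0" "!!x. r0 < norm x ==> th x = 0" using test_support[OF th] by metis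
  define r where "r = r0 + 1"
  have r: "r > 0" "!!x. r \<le> norm x ==> th x = 0" using r0 by (auto simp: r_def)
  obtain K where K: "smooth K" "!!s. (K has_real_derivative th s) (at s)" "K (- r) = 0"
   using smooth_antiderivative[OF test_smooth[OF th]] by metis
  have "(LI s. th s) = K r - K (- r)"
  proof (rule LBINT_continuous_support(1)[where F=K and f=th and a="-r" and b=r])
   show "AE x in lborel. x \<notin> {- r..r} --> th x = 0"
   proof (rule AE_I2, rule impI)
    fix x assume "x \<notin> {-r..r}" then show "th x = 0" by (intro r(2)) auto
   qed
  qed (use r K(2) smooth_continuous[OF test_smooth[OF th]] test_borel[OF th] in auto)
  moreover have "(LI s. th s) = 0"
   using test_borel[OF \<rho>] test_integrable[OF \<rho>] test_integrable[OF test_translate[OF \<rho>]]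
   by (simp add: th_def lborel_integral_translate(1))
  ultimately have Kr: "K r = 0" using K(3) by simp
  have const: "K x = K y" if "!!s. s \<in> {x..y} ==> th s = 0" "x \<le> y" for x y
  proof (cases "x = y")
   case False
   have "\<exists>l z. x < z \<and> z < y \<and> (K has_real_derivative l) (at z) \<and> K y - K x = (y - x) * l"
    by (rule MVT) (use False that K(2) in "auto intro: smooth_continuous[OF K(1)] simp: real_differentiable_def")
   then obtain l z where z: "x < z" "z < y" "(K has_real_derivative l) (at z)" "K y - K x = (y - x) * l" by blast
   have "l = th z" using DERIV_unique[OF z(3) K(2)] .
   then show ?thesis using that(1)[of z] z by simp
  qed simp
  have "test_fn K"
  proof (rule test_fnI[OF K(1)])
   fix x assume nz: "K x \<noteq> 0"
   show "norm x \<le> r"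
   proof (rule ccontr)
    assume a: "\<not> norm x \<le> r"
    have z: "th s = 0" if "s \<ge> r \<or> s \<le> - r" for s by (rule r(2)) (use that in auto)
    consider "x > r" | "x < - r" using a by fastforce
    then show False
    proof cases
     case 1
     have "K r = K x" by (rule const) (use 1 z in auto)
     then show ?thesis using nz Kr by simp
    next
     case 2
     have "K x = K (- r)" by (rule const) (use 2 z in auto)
     then show ?thesis using nz K(3) by simp
    qed
   qed
  qed
  have dK: "deriv K s = th s" for s by (rule DERIV_imp_deriv[OF K(2)])
  from o[OF \<open>test_fn K\<close>] have 0: "(LI s. f s * th s) = 0" by (simp only: dK)
  have i: "integrable lborel (%s. f s * \<rho> (s + h))" "integrable lborel (%s. f (s + k) * \<rho> (s + h))" for h k
  proof -
   have t: "test_fn (%s. \<rho> (s + h))" by (rule test_translate[OF \<rho>])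
   obtain R where R: "!!x. R < norm x ==> \<rho> (x + h) = 0" using test_support[OF t] by metis
   show "integrable lborel (%s. f s * \<rho> (s + h))" "integrable lborel (%s. f (s + k) * \<rho> (s + h))"
    by (rule integrable_continuous_support[of _ R];
      (intro continuous_intros continuous_on_compose2[OF c] continuous_on_compose2[OF smooth_continuous[OF test_smooth[OF \<rho>]]])?;
      use R in auto)+
  qed
  have [measurable]: "f \<in> borel_measurable borel" "\<rho> \<in> borel_measurable borel"
   using c borel_measurable_continuous_onI test_borel[OF \<rho>] by auto
  have "(LI s. f (s + (a - b)) * \<rho> (s + (b - a) + (a - b))) = (LI s. f s * \<rho> (s + (b - a)))"
   using lborel_integral_translate(1)[of "%s. f s * \<rho> (s + (b - a))" "a - b"] by (simp add: algebra_simps)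
  then show "(LI s. (f (s + (a - b)) - f s) * \<rho> s) = 0"
   using 0 i(1)[of 0] i(1)[of "b - a"] i(2)[of "a - b" 0] by (simp add: th_def algebra_simps)
 qed
 then show ?thesis by simp
qed

subsection \<open>Polar coordinates\<close>

text \<open>\<open>dirv\<close> pushes the uniform measure of the unit ball to the sphere, so spherical means are
  plain Lebesgue integrals over the ball; no surface measure is needed.\<close>

definition dirv :: "R3 => R3" where "dirv y = (1 / norm y) *R y"

definition ksph :: "R3 => real" where "ksph y = 3 / (4 * pi) * (if norm y < 1 then 1 else 0)"

lemma dirv_measurable [measurable]: "dirv \<in> borel_measurable borel"
 unfolding dirv_def[abs_def] by measurable

lemma norm_dirv: "y \<noteq> 0 ==> norm (dirv y) = 1" "norm (dirv y) \<le> 1"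
 by (auto simp: dirv_def)

lemma ksph_measurable [measurable]: "ksph \<in> borel_measurable borel"
 unfolding ksph_def[abs_def] by measurable

lemma measure_unit_ball_R3: "measure lborel (ball (0::R3) 1) = 4/3 * pi"
 using content_ball[of 1 "0::R3"] by (simp add: unit_ball_vol_3)

lemma ksph_integrable: "integrable lborel ksph" and integral_ksph: "(LI y. ksph y) = 1"
 and ksph_nonneg: "0 \<le> ksph y"
proof -
 have "integrable lborel (indicator (ball (0::R3) 1) :: _ => real)"
  by (intro integrable_real_indicator emeasure_bounded_finite bounded_ball) auto
 moreover have ke: "ksph = (%y. 3 / (4 * pi) * indicator (ball 0 1) y)"
  by (auto simp: ksph_def indicator_def fun_eq_iff)
 ultimately show "integrable lborel ksph" "(LI y. ksph y) = 1" "0 \<le> ksph y"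
  unfolding ke by (auto simp: measure_unit_ball_R3)
qed

lemma nn_integral_scale_R3:
 fixes f :: "R3 => ennreal"
 assumes [measurable]: "f \<in> borel_measurable borel" and c: "c > 0"
 shows "(NI x. f x) = ennreal (c^3) * (NI x. f (c *R x))"
proof -
 have "(NI x. f x) = (\<integral>\<^sup>+x. f x \<partial>density (distr lborel borel (%x. 0 + c *R x)) (%_. ennreal (\<bar>c\<bar>^DIM(R3))))"
  by (subst lborel_affine[of c 0]) (use c in auto)
 also have "... = ennreal (c^3) * (NI x. f (c *R x))"
  using c by (simp add: nn_integral_density nn_integral_distr nn_integral_cmult)
 finally show ?thesis .
qed

lemma AE_R3_nonzero: "AE y in lborel. (y::R3) \<noteq> 0"
 by (rule AE_I'[of "{0}"]) auto

text \<open>In the double integral substitute \<open>r = norm y * s\<close> for fixed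
  \<open>y\<close>, which turns \<open>r *R dirv y\<close> into \<open>s *R y\<close>, and then
  \<open>z = s *R y\<close> for fixed \<open>s\<close>. What remains is the integral of 3 / s^4 over
  s > norm z; its value cancels the factor norm z ^ 3 left by the substitutions.\<close>

lemma nn_integral_polar:
 fixes f :: "R3 => ennreal"
 assumes [measurable]: "f \<in> borel_measurable borel"
 shows "(NI x. f x) =
  (NI r. NI y. ennreal (indicator {0<..} r * (4 * pi * r^2) * ksph y) * f (r *R dirv y))"
proof -
 have "(NI r. NI y. ennreal (indicator {0<..} r * (4 * pi * r^2) * ksph y) * f (r *R dirv y))
  = (NI y. NI r. ennreal (indicator {0<..} r * (4 * pi * r^2) * ksph y) * f (r *R dirv y))"
  by (rule lborel_pair.Fubini') measurable
 also have "... = (NI y. NI s. ennreal (indicator {0<..} s * (3 * s^2) * ((if norm y < 1 then 1 else 0) * norm y ^ 3)) * f (s *R y))"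
 proof (rule nn_integral_cong_AE, use AE_R3_nonzero in eventually_elim)
  fix y :: R3 assume y: "y \<noteq> 0"
  have "(NI r. ennreal (indicator {0<..} r * (4 * pi * r^2) * ksph y) * f (r *R dirv y))
   = ennreal \<bar>norm y\<bar> * (NI s. ennreal (indicator {0<..} (0 + norm y * s) * (4 * pi * (0 + norm y * s)^2) * ksph y) * f ((0 + norm y * s) *R dirv y))"
   by (rule nn_integral_real_affine) (use y in auto)
  also have "... = (NI s. ennreal \<bar>norm y\<bar> * (ennreal (indicator {0<..} (0 + norm y * s) * (4 * pi * (0 + norm y * s)^2) * ksph y) * f ((0 + norm y * s) *R dirv y)))"
   by (rule nn_integral_cmult[symmetric]) measurable
  also have "... = (NI s. ennreal (indicator {0<..} s * (3 * s^2) * ((if norm y < 1 then 1 else 0) * norm y ^ 3)) * f (s *R y))"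
  proof (rule nn_integral_cong)
   fix s :: real
   have "(0 + norm y * s) *R dirv y = s *R y" using y by (simp add: dirv_def)
   moreover have "\<bar>norm y\<bar> * (indicator {0<..} (0 + norm y * s) * (4 * pi * (0 + norm y * s)^2) * ksph y)
    = indicator {0<..} s * (3 * s^2) * ((if norm y < 1 then 1 else 0) * norm y ^ 3)"
    using y by (simp add: ksph_def indicator_def zero_less_mult_iff power2_eq_square power3_eq_cube)
   ultimately show "ennreal \<bar>norm y\<bar> * (ennreal (indicator {0<..} (0 + norm y * s) * (4 * pi * (0 + norm y * s)^2) * ksph y) * f ((0 + norm y * s) *R dirv y))
    = ennreal (indicator {0<..} s * (3 * s^2) * ((if norm y < 1 then 1 else 0) * norm y ^ 3)) * f (s *R y)"
    using ksph_nonneg[of y] by (simp add: mult.assoc[symmetric] ennreal_mult'[symmetric])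
  qed
  finally show "(NI r. ennreal (indicator {0<..} r * (4 * pi * r^2) * ksph y) * f (r *R dirv y)) =
   (NI s. ennreal (indicator {0<..} s * (3 * s^2) * ((if norm y < 1 then 1 else 0) * norm y ^ 3)) * f (s *R y))" .
 qed
 also have "... = (NI s. NI y. ennreal (indicator {0<..} s * (3 * s^2) * ((if norm y < 1 then 1 else 0) * norm y ^ 3)) * f (s *R y))"
  by (rule lborel_pair.Fubini') measurable
 also have "... = (NI s. NI z. ennreal ((if norm z < s then 1 else 0) * (3 / s^4)) * (ennreal (norm z ^ 3) * f z))"
 proof (rule nn_integral_cong)
  fix s :: real
  show "(NI y. ennreal (indicator {0<..} s * (3 * s^2) * ((if norm y < 1 then 1 else 0) * norm y ^ 3)) * f (s *R y))
   = (NI z. ennreal ((if norm z < s then 1 else 0) * (3 / s^4)) * (ennreal (norm z ^ 3) * f z))"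
  proof (cases "s > 0")
   case False
   then have "(if norm z < s then 1 else 0) = (0::real)" for z :: R3
    using False le_less_trans[OF norm_ge_zero[of z], of s] by auto
   then show ?thesis using False by simp
  next
   case True
   have "(NI z. ennreal ((if norm z < s then 1 else 0) * (3 / s^4)) * (ennreal (norm z ^ 3) * f z))
    = ennreal (s^3) * (NI y. ennreal ((if norm (s *R y) < s then 1 else 0) * (3 / s^4)) * (ennreal (norm (s *R y) ^ 3) * f (s *R y)))"
    by (rule nn_integral_scale_R3) (use True in auto)
   also have "... = (NI y. ennreal (s^3) * (ennreal ((if norm (s *R y) < s then 1 else 0) * (3 / s^4)) * (ennreal (norm (s *R y) ^ 3) * f (s *R y))))"
    by (rule nn_integral_cmult[symmetric]) measurable
   also have "... = (NI y. ennreal (indicator {0<..} s * (3 * s^2) * ((if norm y < 1 then 1 else 0) * norm y ^ 3)) * f (s *R y))"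
   proof (rule nn_integral_cong)
    fix y :: R3
    have i: "(if norm (s *R y) < s then 1 else 0) = (if norm y < 1 then 1 else 0 :: real)"
     using True by simp
    have "s^3 * ((if norm (s *R y) < s then 1 else 0) * (3 / s^4)) * norm (s *R y) ^ 3
     = indicator {0<..} s * (3 * s^2) * ((if norm y < 1 then 1 else 0) * norm y ^ 3)"
     unfolding i using True by (simp add: power_mult_distrib field_simps eval_nat_numeral)
    then show "ennreal (s^3) * (ennreal ((if norm (s *R y) < s then 1 else 0) * (3 / s^4)) * (ennreal (norm (s *R y) ^ 3) * f (s *R y)))
     = ennreal (indicator {0<..} s * (3 * s^2) * ((if norm y < 1 then 1 else 0) * norm y ^ 3)) * f (s *R y)"
     using True by (simp add: mult.assoc[symmetric] ennreal_mult''[symmetric] del: norm_scaleR)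
   qed
   finally show ?thesis ..
  qed
 qed
 also have "... = (NI z. NI s. ennreal ((if norm z < s then 1 else 0) * (3 / s^4)) * (ennreal (norm z ^ 3) * f z))"
  by (rule lborel_pair.Fubini') measurable
 also have "... = (NI z. f z)"
 proof (rule nn_integral_cong_AE, use AE_R3_nonzero in eventually_elim)
  fix z :: R3 assume z: "z \<noteq> 0"
  have "(NI s. ennreal (3 / s^4) * indicator {norm z..} s) = ennreal (0 - (- (1 / norm z ^ 3)))"
  proof (rule nn_integral_FTC_atLeast)
   fix s assume s: "norm z \<le> s"
   then have "s > 0" using z by (meson less_le_trans zero_less_norm_iff)
   then show "((%s. - (1 / s ^ 3)) has_real_derivative 3 / s ^ 4) (at s)"
    by (auto intro!: derivative_eq_intros simp: field_simps eval_nat_numeral)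
   show "0 \<le> 3 / s ^ 4" by simp
  next
   have "((%s::real. - (inverse s ^ 3)) ---> - (0 ^ 3)) at_top"
    by (intro tendsto_intros tendsto_inverse_0_at_top filterlim_ident)
   then show "((%s::real. - (1 / s ^ 3)) ---> 0) at_top" by (simp add: power_inverse inverse_eq_divide power_one_over)
  qed measurable
  moreover have "(NI s. ennreal ((if norm z < s then 1 else 0) * (3 / s^4))) = (NI s. ennreal (3 / s^4) * indicator {norm z..} s)"
   by (rule nn_integral_cong_AE, rule eventually_mono[OF AE_lborel_singleton[of "norm z"]]) (auto simp: indicator_def)
  ultimately have i: "(NI s. ennreal ((if norm z < s then 1 else 0) * (3 / s^4))) = ennreal (1 / norm z ^ 3)" by simp
  have "(NI s. ennreal ((if norm z < s then 1 else 0) * (3 / s^4)) * (ennreal (norm z ^ 3) * f z))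
   = ennreal (1 / norm z ^ 3) * (ennreal (norm z ^ 3) * f z)"
   unfolding i[symmetric] by (rule nn_integral_multc) measurable
  also have "... = f z" using z by (simp add: mult.assoc[symmetric] ennreal_mult''[symmetric])
  finally show "(NI s. ennreal ((if norm z < s then 1 else 0) * (3 / s^4)) * (ennreal (norm z ^ 3) * f z)) = f z" .
 qed
 finally show ?thesis ..
qed

lemma nn_integral_radial:
 fixes g :: "real => ennreal"
 assumes [measurable]: "g \<in> borel_measurable borel"
 shows "(NI x. g (norm (x::R3))) = (NI r. ennreal (indicator {0<..} r * (4 * pi * r^2)) * g r)"
proof -
 have "(NI x. g (norm (x::R3))) = (NI r. NI y. ennreal (indicator {0<..} r * (4 * pi * r^2) * ksph y) * g (norm (r *R dirv y)))"
  by (rule nn_integral_polar) measurable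
 also have "... = (NI r. NI y. ennreal (ksph y) * (ennreal (indicator {0<..} r * (4 * pi * r^2)) * g r))"
 proof (rule nn_integral_cong, rule nn_integral_cong_AE, use AE_R3_nonzero in eventually_elim)
  fix r :: real and y :: R3 assume "y \<noteq> 0"
  then show "ennreal (indicator {0<..} r * (4 * pi * r^2) * ksph y) * g (norm (r *R dirv y)) = ennreal (ksph y) * (ennreal (indicator {0<..} r * (4 * pi * r^2)) * g r)"
   by (cases "r > 0") (auto simp: norm_dirv ennreal_mult'' ksph_nonneg mult_ac)
 qed
 also have "... = (NI r. (NI y. ennreal (ksph y)) * (ennreal (indicator {0<..} r * (4 * pi * r^2)) * g r))"
  by (intro nn_integral_cong nn_integral_multc) measurable
 also have "(NI y. ennreal (ksph y)) = 1"
  using nn_integral_eq_integral[OF ksph_integrable] ksph_nonneg integral_ksph by simp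
 finally show ?thesis by simp
qed

text \<open>As an identity of measures, the polar formula transfers to signed integrands by the
  rules for image measures and densities.\<close>

lemma polar_measure:
 "distr (density (lborel \<Otimes>\<^sub>M lborel) (%(r, y). ennreal (indicator {0<..} r * (4 * pi * r^2) * ksph y))) borel
  (%(r, y). r *R dirv y) = (lborel :: R3 measure)"
proof (rule measure_eqI)
 fix A :: "R3 set" assume "A \<in> sets (distr (density (lborel \<Otimes>\<^sub>M lborel) (%(r, y). ennreal (indicator {0<..} r * (4 * pi * r^2) * ksph y))) borel
  (%(r, y). r *R dirv y))"
 then have [measurable]: "A \<in> sets borel" by simp
 have "emeasure lborel A = (NI x. indicator A x)" by simp
 also have "... = (NI r. NI y. ennreal (indicator {0<..} r * (4 * pi * r^2) * ksph y) * indicator A (r *R dirv y))"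
  by (rule nn_integral_polar) measurable
 also have "... = (\<integral>\<^sup>+p. ennreal (indicator {0<..} (fst p) * (4 * pi * (fst p)^2) * ksph (snd p)) * indicator A (fst p *R dirv (snd p)) \<partial>(lborel \<Otimes>\<^sub>M lborel))"
  by (subst lborel.nn_integral_fst[symmetric]) (auto, measurable)
 also have "... = (\<integral>\<^sup>+x. indicator A x \<partial>distr (density (lborel \<Otimes>\<^sub>M lborel) (%(r, y). ennreal (indicator {0<..} r * (4 * pi * r^2) * ksph y))) borel
  (%(r, y). r *R dirv y))"
  by (subst nn_integral_distr, measurable, subst nn_integral_density, measurable) (auto simp: split_beta)
 also have "... = emeasure (distr (density (lborel \<Otimes>\<^sub>M lborel) (%(r, y). ennreal (indicator {0<..} r * (4 * pi * r^2) * ksph y))) borel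
  (%(r, y). r *R dirv y)) A"
  by (rule nn_integral_indicator) simp
 finally show "emeasure (distr (density (lborel \<Otimes>\<^sub>M lborel) (%(r, y). ennreal (indicator {0<..} r * (4 * pi * r^2) * ksph y))) borel
  (%(r, y). r *R dirv y)) A = emeasure lborel A" ..
qed simp

lemma integral_polar:
 fixes f :: "R3 => real"
 assumes f: "integrable lborel f"
 shows "(LI x. f x) = (LI r. indicator {0<..} r * (4 * pi * r^2) * (LI y. ksph y * f (r *R dirv y)))"
  and "integrable lborel (%r. indicator {0<..} r * (4 * pi * r^2) * (LI y. ksph y * f (r *R dirv y)))"
proof -
 have [measurable]: "f \<in> borel_measurable borel" using f by auto
 let ?w = "%(r, y). indicator {0<..} r * (4 * pi * r^2) * ksph y"
 have wn: "0 \<le> ?w p" for p by (auto simp: split_beta ksph_nonneg)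
 let ?D = "density (lborel \<Otimes>\<^sub>M lborel) (%p. ennreal (?w p))"
 have D: "distr ?D borel (%(r, y). r *R dirv y) = (lborel :: R3 measure)"
  using polar_measure by (simp add: split_beta')
 have "integrable (distr ?D borel (%(r, y). r *R dirv y)) f" unfolding D by (rule f)
 then have "integrable ?D (%p. f ((%(r, y). r *R dirv y) p))"
  by (subst (asm) integrable_distr_eq) auto
 then have i: "integrable (lborel \<Otimes>\<^sub>M lborel) (%p. ?w p *R f ((%(r, y). r *R dirv y) p))"
  by (subst (asm) integrable_density) (use wn in auto)
 have "(LI x. f x) = (LINT x|distr ?D borel (%(r, y). r *R dirv y). f x)" unfolding D ..
 also have "... = (LINT p|?D. f ((%(r, y). r *R dirv y) p))"
  by (rule integral_distr) auto
 also have "... = (LINT p|(lborel \<Otimes>\<^sub>M lborel). ?w p *R f ((%(r, y). r *R dirv y) p))"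
  by (rule integral_density) (use wn in auto)
 also have "... = (LI r. LI y. ?w (r, y) *R f ((%(r, y). r *R dirv y) (r, y)))"
  using lborel_pair.integral_fst'[OF i] by simp
 finally have 1: "(LI x. f x) = (LI r. LI y. ?w (r, y) *R f ((%(r, y). r *R dirv y) (r, y)))" .
 have e: "(LI y. ?w (r, y) *R f ((%(r, y). r *R dirv y) (r, y))) = indicator {0<..} r * (4 * pi * r^2) * (LI y. ksph y * f (r *R dirv y))" for r
  by (simp add: mult.assoc)
 show "(LI x. f x) = (LI r. indicator {0<..} r * (4 * pi * r^2) * (LI y. ksph y * f (r *R dirv y)))"
  using 1 unfolding e .
 have "integrable lborel (%r. LI y. ?w (r, y) *R f ((%(r, y). r *R dirv y) (r, y)))"
  using lborel_pair.integrable_fst'[OF i] by simp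
 then show "integrable lborel (%r. indicator {0<..} r * (4 * pi * r^2) * (LI y. ksph y * f (r *R dirv y)))"
  unfolding e .
qed

lemma dder_components:
 fixes f :: "R3 => real"
 assumes "f differentiable (at x)"
 shows "dder v f x = (\<Sum>i\<in>UNIV. v $ i * pd i f x)"
proof -
 have "dder (\<Sum>i\<in>UNIV. (v $ i) *R axis i 1) f x = (\<Sum>i\<in>UNIV. v $ i * pd i f x)"
  using linear_sum[OF linear_dder[OF assms], of "%i. (v $ i) *R axis i 1" UNIV] linear_cmul[OF linear_dder[OF assms]]
  by simp
 then show ?thesis using basis_expansion[of v] by (simp add: scalar_mult_eq_scaleR)
qed

lemma test_lapf: "test_fn ph ==> test_fn (lapf ph)"
 unfolding lapf_def[abs_def] by (intro test_sum test_dder)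

lemma lapf_add:
 assumes "smooth ph" "smooth th" shows "lapf (%x. ph x + th x) x = lapf ph x + lapf th x"
proof -
 have "dder v (%x. ph x + th x) = (%x. dder v ph x + dder v th x)" for v
  by (rule ext, rule dder_add) (auto intro: smooth_differentiable assms)
 then show ?thesis
  by (simp add: lapf_def dder_add smooth_differentiable smooth_dder assms sum.distrib)
qed

lemma lapf_cmult:
 assumes "smooth ph" shows "lapf (%x. c * ph x) x = c * lapf ph x"
proof -
 have "dder v (%x. c * ph x) = (%x. c * dder v ph x)" for v
  by (rule ext, rule dder_cmult) (auto intro: smooth_differentiable assms)
 then show ?thesis
  by (simp add: lapf_def dder_cmult smooth_differentiable smooth_dder assms sum_distrib_left)
qed

lemma lapf_diff:
 assumes "smooth ph" "smooth th" shows "lapf (%x. ph x - th x) x = lapf ph x - lapf th x"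
 using lapf_add[OF assms(1) smooth_cmult[OF assms(2), of "-1"]] lapf_cmult[OF assms(2), of "-1"] by simp

lemma dder_translate:
 assumes "smooth f" shows "dder v (%z. f (z + a)) = (%z. dder v f (z + a))"
 using dder_affine(2)[OF bounded_linear_ident smooth_differentiable[OF assms], where a=a] by auto

lemma lapf_translate:
 assumes "smooth f" shows "lapf (%z. f (z + a)) = (%z. lapf f (z + a))"
 by (simp add: fun_eq_iff lapf_def dder_translate smooth_dder assms)

subsection \<open>Averages over spheres\<close>

definition Av :: "(R3 => real) => (R3 => real) => real => R3 => real" where
 "Av k ph r x = (LI y. k y * ph (x + r *R dirv y))"

lemma integrable_mult_bounded:
 fixes k g :: "'a::euclidean_space => real"
 assumes k: "integrable lborel k" and g: "g \<in> borel_measurable borel" "!!y. \<bar>g y\<bar> \<le> C"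
 shows "integrable lborel (%y. k y * g y)"
proof (rule Bochner_Integration.integrable_bound[of lborel "%y. C * k y"])
 show "integrable lborel (%y. C * k y)" using k by simp
 have "k \<in> borel_measurable borel" using k by auto
 then show "(%y. k y * g y) \<in> borel_measurable lborel" using g(1) by simp
 show "AE x in lborel. norm (k x * g x) \<le> norm (C * k x)"
 proof (rule AE_I2)
  fix x
  have "\<bar>g x\<bar> \<le> \<bar>C\<bar>" using g(2)[of x] by simp
  then have "\<bar>k x\<bar> * \<bar>g x\<bar> \<le> \<bar>k x\<bar> * \<bar>C\<bar>" by (intro mult_left_mono) auto
  then show "norm (k x * g x) \<le> norm (C * k x)" by (simp add: abs_mult mult.commute)
 qed
qed

lemma Av_integrable:
 assumes k: "integrable lborel k" and ph: "test_fn ph"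
 shows "integrable lborel (%y. k y * ph (x + r *R dirv y))"
proof -
 obtain C where C: "!!x. \<bar>ph x\<bar> \<le> C" using test_bounded[OF ph] by metis
 show ?thesis
  by (rule integrable_mult_bounded[OF k _ C]) (use test_borel[OF ph] in measurable)
qed

lemma Av_quadratic:
 fixes g :: "R3 => real"
 assumes k: "integrable lborel k" and i: "integrable lborel (%y. k y * g y)" and b: "!!y. \<bar>g y\<bar> \<le> C"
 shows "\<bar>LI y. k y * g y\<bar> \<le> C * (LI y. \<bar>k y\<bar>)"
proof -
 have "norm (LI y. k y * g y) \<le> (LI y. C * \<bar>k y\<bar>)"
 proof (rule Bochner_Integration.integral_norm_bound_integral[OF i])
  show "integrable lborel (%y. C * \<bar>k y\<bar>)" using k by simp
  show "norm (k y * g y) \<le> C * \<bar>k y\<bar>" for y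
   using mult_right_mono[OF b[of y], of "\<bar>k y\<bar>"] by (simp add: abs_mult mult.commute)
 qed
 then show ?thesis by simp
qed

lemma Av_has_derivative:
 assumes k: "integrable lborel k" and ph: "test_fn ph"
 shows "(Av k ph r has_derivative (%v. Av k (dder v ph) r x)) (at x)"
proof -
 obtain C where C: "C \<ge> 0" "!!x h. norm h \<le> 1 ==> \<bar>ph (x + h) - ph x - dder h ph x\<bar> \<le> C * (norm h)^2"
  using test_Taylor_vec[OF ph] by metis
 note i = Av_integrable[OF k]
 show ?thesis
 proof (rule has_derivativeI_quadratic[where \<delta>=1 and C="C * (LI y. \<bar>k y\<bar>)"])
  have l: "linear (%v. dder v ph z)" for z by (rule linear_dder[OF test_differentiable[OF ph]])
  show "linear (%v. Av k (dder v ph) r x)"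
  proof (rule linearI)
   fix v w :: R3 and c :: real
   show "Av k (dder (v + w) ph) r x = Av k (dder v ph) r x + Av k (dder w ph) r x"
    unfolding Av_def using i[OF test_dder[OF ph]] by (simp add: linear_add[OF l] distrib_left)
   show "Av k (dder (c *R v) ph) r x = c *R Av k (dder v ph) r x"
    unfolding Av_def by (simp add: linear_cmul[OF l] mult.left_commute)
  qed
  fix h :: R3 assume h: "norm h \<le> 1"
  define g where "g y = ph ((x + r *R dirv y) + h) - ph (x + r *R dirv y) - dder h ph (x + r *R dirv y)" for y
  have i1: "integrable lborel (%y. k y * ph ((x + r *R dirv y) + h))"
   using i[OF ph, of "x + h" r] by (simp add: add_ac)
  have e: "k y * g y = k y * ph ((x + r *R dirv y) + h) - k y * ph (x + r *R dirv y) - k y * dder h ph (x + r *R dirv y)" for y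
   by (simp add: g_def algebra_simps)
  have ig: "integrable lborel (%y. k y * g y)"
   unfolding e using i1 i[OF ph] i[OF test_dder[OF ph]] by simp
  have "Av k ph r (x + h) - Av k ph r x - Av k (dder h ph) r x = (LI y. k y * g y)"
   unfolding e Av_def using i1 i[OF ph] i[OF test_dder[OF ph]] by (simp add: add_ac)
  moreover have "\<bar>LI y. k y * g y\<bar> \<le> (C * (norm h)^2) * (LI y. \<bar>k y\<bar>)"
   by (rule Av_quadratic[OF k ig]) (use C(2)[OF h] in "simp add: g_def")
  ultimately show "\<bar>Av k ph r (x + h) - Av k ph r x - Av k (dder h ph) r x\<bar> \<le> C * (LI y. \<bar>k y\<bar>) * (norm h)^2"
   by (simp add: mult_ac)
 qed simp
qed

lemma Av_dder: "integrable lborel k ==> test_fn ph ==> dder v (Av k ph r) = Av k (dder v ph) r"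
 by (rule ext, rule dder_eq[OF Av_has_derivative])

lemma Av_smooth:
 assumes k: "integrable lborel k" and ph: "test_fn ph" shows "smooth (Av k ph r)"
proof (rule smooth_coinduct[where A="{Av k th r | th. test_fn th}"])
 show "Av k ph r \<in> {Av k th r | th. test_fn th}" using ph by blast
 show "g differentiable (at x)" if "g \<in> {Av k th r | th. test_fn th}" for g x
  using that Av_has_derivative[OF k] by (auto simp: differentiable_def)
 show "dder v g \<in> {Av k th r | th. test_fn th}" if "g \<in> {Av k th r | th. test_fn th}" for g v
  using that Av_dder[OF k] test_dder by blast
qed

lemma Av_support:
 assumes ph: "!!x. R < norm x ==> ph x = 0" and x: "R + \<bar>r\<bar> < norm x"
 shows "Av k ph r x = 0"
proof -
 have "ph (x + r *R dirv y) = 0" for y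
 proof (rule ph)
  have "norm (r *R dirv y) \<le> \<bar>r\<bar>" using norm_dirv(2)[of y] by (simp add: mult_left_le)
  then show "R < norm (x + r *R dirv y)" using x norm_triangle_ineq4[of "x + r *R dirv y" "r *R dirv y"] by simp
 qed
 then show ?thesis by (simp add: Av_def)
qed

text \<open>Huygens' principle at the origin: the points \<open>r *R dirv y\<close> have norm |r|
  and so miss the support. The exception is \<open>y = 0\<close>, where \<open>dirv y = 0\<close>,
  hence the argument almost everywhere.\<close>

lemma Av_support0:
 assumes ph: "!!x. R < norm x ==> ph x = 0" and x: "R < \<bar>r\<bar>"
 shows "Av k ph r 0 = 0"
proof -
 have "AE y in lborel. k y * ph (0 + r *R dirv y) = 0"
  using AE_R3_nonzero by eventually_elim (simp add: ph norm_dirv x)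
 then show ?thesis unfolding Av_def by (rule integral_eq_zero_AE)
qed

lemma Av_test:
 assumes k: "integrable lborel k" and ph: "test_fn ph" shows "test_fn (Av k ph r)"
proof -
 obtain R where R: "!!x. R < norm x ==> ph x = 0" using test_support[OF ph] by metis
 show ?thesis
  by (rule test_fnI[OF Av_smooth[OF k ph], where r="R + \<bar>r\<bar>"]) (use Av_support[of R ph, OF R] in "meson not_le")
qed

lemma Av_bounded:
 assumes k: "integrable lborel k" and ph: "test_fn ph"
 obtains C where "C \<ge> 0" "!!r x. \<bar>Av k ph r x\<bar> \<le> C"
proof -
 obtain C where C: "C > 0" "!!x. \<bar>ph x\<bar> \<le> C" using test_bounded[OF ph] by metis
 show ?thesis
 proof (rule that[of "C * (LI y. \<bar>k y\<bar>)"])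
  show "\<bar>Av k ph r x\<bar> \<le> C * (LI y. \<bar>k y\<bar>)" for r x
   unfolding Av_def by (rule Av_quadratic[OF k Av_integrable[OF k ph] C(2)])
 qed (use C in auto)
qed

lemma Av_diff: "integrable lborel k ==> test_fn ph ==> test_fn th ==>
  Av k (%x. ph x - th x) r x = Av k ph r x - Av k th r x"
 unfolding Av_def using Av_integrable[of k ph] Av_integrable[of k th] by (simp add: right_diff_distrib)

lemma Av_sum: "integrable lborel k ==> (!!i. i \<in> I ==> test_fn (ph i)) ==>
  Av k (%x. \<Sum>i\<in>I. ph i x) r x = (\<Sum>i\<in>I. Av k (ph i) r x)"
 unfolding Av_def by (simp add: sum_distrib_left Av_integrable)

lemma Av_lapf:
 assumes "integrable lborel k" "test_fn ph"
 shows "lapf (Av k ph r) = Av k (lapf ph) r"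
 by (rule ext) (simp add: lapf_def[abs_def] Av_dder Av_sum assms test_dder)

lemma dirv_nth_measurable [measurable]: "(%y. dirv y $ i) \<in> borel_measurable borel"
proof -
 have "(%y. dirv y \<bullet> axis i 1) \<in> borel_measurable borel" by measurable
 then show ?thesis by (simp add: inner_axis)
qed

lemma integrable_mult_dirv: "integrable lborel k ==> integrable lborel (%y. k y * dirv y $ i)"
proof (rule integrable_mult_bounded[where C=1])
 show "\<bar>dirv y $ i\<bar> \<le> 1" for y using component_le_norm_cart[of "dirv y" i] norm_dirv(2)[of y] by linarith
qed (auto intro: dirv_nth_measurable)

lemma Av_DERIV:
 assumes k: "integrable lborel k" and ph: "test_fn ph"
 shows "((%r. Av k ph r x) has_real_derivative (\<Sum>i\<in>UNIV. Av (%y. k y * dirv y $ i) (pd i ph) r x)) (at r)"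
proof -
 obtain C where C: "C \<ge> 0" "!!x v h. norm v \<le> 1 ==> \<bar>h\<bar> \<le> 1 ==> \<bar>ph (x + h *R v) - ph x - h * dder v ph x\<bar> \<le> C * h^2"
  using test_Taylor_vec[OF ph] by metis
 let ?z = "%y. x + r *R dirv y"
 note i = Av_integrable[OF k ph]
 have j: "integrable lborel (%y. k y * dirv y $ i * pd i ph (?z y))" for i
  by (rule Av_integrable[OF integrable_mult_dirv[OF k] test_dder[OF ph]])
 have ke: "k y * dder (dirv y) ph (?z y) = (\<Sum>i\<in>UNIV. k y * dirv y $ i * pd i ph (?z y))" for y
  by (subst dder_components[OF test_differentiable[OF ph]]) (simp add: sum_distrib_left mult.assoc)
 have j2: "integrable lborel (%y. k y * dder (dirv y) ph (?z y))"
  unfolding ke by (intro Bochner_Integration.integrable_sum j)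
 have D: "(\<Sum>i\<in>UNIV. Av (%y. k y * dirv y $ i) (pd i ph) r x) = (LI y. k y * dder (dirv y) ph (?z y))"
  unfolding ke Av_def using j by simp
 show ?thesis unfolding D
 proof (rule DERIV_quadratic[where C="C * (LI y. \<bar>k y\<bar>)"])
  fix h :: real assume h: "\<bar>h\<bar> \<le> 1"
  define g where "g y = ph (?z y + h *R dirv y) - ph (?z y) - h * dder (dirv y) ph (?z y)" for y
  have i1: "integrable lborel (%y. k y * ph (?z y + h *R dirv y))"
   using i[of x "r + h"] by (simp add: scaleR_left_distrib add_ac)
  have e: "k y * g y = k y * ph (?z y + h *R dirv y) - k y * ph (?z y) - h * (k y * dder (dirv y) ph (?z y))" for y
   by (simp add: g_def algebra_simps)
  have ig: "integrable lborel (%y. k y * g y)" unfolding e using i1 i j2 by simp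
  have "Av k ph (r + h) x - Av k ph r x - h * (LI y. k y * dder (dirv y) ph (?z y)) = (LI y. k y * g y)"
   unfolding e Av_def using i1 i j2 by (simp add: scaleR_left_distrib add_ac)
  moreover have "\<bar>LI y. k y * g y\<bar> \<le> (C * h^2) * (LI y. \<bar>k y\<bar>)"
   by (rule Av_quadratic[OF k ig]) (use C(2)[OF norm_dirv(2) h] in "simp add: g_def")
  ultimately show "\<bar>Av k ph (r + h) x - Av k ph r x - h * (LI y. k y * dder (dirv y) ph (?z y))\<bar> \<le> C * (LI y. \<bar>k y\<bar>) * h^2"
   by (simp add: mult_ac)
 qed
qed

lemma Av_continuous_r:
 assumes k: "integrable lborel k" and ph: "test_fn ph"
 shows "continuous_on A (%r. Av k ph r x)"
 by (intro DERIV_cont[OF Av_DERIV[OF k ph]])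

subsection \<open>Darboux's equation for spherical means\<close>

definition kdir :: "3 => R3 => real" where "kdir i y = ksph y * dirv y $ i"

lemma kdir_integrable: "integrable lborel (kdir i)"
 unfolding kdir_def[abs_def] by (rule integrable_mult_dirv[OF ksph_integrable])

definition Avr :: "(R3 => real) => real => R3 => real" where
 "Avr ph r x = (\<Sum>i\<in>UNIV. Av (kdir i) (pd i ph) r x)"

lemma Av_ksph_DERIV: "test_fn ph ==> ((%r. Av ksph ph r x) has_real_derivative Avr ph r x) (at r)"
 using Av_DERIV[OF ksph_integrable, of ph x r] by (simp add: Avr_def kdir_def[abs_def])

definition Avrr :: "(R3 => real) => real => R3 => real" where
 "Avrr ph r x = (\<Sum>i\<in>UNIV. \<Sum>j\<in>UNIV. Av (%y. kdir i y * dirv y $ j) (dder (axis j 1) (pd i ph)) r x)"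

lemma Avr_DERIV: "test_fn ph ==> ((%r. Avr ph r x) has_real_derivative Avrr ph r x) (at r)"
 unfolding Avr_def Avrr_def by (intro DERIV_sum Av_DERIV kdir_integrable test_dder)

lemma Avrr_continuous: "test_fn ph ==> continuous_on A (%r. Avrr ph r x)"
 unfolding Avrr_def
 by (intro continuous_on_sum Av_continuous_r integrable_mult_dirv kdir_integrable test_dder)

lemma Avr_continuous: "test_fn ph ==> continuous_on A (%r. Avr ph r x)"
 by (intro DERIV_cont[OF Avr_DERIV])

lemma Av_translate: "Av k ph r x = Av k (%z. ph (z + x)) r 0"
 by (simp add: Av_def add.commute)

lemma Avr_translate: "smooth ph ==> Avr ph r x = Avr (%z. ph (z + x)) r 0"
 unfolding Avr_def by (simp add: dder_translate Av_translate[symmetric])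

lemma Avrr_translate: "smooth ph ==> Avrr ph r x = Avrr (%z. ph (z + x)) r 0"
 unfolding Avrr_def by (simp add: dder_translate smooth_dder Av_translate[symmetric])

lemma antiderivative_continuous_real:
 fixes th :: "real => real"
 assumes th: "continuous_on UNIV th"
 obtains K where "!!s. (K has_real_derivative th s) (at s)" "K a = 0"
proof -
 have "\<exists>F. \<forall>x. -\<infinity> < ereal x --> ereal x < \<infinity> --> (F has_vector_derivative th x) (at x)"
  by (rule einterval_antiderivative) (use th in "auto simp: continuous_on_eq_continuous_at")
 then obtain F where F: "!!x. (F has_real_derivative th x) (at x)"
  by (auto simp: has_real_derivative_iff_has_vector_derivative)
 have "((%s. F s - F a) has_real_derivative th s) (at s)" for s
  using DERIV_diff[OF F[of s] DERIV_const, of "F a"] by simp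
 then show ?thesis using that[of "%s. F s - F a"] by simp
qed

lemma smooth_radial:
 assumes K: "smooth K"
 shows "smooth (%x::R3. K (x \<bullet> x))" and "dder v (%x::R3. K (x \<bullet> x)) x = 2 * (x \<bullet> v) * deriv K (x \<bullet> x)"
proof -
 have dK: "(K has_real_derivative deriv K s) (at s)" if "smooth K" for K :: "real => real" and s
  using smooth_differentiable[OF that] by (simp add: real_differentiable_def DERIV_deriv_iff_real_differentiable)
 have d: "((%x::R3. K (x \<bullet> x)) has_derivative (%v. 2 * (x \<bullet> v) * deriv K (x \<bullet> x))) (at x)"
  if "smooth K" for K x
 proof -
  have 1: "((%x::R3. x \<bullet> x) has_derivative (%v. x \<bullet> v + v \<bullet> x)) (at x)"
   by (rule has_derivative_inner) auto
  have "((%x::R3. K (x \<bullet> x)) has_derivative (%v. deriv K (x \<bullet> x) * (x \<bullet> v + v \<bullet> x))) (at x)"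
   by (rule has_derivative_compose[OF 1 dK[OF that, unfolded has_field_derivative_def]])
  then show ?thesis by (rule has_derivative_eq_rhs) (simp add: inner_commute fun_eq_iff)
 qed
 show "dder v (%x::R3. K (x \<bullet> x)) x = 2 * (x \<bullet> v) * deriv K (x \<bullet> x)" by (rule dder_eq[OF d[OF K]])
 let ?B = "{%x::R3. L (x \<bullet> x) | L. smooth L} \<union> {%x. x \<bullet> v | v. True}"
 show "smooth (%x::R3. K (x \<bullet> x))"
 proof (rule smooth_gen_alg[of ?B])
  show "f differentiable (at x)" if "f \<in> ?B" for f x
   using that d by (auto simp: differentiable_def intro: smooth_differentiable[OF smooth_inner, unfolded differentiable_def])
  show "dder v f \<in> gen_alg ?B" if f: "f \<in> ?B" for f v
  proof -
   consider L where "smooth L" "f = (%x. L (x \<bullet> x))" | w where "f = (%x. x \<bullet> w)" using f by blast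
   then show ?thesis
   proof cases
    case 1
    have "dder v f = (%x. (2 * (x \<bullet> v)) * deriv L (x \<bullet> x))"
     unfolding 1(2) by (rule ext, rule dder_eq[OF d[OF 1(1)]])
    moreover have "dder 1 L = deriv L" by (rule ext) (simp add: dder_real[OF dK[OF 1(1)]])
    then have "smooth (deriv L)" using smooth_dder[OF 1(1), of 1] by simp
    then have "(%x. (2 * (x \<bullet> v)) * deriv L (x \<bullet> x)) \<in> gen_alg ?B"
     by (intro gen_alg.mult gen_alg.const gen_alg.base) auto
    ultimately show ?thesis by simp
   next
    case 2
    have "dder v f = (%x. v \<bullet> w)" unfolding 2
     by (rule ext, rule dder_eq) (auto intro!: derivative_eq_intros)
    then show ?thesis by (simp add: gen_alg.const)
   qed
  qed
 qed (use K in "auto intro: gen_alg.base")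
qed

lemma test_radial:
 assumes K: "test_fn K" shows "test_fn (%x::R3. K (x \<bullet> x))"
proof -
 obtain R where R: "R > 0" "!!s. R < norm s ==> K s = 0" using test_support[OF K] by metis
 show ?thesis
 proof (rule test_fnI[OF smooth_radial(1)[OF test_smooth[OF K]], where r="sqrt R"])
  fix x :: R3 assume "K (x \<bullet> x) \<noteq> 0"
  then have "x \<bullet> x \<le> R" using R(2)[of "x \<bullet> x"] by (cases "x \<bullet> x \<le> R") auto
  then show "norm x \<le> sqrt R" by (simp add: norm_eq_sqrt_inner)
 qed
qed

lemma DERIV_smooth: "smooth K ==> (K has_real_derivative deriv K s) (at s)"
 using smooth_differentiable[of K s] by (simp add: real_differentiable_def DERIV_deriv_iff_real_differentiable)

lemma smooth_deriv: "smooth (K :: real => real) ==> smooth (deriv K)"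
proof -
 assume K: "smooth K"
 have "dder 1 K = deriv K" by (rule ext) (simp add: dder_real[OF DERIV_smooth[OF K]])
 then show ?thesis using smooth_dder[OF K, of 1] by simp
qed

lemma test_deriv: "test_fn (K :: real => real) ==> test_fn (deriv K)"
proof -
 assume K: "test_fn K"
 have "dder 1 K = deriv K" by (rule ext) (simp add: dder_real[OF DERIV_smooth[OF test_smooth[OF K]]])
 then show ?thesis using test_dder[OF K, of 1] by simp
qed

lemma sphere_integral_cong:
 fixes f g k :: "R3 => real"
 assumes r: "r > 0" and [measurable]: "f \<in> borel_measurable borel" "g \<in> borel_measurable borel" "k \<in> borel_measurable borel"
  and eq: "!!y. norm (dirv y) = 1 ==> k y * f (r *R dirv y) = g y"
 shows "(LI y. k y * f (r *R dirv y)) = (LI y. g y)"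
proof (rule integral_cong_AE)
 show "AE y in lborel. k y * f (r *R dirv y) = g y"
  using AE_R3_nonzero by eventually_elim (simp add: eq norm_dirv)
 have "(%y. k y * f (r *R dirv y)) \<in> borel_measurable borel" by measurable
 then show "(%y. k y * f (r *R dirv y)) \<in> borel_measurable lborel" "g \<in> borel_measurable lborel"
  using assms(3) by simp_all
qed

lemma kdir_measurable [measurable]: "kdir i \<in> borel_measurable borel"
 unfolding kdir_def[abs_def] by measurable

text \<open>With M the spherical mean about 0, the claim is the derivative of E = 0, where E(r) =
  r^2 M'(r) minus the integral of s^2 times the mean of the Laplacian; this is the divergence
  theorem on balls. It is proved weakly: the divergence of K(|x|^2) grad \<psi> has integral 0,
  which in polar coordinates says that E(sqrt u) is orthogonal to K'. Du Bois-Reymond then makes it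
  constant.\<close>

lemma Darboux_right:
 assumes \<psi>: "test_fn \<psi>" and r: "r > 0"
 shows "2 * Avr \<psi> r 0 + r * Avrr \<psi> r 0 = r * Av ksph (lapf \<psi>) r 0"
proof -
 define \<Delta> where "\<Delta> s = Av ksph (lapf \<psi>) s 0" for s
 have \<Delta>c: "continuous_on A \<Delta>" for A
  unfolding \<Delta>_def[abs_def] by (rule Av_continuous_r[OF ksph_integrable test_lapf[OF \<psi>]])
 have "continuous_on UNIV (%s. s^2 * \<Delta> s)" by (intro continuous_intros \<Delta>c)
 then have "\<exists>D. (\<forall>s. (D has_real_derivative s^2 * \<Delta> s) (at s)) \<and> D 0 = 0"
  by (rule antiderivative_continuous_real[where a=0]) auto
 then obtain D where D: "!!s. (D has_real_derivative s^2 * \<Delta> s) (at s)" "D 0 = 0" by blast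
 define E where "E r = r^2 * Avr \<psi> r 0 - D r" for r
 have dE: "(E has_real_derivative (2 * r * Avr \<psi> r 0 + r^2 * Avrr \<psi> r 0 - r^2 * \<Delta> r)) (at r)" for r
  unfolding E_def[abs_def]
  by (rule DERIV_cong[OF DERIV_diff[OF DERIV_mult[OF DERIV_power[OF DERIV_ident, of 2] Avr_DERIV[OF \<psi>]] D(1)]])
   (simp add: algebra_simps)
 have Ec: "continuous_on A E" for A
  by (intro DERIV_cont[OF dE])
 \<comment> \<open>Extended by \<open>E 0 = 0\<close> to negative \<open>u\<close>, so that the
   constant found by du Bois-Reymond must be 0.\<close>
 define f where "f u = E (sqrt (max u 0))" for u
 have fc: "continuous_on UNIV f"
  unfolding f_def[abs_def] by (intro continuous_on_compose2[OF Ec[of UNIV]] continuous_intros) auto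
 have E0: "E 0 = 0" by (simp add: E_def D)
 have key: "(LI u. f u * deriv K u) = 0" if K: "test_fn K" for K :: "real => real"
 proof -
  obtain R0 where R0: "R0 > 0" "!!s. R0 < norm s ==> K s = 0" using test_support[OF K] by metis
  have dK: "(K has_real_derivative deriv K s) (at s)" for s by (rule DERIV_smooth[OF test_smooth[OF K]])
  have dd: "dder 1 K = deriv K" by (rule ext) (simp add: dder_real[OF dK])
  have R0': "deriv K s = 0" if "R0 < norm s" for s
   using dder_support[of R0 K, OF R0(2) that, of 1] by (simp add: dd)
  \<comment> \<open>The support bound for \<open>K\<close> concerns the squared radius;
    \<open>R > 1\<close> gives \<open>R0 < R^2\<close>.\<close>
  define R where "R = R0 + 1"
  have R: "R > 0" "R0 < R^2" "!!r. R < r ==> R0 < r^2"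
  proof -
   show "R > 0" using R0 by (simp add: R_def)
   have "R0 < r^2" if "R \<le> r" for r
   proof -
    have "R0 < r * 1" using that R0 by (simp add: R_def)
    also have "r * 1 \<le> r * r" by (rule mult_left_mono) (use that R0 in "auto simp: R_def")
    finally show ?thesis by (simp add: power2_eq_square)
   qed
   then show "R0 < R^2" "!!r. R < r ==> R0 < r^2" by auto
  qed
  have dKc: "continuous_on A (deriv K)" for A by (rule smooth_continuous[OF test_smooth[OF test_deriv[OF K]]])
  have fdc: "continuous_on UNIV (%s. f s * deriv K s)" by (intro continuous_intros fc dKc)
  then have "\<exists>H. (\<forall>s. (H has_real_derivative f s * deriv K s) (at s)) \<and> H 0 = 0"
   by (rule antiderivative_continuous_real[where a=0]) auto
  then obtain H where H: "!!s. (H has_real_derivative f s * deriv K s) (at s)" "H 0 = 0" by blast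
  have A: "(LI u. f u * deriv K u) = H (R^2) - H 0"
  proof (rule LBINT_continuous_support(1)[where f="%s. f s * deriv K s" and F=H and a=0 and b="R^2"])
   show "AE u in lborel. u \<notin> {0..R^2} --> f u * deriv K u = 0"
   proof (rule AE_I2, rule impI)
    fix u assume "u \<notin> {0..R^2}"
    then consider "u < 0" | "R^2 < u" by fastforce
    then show "f u * deriv K u = 0"
    proof cases
     case 1 then show ?thesis by (simp add: f_def E0)
    next
     case 2 then show ?thesis using R0'[of u] R(2) by simp
    qed
   qed
   show "continuous_on {0..R^2} (%s. f s * deriv K s)" by (rule continuous_on_subset[OF fdc]) auto
   show "(%u. f u * deriv K u) \<in> borel_measurable borel" by (rule borel_measurable_continuous_onI[OF fdc])
  qed (use H in auto)
  define ka where "ka x = K (x \<bullet> x)" for x :: R3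
  have ka: "test_fn ka" unfolding ka_def[abs_def] by (rule test_radial[OF K])
  define Q where "Q x = ka x * lapf \<psi> x + (\<Sum>i\<in>UNIV. pd i ka x * pd i \<psi> x)" for x
  have tQ1: "test_fn (%x. ka x * pd i (pd i \<psi>) x)" for i
   by (rule test_mult[OF ka test_smooth[OF test_dder[OF test_dder[OF \<psi>]]]])
  have tQ2: "test_fn (%x. pd i ka x * pd i \<psi> x)" for i
   by (rule test_mult[OF test_dder[OF ka] test_smooth[OF test_dder[OF \<psi>]]])
  have Qe: "Q = (%x. \<Sum>i\<in>UNIV. ka x * pd i (pd i \<psi>) x + pd i ka x * pd i \<psi> x)"
   by (simp add: fun_eq_iff Q_def lapf_def sum_distrib_left sum.distrib)
  have tQ: "test_fn Q" unfolding Qe by (intro test_sum test_add tQ1 tQ2)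
  have "(LI x. Q x) = 0"
  proof -
   have "(LI x. ka x * pd i (pd i \<psi>) x + pd i ka x * pd i \<psi> x) = 0" for i
    using integral_by_parts_test[OF test_dder[OF \<psi>] test_smooth[OF ka], of "axis i 1" "axis i 1"]
     test_integrable[OF tQ1] test_integrable[OF tQ2] by simp
   then show ?thesis unfolding Qe
    by (subst Bochner_Integration.integral_sum) (auto intro!: test_integrable test_add tQ1 tQ2)
  qed
  define g where "g r = indicator {0<..} r * (4 * pi * r^2) * (LI y. ksph y * Q (r *R dirv y))" for r
  have g0: "(LI r. g r) = 0"
   using integral_polar(1)[OF test_integrable[OF tQ]] \<open>(LI x. Q x) = 0\<close> by (simp add: g_def[abs_def])
  have gm: "g \<in> borel_measurable borel"
   using integral_polar(2)[OF test_integrable[OF tQ]] unfolding g_def[abs_def] by auto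
  have inner: "(LI y. ksph y * Q (r *R dirv y)) = K (r^2) * \<Delta> r + 2 * r * deriv K (r^2) * Avr \<psi> r 0" if r: "r > 0" for r
  proof -
   have "(LI y. ksph y * Q (r *R dirv y)) = (LI y. K (r^2) * (ksph y * lapf \<psi> (0 + r *R dirv y)) +
    2 * r * deriv K (r^2) * (\<Sum>i\<in>UNIV. kdir i y * pd i \<psi> (0 + r *R dirv y)))"
   proof (rule sphere_integral_cong[OF r])
    show "Q \<in> borel_measurable borel" by (rule test_borel[OF tQ])
    have [measurable]: "lapf \<psi> \<in> borel_measurable borel" "dder v \<psi> \<in> borel_measurable borel" for v
     by (intro test_borel test_lapf test_dder \<psi>)+
    show "(%y. K (r^2) * (ksph y * lapf \<psi> (0 + r *R dirv y)) + 2 * r * deriv K (r^2) * (\<Sum>i\<in>UNIV. kdir i y * pd i \<psi> (0 + r *R dirv y))) \<in> borel_measurable borel"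
     by measurable
    fix y assume y: "norm (dirv y) = 1"
    have n: "(r *R dirv y) \<bullet> (r *R dirv y) = r^2"
     using y by (simp add: power2_norm_eq_inner[symmetric] power2_eq_square dot_square_norm)
    have "pd i ka (r *R dirv y) = 2 * (r * dirv y $ i) * deriv K (r^2)" for i
     unfolding ka_def[abs_def] smooth_radial(2)[OF test_smooth[OF K]] n by (simp add: inner_axis)
    then show "ksph y * Q (r *R dirv y) = K (r^2) * (ksph y * lapf \<psi> (0 + r *R dirv y)) +
     2 * r * deriv K (r^2) * (\<Sum>i\<in>UNIV. kdir i y * pd i \<psi> (0 + r *R dirv y))"
     unfolding Q_def kdir_def using n by (simp add: ka_def sum_distrib_left algebra_simps)
   qed measurable
   also have "... = K (r^2) * \<Delta> r + 2 * r * deriv K (r^2) * Avr \<psi> r 0"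
   proof -
    have i1: "integrable lborel (%y. ksph y * lapf \<psi> (0 + r *R dirv y))"
     by (rule Av_integrable[OF ksph_integrable test_lapf[OF \<psi>]])
    have i2: "integrable lborel (%y. kdir i y * pd i \<psi> (0 + r *R dirv y))" for i
     by (rule Av_integrable[OF kdir_integrable test_dder[OF \<psi>]])
    have i3: "integrable lborel (%y. \<Sum>i\<in>UNIV. kdir i y * pd i \<psi> (0 + r *R dirv y))"
     by (rule Bochner_Integration.integrable_sum[OF i2])
    have "(LI y. (\<Sum>i\<in>UNIV. kdir i y * pd i \<psi> (0 + r *R dirv y))) = Avr \<psi> r 0"
     unfolding Avr_def Av_def by (rule Bochner_Integration.integral_sum[OF i2])
    then show ?thesis
     using i1 i3 by (simp only: Bochner_Integration.integral_add[OF integrable_mult_right[OF i1] integrable_mult_right[OF i3]]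
      integral_mult_right_zero \<Delta>_def Av_def)
   qed
   finally show ?thesis .
  qed
  \<comment> \<open>A primitive of the radial integrand. The parts of \<open>\<Phi>'\<close> with
    \<open>deriv K\<close> combine because
    \<open>D r + f (r^2) = r^2 * Avr \<psi> r 0\<close>.\<close>
  define \<Phi> where "\<Phi> r = 4 * pi * (K (r^2) * D r + H (r^2))" for r
  define \<Phi>' where "\<Phi>' r = 4 * pi * r^2 * (K (r^2) * \<Delta> r + 2 * r * deriv K (r^2) * Avr \<psi> r 0)" for r
  have sq: "((%r. r^2) has_real_derivative 2 * r) (at r)" for r :: real
   by (auto intro!: derivative_eq_intros)
  have d\<Phi>: "(\<Phi> has_real_derivative \<Phi>' r) (at r)" if "0 \<le> r" for r
  proof -
   have fE: "f (r^2) = r^2 * Avr \<psi> r 0 - D r" using that by (simp add: f_def E_def)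
   show ?thesis
    unfolding \<Phi>_def[abs_def]
    by (rule DERIV_cong[OF DERIV_cmult[OF DERIV_add[OF DERIV_mult[OF DERIV_chain2[OF dK sq] D(1)] DERIV_chain2[OF H(1) sq]]]])
     (simp add: \<Phi>'_def fE algebra_simps)
  qed
  have c\<Phi>': "continuous_on {0..R} \<Phi>'"
   unfolding \<Phi>'_def[abs_def]
   by (intro continuous_intros continuous_on_compose2[OF dKc[of UNIV]]
     continuous_on_compose2[OF smooth_continuous[OF test_smooth[OF K], of UNIV]] \<Delta>c Avr_continuous \<psi>) auto
  have "(LI r. g r) = \<Phi> R - \<Phi> 0"
  proof (rule LBINT_continuous_support(1)[where f=\<Phi>' and F=\<Phi> and a=0 and b=R, OF _ c\<Phi>' _ _ _ gm])
   show "AE r in lborel. r \<notin> {0..R} --> g r = 0"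
   proof (rule AE_I2, rule impI)
    fix r assume "r \<notin> {0..R}"
    then consider "r < 0" | "R < r" by fastforce
    then show "g r = 0"
    proof cases
     case 1 then show ?thesis by (simp add: g_def)
    next
     case 2
     then have "K (r^2) = 0" "deriv K (r^2) = 0" "r > 0" using R0(2)[of "r^2"] R0'[of "r^2"] R(3)[OF 2] R(1) by auto
     then show ?thesis by (simp add: g_def inner)
    qed
   qed
   show "AE r in lborel. r \<in> {0..R} --> g r = \<Phi>' r"
    using AE_lborel_singleton[of 0] by eventually_elim (auto simp: g_def \<Phi>'_def inner)
  qed (use R d\<Phi> in auto)
  then have "H (R^2) = 0"
   using g0 R0(2)[of "R^2"] R(2) by (simp add: \<Phi>_def D H)
  then show ?thesis using A H(2) by simp
 qed
 have f0: "f u = 0" for u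
  using du_Bois_Reymond[OF fc key, of u "-1"] by (simp add: f_def E0)
 have Ez: "E s = 0" if "s > 0" for s using f0[of "s^2"] that by (simp add: f_def)
 have "(E has_real_derivative 0) (at r)"
  by (rule has_field_derivative_transform_within_open[of "%x. 0" _ _ "{0<..}"]) (use r Ez in auto)
 from DERIV_unique[OF this dE] have "r * (2 * Avr \<psi> r 0 + r * Avrr \<psi> r 0 - r * \<Delta> r) = 0"
  by (simp add: algebra_simps power2_eq_square)
 then show ?thesis using r by (simp add: \<Delta>_def)
qed

lemma reflect_test:
 assumes \<psi>: "test_fn \<psi>" shows "test_fn (%z::R3. \<psi> (- z))" and "lapf (%z. \<psi> (- z)) = (%z. lapf \<psi> (- z))"
proof -
 have l: "bounded_linear (uminus :: R3 => R3)" by (rule bounded_linear_minus[OF bounded_linear_ident])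
 obtain R where R: "!!x. R < norm x ==> \<psi> x = 0" using test_support[OF \<psi>] by metis
 show "test_fn (%z. \<psi> (- z))"
 proof (rule test_fnI[where r=R])
  show "smooth (%z. \<psi> (- z))" using smooth_affine[OF l test_smooth[OF \<psi>], of 0] by simp
  show "norm x \<le> R" if "\<psi> (- x) \<noteq> 0" for x using R[of "- x"] that by (metis not_le norm_minus_cancel)
 qed
 have d: "dder v (%z. g (- z)) = (%z. (-1) * dder v g (- z))" if "smooth g" for g :: "R3 => real" and v
 proof
  fix z
  have "dder v (%z. g (- z)) z = dder (- v) g (- z)"
   using dder_affine(2)[OF l smooth_differentiable[OF that], where a=0] by simp
  then show "dder v (%z. g (- z)) z = (-1) * dder v g (- z)"
   using linear_neg[OF linear_dder[OF smooth_differentiable[OF that]]] by simp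
 qed
 have n: "smooth (%z. g (- z))" if "smooth g" for g :: "R3 => real"
  using smooth_affine[OF l that, of 0] by simp
 show "lapf (%z. \<psi> (- z)) = (%z. lapf \<psi> (- z))"
 proof
  fix z
  have "dder v (dder v (%z. \<psi> (- z))) z = dder v (dder v \<psi>) (- z)" for v
   using d[OF test_smooth[OF \<psi>], of v] d[OF smooth_dder[OF test_smooth[OF \<psi>]], of v v]
   dder_cmult[OF smooth_differentiable[OF n[OF smooth_dder[OF test_smooth[OF \<psi>]]]], of v "-1" v z]
   by simp
  then show "lapf (%z. \<psi> (- z)) z = lapf \<psi> (- z)" by (simp add: lapf_def)
 qed
qed

text \<open>Negative radii reduce to positive ones by reflecting \<psi> in the origin, which
  reverses the sign of the first radial derivative only; radius 0 follows by continuity.\<close>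

lemma Darboux0:
 assumes \<psi>: "test_fn \<psi>"
 shows "2 * Avr \<psi> r 0 + r * Avrr \<psi> r 0 = r * Av ksph (lapf \<psi>) r 0"
proof -
 consider "r > 0" | "r < 0" | "r = 0" by linarith
 then show ?thesis
 proof cases
  case 1 then show ?thesis by (rule Darboux_right[OF \<psi>])
 next
  case 2
  let ?\<psi> = "%z. \<psi> (- z)"
  note t = reflect_test[OF \<psi>]
  have a: "Av k (%z. g (- z)) s 0 = Av k g (- s) 0" for k g s by (simp add: Av_def)
  have m: "((%s::real. - s) has_real_derivative -1) (at s)" for s by (auto intro!: derivative_eq_intros)
  have b: "Avr ?\<psi> s 0 = - Avr \<psi> (- s) 0" for s
  proof -
   have "((%s. Av ksph \<psi> (- s) 0) has_real_derivative Avr ?\<psi> s 0) (at s)"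
    using Av_ksph_DERIV[OF t(1), of 0 s] by (simp add: a)
   from DERIV_unique[OF this DERIV_chain2[OF Av_ksph_DERIV[OF \<psi>] m]] show ?thesis by simp
  qed
  have c: "Avrr ?\<psi> s 0 = Avrr \<psi> (- s) 0" for s
  proof -
   have "((%s. - Avr \<psi> (- s) 0) has_real_derivative Avrr ?\<psi> s 0) (at s)"
    using Avr_DERIV[OF t(1), of 0 s] by (simp add: b)
   from DERIV_unique[OF this DERIV_minus[OF DERIV_chain2[OF Avr_DERIV[OF \<psi>] m]]] show ?thesis by simp
  qed
  show ?thesis using Darboux_right[OF t(1), of "- r"] 2 by (simp add: a b c t(2))
 next
  case 3
  define G where "G r = 2 * Avr \<psi> r 0 + r * Avrr \<psi> r 0 - r * Av ksph (lapf \<psi>) r 0" for r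
  have "continuous_on UNIV G"
   unfolding G_def[abs_def] by (intro continuous_intros Avr_continuous Avrr_continuous Av_continuous_r ksph_integrable test_lapf \<psi>)
  then have "(G ---> G 0) (at 0)" by (simp add: continuous_on_eq_continuous_at isCont_def)
  then have 1: "(G ---> G 0) (at_right 0)" by (rule filterlim_mono) (auto simp: at_le)
  have "\<forall>\<^sub>F r in at_right 0. G r = 0"
   unfolding eventually_at_right_field using Darboux_right[OF \<psi>] by (intro exI[of _ 1]) (auto simp: G_def)
  then have "(G ---> 0) (at_right 0)" by (rule tendsto_eventually)
  from tendsto_unique[OF _ 1 this] show ?thesis using 3 by (simp add: G_def)
 qed
qed

lemma Darboux:
 assumes ph: "test_fn ph"
 shows "2 * Avr ph r x + r * Avrr ph r x = r * Av ksph (lapf ph) r x"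
 using Darboux0[OF test_translate[OF ph, of x], of r] lapf_translate[OF test_smooth[OF ph], of x]
 by (simp add: Avr_translate[OF test_smooth[OF ph], of r x] Avrr_translate[OF test_smooth[OF ph], of r x] Av_translate[of _ _ r x])

text \<open>\<open>Sph ph t\<close> and \<open>Cph ph t\<close> are Kirchhoff's solutions of the free wave equation with Cauchy data
  \<open>(0, ph)\<close> and \<open>(ph, 0)\<close>.\<close>

definition Sph :: "(R3 => real) => real => R3 => real" where
 "Sph ph t x = t * Av ksph ph t x"

definition Cph :: "(R3 => real) => real => R3 => real" where
 "Cph ph t x = Av ksph ph t x + t * Avr ph t x"

lemma Sph_DERIV: "test_fn ph ==> ((%t. Sph ph t x) has_real_derivative Cph ph t x) (at t)"
 unfolding Sph_def Cph_def
 by (rule DERIV_cong[OF DERIV_mult[OF DERIV_ident Av_ksph_DERIV]]) auto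

text \<open>For the spherical mean M, the derivative of M + t M' is 2 M' + t M'', which the equation
  of Darboux turns into t times the mean of the Laplacian. Together with \<open>Sph_DERIV\<close>
  this is the wave equation.\<close>

lemma Cph_DERIV: "test_fn ph ==> ((%t. Cph ph t x) has_real_derivative Sph (lapf ph) t x) (at t)"
 unfolding Sph_def Cph_def
 by (rule DERIV_cong[OF DERIV_add[OF Av_ksph_DERIV DERIV_mult[OF DERIV_ident Avr_DERIV]]])
  (auto simp: Darboux[symmetric])

lemma Avr_test: "test_fn ph ==> test_fn (Avr ph r)"
 unfolding Avr_def[abs_def] by (intro test_sum Av_test kdir_integrable test_dder)

lemma Sph_test: "test_fn ph ==> test_fn (Sph ph t)"
 unfolding Sph_def[abs_def] by (intro test_cmult Av_test ksph_integrable)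

lemma Cph_test: "test_fn ph ==> test_fn (Cph ph t)"
 unfolding Cph_def[abs_def] by (intro test_add test_cmult Av_test Avr_test ksph_integrable)

lemma Sph_support:
 assumes ph: "!!x. R < norm x ==> ph x = 0" and x: "R + \<bar>r\<bar> < norm x"
 shows "Sph ph r x = 0" "Cph ph r x = 0"
 by (simp_all add: Sph_def Cph_def Avr_def Av_support[OF ph x] Av_support[OF dder_support[of R ph, OF ph] x])

lemma Sph_support0:
 assumes ph: "!!x. R < norm x ==> ph x = 0" and r: "R < \<bar>r\<bar>"
 shows "Sph ph r 0 = 0" "Cph ph r 0 = 0" "Avr ph r 0 = 0"
 by (simp_all add: Sph_def Cph_def Avr_def Av_support0[OF ph r] Av_support0[OF dder_support[of R ph, OF ph] r])

lemma Sph_bounded: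
 assumes ph: "test_fn ph"
 obtains C where "C \<ge> 0" "!!r x. \<bar>r\<bar> \<le> T ==> \<bar>Sph ph r x\<bar> \<le> C" "!!r x. \<bar>r\<bar> \<le> T ==> \<bar>Cph ph r x\<bar> \<le> C"
proof -
 obtain C1 where C1: "C1 \<ge> 0" "!!r x. \<bar>Av ksph ph r x\<bar> \<le> C1" using Av_bounded[OF ksph_integrable ph] by metis
 have "\<exists>C. \<forall>r x. \<bar>Av (kdir i) (pd i ph) r x\<bar> \<le> C" for i
  using Av_bounded[OF kdir_integrable test_dder[OF ph]] by metis
 then obtain M where M: "!!i r x. \<bar>Av (kdir i) (pd i ph) r x\<bar> \<le> M i" by metis
 define C2 where "C2 = (\<Sum>i\<in>UNIV. M i)"
 have C2: "\<bar>Avr ph r x\<bar> \<le> C2" for r x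
  unfolding Avr_def C2_def by (rule order_trans[OF sum_abs sum_mono[OF M]])
 have C20: "C2 \<ge> 0" using C2[of 0 0] by simp
 show ?thesis
 proof (rule that[of "C1 * (1 + \<bar>T\<bar>) + \<bar>T\<bar> * C2"])
  fix r x assume r: "\<bar>r\<bar> \<le> T"
  have 1: "\<bar>r * Av ksph ph r x\<bar> \<le> \<bar>T\<bar> * C1" unfolding abs_mult by (rule mult_mono) (use r C1 in auto)
  have 2: "\<bar>r * Avr ph r x\<bar> \<le> \<bar>T\<bar> * C2" unfolding abs_mult by (rule mult_mono) (use r C2 in auto)
  have 3: "0 \<le> \<bar>T\<bar> * C2" "0 \<le> \<bar>T\<bar> * C1" using C1(1) C20 by auto
  have 4: "C1 * (1 + \<bar>T\<bar>) = C1 + \<bar>T\<bar> * C1" by (simp add: algebra_simps)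
  show "\<bar>Sph ph r x\<bar> \<le> C1 * (1 + \<bar>T\<bar>) + \<bar>T\<bar> * C2" unfolding Sph_def using 1 3 4 C1(1) by linarith
  show "\<bar>Cph ph r x\<bar> \<le> C1 * (1 + \<bar>T\<bar>) + \<bar>T\<bar> * C2"
   unfolding Cph_def using 2 3 4 C1(2)[of r x] abs_triangle_ineq[of "Av ksph ph r x" "r * Avr ph r x"] by linarith
 qed (use C1 C20 in auto)
qed

lemma has_vector_derivative_cls2:
 fixes \<Phi> :: "real => 'a::euclidean_space => real"
 assumes d: "!!s x. ((%s. \<Phi> s x) has_real_derivative \<Phi>' s x) (at s)"
  and d': "!!s x. ((%s. \<Phi>' s x) has_real_derivative \<Phi>'' s x) (at s)"
  and b: "!!s x. \<bar>s - t\<bar> \<le> 1 ==> \<bar>\<Phi>'' s x\<bar> \<le> C"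
  and z: "!!s x. \<bar>s - t\<bar> \<le> 1 ==> R < norm x ==> \<Phi> s x = 0 \<and> \<Phi>' s x = 0"
  and s: "!!s. sqi (\<Phi> s)" "sqi (\<Phi>' t)"
 shows "((%t. cls (\<Phi> t)) has_vector_derivative cls (\<Phi>' t)) (at t)"
proof (rule has_vector_derivative_cls[where \<delta>=1 and C=C and r=R])
 have C0: "0 \<le> C" using b[of t 0] by simp
 then show "0 \<le> C" .
 fix h :: real and x :: 'a assume h: "\<bar>h\<bar> < 1"
 show "\<bar>\<Phi> (t + h) x - \<Phi> t x - h * \<Phi>' t x\<bar> \<le> C * h^2 * indicator (cball 0 R) x"
 proof (cases "R < norm x")
  case True
  then show ?thesis using z[of "t + h" x] z[of t x] h C0 by simp
 next
  case False
  have p: "((%s. t + s) has_real_derivative 1) (at s)" for s by (auto intro!: derivative_eq_intros)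
  have "\<bar>\<Phi> (t + h) x - \<Phi> (t + 0) x - h * \<Phi>' (t + 0) x\<bar> \<le> C * h^2"
   by (rule Taylor_bound[where g''="%s. \<Phi>'' (t + s) x"])
    (use DERIV_chain2[OF d p] DERIV_chain2[OF d' p] b h in auto)
  then show ?thesis using False by simp
 qed
qed (use s in auto)

lemma Sph_curve:
 assumes ph: "test_fn ph"
 shows "((%t. cls (Sph ph t)) has_vector_derivative cls (Cph ph t)) (at t)"
  and "((%t. cls (Cph ph t)) has_vector_derivative cls (Sph (lapf ph) t)) (at t)"
proof -
 obtain C where C: "C \<ge> 0" "!!r x. \<bar>r\<bar> \<le> \<bar>t\<bar> + 1 ==> \<bar>Sph (lapf ph) r x\<bar> \<le> C" "!!r x. \<bar>r\<bar> \<le> \<bar>t\<bar> + 1 ==> \<bar>Cph (lapf ph) r x\<bar> \<le> C"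
  using Sph_bounded[OF test_lapf[OF ph]] by metis
 obtain R where R: "!!x. R < norm x ==> ph x = 0" using test_support[OF ph] by metis
 obtain R' where R': "!!x. R' < norm x ==> lapf ph x = 0" using test_support[OF test_lapf[OF ph]] by metis
 show "((%t. cls (Sph ph t)) has_vector_derivative cls (Cph ph t)) (at t)"
 proof (rule has_vector_derivative_cls2[where \<Phi>''="Sph (lapf ph)" and C=C and R="R + (\<bar>t\<bar> + 1)"])
  fix s x assume s: "\<bar>s - t\<bar> \<le> 1"
  show "\<bar>Sph (lapf ph) s x\<bar> \<le> C" by (rule C(2)) (use s in linarith)
  show "R + (\<bar>t\<bar> + 1) < norm x ==> Sph ph s x = 0 \<and> Cph ph s x = 0"
   using Sph_support[of R ph s x, OF R] s by auto
 qed (auto intro: Sph_DERIV Cph_DERIV ph test_sqi Sph_test Cph_test)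
 show "((%t. cls (Cph ph t)) has_vector_derivative cls (Sph (lapf ph) t)) (at t)"
 proof (rule has_vector_derivative_cls2[where \<Phi>''="Cph (lapf ph)" and C=C and R="max R R' + (\<bar>t\<bar> + 1)"])
  fix s x assume s: "\<bar>s - t\<bar> \<le> 1"
  show "\<bar>Cph (lapf ph) s x\<bar> \<le> C" by (rule C(3)) (use s in linarith)
  show "max R R' + (\<bar>t\<bar> + 1) < norm x ==> Cph ph s x = 0 \<and> Sph (lapf ph) s x = 0"
   using Sph_support[of R ph s x, OF R] Sph_support[of R' "lapf ph" s x, OF R'] s by auto
 qed (auto intro: Sph_DERIV Cph_DERIV ph test_sqi Sph_test Cph_test test_lapf)
qed

text \<open>Proved in L2: translate \<open>ph\<close> along \<open>v\<close>, integrate by parts in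
  direction \<open>w\<close> against a test function, and differentiate the identity at 0.
  Uniqueness of the derivative exchanges the two directions, and continuity removes the null
  set.\<close>

lemma dder_commute:
 fixes ph :: "'a::euclidean_space => real"
 assumes ph: "test_fn ph" and v: "norm v \<le> 1"
 shows "dder w (dder v ph) = dder v (dder w ph)"
proof -
 have cur: "((%s. cls (%x. th (x + s *R v))) has_vector_derivative cls (dder v th)) (at 0)" if th: "test_fn th" for th
 proof -
  obtain C r where C: "C \<ge> 0" "!!x v h. [|norm v \<le> 1; \<bar>h\<bar> \<le> 1|] ==>
  \<bar>th (x + h *R v) - th x - h * dder v th x\<bar> \<le> C * h^2 * indicator (cball 0 r) x"
   using test_Taylor[OF th] by metis
  show ?thesis
   by (rule has_vector_derivative_cls[where \<delta>=1 and C=C and r=r]) (use C v in "auto intro!: test_sqi[OF test_translate[OF th]] test_sqi[OF test_dder[OF th]]")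
 qed
 have "cls (dder w (dder v ph)) = cls (dder v (dder w ph))"
 proof (rule l2_eqI_test)
  fix th :: "'a => real" assume th: "test_fn th"
  have e: "inner (cls (%x. ph (x + s *R v))) (cls (dder w th)) = - inner (cls (%x. dder w ph (x + s *R v))) (cls th)" for s
   using inner_dder_test[OF test_translate[OF ph, of "s *R v"] th, of w] by (simp add: dder_translate test_smooth[OF ph])
  have 1: "((%s. inner (cls (%x. ph (x + s *R v))) (cls (dder w th))) has_vector_derivative inner (cls (dder v ph)) (cls (dder w th))) (at 0)"
   by (rule bounded_linear.has_vector_derivative[OF bounded_linear_inner_left cur[OF ph]])
  have 2: "((%s. inner (cls (%x. dder w ph (x + s *R v))) (cls th)) has_vector_derivative inner (cls (dder v (dder w ph))) (cls th)) (at 0)"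
   by (rule bounded_linear.has_vector_derivative[OF bounded_linear_inner_left cur[OF test_dder[OF ph]]])
  have "inner (cls (dder v ph)) (cls (dder w th)) = - inner (cls (dder v (dder w ph))) (cls th)"
   by (rule vector_derivative_unique_at[OF 1[unfolded e] has_vector_derivative_minus[OF 2]])
  then show "inner (cls (dder w (dder v ph))) (cls th) = inner (cls (dder v (dder w ph))) (cls th)"
   using inner_dder_test[OF test_dder[OF ph] th, of w v] by simp
 qed
 then have "AE x in lborel. dder w (dder v ph) x - dder v (dder w ph) x = 0"
  using cls_eq_iff[of "dder w (dder v ph)" "dder v (dder w ph)"] by (auto simp: test_dder ph elim: eventually_mono)
 moreover have "continuous_on UNIV (%x. dder w (dder v ph) x - dder v (dder w ph) x)"
  by (rule continuous_on_diff; rule smooth_continuous[OF test_smooth[OF test_dder[OF test_dder[OF ph]]]])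
 ultimately have "dder w (dder v ph) x - dder v (dder w ph) x = 0" for x
  using AE_zero_continuous[of UNIV "%x. dder w (dder v ph) x - dder v (dder w ph) x" x] by simp
 then show ?thesis by (simp add: fun_eq_iff)
qed

lemma lapf_dder: "test_fn ph ==> lapf (pd i ph) = pd i (lapf ph)"
proof
 fix x assume ph: "test_fn ph"
 have c: "dder (axis j 1) (pd i th) = pd i (dder (axis j 1) th)" if "test_fn th" for j and th :: "R3 => real"
  by (rule dder_commute[OF that]) (simp add: norm_axis_1)
 have "((%x. \<Sum>j\<in>UNIV. dder (axis j 1) (dder (axis j 1) ph) x) has_derivative
   (%w. \<Sum>j\<in>UNIV. dder w (dder (axis j 1) (dder (axis j 1) ph)) x)) (at x)"
  by (intro has_derivative_sum has_derivative_dder test_differentiable test_dder ph)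
 from dder_eq[OF this, of "axis i 1"]
 show "lapf (pd i ph) x = pd i (lapf ph) x"
  by (simp add: lapf_def[abs_def] c ph test_dder)
qed

lemma lapf_sum: "(!!i. i \<in> I ==> smooth (f i)) ==> lapf (%x. \<Sum>i\<in>I. f i x) x = (\<Sum>i\<in>I. lapf (f i) x)"
proof (induction I rule: infinite_finite_induct)
 case (insert i I)
 then show ?case by (simp add: lapf_add smooth_sum)
qed (simp_all add: lapf_def)

lemma lapf_Sph: "test_fn ph ==> lapf (Sph ph t) = Sph (lapf ph) t"
 unfolding Sph_def[abs_def] by (rule ext) (simp add: lapf_cmult Av_smooth ksph_integrable Av_lapf)

lemma lapf_Cph: assumes ph: "test_fn ph" shows "lapf (Cph ph t) = Cph (lapf ph) t"
proof
 fix x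
 have s: "smooth (Av (kdir i) (pd i ph) t)" for i
  by (intro Av_smooth kdir_integrable test_dder ph)
 have "lapf (Avr ph t) x = Avr (lapf ph) t x"
  unfolding Avr_def[abs_def] by (simp add: lapf_sum s Av_lapf kdir_integrable test_dder ph lapf_dder)
 then show "lapf (Cph ph t) x = Cph (lapf ph) t x"
  unfolding Cph_def[abs_def]
  by (simp add: lapf_add lapf_cmult smooth_cmult Av_smooth ksph_integrable ph test_smooth[OF Avr_test] Av_lapf)
qed

lemma Sph_0 [simp]: "Sph ph 0 x = 0" and Cph_0 [simp]: "Cph ph 0 x = ph x"
 using integral_ksph by (auto simp: Sph_def Cph_def Av_def)

section \<open>Traces of free waves at the origin\<close>

lemma sqi_continuous_support:
 fixes f :: "'a::euclidean_space => real"
 assumes c: "continuous_on UNIV f" and z: "!!x. r < norm x ==> f x = 0"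
 shows "sqi f"
 unfolding sqi_def
proof
 show "f \<in> borel_measurable lborel" using borel_measurable_continuous_onI[OF c] by simp
 show "integrable lborel (%x. (f x)^2)"
  by (rule integrable_continuous_support[of _ r]) (use z in "auto intro: continuous_on_power c")
qed

lemma sqi_half:
 fixes f :: "real => real"
 assumes "sqi f" shows "sqi (%r. indicator {0<..} r * f r)"
 by (rule sqi_bound[OF assms]) (use sqi_borel[OF assms] in "auto simp: indicator_def")

lemma Sph0_continuous: "test_fn ph ==> continuous_on A (%r. Sph ph r x)"
 and Cph0_continuous: "test_fn ph ==> continuous_on A (%r. Cph ph r x)"
 by (auto intro!: continuous_at_imp_continuous_on DERIV_isCont[OF Sph_DERIV] DERIV_isCont[OF Cph_DERIV])

lemma sqi_Sph0: assumes "test_fn ph" shows "sqi (%r. Sph ph r 0)" "sqi (%r. Cph ph r 0)"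
proof -
 obtain R where R: "!!x. R < norm x ==> ph x = 0" using test_support[OF assms] by metis
 show "sqi (%r. Sph ph r 0)" "sqi (%r. Cph ph r 0)"
  by (rule sqi_continuous_support[of _ R];
    use assms Sph_support0[of R ph, OF R] in "auto intro: Sph0_continuous Cph0_continuous")+
qed

text \<open>Traces at the origin, for positive times, of the waves with data (0, ph) and (ph, 0). As
  elements of L2 of the line they pass to limits when data are approximated.\<close>

definition wS :: "(R3 => real) => real l2" where "wS ph = cls (%r. indicator {0<..} r * Sph ph r 0)"
definition wC :: "(R3 => real) => real l2" where "wC ph = cls (%r. indicator {0<..} r * Cph ph r 0)"

text \<open>\<open>ksph\<close> has total mass 1, so the variance of \<open>g\<close> with respect
  to it is nonnegative.\<close>

lemma ksph_Jensen:
 assumes i: "integrable lborel (%y. ksph y * g y)" "integrable lborel (%y. ksph y * (g y)^2)"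
 shows "(LI y. ksph y * g y)^2 \<le> (LI y. ksph y * (g y)^2)"
proof -
 define c where "c = (LI y. ksph y * g y)"
 have "0 \<le> (LI y. ksph y * (g y - c)^2)"
  by (rule integral_nonneg_AE) (auto simp: ksph_nonneg)
 also have "(%y. ksph y * (g y - c)^2) = (%y. ksph y * (g y)^2 - 2 * c * (ksph y * g y) + c^2 * ksph y)"
  by (simp add: fun_eq_iff power2_diff algebra_simps)
 also have "(LI y. ksph y * (g y)^2 - 2 * c * (ksph y * g y) + c^2 * ksph y)
  = (LI y. ksph y * (g y)^2) - 2 * c * c + c^2"
  using i ksph_integrable integral_ksph by (simp add: c_def)
 finally show ?thesis by (simp add: c_def power2_eq_square)
qed

lemma sphere_sq_integrable:
 assumes "test_fn ph" shows "integrable lborel (%y. ksph y * (ph (r *R dirv y))^2)"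
 using Av_integrable[OF ksph_integrable test_mult[OF assms test_smooth[OF assms]], of 0 r] by (simp add: power2_eq_square)

lemma polar_sq:
 assumes "test_fn ph"
 shows "(norm (cls ph))^2 = (LI r. indicator {0<..} r * (4 * pi * r^2) * (LI y. ksph y * (ph (r *R dirv y))^2))"
  and "integrable lborel (%r. indicator {0<..} r * (4 * pi * r^2) * (LI y. ksph y * (ph (r *R dirv y))^2))"
 using integral_polar[of "%x. (ph x)^2"] test_sqi[OF assms] by (auto simp: norm_cls_sq sqi_def)

lemma four_pi_ge_1: "1 \<le> 4 * pi" using pi_gt3 by linarith

text \<open>The square of a spherical mean is at most the mean of the square, and r^2 times the
  latter is the polar density of the squared L2 norm up to the factor 4 pi, which is at least
  1.\<close>

lemma norm_wS_le:
 assumes ph: "test_fn ph" shows "norm (wS ph) \<le> norm (cls ph)"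
proof (rule power2_le_imp_le)
 have s: "sqi (%r. indicator {0<..} r * Sph ph r 0)" by (rule sqi_half[OF sqi_Sph0(1)[OF ph]])
 show "(norm (wS ph))^2 \<le> (norm (cls ph))^2"
  unfolding wS_def norm_cls_sq[OF s] polar_sq(1)[OF ph]
 proof (rule integral_mono)
  show "integrable lborel (%r. (indicator {0<..} r * Sph ph r 0)^2)" using s by (simp add: sqi_def)
  fix r :: real
  have J: "(Av ksph ph r 0)^2 \<le> (LI y. ksph y * (ph (r *R dirv y))^2)"
   using ksph_Jensen[of "%y. ph (r *R dirv y)"] Av_integrable[OF ksph_integrable ph, of 0 r] sphere_sq_integrable[OF ph, of r]
   by (simp add: Av_def)
  have "r^2 * (Av ksph ph r 0)^2 \<le> (4 * pi * r^2) * (LI y. ksph y * (ph (r *R dirv y))^2)"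
   by (rule mult_mono[OF _ J]) (use mult_right_mono[OF four_pi_ge_1, of "r^2"] in auto)
  then show "(indicator {0<..} r * Sph ph r 0)^2 \<le> indicator {0<..} r * (4 * pi * r^2) * (LI y. ksph y * (ph (r *R dirv y))^2)"
   by (simp add: Sph_def indicator_def power_mult_distrib)
 qed (rule polar_sq(2)[OF ph])
qed simp

text \<open>With M the spherical mean, (M + r M')^2 = (r M^2)' + (r M')^2. The first term integrates
  to 0, since r M^2 vanishes at 0 and beyond the support; in the second, M' is a mean of the radial
  derivative. Thus the gradient alone controls the trace.\<close>

lemma norm_wC_le:
 assumes ph: "test_fn ph" shows "(norm (wC ph))^2 \<le> (\<Sum>i\<in>UNIV. (norm (cls (pd i ph)))^2)"
proof -
 note td = test_dder[OF ph]
 have s: "sqi (%r. indicator {0<..} r * Cph ph r 0)" by (rule sqi_half[OF sqi_Sph0(2)[OF ph]])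
 obtain R0 where R0: "R0 > 0" "!!x. R0 < norm x ==> ph x = 0" using test_support[OF ph] by metis
 define R where "R = R0 + 1"
 have R: "R > 0" "!!r. R \<le> \<bar>r\<bar> ==> Avr ph r 0 = 0" "!!r. R \<le> \<bar>r\<bar> ==> Av ksph ph r 0 = 0"
  using Sph_support0(3)[of R0 ph, OF R0(2)] Av_support0[of R0 ph, OF R0(2)] R0(1) by (auto simp: R_def)
 define A where "A r = indicator {0<..} r * ((Av ksph ph r 0)^2 + 2 * r * Av ksph ph r 0 * Avr ph r 0)" for r
 define B where "B r = indicator {0<..} r * (r^2 * (Avr ph r 0)^2)" for r
 let ?F = "%r. r * (Av ksph ph r 0)^2"
 let ?f = "%r. (Av ksph ph r 0)^2 + 2 * r * Av ksph ph r 0 * Avr ph r 0"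
 have cf: "continuous_on S ?f" for S
  by (intro continuous_intros Av_continuous_r Avr_continuous ksph_integrable ph)
 have Am: "A \<in> borel_measurable borel"
  unfolding A_def[abs_def] using borel_measurable_continuous_onI[OF cf] by measurable
 have dF: "(?F has_real_derivative ?f r) (at r)" for r
  by (rule DERIV_cong[OF DERIV_mult[OF DERIV_ident DERIV_power[OF Av_ksph_DERIV[OF ph], where n=2]]]) (simp add: algebra_simps power2_eq_square)
 have A0: "AE x in lborel. x \<notin> {0..R} --> A x = 0" "AE x in lborel. x \<in> {0..R} --> A x = ?f x"
 proof -
  show "AE x in lborel. x \<notin> {0..R} --> A x = 0"
  proof (rule AE_I2, rule impI)
   fix x assume "x \<notin> {0..R}"
   then have "x < 0 \<or> R \<le> \<bar>x\<bar>" by auto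
   then show "A x = 0" using R by (auto simp: A_def)
  qed
  show "AE x in lborel. x \<in> {0..R} --> A x = ?f x"
   using AE_lborel_singleton[of 0] by eventually_elim (auto simp: A_def)
 qed
 have A: "(LI r. A r) = 0" "integrable lborel A"
  using LBINT_continuous_support[of 0 R ?F ?f A, OF dF cf _ A0 Am] R by simp_all
 have e: "(indicator {0<..} r * Cph ph r 0)^2 = A r + B r" for r
  by (simp add: A_def B_def Cph_def indicator_def power2_eq_square algebra_simps)
 have iC: "integrable lborel (%r. A r + B r)" using s unfolding e[symmetric] by (simp add: sqi_def)
 have iB: "integrable lborel B" using Bochner_Integration.integrable_diff[OF iC A(2)] by simp
 define G where "G i r = indicator {0<..} r * (4 * pi * r^2) * (LI y. ksph y * (pd i ph (r *R dirv y))^2)" for i :: 3 and r :: real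
 have iG: "integrable lborel (G i)" and nG: "(norm (cls (pd i ph)))^2 = (LI r. G i r)" for i
  using polar_sq[OF td] by (auto simp: G_def[abs_def])
 have "(norm (wC ph))^2 = (LI r. B r)"
  unfolding wC_def norm_cls_sq[OF s] e using A iB by simp
 also have "... \<le> (LI r. (\<Sum>i\<in>UNIV. G i r))"
 proof (rule integral_mono[OF iB])
  show "integrable lborel (%r. \<Sum>i\<in>UNIV. G i r)" by (intro Bochner_Integration.integrable_sum iG)
  fix r :: real
  define g where "g y = (\<Sum>i\<in>UNIV. dirv y $ i * pd i ph (r *R dirv y))" for y
  have i1: "integrable lborel (%y. kdir i y * pd i ph (0 + r *R dirv y))" for i
   by (rule Av_integrable[OF kdir_integrable td])
  have ge: "ksph y * g y = (\<Sum>i\<in>UNIV. kdir i y * pd i ph (0 + r *R dirv y))" for y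
   by (simp add: g_def kdir_def sum_distrib_left mult.assoc)
  have ig: "integrable lborel (%y. ksph y * g y)" unfolding ge by (intro Bochner_Integration.integrable_sum i1)
  have Ag: "Avr ph r 0 = (LI y. ksph y * g y)"
   unfolding ge Avr_def Av_def using i1 by (subst Bochner_Integration.integral_sum) auto
  have gg: "(g y)^2 \<le> (\<Sum>i\<in>UNIV. (pd i ph (r *R dirv y))^2)" for y
  proof -
   define v :: R3 where "v = (\<chi> i. pd i ph (r *R dirv y))"
   have "g y = dirv y \<bullet> v" by (simp add: g_def v_def inner_vec_def)
   then have "(g y)^2 \<le> (dirv y \<bullet> dirv y) * (v \<bullet> v)" using Cauchy_Schwarz_ineq by metis
   also have "... \<le> 1 * (v \<bullet> v)"
    by (rule mult_right_mono) (use norm_dirv(2)[of y] in "auto simp: dot_square_norm power_le_one")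
   also have "1 * (v \<bullet> v) = (\<Sum>i\<in>UNIV. (pd i ph (r *R dirv y))^2)"
    by (simp add: inner_vec_def v_def power2_eq_square)
   finally show ?thesis .
  qed
  have iss: "integrable lborel (%y. \<Sum>i\<in>UNIV. ksph y * (pd i ph (r *R dirv y))^2)"
   by (intro Bochner_Integration.integrable_sum sphere_sq_integrable td)
  have gm: "g \<in> borel_measurable borel"
   unfolding g_def[abs_def] using test_borel[OF td] by measurable
  have bnd: "ksph y * (g y)^2 \<le> (\<Sum>i\<in>UNIV. ksph y * (pd i ph (r *R dirv y))^2)" for y
   using mult_left_mono[OF gg[of y] ksph_nonneg[of y]] by (simp add: sum_distrib_left)
  have ig2: "integrable lborel (%y. ksph y * (g y)^2)"
  proof (rule Bochner_Integration.integrable_bound[OF iss])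
   show "(%y. ksph y * (g y)^2) \<in> borel_measurable lborel" using gm by measurable
   show "AE y in lborel. norm (ksph y * (g y)^2) \<le> norm (\<Sum>i\<in>UNIV. ksph y * (pd i ph (r *R dirv y))^2)"
    using bnd ksph_nonneg by (intro AE_I2) (auto simp: abs_mult intro: order_trans[OF _ abs_ge_self])
  qed
  have "(Avr ph r 0)^2 \<le> (LI y. ksph y * (g y)^2)" unfolding Ag by (rule ksph_Jensen[OF ig ig2])
  also have "... \<le> (LI y. (\<Sum>i\<in>UNIV. ksph y * (pd i ph (r *R dirv y))^2))"
   by (rule integral_mono[OF ig2 iss bnd])
  also have "... = (\<Sum>i\<in>UNIV. LI y. ksph y * (pd i ph (r *R dirv y))^2)"
   by (rule Bochner_Integration.integral_sum) (rule sphere_sq_integrable[OF td])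
  finally have J: "(Avr ph r 0)^2 \<le> (\<Sum>i\<in>UNIV. LI y. ksph y * (pd i ph (r *R dirv y))^2)" .
  have "r^2 * (Avr ph r 0)^2 \<le> (4 * pi * r^2) * (\<Sum>i\<in>UNIV. LI y. ksph y * (pd i ph (r *R dirv y))^2)"
   by (rule mult_mono[OF _ J]) (use mult_right_mono[OF four_pi_ge_1, of "r^2"] in auto)
  then show "B r \<le> (\<Sum>i\<in>UNIV. G i r)"
   by (simp add: B_def G_def indicator_def sum_distrib_left)
 qed
 also have "... = (\<Sum>i\<in>UNIV. (norm (cls (pd i ph)))^2)"
  unfolding nG by (rule Bochner_Integration.integral_sum) (rule iG)
 finally show ?thesis .
qed

subsection \<open>The Green function\<close>

lemma Gr_measurable [measurable]: "Gr \<in> borel_measurable borel"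
 unfolding Gr_def[abs_def] by measurable

lemma Gr_loc_integrable: "integrable lborel (%x. Gr x * indicator (cball 0 R) x)"
proof (rule integrableI_bounded)
 have "(NI x. ennreal (norm (Gr x * indicator (cball 0 R) x)))
  = (NI x. ennreal (1 / (4 * pi * norm (x::R3)) * (if norm x \<le> R then 1 else 0)))"
  by (rule nn_integral_cong) (simp add: Gr_def)
 also have "... = (NI r. ennreal (indicator {0<..} r * (4 * pi * r^2)) * ennreal (1 / (4 * pi * r) * (if r \<le> R then 1 else 0)))"
  by (rule nn_integral_radial) measurable
 also have "... \<le> (NI r. ennreal \<bar>R\<bar> * indicator {0..R} r)"
  by (rule nn_integral_mono) (auto simp: indicator_def ennreal_mult''[symmetric] power2_eq_square intro!: ennreal_leI)
 also have "... < \<infinity>" by (cases "0 \<le> R") (simp_all add: nn_integral_cmult_indicator ennreal_mult_less_top)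
 finally show "(NI x. ennreal (norm (Gr x * indicator (cball 0 R) x))) < \<infinity>" .
qed (auto intro!: borel_measurable_times borel_measurable_indicator Gr_measurable)

lemma Gr_test_integrable:
 assumes ph: "test_fn ph" shows "integrable lborel (%x. Gr x * ph x)"
proof -
 obtain R where R: "!!x. R < norm x ==> ph x = 0" using test_support[OF ph] by metis
 obtain C where C: "!!x. \<bar>ph x\<bar> \<le> C" using test_bounded[OF ph] by metis
 have "integrable lborel (%x. (Gr x * indicator (cball 0 R) x) * ph x)"
  by (rule integrable_mult_bounded[OF Gr_loc_integrable test_borel[OF ph] C])
 moreover have "(%x. (Gr x * indicator (cball 0 R) x) * ph x) = (%x. Gr x * ph x)"
  using R by (force simp: indicator_def)
 ultimately show ?thesis by simp
qed

text \<open>In polar coordinates G turns the integrand into \<open>Sph (lapf ph) r 0\<close>, which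
  is the derivative of \<open>Cph ph r 0\<close>; that function equals \<open>ph 0\<close> at r = 0
  and vanishes for large r. In distributions: -\<Delta>G = \<delta>.\<close>

lemma Gr_lapf:
 assumes ph: "test_fn ph" shows "(LI x. Gr x * lapf ph x) = - ph 0"
proof -
 obtain R0 where R0: "R0 > 0" "!!x. R0 < norm x ==> ph x = 0" using test_support[OF ph] by metis
 obtain R1 where R1: "R1 > 0" "!!x. R1 < norm x ==> lapf ph x = 0" using test_support[OF test_lapf[OF ph]] by metis
 define R where "R = max R0 R1 + 1"
 define g where "g r = indicator {0<..} r * Sph (lapf ph) r 0" for r
 have "(LI x. Gr x * lapf ph x) = (LI r. indicator {0<..} r * (4 * pi * r^2) * (LI y. ksph y * (Gr (r *R dirv y) * lapf ph (r *R dirv y))))"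
  by (rule integral_polar(1)[OF Gr_test_integrable[OF test_lapf[OF ph]]])
 also have "... = (LI r. g r)"
 proof (rule Bochner_Integration.integral_cong[OF refl])
  fix r :: real
  show "indicator {0<..} r * (4 * pi * r^2) * (LI y. ksph y * (Gr (r *R dirv y) * lapf ph (r *R dirv y))) = g r"
  proof (cases "r > 0")
   case True
   note [measurable] = test_borel[OF test_lapf[OF ph]]
   have "(LI y. ksph y * (Gr (r *R dirv y) * lapf ph (r *R dirv y))) = (LI y. 1 / (4 * pi * r) * (ksph y * lapf ph (0 + r *R dirv y)))"
    by (rule sphere_integral_cong[OF True, where f="%x. Gr x * lapf ph x"]) (use True in "auto simp: Gr_def")
   then show ?thesis using True by (simp add: g_def Sph_def Av_def power2_eq_square)
  qed (simp add: g_def)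
 qed
 also have "... = Cph ph R 0 - Cph ph 0 0"
 proof (rule LBINT_continuous_support(1)[where F="%r. Cph ph r 0" and f="%r. Sph (lapf ph) r 0" and a=0 and b=R])
  show "AE x in lborel. x \<notin> {0..R} --> g x = 0"
   using Sph_support0(1)[of R1 "lapf ph", OF R1(2)] by (intro AE_I2) (auto simp: g_def R_def indicator_def)
  show "AE x in lborel. x \<in> {0..R} --> g x = Sph (lapf ph) x 0"
   using AE_lborel_singleton[of 0] by eventually_elim (auto simp: g_def)
  show "g \<in> borel_measurable borel" using sqi_borel[OF sqi_half[OF sqi_Sph0(1)[OF test_lapf[OF ph]]]] by (simp add: g_def[abs_def])
 qed (use R0 R1 in "auto simp: R_def intro!: Cph_DERIV Sph0_continuous test_lapf ph")
 also have "Cph ph R 0 = 0" using Sph_support0(2)[of R0 ph R, OF R0(2)] R0(1) by (simp add: R_def)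
 finally show ?thesis by simp
qed

section \<open>Pointwise bounds and the equation \<Delta>w = w\<close>

lemma exp_half_sqi: "sqi (%r::real. indicator {0<..} r * exp (- r))" "norm (cls (%r::real. indicator {0<..} r * exp (- r))) \<le> 1"
proof -
 have "(NI r. ennreal ((indicator {0<..} r * exp (- r))^2)) = (NI r. ennreal (exp (- (2 * r))) * indicator {0..} r)"
  by (rule nn_integral_cong_AE, rule eventually_mono[OF AE_lborel_singleton[of "0::real"]])
   (auto simp: indicator_def exp_double[symmetric] power2_eq_square exp_add[symmetric])
 also have "... = ennreal (0 - (- (1/2) * exp (- (2 * 0))))"
 proof (rule nn_integral_FTC_atLeast)
  show "((%r. - (1/2) * exp (- (2 * r))) has_real_derivative exp (- (2 * x))) (at x)" for x :: real
   by (auto intro!: derivative_eq_intros)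
  have "((%r::real. - (1/2) * exp (- (2 * r))) ---> - (1/2) * 0) at_top"
   by (intro tendsto_intros filterlim_compose[OF exp_at_bot] filterlim_compose[OF filterlim_uminus_at_bot_at_top]
     filterlim_tendsto_pos_mult_at_top[OF tendsto_const] filterlim_ident) auto
  then show "((%r::real. - (1/2) * exp (- (2 * r))) ---> 0) at_top" by simp
 qed auto
 finally have nn: "(NI r. ennreal ((indicator {0<..} r * exp (- r))^2)) = ennreal (1/2)" by simp
 have i: "integrable lborel (%r::real. (indicator {0<..} r * exp (- r))^2)" "(LI r. (indicator {0<..} r * exp (- r::real))^2) = 1/2"
  using nn_integral_eq_integrable[of "%r::real. (indicator {0<..} r * exp (- r))^2" lborel "1/2"] nn by auto
 then show s: "sqi (%r::real. indicator {0<..} r * exp (- r))" by (simp add: sqi_def)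
 show "norm (cls (%r::real. indicator {0<..} r * exp (- r))) \<le> 1"
  unfolding norm_cls[OF s] i(2) by simp
qed

text \<open>The Laplace transform of a wave is a resolvent. With \<open>th = ph - lapf ph\<close>,
  the function \<open>- exp (- r) * (Sph ph r 0 + Cph ph r 0)\<close> has derivative
  \<open>exp (- r) * Sph th r 0\<close>, so \<open>ph 0\<close> is the inner product of exp (-r)
  with the trace \<open>wS th\<close>, which \<open>norm_wS_le\<close> bounds.\<close>

lemma test_sup_bound0:
 assumes ph: "test_fn ph" shows "\<bar>ph 0\<bar> \<le> norm (cls (%x. ph x - lapf ph x))"
proof -
 define th where "th x = ph x - lapf ph x" for x
 have th: "test_fn th" unfolding th_def[abs_def] by (intro test_diff test_lapf ph)
 obtain R0 where R0: "R0 > 0" "!!x. R0 < norm x ==> ph x = 0" using test_support[OF ph] by metis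
 obtain R1 where R1: "R1 > 0" "!!x. R1 < norm x ==> th x = 0" using test_support[OF th] by metis
 define R where "R = max R0 R1 + 1"
 define g where "g r = (indicator {0<..} r * exp (- r)) * (indicator {0<..} r * Sph th r 0)" for r :: real
 note s1 = exp_half_sqi(1) and s2 = sqi_half[OF sqi_Sph0(1)[OF th]]
 have st: "Sph th r 0 = Sph ph r 0 - Sph (lapf ph) r 0" for r
  unfolding Sph_def th_def[abs_def] by (simp add: Av_diff ksph_integrable ph test_lapf right_diff_distrib)
 have "(LI r. g r) = (- exp (- R) * (Sph ph R 0 + Cph ph R 0)) - (- exp (- 0) * (Sph ph 0 0 + Cph ph 0 0))"
 proof (rule LBINT_continuous_support(1)[where F="%r. - exp (- r) * (Sph ph r 0 + Cph ph r 0)" and f="%r. exp (- r) * Sph th r 0" and a=0 and b=R])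
  show "((%r. - exp (- r) * (Sph ph r 0 + Cph ph r 0)) has_real_derivative exp (- r) * Sph th r 0) (at r)" for r
  proof -
   have e: "((%r::real. - exp (- r)) has_real_derivative exp (- r)) (at r)" by (auto intro!: derivative_eq_intros)
   show ?thesis
    by (rule DERIV_cong[OF DERIV_mult[OF e DERIV_add[OF Sph_DERIV[OF ph] Cph_DERIV[OF ph]]]]) (simp add: st algebra_simps)
  qed
  show "continuous_on {0..R} (%r. exp (- r) * Sph th r 0)" by (intro continuous_intros Sph0_continuous th)
  show "AE x in lborel. x \<notin> {0..R} --> g x = 0"
   using Sph_support0(1)[of R1 th, OF R1(2)] by (intro AE_I2) (auto simp: g_def R_def indicator_def)
  show "AE x in lborel. x \<in> {0..R} --> g x = exp (- x) * Sph th x 0"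
   using AE_lborel_singleton[of 0] by eventually_elim (auto simp: g_def)
  show "g \<in> borel_measurable borel" unfolding g_def[abs_def] using sqi_borel[OF s1] sqi_borel[OF s2] by measurable
 qed (use R0 in "auto simp: R_def")
 moreover have "Sph ph R 0 = 0" "Cph ph R 0 = 0"
  using Sph_support0[of R0 ph R, OF R0(2)] R0(1) by (simp_all add: R_def)
 ultimately have "ph 0 = (LI r. g r)" by simp
 also have "... = inner (cls (%r::real. indicator {0<..} r * exp (- r))) (wS th)"
  unfolding wS_def inner_cls[OF s1 s2] g_def ..
 finally have "\<bar>ph 0\<bar> \<le> norm (cls (%r::real. indicator {0<..} r * exp (- r))) * norm (wS th)"
  by (simp add: Cauchy_Schwarz_ineq2)
 also have "... \<le> 1 * norm (cls th)"
  by (intro mult_mono exp_half_sqi(2) norm_wS_le th) auto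
 finally show ?thesis by (simp add: th_def[abs_def])
qed

lemma test_sup_bound:
 assumes ph: "test_fn ph" shows "\<bar>ph x\<bar> \<le> norm (cls ph - cls (lapf ph))"
proof -
 have t: "test_fn (%z. ph z - lapf ph z)" by (intro test_diff test_lapf ph)
 have "\<bar>ph (0 + x)\<bar> \<le> norm (cls (%z. ph (z + x) - lapf ph (z + x)))"
  using test_sup_bound0[OF test_translate[OF ph, of x]] by (simp add: lapf_translate test_smooth[OF ph])
 also have "cls (%z. ph (z + x) - lapf ph (z + x)) = tr x (cls (%z. ph z - lapf ph z))"
  by (simp add: tr_cls t)
 finally show ?thesis by (simp add: cls_diff ph test_lapf)
qed

lemma cls_tendsto_dominated:
 fixes f :: "nat => 'a::euclidean_space => real"
 assumes g: "sqi g" and m: "!!n. f n \<in> borel_measurable borel" "f' \<in> borel_measurable borel"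
  and b: "!!n. AE x in lborel. \<bar>f n x\<bar> \<le> \<bar>g x\<bar>" and l: "AE x in lborel. (%n. f n x) ----> f' x"
 shows "(%n. cls (f n)) ----> cls f'" "sqi f'" "!!n. sqi (f n)"
proof -
 show sf: "sqi (f n)" for n by (rule sqi_bound[OF g]) (use m b in auto)
 have b': "AE x in lborel. \<bar>f' x\<bar> \<le> \<bar>g x\<bar>"
 proof -
  have "AE x in lborel. \<forall>n. \<bar>f n x\<bar> \<le> \<bar>g x\<bar>" using b by (simp add: AE_all_countable)
  then show ?thesis using l by eventually_elim (intro Lim_bounded[OF tendsto_rabs], auto)
 qed
 show sf': "sqi f'" by (rule sqi_bound[OF g]) (use m b' in auto)
 note [measurable] = m
 have "(%n. LI x. (f n x - f' x)^2) ----> (LINT x::'a|lborel. 0)"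
 proof (rule integral_dominated_convergence[where w="%x. 4 * (g x)^2"])
  show "integrable lborel (%x. 4 * (g x)^2)" using g by (simp add: sqi_def)
  show "AE x in lborel. (%n. (f n x - f' x)^2) ----> 0"
   using l
  proof eventually_elim
   case (elim x)
   from tendsto_power[OF tendsto_diff[OF elim tendsto_const[of "f' x"]], of 2] show ?case by simp
  qed
  show "AE x in lborel. norm ((f n x - f' x)^2) \<le> 4 * (g x)^2" for n
   using b[of n] b'
  proof eventually_elim
   case (elim x)
   then have "\<bar>f n x - f' x\<bar> \<le> \<bar>2 * g x\<bar>" by (simp add: abs_mult)
   then have "(f n x - f' x)^2 \<le> (2 * g x)^2" by (simp add: abs_le_square_iff)
   then show ?case by (simp add: power_mult_distrib)
  qed
 qed measurable
 then have "(%n. (norm (cls (f n) - cls f'))^2) ----> 0"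
  by (simp add: cls_diff[symmetric] sf sf' norm_cls_sq sqi_diff)
 then have "(%n. norm (cls (f n) - cls f')) ----> 0"
  using tendsto_real_sqrt[of "%n. (norm (cls (f n) - cls f'))^2" 0] by simp
 then show "(%n. cls (f n)) ----> cls f'" by (rule LIM_zero_cancel[OF tendsto_norm_zero_cancel])
qed

lemma second_derivative_at_max:
 fixes g :: "real => real"
 assumes g: "!!s. (g has_real_derivative g' s) (at s)" and g': "(g' has_real_derivative D) (at 0)"
  and mx: "!!s. g s \<le> g 0"
 shows "D \<le> 0"
proof (rule ccontr)
 assume "\<not> D \<le> 0"
 then obtain d where d: "d > 0" "!!h. 0 < h ==> h < d ==> g' 0 < g' (0 + h)"
  using DERIV_pos_inc_right[OF g'] by auto
 have 0: "g' 0 = 0" by (rule DERIV_local_max[OF g[of 0], of 1]) (use mx in auto)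
 have "\<exists>l z. 0 < z \<and> z < d/2 \<and> (g has_real_derivative l) (at z) \<and> g (d/2) - g 0 = (d/2 - 0) * l"
  by (rule MVT) (use d(1) g in "auto simp: real_differentiable_def intro!: continuous_at_imp_continuous_on DERIV_isCont[OF g]")
 then obtain l z where z: "0 < z" "z < d/2" "(g has_real_derivative l) (at z)" "g (d/2) - g 0 = (d/2 - 0) * l" by blast
 have "l = g' z" using DERIV_unique[OF z(3) g] .
 then have "l > 0" using d(2)[of z] z 0 d(1) by simp
 then have "0 < (d/2 - 0) * l" using d(1) by (intro mult_pos_pos) auto
 then have "g (d/2) - g 0 > 0" unfolding z(4) .
 then show False using mx[of "d/2"] by simp
qed

text \<open>For a distributional \<open>L\<^sup>2\<close> solution \<open>w\<close> of \<open>\<Delta>w = w\<close>, the smooth function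
  \<open>x \<mapsto> \<langle>w, ph(\<cdot> + x)\<rangle>\<close> solves the same equation and vanishes at infinity, so the maximum principle
  forces it to vanish.\<close>

lemma helmholtz_zero:
 fixes w :: "R3 l2"
 assumes w: "!!ph. test_fn ph ==> inner w (cls (lapf ph)) = inner w (cls ph)"
 shows "w = 0"
proof -
 have nonpos: "inner w (tr p (cls ph)) \<le> 0" if ph: "test_fn ph" for ph p
 proof (rule ccontr)
  assume pos: "\<not> inner w (tr p (cls ph)) \<le> 0"
  define W where "W x = inner w (tr x (cls ph))" for x
  define \<epsilon> where "\<epsilon> = W p"
  have \<epsilon>: "\<epsilon> > 0" using pos by (simp add: \<epsilon>_def W_def)
  obtain R where R: "R > 0" "!!x. R < norm x ==> ph x = 0" using test_support[OF ph] by metis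
  define f where "f = fn w"
  have sf: "sqi f" by (simp add: f_def)
  note [measurable] = sqi_borel[OF sf]
  \<comment> \<open>The tails of \<open>w\<close> tend to 0 in norm. A test function translated far
    out meets only a tail, which is the vanishing at infinity used in \<open>far\<close>.\<close>
  have "(%n. cls (%x. (if real n \<le> norm x then f x else 0))) ----> cls (%x. 0)"
  proof (rule cls_tendsto_dominated(1)[OF sf])
   show "AE x in lborel. (%n. if real n \<le> norm x then f x else 0) ----> 0"
   proof (rule AE_I2, rule tendsto_eventually)
    fix x :: R3
    obtain N :: nat where "norm x < real N" using reals_Archimedean2 by blast
    then show "\<forall>\<^sub>F n in sequentially. (if real n \<le> norm x then f x else 0) = 0"
     by (intro eventually_sequentiallyI[of N]) auto
   qed
  qed auto
  then have "(%n. norm (cls (%x. (if real n \<le> norm x then f x else 0)))) ----> 0"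
   by (simp add: cls_zero tendsto_norm_zero)
  from order_tendstoD(2)[OF this, of "\<epsilon> / (norm (cls ph) + 1)"]
  have "\<forall>\<^sub>F n in sequentially. norm (cls (%x. (if real n \<le> norm x then f x else 0))) < \<epsilon> / (norm (cls ph) + 1)"
   using \<epsilon> by (simp add: add_nonneg_pos)
  then obtain n where n: "norm (cls (%x. (if real n \<le> norm x then f x else 0))) < \<epsilon> / (norm (cls ph) + 1)"
   by (auto simp: eventually_sequentially)
  have sc: "sqi (%x. (if real n \<le> norm x then f x else 0))"
   by (rule sqi_bound[OF sf]) auto
  have far: "W x < \<epsilon>" if x: "real n + R \<le> norm x" for x
  proof -
   have e: "f z * ph (z + x) = (if real n \<le> norm z then f z else 0) * ph (z + x)" for z
   proof (cases "real n \<le> norm z")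
    case False
    then have "R < norm (z + x)" using x norm_triangle_ineq4[of "z + x" z] by simp
    then show ?thesis using R(2) by simp
   qed simp
   have "W x = (LI z. f z * ph (z + x))"
    unfolding W_def tr_cls[OF test_sqi[OF ph]] inner_fn[OF test_sqi[OF test_translate[OF ph]]] f_def ..
   also have "... = inner (cls (%x. (if real n \<le> norm x then f x else 0))) (tr x (cls ph))"
    by (simp only: e tr_cls[OF test_sqi[OF ph]] inner_cls[OF sc test_sqi[OF test_translate[OF ph]]])
   also have "... \<le> norm (cls (%x. (if real n \<le> norm x then f x else 0))) * norm (cls ph)"
    using norm_cauchy_schwarz[of "cls (%x. (if real n \<le> norm x then f x else 0))" "tr x (cls ph)"] by simp
   also have "... \<le> norm (cls (%x. (if real n \<le> norm x then f x else 0))) * (norm (cls ph) + 1)"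
    by (rule mult_left_mono) auto
   also have "... < \<epsilon>" using n by (simp add: pos_less_divide_eq add_nonneg_pos)
   finally show ?thesis .
  qed
  have Wc: "continuous_on A W" for A unfolding W_def[abs_def]
   by (intro continuous_intros continuous_on_tr)
  \<comment> \<open>The ball contains \<open>p\<close>, so the maximum of \<open>W\<close> over it
    is at least \<epsilon>; outside it \<open>W\<close> is below \<epsilon>. Hence that maximum is
    global.\<close>
  define M where "M = max (real n + R) (norm p)"
  have "\<exists>q\<in>cball 0 M. \<forall>y\<in>cball 0 M. W y \<le> W q"
   by (rule continuous_attains_sup) (use R Wc in "auto simp: M_def")
  then obtain q where q: "q \<in> cball 0 M" "!!y. y \<in> cball 0 M ==> W y \<le> W q" by blast
  have q\<epsilon>: "\<epsilon> \<le> W q" unfolding \<epsilon>_def by (rule q(2)) (simp add: M_def)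
  have qmax: "W y \<le> W q" for y
  proof (cases "y \<in> cball 0 M")
   case False
   then have "real n + R \<le> norm y" by (simp add: M_def)
   then show ?thesis using far[of y] q\<epsilon> by simp
  qed (rule q(2))
  have dW: "((%s. inner w (tr (q + s *R axis i 1) (cls th))) has_real_derivative inner w (tr (q + s *R axis i 1) (cls (pd i th)))) (at s)"
   if th: "test_fn th" for th i s
  proof -
   have n1: "norm (axis i 1 :: R3) \<le> 1" by (simp add: norm_axis_1)
   let ?th = "%x. th (x + (q + s *R axis i 1))"
   have t: "test_fn ?th" by (rule test_translate[OF th])
   obtain C r where C: "C \<ge> 0" "!!x v h. [|norm v \<le> 1; \<bar>h\<bar> \<le> 1|] ==>
    \<bar>?th (x + h *R v) - ?th x - h * dder v ?th x\<bar> \<le> C * h^2 * indicator (cball 0 r) x"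
    using test_Taylor[OF t] by metis
   have "((%s. cls (%x. th (x + (q + s *R axis i 1)))) has_vector_derivative cls (pd i ?th)) (at s)"
   proof (rule has_vector_derivative_cls[where \<delta>=1 and C=C and r=r])
    fix h :: real and x assume h: "\<bar>h\<bar> < 1"
    show "\<bar>th (x + (q + (s + h) *R axis i 1)) - th (x + (q + s *R axis i 1)) - h * pd i ?th x\<bar> \<le> C * h^2 * indicator (cball 0 r) x"
     using C(2)[OF n1, of h x] h by (simp add: scaleR_left_distrib add_ac)
   qed (use C in "auto intro!: test_sqi[OF test_translate[OF th]] test_sqi[OF test_dder[OF t]]")
   then have "((%s. inner w (tr (q + s *R axis i 1) (cls th))) has_vector_derivative inner w (cls (pd i ?th))) (at s)"
    using bounded_linear.has_vector_derivative[OF bounded_linear_inner_right] by (simp add: tr_cls th)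
   then show ?thesis
    by (simp add: has_real_derivative_iff_has_vector_derivative dder_translate test_smooth[OF th] tr_cls test_dder th)
  qed
  have le: "inner w (tr q (cls (pd i (pd i ph)))) \<le> 0" for i
  proof (rule second_derivative_at_max[where g="%s. W (q + s *R axis i 1)" and g'="%s. inner w (tr (q + s *R axis i 1) (cls (pd i ph)))"])
   show "((%s. W (q + s *R axis i 1)) has_real_derivative inner w (tr (q + s *R axis i 1) (cls (pd i ph)))) (at s)" for s
    unfolding W_def by (rule dW[OF ph])
   show "((%s. inner w (tr (q + s *R axis i 1) (cls (pd i ph)))) has_real_derivative inner w (tr q (cls (pd i (pd i ph))))) (at 0)"
    using dW[OF test_dder[OF ph], of i "axis i 1" 0] by simp
   show "W (q + s *R axis i 1) \<le> W (q + 0 *R axis i 1)" for s using qmax by simp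
  qed
  have cls_sum: "cls (%x. \<Sum>i\<in>I. F i x) = (\<Sum>i\<in>I. cls (F i))" if "finite I" "!!i. i \<in> I ==> test_fn (F i)" for I :: "3 set" and F :: "3 => R3 => real"
   using that by (induction I rule: finite_induct) (auto simp: cls_zero cls_add test_sum)
  have "cls (lapf ph) = (\<Sum>i\<in>UNIV. cls (pd i (pd i ph)))"
   unfolding lapf_def[abs_def] by (rule cls_sum) (auto intro: test_dder ph)
  then have "inner w (tr q (cls (lapf ph))) = (\<Sum>i\<in>UNIV. inner w (tr q (cls (pd i (pd i ph)))))"
   by (simp add: linear_sum[OF bounded_linear.linear[OF bounded_linear_tr]] inner_sum_right)
  also have "... \<le> 0" by (rule sum_nonpos) (rule le)
  finally have "inner w (tr q (cls (lapf ph))) \<le> 0" .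
  moreover have "inner w (tr q (cls (lapf ph))) = W q"
   using w[OF test_translate[OF ph, of q]] by (simp add: W_def tr_cls ph test_lapf lapf_translate test_smooth)
  ultimately show False using q\<epsilon> \<epsilon> by simp
 qed
 show ?thesis
 proof (rule l2_eq_0_if_orthogonal_test)
  fix ph :: "R3 => real" assume ph: "test_fn ph"
  have "inner w (cls (%x. (-1) * ph x)) \<le> 0" using nonpos[OF test_cmult[OF ph, of "-1"], of 0] by simp
  then have "- inner w (cls ph) \<le> 0" by (simp only: cls_scale[OF test_sqi[OF ph]]) simp
  then show "inner w (cls ph) = 0" using nonpos[OF ph, of 0] by simp
 qed
qed

lemma seq_in_closure_image:
 fixes f :: "'b => 'a::metric_space"
 assumes "x \<in> closure (f ` A)"
 obtains a where "!!n::nat. a n \<in> A" "(%n. f (a n)) ----> x"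
proof -
 have "\<exists>y. (\<forall>n. y n \<in> f ` A) \<and> y ----> x" using assms by (simp only: closure_sequential)
 then obtain y where y: "(\<forall>n. y n \<in> f ` A) \<and> y ----> x" ..
 then have "\<forall>n. \<exists>a\<in>A. y n = f a" by blast
 then obtain a where a: "!!n. a n \<in> A" "!!n. y n = f (a n)" by metis
 then have "y = (%n. f (a n))" by blast
 then show ?thesis using that a(1) y by blast
qed

lemma lapf_diff_fun: "smooth ph ==> smooth th ==> lapf (%x. ph x - th x) = (%x. lapf ph x - lapf th x)"
 by (rule ext) (rule lapf_diff)
lemma lapf_add_fun: "smooth ph ==> smooth th ==> lapf (%x. ph x + th x) = (%x. lapf ph x + lapf th x)"
 by (rule ext) (rule lapf_add)
lemma lapf_cmult_fun: "smooth ph ==> lapf (%x. c * ph x) = (%x. c * lapf ph x)"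
 by (rule ext) (rule lapf_cmult)

section \<open>Weak gradients and Laplacians in the presence of a point charge\<close>

definition cgrad :: "(R3 => real) => (R3 l2)^3" where
 "cgrad ph = (\<chi> i. cls (pd i ph))"

lemma dder_add_fun: "smooth ph ==> smooth th ==> dder v (%x. ph x + th x) = (%x. dder v ph x + dder v th x)"
 by (rule ext) (rule dder_add; rule smooth_differentiable)
lemma dder_diff_fun: "smooth ph ==> smooth th ==> dder v (%x. ph x - th x) = (%x. dder v ph x - dder v th x)"
 by (rule ext) (rule dder_diff; rule smooth_differentiable)
lemma dder_cmult_fun: "smooth ph ==> dder v (%x. c * ph x) = (%x. c * dder v ph x)"
 by (rule ext) (rule dder_cmult; rule smooth_differentiable)

lemma cgrad_add: "test_fn ph ==> test_fn th ==> cgrad (%x. ph x + th x) = cgrad ph + cgrad th"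
 by (simp add: cgrad_def vec_eq_iff dder_add_fun test_smooth cls_add test_dder)
lemma cgrad_diff: "test_fn ph ==> test_fn th ==> cgrad (%x. ph x - th x) = cgrad ph - cgrad th"
 by (simp add: cgrad_def vec_eq_iff dder_diff_fun test_smooth cls_diff test_dder)
lemma cgrad_cmult: "test_fn ph ==> cgrad (%x. c * ph x) = c *R cgrad ph"
 by (simp add: cgrad_def vec_eq_iff dder_cmult_fun test_smooth cls_scale test_dder)

lemma inner_cls_sum_right:
 assumes "!!i. test_fn (F i)"
 shows "inner u (cls (%x. \<Sum>i\<in>(UNIV::3 set). F i x)) = (\<Sum>i\<in>UNIV. inner u (cls (F i)))"
proof -
 have "cls (%x. \<Sum>i\<in>I. F i x) = (\<Sum>i\<in>I. cls (F i))" if "finite I" for I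
  using that by (induction I rule: finite_induct) (auto simp: cls_zero cls_add test_sum assms)
 then show ?thesis by (simp add: inner_sum_right)
qed

lemma inner_lapf: "test_fn ph ==> inner u (cls (lapf ph)) = (\<Sum>i\<in>UNIV. inner u (cls (pd i (pd i ph))))"
 unfolding lapf_def[abs_def] by (rule inner_cls_sum_right) (intro test_dder)

lemma inner_cgrad: "test_fn ph ==> test_fn th ==> inner (cgrad ph) (cgrad th) = - inner (cls ph) (cls (lapf th))"
 by (simp add: inner_vec_def cgrad_def inner_lapf inner_dder_test test_dder sum_negf)

lemma inner_lapf_commute: "test_fn ph ==> test_fn th ==> inner (cls (lapf ph)) (cls th) = inner (cls ph) (cls (lapf th))"
 using inner_cgrad[of ph th] inner_cgrad[of th ph] by (simp add: inner_commute)

text \<open>The cross term of the square is -2 times the inner product of \<open>ph\<close> and its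
  Laplacian, that is, twice the squared gradient. So one norm controls function, gradient and
  Laplacian together.\<close>

lemma norm_helmholtz:
 assumes ph: "test_fn ph"
 shows "(norm (cls ph - cls (lapf ph)))^2 = (norm (cls ph))^2 + 2 * (norm (cgrad ph))^2 + (norm (cls (lapf ph)))^2"
 using inner_cgrad[OF ph ph]
 by (simp add: power2_norm_eq_inner inner_diff_left inner_diff_right inner_commute)

lemma norm_helmholtz_bounds:
 assumes ph: "test_fn ph"
 shows "norm (cls ph) \<le> norm (cls ph - cls (lapf ph))" "norm (cgrad ph) \<le> norm (cls ph - cls (lapf ph))"
  "norm (cls (lapf ph)) \<le> norm (cls ph - cls (lapf ph))"
 by (rule power2_le_imp_le; simp add: norm_helmholtz[OF ph])+

text \<open>\<open>wgr u et g\<close>: the distributional gradient of \<open>u - et G\<close> is \<open>g\<close>;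
  \<open>wlp u ze h\<close>: the distributional Laplacian of \<open>u\<close> is \<open>h - ze \<delta>\<close>.\<close>

definition wgr :: "R3 l2 => real => (R3 l2)^3 => bool" where
 "wgr u et g \<longleftrightarrow> (\<forall>ph. test_fn ph --> (\<forall>i. inner u (cls (pd i ph)) =
  et * (LI x. Gr x * pd i ph x) - inner (g $ i) (cls ph)))"

definition wlp :: "R3 l2 => real => R3 l2 => bool" where
 "wlp u ze h \<longleftrightarrow> (\<forall>ph. test_fn ph --> inner u (cls (lapf ph)) = inner h (cls ph) - ze * ph 0)"

lemma wgr_lin: "wgr u et g ==> wgr u' et' g' ==> wgr (a *R u + b *R u') (a * et + b * et') (a *R g + b *R g')"
 unfolding wgr_def
proof (intro allI impI)
 fix ph :: "R3 => real" and i :: 3 assume ph: "test_fn ph"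
 let ?d = "cls (pd i ph)" and ?I = "LI x. Gr x * pd i ph x"
 assume "\<forall>ph. test_fn ph --> (\<forall>i. inner u (cls (pd i ph)) = et * (LI x. Gr x * pd i ph x) - inner (g $ i) (cls ph))"
  "\<forall>ph. test_fn ph --> (\<forall>i. inner u' (cls (pd i ph)) = et' * (LI x. Gr x * pd i ph x) - inner (g' $ i) (cls ph))"
 then have "inner u ?d = et * ?I - inner (g $ i) (cls ph)" "inner u' ?d = et' * ?I - inner (g' $ i) (cls ph)" using ph by blast+
 then show "inner (a *R u + b *R u') ?d = (a * et + b * et') * ?I - inner ((a *R g + b *R g') $ i) (cls ph)"
  by (simp only: inner_add_left inner_scaleR_left vector_add_component vector_scaleR_component) (simp add: algebra_simps)
qed

lemma wlp_lin: "wlp u ze h ==> wlp u' ze' h' ==> wlp (a *R u + b *R u') (a * ze + b * ze') (a *R h + b *R h')"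
 unfolding wlp_def
proof (intro allI impI)
 fix ph :: "R3 => real" assume ph: "test_fn ph"
 assume "\<forall>ph. test_fn ph --> inner u (cls (lapf ph)) = inner h (cls ph) - ze * ph 0"
  "\<forall>ph. test_fn ph --> inner u' (cls (lapf ph)) = inner h' (cls ph) - ze' * ph 0"
 then have "inner u (cls (lapf ph)) = inner h (cls ph) - ze * ph 0" "inner u' (cls (lapf ph)) = inner h' (cls ph) - ze' * ph 0"
  using ph by blast+
 then show "inner (a *R u + b *R u') (cls (lapf ph)) = inner (a *R h + b *R h') (cls ph) - (a * ze + b * ze') * ph 0"
  by (simp only: inner_add_left inner_scaleR_left) (simp add: algebra_simps)
qed

lemma wgr_diff: "wgr u et g ==> wgr u' et' g' ==> wgr (u - u') (et - et') (g - g')"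
 using wgr_lin[of u et g u' et' g' 1 "-1"] by simp
lemma wlp_diff: "wlp u ze h ==> wlp u' ze' h' ==> wlp (u - u') (ze - ze') (h - h')"
 using wlp_lin[of u ze h u' ze' h' 1 "-1"] by simp

lemma wgr_unique: "wgr u et g ==> wgr u et g' ==> g = g'"
 by (auto simp: wgr_def vec_eq_iff intro!: l2_eqI_test)
lemma wlp_unique: "wlp u ze h ==> wlp u ze h' ==> h = h'"
 by (auto simp: wlp_def intro!: l2_eqI_test)

lemma wgr_test: "test_fn ph ==> wgr (cls ph) 0 (cgrad ph)"
 by (simp add: wgr_def cgrad_def inner_dder_test)
lemma wlp_test: "test_fn ph ==> wlp (cls ph) 0 (cls (lapf ph))"
 by (simp add: wlp_def inner_lapf_commute)

lemma wgr_closed: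
 assumes "!!n. wgr (u n) (et n) (g n)" "(u ---> u') F" "(et ---> et') F" "(g ---> g') F" "F \<noteq> bot"
 shows "wgr u' et' g'"
 unfolding wgr_def
proof (intro allI impI)
 fix ph :: "R3 => real" and i :: 3 assume ph: "test_fn ph"
 have "((%n. inner (u n) (cls (pd i ph))) ---> inner u' (cls (pd i ph))) F"
  by (intro tendsto_intros assms)
 moreover have "((%n. et n * (LI x. Gr x * pd i ph x) - inner (g n $ i) (cls ph)) --->
  et' * (LI x. Gr x * pd i ph x) - inner (g' $ i) (cls ph)) F"
  by (intro tendsto_intros assms)
 ultimately show "inner u' (cls (pd i ph)) = et' * (LI x. Gr x * pd i ph x) - inner (g' $ i) (cls ph)"
  using assms(1) ph tendsto_unique[OF assms(5)] by (simp add: wgr_def)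
qed

lemma wlp_closed:
 assumes "!!n. wlp (u n) (ze n) (h n)" "(u ---> u') F" "(ze ---> ze') F" "(h ---> h') F" "F \<noteq> bot"
 shows "wlp u' ze' h'"
 unfolding wlp_def
proof (intro allI impI)
 fix ph :: "R3 => real" assume ph: "test_fn ph"
 have "((%n. inner (u n) (cls (lapf ph))) ---> inner u' (cls (lapf ph))) F"
  by (intro tendsto_intros assms)
 moreover have "((%n. inner (h n) (cls ph) - ze n * ph 0) ---> inner h' (cls ph) - ze' * ph 0) F"
  by (intro tendsto_intros assms)
 ultimately show "inner u' (cls (lapf ph)) = inner h' (cls ph) - ze' * ph 0"
  using assms(1) ph tendsto_unique[OF assms(5)] by (simp add: wlp_def)
qed

text \<open>Sum the identity of \<open>wgr\<close> over the first derivatives of \<open>ph\<close>;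
  the singular part contributes through -\<Delta>G = \<delta>, which is
  \<open>Gr_lapf\<close>.\<close>

lemma wgr_lapf:
 assumes "wgr u et g" and ph: "test_fn ph"
 shows "inner u (cls (lapf ph)) = - et * ph 0 - inner g (cgrad ph)"
proof -
 have "inner u (cls (lapf ph)) = et * (\<Sum>i\<in>UNIV. LI x. Gr x * pd i (pd i ph) x) - inner g (cgrad ph)"
  using assms test_dder[OF ph] unfolding wgr_def
  by (simp add: inner_lapf sum_subtractf sum_distrib_left inner_vec_def cgrad_def)
 also have "(\<Sum>i\<in>UNIV. LI x. Gr x * pd i (pd i ph) x) = (LI x. Gr x * lapf ph x)"
  unfolding lapf_def sum_distrib_left
  by (rule Bochner_Integration.integral_sum[symmetric]) (intro Gr_test_integrable test_dder ph)
 finally show ?thesis by (simp add: Gr_lapf ph)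
qed

text \<open>A vector orthogonal to this range solves \<Delta>w = w in distributions and vanishes by
  \<open>helmholtz_zero\<close>.\<close>

lemma helmholtz_dense: "closure ((%ph. cls ph - cls (lapf ph)) ` Collect test_fn) = (UNIV :: R3 l2 set)"
proof -
 have sub: "subspace ((%ph. cls ph - cls (lapf ph)) ` Collect test_fn)"
 proof (rule subspaceI)
  show "0 \<in> (%ph. cls ph - cls (lapf ph)) ` Collect test_fn"
   by (rule image_eqI[of _ _ "%x. 0"]) (auto simp: lapf_def[abs_def])
  fix u v :: "R3 l2" and c assume "u \<in> (%ph. cls ph - cls (lapf ph)) ` Collect test_fn"
  then obtain ph where ph: "test_fn ph" "u = cls ph - cls (lapf ph)" by blast
  show "c *R u \<in> (%ph. cls ph - cls (lapf ph)) ` Collect test_fn"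
   by (rule image_eqI[of _ _ "%x. c * ph x"])
    (auto simp: ph lapf_cmult_fun test_smooth cls_scale test_lapf scaleR_diff_right intro: test_cmult)
  assume "v \<in> (%ph. cls ph - cls (lapf ph)) ` Collect test_fn"
  then obtain th where th: "test_fn th" "v = cls th - cls (lapf th)" by blast
  show "u + v \<in> (%ph. cls ph - cls (lapf ph)) ` Collect test_fn"
   by (rule image_eqI[of _ _ "%x. ph x + th x"])
    (auto simp: ph th lapf_add_fun test_smooth cls_add test_lapf intro: test_add)
 qed
 have "u \<in> closure ((%ph. cls ph - cls (lapf ph)) ` Collect test_fn)" for u :: "R3 l2"
 proof (rule dense_subspace_if_orthogonal_trivial[OF sub subspace_UNIV])
  fix v :: "R3 l2" assume "!!s. s \<in> (%ph. cls ph - cls (lapf ph)) ` Collect test_fn ==> inner v s = 0"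
  then have "inner v (cls (lapf ph)) = inner v (cls ph)" if "test_fn ph" for ph
   using that by (force simp: inner_diff_right)
  then show "v = 0" by (rule helmholtz_zero)
 qed auto
 then show ?thesis by blast
qed

text \<open>Approximate \<open>u - h\<close> by \<open>ph - lapf ph\<close>. By
  \<open>norm_helmholtz\<close> and \<open>test_sup_bound\<close> the functions, gradients,
  Laplacians and values at 0 are then Cauchy. Their limits u', h' satisfy u' - h' = u - h, so u' - u
  solves \<Delta>w = w and is 0.\<close>

lemma domain_approx:
 assumes u: "wlp u 0 h"
 obtains ph g c where "!!n. test_fn (ph n)" "(%n. cls (ph n)) ----> u" "(%n. cls (lapf (ph n))) ----> h"
  "(%n. cgrad (ph n)) ----> g" "(%n. ph n 0) ----> c" "norm g \<le> norm (u - h)" "\<bar>c\<bar> \<le> norm (u - h)"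
proof -
 have cl: "u - h \<in> closure ((%ph. cls ph - cls (lapf ph)) ` Collect test_fn)" unfolding helmholtz_dense by simp
 obtain ph where ph0: "!!n::nat. ph n \<in> Collect test_fn" and lim: "(%n. cls (ph n) - cls (lapf (ph n))) ----> u - h"
  by (rule seq_in_closure_image[OF cl]) blast
 have ph: "test_fn (ph n)" for n using ph0 by simp
 have C: "Cauchy (%n. cls (ph n) - cls (lapf (ph n)))" using lim LIMSEQ_imp_Cauchy by blast
 have d: "test_fn (%x. ph m x - ph n x)" for m n by (intro test_diff ph)
 have de: "cls (%x. ph m x - ph n x) - cls (lapf (%x. ph m x - ph n x)) = (cls (ph m) - cls (lapf (ph m))) - (cls (ph n) - cls (lapf (ph n)))" for m n
  by (simp add: cls_diff ph test_lapf lapf_diff_fun test_smooth)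
 have Ctrans: "Cauchy F" if "!!m n. norm (F m - F n) \<le> norm ((cls (ph m) - cls (lapf (ph m))) - (cls (ph n) - cls (lapf (ph n))))"
  for F :: "nat => 'z::real_normed_vector"
 proof (rule CauchyI)
  fix e :: real assume "0 < e"
  then show "\<exists>M. \<forall>m\<ge>M. \<forall>n\<ge>M. norm (F m - F n) < e"
   using CauchyD[OF C] that by (meson order_le_less_trans)
 qed
 have "Cauchy (%n. cls (ph n))"
  by (rule Ctrans) (use norm_helmholtz_bounds(1)[OF d, unfolded de] in "simp only: cls_diff[OF test_sqi[OF ph] test_sqi[OF ph]]")
 then obtain u' where u': "(%n. cls (ph n)) ----> u'" using Cauchy_convergent convergent_def by blast
 have "Cauchy (%n. cls (lapf (ph n)))"
  by (rule Ctrans) (use norm_helmholtz_bounds(3)[OF d, unfolded de] in "simp only: lapf_diff_fun[OF test_smooth[OF ph] test_smooth[OF ph]] cls_diff[OF test_sqi[OF test_lapf[OF ph]] test_sqi[OF test_lapf[OF ph]]]")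
 then obtain h' where h': "(%n. cls (lapf (ph n))) ----> h'" using Cauchy_convergent convergent_def by blast
 have "Cauchy (%n. cgrad (ph n))"
  by (rule Ctrans) (use norm_helmholtz_bounds(2)[OF d, unfolded de] in "simp only: cgrad_diff[OF ph ph]")
 then obtain g where g: "(%n. cgrad (ph n)) ----> g" using Cauchy_convergent convergent_def by blast
 have "Cauchy (%n. ph n 0)"
  by (rule Ctrans) (use test_sup_bound[OF d, where x=0, unfolded de] in "simp only: real_norm_def")
 then obtain c where c: "(%n. ph n 0) ----> c" using Cauchy_convergent convergent_def by blast
 have w': "wlp u' 0 h'" by (rule wlp_closed[OF wlp_test[OF ph] u' tendsto_const h']) simp
 have eq: "u' - h' = u - h" using LIMSEQ_unique[OF tendsto_diff[OF u' h'] lim] .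
 have "wlp (u' - u) (0 - 0) (h' - h)" by (rule wlp_diff[OF w' u])
 moreover have "h' - h = u' - u" using eq by (simp add: algebra_simps)
 ultimately have "u' - u = 0" by (intro helmholtz_zero) (auto simp: wlp_def)
 then have uu: "u' = u" "h' = h" using eq by auto
 show thesis
 proof (rule that[OF ph _ _ g c])
  show "(%n. cls (ph n)) ----> u" "(%n. cls (lapf (ph n))) ----> h" using u' h' uu by simp_all
  show "norm g \<le> norm (u - h)"
   by (rule LIMSEQ_le[OF tendsto_norm[OF g] tendsto_norm[OF lim]]) (use norm_helmholtz_bounds(2)[OF ph] in auto)
  show "\<bar>c\<bar> \<le> norm (u - h)"
   by (rule LIMSEQ_le[OF tendsto_rabs[OF c] tendsto_norm[OF lim]]) (use test_sup_bound[OF ph] in auto)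
 qed
qed

text \<open>\<open>test_sup_bound\<close> makes the sequence converge uniformly, so its limit is
  continuous; Fatou's lemma identifies this limit with \<open>u\<close> almost everywhere.\<close>

lemma lim0_approx:
 assumes ph: "!!n. test_fn (ph n)" and u: "(%n. cls (ph n)) ----> u" and h: "(%n. cls (lapf (ph n))) ----> h"
  and c: "(%n. ph n 0) ----> c"
 shows "lim0 (fn u) c"
proof -
 have C: "Cauchy (%n. cls (ph n) - cls (lapf (ph n)))"
  using tendsto_diff[OF u h] LIMSEQ_imp_Cauchy by blast
 have uC: "uniformly_Cauchy_on UNIV ph"
  unfolding uniformly_Cauchy_on_def
 proof (intro allI impI)
  fix e :: real assume "e > 0"
  then obtain M where M: "!!m n. m \<ge> M ==> n \<ge> M ==> norm ((cls (ph m) - cls (lapf (ph m))) - (cls (ph n) - cls (lapf (ph n)))) < e"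
   using CauchyD[OF C] by metis
  have "dist (ph m x) (ph n x) < e" if "m \<ge> M" "n \<ge> M" for m n x
   using test_sup_bound[OF test_diff[OF ph[of m] ph[of n]], of x] M[OF that]
   by (simp add: dist_real_def cls_diff ph test_lapf lapf_diff_fun test_smooth algebra_simps)
  then show "\<exists>M. \<forall>x\<in>UNIV. \<forall>m\<ge>M. \<forall>n\<ge>M. dist (ph m x) (ph n x) < e" by blast
 qed
 define f where "f x = lim (%n. ph n x)" for x
 have ul: "uniform_limit UNIV ph f sequentially"
  using uniformly_convergent_uniform_limit_iff[of UNIV ph] Cauchy_uniformly_convergent[OF uC] by (simp add: f_def[abs_def])
 have fc: "continuous_on UNIV f"
  by (rule uniform_limit_theorem[OF always_eventually ul]) (auto intro: smooth_continuous[OF test_smooth[OF ph]])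
 have pt: "(%n. ph n x) ----> f x" for x using tendsto_uniform_limitI[OF ul] by simp
 have fm [measurable]: "f \<in> borel_measurable borel" by (rule borel_measurable_continuous_onI[OF fc])
 note [measurable] = sqi_borel[OF sqi_fn[of u]] test_borel[OF ph]
 have nn: "(NI x. ennreal ((ph n x - fn u x)^2)) = ennreal ((norm (cls (ph n) - u))^2)" for n
 proof -
  have s: "sqi (%x. ph n x - fn u x)" by (intro sqi_diff test_sqi ph sqi_fn)
  have "cls (ph n) - u = cls (%x. ph n x - fn u x)" by (simp add: cls_diff ph)
  then show ?thesis using s by (simp add: norm_cls_sq nn_integral_eq_integral sqi_def)
 qed
 have "(NI x. ennreal ((f x - fn u x)^2)) = (NI x. liminf (%n. ennreal ((ph n x - fn u x)^2)))"
 proof (rule nn_integral_cong)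
  fix x
  have "(%n. ennreal ((ph n x - fn u x)^2)) ----> ennreal ((f x - fn u x)^2)"
   by (intro tendsto_ennrealI tendsto_intros pt)
  then show "ennreal ((f x - fn u x)^2) = liminf (%n. ennreal ((ph n x - fn u x)^2))"
   using lim_imp_Liminf[OF trivial_limit_sequentially] by metis
 qed
 also have "... \<le> liminf (%n. NI x. ennreal ((ph n x - fn u x)^2))"
  by (rule nn_integral_liminf) measurable
 also have "... = liminf (%n. ennreal ((norm (cls (ph n) - u))^2))" unfolding nn ..
 also have "... = 0"
 proof -
  have "(%n. ennreal ((norm (cls (ph n) - u))^2)) ----> ennreal (0^2)"
   using u by (intro tendsto_ennrealI tendsto_power) (simp add: tendsto_norm_zero LIM_zero)
  then show ?thesis using lim_imp_Liminf[OF trivial_limit_sequentially] by fastforce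
 qed
 finally have "(NI x. ennreal ((f x - fn u x)^2)) = 0" by simp
 then have "AE x in lborel. ennreal ((f x - fn u x)^2) = 0"
  by (subst (asm) nn_integral_0_iff_AE) auto
 then have "AE x in lborel. f x = fn u x" by eventually_elim auto
 moreover have "(f ---> f 0) (at 0)"
  using fc by (simp add: continuous_on_eq_continuous_at isCont_def)
 then have "(f ---> c) (at 0)" by (simp only: LIMSEQ_unique[OF pt[of 0] c])
 ultimately show ?thesis unfolding lim0_def by blast
qed

subsection \<open>A smooth function with the behaviour of the Green function at infinity\<close>

text \<open>All derivatives are polynomials in \<open>qf\<close> and the coordinates; the first
  derivatives and the pure second ones are bounded by multiples of qf^2, which is square
  integrable.\<close>

definition qf :: "R3 => real" where "qf x = inverse (sqrt (1 + x \<bullet> x))"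

lemma qf_pos: "0 < qf x" and qf_le_1: "qf x \<le> 1"
 and qf_sq: "(qf x)^2 * (1 + x \<bullet> x) = 1"
proof -
 have "1 \<le> 1 + x \<bullet> x" by simp
 then have 1: "1 \<le> sqrt (1 + x \<bullet> x)" by (metis real_sqrt_ge_1_iff)
 have p: "0 < 1 + x \<bullet> x" by (rule add_pos_nonneg) auto
 then show "0 < qf x" "qf x \<le> 1" using 1 by (auto simp: qf_def inverse_le_1_iff)
 have "(sqrt (1 + x \<bullet> x))^2 = 1 + x \<bullet> x" by (simp add: add_nonneg_nonneg)
 then show "(qf x)^2 * (1 + x \<bullet> x) = 1"
  using 1 by (simp add: qf_def power_inverse) (metis add_nonneg_eq_0_iff inner_ge_zero left_inverse zero_le_one zero_neq_one)
qed

lemma qf_deriv: "(qf has_derivative (%v. - (x \<bullet> v) * (qf x)^3)) (at x)"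
proof -
 have p: "0 < 1 + x \<bullet> x" by (simp add: add_pos_nonneg)
 have 1: "((%x::R3. 1 + x \<bullet> x) has_derivative (%v. 2 * (x \<bullet> v))) (at x)"
  by (auto intro!: derivative_eq_intros simp: inner_commute)
 have 2: "(sqrt has_real_derivative inverse (sqrt (1 + x \<bullet> x)) / 2) (at (1 + x \<bullet> x))"
  by (rule DERIV_real_sqrt[OF p])
 have "((%s. inverse (sqrt s)) has_real_derivative - (inverse (sqrt (1 + x \<bullet> x)) / 2 * inverse ((sqrt (1 + x \<bullet> x))^2))) (at (1 + x \<bullet> x))"
  using DERIV_inverse_fun[OF 2] p by (simp add: numeral_2_eq_2)
 then have hd: "((%x::R3. inverse (sqrt (1 + x \<bullet> x))) has_derivative (%v. - (inverse (sqrt (1 + x \<bullet> x)) / 2 * inverse ((sqrt (1 + x \<bullet> x))^2)) * (2 * (x \<bullet> v)))) (at x)"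
  using has_derivative_compose[OF 1] unfolding has_field_derivative_def by blast
 show ?thesis
  unfolding qf_def[abs_def]
 proof (rule has_derivative_eq_rhs[OF hd], rule ext)
  fix v
  define S where "S = sqrt (1 + x \<bullet> x)"
  have "- (inverse S / 2 * inverse (S^2)) * (2 * (x \<bullet> v)) = - (x \<bullet> v) * inverse S ^ 3"
   by (simp add: power2_eq_square power3_eq_cube)
  then show "- (inverse (sqrt (1 + x \<bullet> x)) / 2 * inverse ((sqrt (1 + x \<bullet> x))^2)) * (2 * (x \<bullet> v)) = - (x \<bullet> v) * inverse (sqrt (1 + x \<bullet> x)) ^ 3"
   unfolding S_def .
 qed
qed

lemma dder_qf: "dder v qf = (%x. - (x \<bullet> v) * (qf x)^3)"
 by (rule ext, rule dder_eq[OF qf_deriv])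

lemma smooth_qf: "smooth qf"
proof (rule smooth_gen_alg[of "insert qf {%x. x \<bullet> v | v. True}"])
 let ?B = "insert qf {%x. x \<bullet> v | v. True}"
 show "f differentiable (at x)" if "f \<in> ?B" for f x
  using that qf_deriv by (auto simp: differentiable_def intro: smooth_differentiable[OF smooth_inner, unfolded differentiable_def])
 show "dder v f \<in> gen_alg ?B" if f: "f \<in> ?B" for f v
 proof (cases "f = qf")
  case True
  have "(%x. (-1) * (x \<bullet> v) * (qf x * qf x * qf x)) \<in> gen_alg ?B"
   by (intro gen_alg.mult gen_alg.const gen_alg.base) auto
  then show ?thesis unfolding True dder_qf by (simp add: power3_eq_cube)
 next
  case False
  then obtain w where w: "f = (%x. x \<bullet> w)" using f by blast
  have "dder v f = (%x. v \<bullet> w)" unfolding w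
   by (rule ext, rule dder_eq) (auto intro!: derivative_eq_intros)
  then show ?thesis by (simp add: gen_alg.const)
 qed
qed (auto intro: gen_alg.base)

lemma component_qf: "\<bar>x $ i\<bar> * qf x \<le> 1"
proof -
 have "(x $ i)^2 \<le> 1 + x \<bullet> x"
  using component_le_norm_cart[of x i] power_mono[of "\<bar>x $ i\<bar>" "norm x" 2] by (simp add: power2_norm_eq_inner)
 then have "(qf x)^2 * (x $ i)^2 \<le> 1"
  using mult_left_mono[of "(x $ i)^2" "1 + x \<bullet> x" "(qf x)^2"] qf_sq[of x] by simp
 then have "(\<bar>x $ i\<bar> * qf x)^2 \<le> 1^2" by (simp add: power_mult_distrib mult.commute)
 then show ?thesis by (rule power2_le_imp_le) simp
qed

lemma dder_qf_bound: "\<bar>pd i qf x\<bar> \<le> (qf x)^2"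
proof -
 have "\<bar>pd i qf x\<bar> = (\<bar>x $ i\<bar> * qf x) * (qf x)^2"
  using qf_pos[of x] by (simp add: dder_qf inner_axis abs_mult power3_eq_cube power2_eq_square)
 also have "... \<le> 1 * (qf x)^2" by (rule mult_right_mono[OF component_qf]) simp
 finally show ?thesis by simp
qed

lemma dder2_qf: "pd i (pd i qf) x = 3 * (x $ i)^2 * (qf x)^5 - (qf x)^3"
proof -
 have "((%x. - (x \<bullet> axis i 1) * (qf x)^3) has_derivative (%v. - (x \<bullet> axis i 1) * (3 * (- (x \<bullet> v) * (qf x)^3) * (qf x)^2) + - (v \<bullet> axis i 1) * (qf x)^3)) (at x)"
  by (auto intro!: derivative_eq_intros qf_deriv simp: fun_eq_iff)
 then have "pd i (pd i qf) x = - (x \<bullet> axis i 1) * (3 * (- (x \<bullet> axis i 1) * (qf x)^3) * (qf x)^2) + - ((axis i 1 :: R3) \<bullet> axis i 1) * (qf x)^3"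
  unfolding dder_qf by (rule dder_eq)
 also have "... = 3 * (x $ i)^2 * (qf x)^5 - (qf x)^3"
  unfolding inner_axis_axis inner_axis by (simp add: eval_nat_numeral algebra_simps)
 finally show ?thesis .
qed

lemma dder2_qf_bound: "\<bar>pd i (pd i qf) x\<bar> \<le> 4 * (qf x)^2"
proof -
 have 1: "(x $ i)^2 * (qf x)^2 \<le> 1"
  using power_mono[OF component_qf[of x i], of 2] qf_pos[of x] by (simp add: power_mult_distrib)
 have q3: "(qf x)^3 \<le> (qf x)^2" using qf_pos[of x] qf_le_1[of x] by (intro power_decreasing) auto
 have "(x $ i)^2 * (qf x)^5 = ((x $ i)^2 * (qf x)^2) * (qf x)^3" by (simp add: power_add[symmetric])
 also have "... \<le> 1 * (qf x)^3" by (rule mult_right_mono[OF 1]) (use qf_pos[of x] in simp)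
 finally have "(x $ i)^2 * (qf x)^5 \<le> (qf x)^2" using q3 by simp
 moreover have "0 \<le> (x $ i)^2 * (qf x)^5" "0 \<le> (qf x)^3" using qf_pos[of x] by auto
 ultimately show ?thesis unfolding dder2_qf using q3 by linarith
qed

lemma qf_measurable [measurable]: "qf \<in> borel_measurable borel"
 by (rule smooth_borel[OF smooth_qf])

lemma nn_integral_inverse_1_plus_sq: "(NI r. ennreal (inverse (1 + r^2)) * indicator {0..} r) < \<infinity>"
proof -
 have "(NI r. ennreal (inverse (1 + r^2)) * indicator {0..} r) = ennreal (pi/2 - arctan 0)"
  by (rule nn_integral_FTC_atLeast) (auto intro!: derivative_eq_intros tendsto_arctan_at_top)
 then show ?thesis by simp
qed

lemma sqi_qf_sq: "sqi (%x. (qf x)^2)"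
 unfolding sqi_def
proof
 show "integrable lborel (%x. ((qf x)^2)^2)"
 proof (rule integrableI_bounded)
  have "(NI x. ennreal (norm (((qf x)^2)^2))) = (NI x. ennreal ((inverse (1 + (norm (x::R3))^2))^2))"
   by (rule nn_integral_cong) (simp add: qf_def power_inverse power2_norm_eq_inner add_nonneg_nonneg)
  also have "... = (NI r. ennreal (indicator {0<..} r * (4 * pi * r^2)) * ennreal ((inverse (1 + r^2))^2))"
   by (rule nn_integral_radial) measurable
  also have "... \<le> (NI r. ennreal (4 * pi) * (ennreal (inverse (1 + r^2)) * indicator {0..} r))"
  proof (rule nn_integral_mono)
   fix r :: real
   have "r^2 * (inverse (1 + r^2))^2 \<le> (1 + r^2) * (inverse (1 + r^2))^2" by (rule mult_right_mono) auto
   also have "... = inverse (1 + r^2)" by (simp add: power2_eq_square) (metis add_nonneg_eq_0_iff mult.assoc mult.left_neutral right_inverse zero_le_one zero_le_square zero_neq_one)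
   finally have "indicator {0<..} r * (4 * pi * r^2) * (inverse (1 + r^2))^2 \<le> 4 * pi * (inverse (1 + r^2) * indicator {0..} r)"
    by (auto simp: indicator_def mult.assoc)
   then show "ennreal (indicator {0<..} r * (4 * pi * r^2)) * ennreal ((inverse (1 + r^2))^2) \<le> ennreal (4 * pi) * (ennreal (inverse (1 + r^2)) * indicator {0..} r)"
    by (cases "r > 0") (auto simp: ennreal_mult''[symmetric] ennreal_mult'[symmetric] intro!: ennreal_leI)
  qed
  also have "... = ennreal (4 * pi) * (NI r. ennreal (inverse (1 + r^2)) * indicator {0..} r)"
   by (rule nn_integral_cmult) measurable
  also have "... < \<infinity>" using nn_integral_inverse_1_plus_sq by (simp add: ennreal_mult_less_top)
  finally show "(NI x. ennreal (norm (((qf x)^2)^2))) < \<infinity>" .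
 qed measurable
qed measurable

text \<open>The standard square integrable field of unit charge: it has the singularity of G at 0,
  and the slow decay of G is cancelled. Subtracting a multiple of it reduces charged fields to
  uncharged ones.\<close>

definition Gam :: "R3 => real" where "Gam x = Gr x - qf x / (4 * pi)"

lemma sqi_Gam: "sqi Gam"
 unfolding sqi_def
proof
 show m: "Gam \<in> borel_measurable lborel" unfolding Gam_def[abs_def] by measurable
 have b: "(Gam x)^2 \<le> (1 / (4 * pi * norm x) * inverse (1 + (norm x)^2))^2" if nz: "x \<noteq> 0" for x
 proof -
  define r where "r = norm x"
  have r: "r > 0" using nz by (simp add: r_def)
  have q2: "(qf x)^2 = inverse (1 + r^2)"
   using qf_sq[of x] by (simp add: r_def power2_norm_eq_inner) (metis inverse_unique mult.commute)
  \<comment> \<open>This factorisation bounds \<open>1 - r * qf x\<close> by (qf x)^2, so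
    \<open>Gam\<close> decays like r^-3; near 0 the remaining factor 1/r is locally square
    integrable in three dimensions.\<close>
  have rq: "(1 - r * qf x) * (1 + r * qf x) = (qf x)^2"
   using qf_sq[of x] by (simp add: r_def power2_norm_eq_inner[symmetric] algebra_simps power2_eq_square)
  have rq0: "0 \<le> r * qf x" using r qf_pos[of x] by simp
  have le: "1 - r * qf x \<le> (qf x)^2" and ge: "0 \<le> 1 - r * qf x"
  proof -
   have p: "0 < 1 + r * qf x" using rq0 by simp
   show ge: "0 \<le> 1 - r * qf x" using rq p by (metis mult_less_0_iff not_less zero_le_power2 less_asym)
   have "(1 - r * qf x) * 1 \<le> (1 - r * qf x) * (1 + r * qf x)" by (rule mult_left_mono) (use ge rq0 in auto)
   then show "1 - r * qf x \<le> (qf x)^2" using rq by simp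
  qed
  have e: "Gam x = 1 / (4 * pi * r) * (1 - r * qf x)" using r by (simp add: Gam_def Gr_def r_def field_simps)
  have "\<bar>Gam x\<bar> \<le> 1 / (4 * pi * r) * inverse (1 + r^2)"
   unfolding e using le ge r q2 by (simp add: abs_mult divide_right_mono)
  then have "\<bar>Gam x\<bar>^2 \<le> (1 / (4 * pi * r) * inverse (1 + r^2))^2" by (rule power_mono) simp
  then show ?thesis by (simp add: r_def)
 qed
 show "integrable lborel (%x. (Gam x)^2)"
 proof (rule integrableI_bounded)
  show "(%x. (Gam x)^2) \<in> borel_measurable lborel" using m by measurable
  have "(NI x. ennreal (norm ((Gam x)^2))) \<le> (NI x. ennreal ((1 / (4 * pi * norm (x::R3)) * inverse (1 + (norm x)^2))^2))"
   by (rule nn_integral_mono_AE, use AE_R3_nonzero in eventually_elim) (use b in "auto intro!: ennreal_leI")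
  also have "... = (NI r. ennreal (indicator {0<..} r * (4 * pi * r^2)) * ennreal ((1 / (4 * pi * r) * inverse (1 + r^2))^2))"
   by (rule nn_integral_radial) measurable
  also have "... \<le> (NI r. ennreal (inverse (1 + r^2)) * indicator {0..} r)"
  proof (rule nn_integral_mono)
   fix r :: real
   show "ennreal (indicator {0<..} r * (4 * pi * r^2)) * ennreal ((1 / (4 * pi * r) * inverse (1 + r^2))^2) \<le> ennreal (inverse (1 + r^2)) * indicator {0..} r"
   proof (cases "r > 0")
    case True
    have "4 * pi * r^2 * (1 / (4 * pi * r) * inverse (1 + r^2))^2 = inverse (4 * pi) * (inverse (1 + r^2))^2"
    proof -
     have "4 * pi * r^2 * (1 / (4 * pi * r) * I)^2 = inverse (4 * pi) * I^2" for I
      using True by (simp add: power2_eq_square divide_simps)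
     then show ?thesis .
    qed
    also have "... \<le> 1 * (inverse (1 + r^2))^2"
     by (rule mult_right_mono, unfold inverse_le_1_iff) (use four_pi_ge_1 in auto)
    also have "... \<le> inverse (1 + r^2)"
     using power_decreasing[of 1 2 "inverse (1 + r^2)"] by (simp add: inverse_le_1_iff)
    finally show ?thesis using True by (simp add: ennreal_mult''[symmetric] ennreal_leI)
   qed simp
  qed
  also have "... < \<infinity>" by (rule nn_integral_inverse_1_plus_sq)
  finally show "(NI x. ennreal (norm ((Gam x)^2))) < \<infinity>" .
 qed
qed

text \<open>\<open>qf / 4\<pi>\<close> is approximated by test functions in the norms of gradient and Laplacian;
  on the support of the cut-off \<open>1/n\<close> is of order at most \<open>qf\<close>, so \<open>qf\<^sup>2\<close> dominates everything.\<close>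

definition bump :: "R3 => real" where "bump = (SOME f. test_fn f \<and> f 0 = 1)"

lemma test_bump: "test_fn bump" and bump_0: "bump 0 = 1"
 using someI_ex[of "%f::R3 => real. test_fn f \<and> f 0 = 1", OF exists_bump] unfolding bump_def by auto

definition qn :: "nat => R3 => real" where
 "qn n x = bump (inverse (real (Suc n)) *R x) * (qf x / (4 * pi))"

lemma dder_scale:
 assumes "smooth f" shows "dder v (%x::R3. f (c *R x)) = (%x. c * dder v f (c *R x))"
proof
 fix x
 have "dder v (%x. f (c *R x)) x = dder (c *R v) f (c *R x)"
  using dder_affine(2)[OF bounded_linear_scaleR_right smooth_differentiable[OF assms], where a=0] by simp
 then show "dder v (%x. f (c *R x)) x = c * dder v f (c *R x)"
  using linear_cmul[OF linear_dder[OF smooth_differentiable[OF assms]]] by simp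
qed

lemma smooth_scale: "smooth f ==> smooth (%x::R3. f (c *R x))"
 using smooth_affine[OF bounded_linear_scaleR_right[of c], of f 0] by simp

lemma test_scale:
 assumes f: "test_fn f" and c: "c > 0" shows "test_fn (%x::R3. f (c *R x))"
proof -
 obtain R where R: "!!x. R < norm x ==> f x = 0" using test_support[OF f] by metis
 show ?thesis
 proof (rule test_fnI[OF smooth_scale[OF test_smooth[OF f]], where r="R / c"])
  fix x assume "f (c *R x) \<noteq> 0"
  then have "norm (c *R x) \<le> R" using R by (meson not_le)
  then show "norm x \<le> R / c" using c by (simp add: field_simps)
 qed
qed

lemma dder_mult_fun: "smooth f ==> smooth g ==> dder v (%x. f x * g x) = (%x. f x * dder v g x + dder v f x * g x)"
 by (rule ext) (rule dder_mult; rule smooth_differentiable)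

lemma scaled_qf_bound:
 assumes f: "test_fn f"
 obtains K where "K \<ge> 0" "!!n x. inverse (real (Suc n)) * \<bar>f (inverse (real (Suc n)) *R x)\<bar> \<le> K * qf x"
  "!!x. \<bar>f x\<bar> \<le> K"
proof -
 obtain R where R: "R > 0" "!!x. R < norm x ==> f x = 0" using test_support[OF f] by metis
 obtain C where C: "C > 0" "!!x. \<bar>f x\<bar> \<le> C" using test_bounded[OF f] by metis
 define K where "K = C * (sqrt (1 + R^2) + 1)"
 show thesis
 proof (rule that[of K])
  show "K \<ge> 0" using C by (simp add: K_def)
  show "\<bar>f x\<bar> \<le> K" for x
  proof -
   have "C * 1 \<le> C * (sqrt (1 + R^2) + 1)" by (rule mult_left_mono) (use C in auto)
   then show ?thesis using C(2)[of x] by (simp add: K_def)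
  qed
  fix n x
  define c where "c = inverse (real (Suc n))"
  have c: "0 < c" "c \<le> 1" by (auto simp: c_def inverse_le_1_iff)
  have "c * \<bar>f (c *R x)\<bar> \<le> K * qf x"
  proof (cases "f (c *R x) = 0")
   case True
   then show ?thesis using C qf_pos[of x] by (simp add: K_def)
  next
   case False
   then have "norm (c *R x) \<le> R" using R(2) by (meson not_le)
   then have "(c * norm x)^2 \<le> R^2" using c by (intro power_mono) auto
   moreover have "c^2 \<le> 1" using c by (simp add: power_le_one)
   ultimately have "c^2 * (1 + x \<bullet> x) \<le> 1 + R^2"
    by (simp add: power_mult_distrib power2_norm_eq_inner algebra_simps)
   then have "sqrt (c^2 * (1 + x \<bullet> x)) \<le> sqrt (1 + R^2)" by (rule real_sqrt_le_mono)
   then have "c * sqrt (1 + x \<bullet> x) \<le> sqrt (1 + R^2)" using c by (simp add: real_sqrt_mult)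
   then have "(c * sqrt (1 + x \<bullet> x)) * qf x \<le> sqrt (1 + R^2) * qf x"
    by (rule mult_right_mono) (use qf_pos[of x] in simp)
   moreover have "sqrt (1 + x \<bullet> x) * qf x = 1"
    using qf_pos[of x] by (simp add: qf_def)
   ultimately have "c \<le> sqrt (1 + R^2) * qf x" by (simp add: mult.assoc)
   also have "... \<le> (sqrt (1 + R^2) + 1) * qf x" by (rule mult_right_mono) (use qf_pos[of x] in auto)
   finally have "c * \<bar>f (c *R x)\<bar> \<le> ((sqrt (1 + R^2) + 1) * qf x) * C"
    by (intro mult_mono C(2)) (use c qf_pos[of x] in auto)
   then show ?thesis by (simp add: K_def mult_ac)
  qed
  then show "inverse (real (Suc n)) * \<bar>f (inverse (real (Suc n)) *R x)\<bar> \<le> K * qf x" unfolding c_def .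
 qed
qed

lemma qn_approx:
 shows "test_fn (qn n)" "qn n 0 = 1 / (4 * pi)"
  "(%n. cls (pd i (qn n))) ----> cls (%x. pd i qf x / (4 * pi))"
  "(%n. cls (pd i (pd i (qn n)))) ----> cls (%x. pd i (pd i qf) x / (4 * pi))"
  "test_fn ph ==> (%n. LI x. qn n x * ph x) ----> (LI x. qf x / (4 * pi) * ph x)"
proof -
 let ?c = "%n. inverse (real (Suc n))"
 define q where "q x = qf x / (4 * pi)" for x
 have sq: "smooth q" unfolding q_def[abs_def] using smooth_cmult[OF smooth_qf, of "1 / (4 * pi)"] by simp
 have dq: "dder v q = (%x. dder v qf x / (4 * pi))" for v
  unfolding q_def[abs_def] using dder_cmult_fun[OF smooth_qf, of v "1 / (4 * pi)"] by simp
 have ddq: "dder v (dder v q) = (%x. dder v (dder v qf) x / (4 * pi))" for v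
  unfolding dq using dder_cmult_fun[OF smooth_dder[OF smooth_qf], of v "1 / (4 * pi)" v] by simp
 have qne: "qn n = (%x. bump (?c n *R x) * q x)" for n by (simp add: qn_def q_def fun_eq_iff)
 have tb: "test_fn (%x. bump (?c n *R x))" for n by (rule test_scale[OF test_bump]) simp
 have sb: "smooth bump" by (rule test_smooth[OF test_bump])
 have tq: "test_fn (qn n)" for n unfolding qne by (rule test_mult[OF tb sq])
 then show "test_fn (qn n)" for n .
 show "qn n 0 = 1 / (4 * pi)" by (simp add: qn_def bump_0 qf_def)
 have pc: "\<bar>y / (4 * pi)\<bar> \<le> \<bar>y\<bar>" for y :: real
 proof -
  have "\<bar>y\<bar> * 1 \<le> \<bar>y\<bar> * (4 * pi)" by (rule mult_left_mono[OF four_pi_ge_1]) simp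
  then show ?thesis by (simp add: divide_le_eq)
 qed
 have q0: "0 \<le> q x" "q x \<le> qf x" for x using pc[of "qf x"] qf_pos[of x] by (auto simp: q_def)
 let ?e = "axis i 1 :: R3"
 have d1: "dder ?e (%x. bump (?c n *R x)) = (%x. ?c n * dder ?e bump (?c n *R x))" for n
  by (rule dder_scale[OF sb])
 have d2: "dder ?e (%x. ?c n * dder ?e bump (?c n *R x)) = (%x. ?c n * (?c n * dder ?e (dder ?e bump) (?c n *R x)))" for n
  using dder_cmult_fun[OF smooth_scale[OF smooth_dder[OF sb]]] dder_scale[OF smooth_dder[OF sb]] by metis
 have e1: "dder ?e (qn n) = (%x. bump (?c n *R x) * dder ?e q x + ?c n * dder ?e bump (?c n *R x) * q x)" for n
  unfolding qne dder_mult_fun[OF test_smooth[OF tb] sq] d1 ..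
 have e2: "dder ?e (dder ?e (qn n)) = (%x. bump (?c n *R x) * dder ?e (dder ?e q) x + 2 * (?c n * dder ?e bump (?c n *R x) * dder ?e q x)
   + ?c n * (?c n * dder ?e (dder ?e bump) (?c n *R x)) * q x)" for n
 proof -
  have s1: "smooth (%x. ?c n * dder ?e bump (?c n *R x))" by (rule smooth_cmult[OF smooth_scale[OF smooth_dder[OF sb]]])
  show ?thesis
   unfolding e1 dder_add_fun[OF smooth_mult[OF test_smooth[OF tb] smooth_dder[OF sq]] smooth_mult[OF s1 sq]]
    dder_mult_fun[OF test_smooth[OF tb] smooth_dder[OF sq]] dder_mult_fun[OF s1 sq] d1 d2
   by (simp add: fun_eq_iff)
 qed
 have c0: "?c ----> 0" by (rule LIMSEQ_inverse_real_of_nat)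
 have cc: "0 < ?c n" "?c n \<le> 1" for n by (auto simp: inverse_le_1_iff)
 have lim: "(%n. f (?c n *R x)) ----> f 0" if "smooth f" for f :: "R3 => real" and x
 proof -
  have "(%n. ?c n *R x) ----> 0 *R x" by (intro tendsto_intros c0)
  then have "(%n. ?c n *R x) ----> 0" by simp
  then show ?thesis using smooth_continuous[OF that, of UNIV] by (auto simp: continuous_on_eq_continuous_at intro: isCont_tendsto_compose)
 qed
 obtain K0 where K0: "K0 \<ge> 0" "!!x. \<bar>bump x\<bar> \<le> K0" using scaled_qf_bound[OF test_bump] by metis
 obtain K1 where K1: "K1 \<ge> 0" "!!n x. ?c n * \<bar>dder ?e bump (?c n *R x)\<bar> \<le> K1 * qf x" "!!x. \<bar>dder ?e bump x\<bar> \<le> K1"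
  using scaled_qf_bound[OF test_dder[OF test_bump]] by metis
 obtain K2 where K2: "K2 \<ge> 0" "!!n x. ?c n * \<bar>dder ?e (dder ?e bump) (?c n *R x)\<bar> \<le> K2 * qf x"
  using scaled_qf_bound[OF test_dder[OF test_dder[OF test_bump]]] by metis
 have bd1: "\<bar>dder ?e q x\<bar> \<le> (qf x)^2" for x
  unfolding dq using order_trans[OF pc dder_qf_bound] .
 have bd2: "\<bar>dder ?e (dder ?e q) x\<bar> \<le> 4 * (qf x)^2" for x
  unfolding ddq using order_trans[OF pc dder2_qf_bound] .
 have B1: "\<bar>bump (?c n *R x) * dder ?e q x\<bar> \<le> K0 * (qf x)^2" for n x
  unfolding abs_mult by (rule mult_mono[OF K0(2) bd1]) (use K0 in auto)
 have B2: "\<bar>?c n * dder ?e bump (?c n *R x) * q x\<bar> \<le> K1 * (qf x)^2" for n x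
 proof -
  have "\<bar>?c n * dder ?e bump (?c n *R x) * q x\<bar> = (?c n * \<bar>dder ?e bump (?c n *R x)\<bar>) * q x"
   using cc[of n] q0 by (simp add: abs_mult)
  also have "... \<le> (K1 * qf x) * qf x" by (rule mult_mono[OF K1(2) q0(2)]) (use K1 qf_pos[of x] q0 in auto)
  finally show ?thesis by (simp add: power2_eq_square mult.assoc)
 qed
 have B3: "\<bar>bump (?c n *R x) * dder ?e (dder ?e q) x\<bar> \<le> K0 * (4 * (qf x)^2)" for n x
  unfolding abs_mult by (rule mult_mono[OF K0(2) bd2]) (use K0 in auto)
 have B4: "\<bar>?c n * dder ?e bump (?c n *R x) * dder ?e q x\<bar> \<le> K1 * (qf x)^2" for n x
 proof -
  have "?c n * \<bar>dder ?e bump (?c n *R x)\<bar> \<le> 1 * K1" by (rule mult_mono[OF cc(2) K1(3)]) auto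
  then show ?thesis unfolding abs_mult using cc[of n] K1 bd1[of x] by (intro mult_mono) auto
 qed
 have B5: "\<bar>?c n * (?c n * dder ?e (dder ?e bump) (?c n *R x)) * q x\<bar> \<le> K2 * (qf x)^2" for n x
 proof -
  have "\<bar>?c n * (?c n * dder ?e (dder ?e bump) (?c n *R x)) * q x\<bar> = ?c n * ((?c n * \<bar>dder ?e (dder ?e bump) (?c n *R x)\<bar>) * q x)"
   using cc[of n] q0 by (simp add: abs_mult)
  also have "... \<le> 1 * ((K2 * qf x) * qf x)"
   by (intro mult_mono K2(2) q0(2) cc) (use K2 qf_pos[of x] q0 cc[of n] in auto)
  finally show ?thesis by (simp add: power2_eq_square mult.assoc)
 qed
 have mq: "dder v q \<in> borel_measurable borel" "dder v (dder v q) \<in> borel_measurable borel" for v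
  by (intro smooth_borel smooth_dder sq)+
 have "(%n. cls (dder ?e (qn n))) ----> cls (dder ?e q)"
 proof (rule cls_tendsto_dominated(1)[OF sqi_scale[OF sqi_qf_sq, of "K0 + K1"]])
  show "dder ?e (qn n) \<in> borel_measurable borel" for n by (intro test_borel test_dder tq)
  show "AE x in lborel. \<bar>dder ?e (qn n) x\<bar> \<le> \<bar>(K0 + K1) * (qf x)^2\<bar>" for n
  proof (rule AE_I2)
   fix x
   have "\<bar>dder ?e (qn n) x\<bar> \<le> K0 * (qf x)^2 + K1 * (qf x)^2"
    unfolding e1 by (rule order_trans[OF abs_triangle_ineq add_mono[OF B1 B2]])
   then show "\<bar>dder ?e (qn n) x\<bar> \<le> \<bar>(K0 + K1) * (qf x)^2\<bar>" by (simp add: distrib_right)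
  qed
  have "(%n. dder ?e (qn n) x) ----> bump 0 * dder ?e q x + 0 * dder ?e bump 0 * q x" for x
   unfolding e1 by (intro tendsto_intros lim c0 sb smooth_dder)
  then show "AE x in lborel. (%n. dder ?e (qn n) x) ----> dder ?e q x" by (simp add: bump_0)
 qed (rule mq)
 then show "(%n. cls (dder ?e (qn n))) ----> cls (%x. dder ?e qf x / (4 * pi))" by (simp add: dq)
 have "(%n. cls (dder ?e (dder ?e (qn n)))) ----> cls (dder ?e (dder ?e q))"
 proof (rule cls_tendsto_dominated(1)[OF sqi_scale[OF sqi_qf_sq, of "4 * K0 + 2 * K1 + K2"]])
  show "dder ?e (dder ?e (qn n)) \<in> borel_measurable borel" for n by (intro test_borel test_dder tq)
  show "AE x in lborel. \<bar>dder ?e (dder ?e (qn n)) x\<bar> \<le> \<bar>(4 * K0 + 2 * K1 + K2) * (qf x)^2\<bar>" for n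
  proof (rule AE_I2)
   fix x
   have "\<bar>2 * (?c n * dder ?e bump (?c n *R x) * dder ?e q x)\<bar> \<le> 2 * (K1 * (qf x)^2)"
    using B4[of n x] by (simp add: abs_mult)
   then have "\<bar>dder ?e (dder ?e (qn n)) x\<bar> \<le> K0 * (4 * (qf x)^2) + 2 * (K1 * (qf x)^2) + K2 * (qf x)^2"
    unfolding e2 by (intro order_trans[OF abs_triangle_ineq add_mono[OF order_trans[OF abs_triangle_ineq add_mono[OF B3]] B5]])
   then show "\<bar>dder ?e (dder ?e (qn n)) x\<bar> \<le> \<bar>(4 * K0 + 2 * K1 + K2) * (qf x)^2\<bar>" by (simp add: distrib_right)
  qed
  have "(%n. dder ?e (dder ?e (qn n)) x) ----> bump 0 * dder ?e (dder ?e q) x + 2 * (0 * dder ?e bump 0 * dder ?e q x) + 0 * (0 * dder ?e (dder ?e bump) 0) * q x" for x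
   unfolding e2 by (intro tendsto_intros lim c0 sb smooth_dder)
  then show "AE x in lborel. (%n. dder ?e (dder ?e (qn n)) x) ----> dder ?e (dder ?e q) x" by (simp add: bump_0)
 qed (rule mq)
 then show "(%n. cls (dder ?e (dder ?e (qn n)))) ----> cls (%x. dder ?e (dder ?e qf) x / (4 * pi))" by (simp add: ddq)
 assume ph: "test_fn ph"
 show "(%n. LI x. qn n x * ph x) ----> (LI x. qf x / (4 * pi) * ph x)"
 proof (rule integral_dominated_convergence[where w="%x. K0 * \<bar>ph x\<bar>"])
  note [measurable] = test_borel[OF ph]
  show "(%x. qf x / (4 * pi) * ph x) \<in> borel_measurable lborel" by measurable
  have "qn n \<in> borel_measurable borel" for n by (rule test_borel[OF tq])
  then show "(%x. qn n x * ph x) \<in> borel_measurable lborel" for n by measurable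
  show "integrable lborel (%x. K0 * \<bar>ph x\<bar>)" using test_integrable[OF ph] by simp
  have "(%n. qn n x * ph x) ----> bump 0 * q x * ph x" for x
   unfolding qne by (intro tendsto_intros lim sb)
  then show "AE x in lborel. (%n. qn n x * ph x) ----> qf x / (4 * pi) * ph x" by (simp add: bump_0 q_def)
  show "AE x in lborel. norm (qn n x * ph x) \<le> K0 * \<bar>ph x\<bar>" for n
  proof (rule AE_I2)
   fix x
   have "\<bar>qn n x\<bar> \<le> K0 * 1" unfolding qne abs_mult
    by (rule mult_mono[OF K0(2)]) (use q0[of x] qf_le_1[of x] K0 in auto)
   then show "norm (qn n x * ph x) \<le> K0 * \<bar>ph x\<bar>" by (simp add: abs_mult mult_right_mono)
  qed
 qed
qed

subsection \<open>Regular parts\<close>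

text \<open>\<open>dapprox \<psi> ze g th\<close>: the test functions \<open>th\<close> witness that \<open>\<psi> - ze G\<close> belongs to the homogeneous
  Sobolev space, with gradient \<open>g\<close>.\<close>

definition dapprox :: "R3 l2 => real => (R3 l2)^3 => (nat => R3 => real) => bool" where
 "dapprox \<psi> ze g th \<longleftrightarrow> (\<forall>n. test_fn (th n)) \<and> (%n. cgrad (th n)) ----> g \<and>
  (\<forall>ph. test_fn ph --> (%n. LI x. th n x * ph x) ----> inner \<psi> (cls ph) - ze * (LI x. Gr x * ph x))"

lemma cls_lapf: "test_fn ph ==> cls (lapf ph) = (\<Sum>i\<in>UNIV. cls (pd i (pd i ph)))"
 by (rule l2_eqI_test) (subst (1 2) inner_commute, simp add: inner_lapf inner_sum_right)

text \<open>Gradient and Laplacian of qf / (4 pi). They belong to L2 although the function itself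
  does not.\<close>

definition gB :: "(R3 l2)^3" where "gB = (\<chi> i. cls (%x. pd i qf x / (4 * pi)))"
definition hB :: "R3 l2" where "hB = (\<Sum>i\<in>UNIV. cls (%x. pd i (pd i qf) x / (4 * pi)))"

lemma cgrad_qn: "(%n. cgrad (qn n)) ----> gB"
 by (rule vec_tendstoI) (simp add: cgrad_def gB_def qn_approx(3))

lemma lapf_qn: "(%n. cls (lapf (qn n))) ----> hB"
 unfolding hB_def cls_lapf[OF qn_approx(1)] by (intro tendsto_sum qn_approx(4))

lemma integrable_qf_test: assumes "test_fn ph" shows "integrable lborel (%x. qf x / (4 * pi) * ph x)"
 using test_integrable[OF test_mult2[OF smooth_cmult[OF smooth_qf, of "1 / (4 * pi)"] assms]] by simp

lemma inner_Gam:
 assumes ph: "test_fn ph"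
 shows "inner (cls Gam) (cls ph) = (LI x. Gr x * ph x) - (LI x. qf x / (4 * pi) * ph x)"
 using Gr_test_integrable[OF ph] integrable_qf_test[OF ph]
 by (simp add: inner_cls sqi_Gam ph Gam_def left_diff_distrib)

text \<open>The regular part \<open>Gam - Gr\<close> is -qf / (4 pi), hence the sign of
  \<open>gB\<close>. Integration by parts for \<open>qf\<close> passes through the test functions
  \<open>qn\<close>.\<close>

lemma wgr_Gam: "wgr (cls Gam) 1 (- gB)"
 unfolding wgr_def
proof (intro allI impI)
 fix ph :: "R3 => real" and i :: 3 assume ph: "test_fn ph"
 have "(%n. LI x. qn n x * pd i ph x) ----> (LI x. qf x / (4 * pi) * pd i ph x)"
  by (rule qn_approx(5)[OF test_dder[OF ph]])
 moreover have "(LI x. qn n x * pd i ph x) = - inner (cls (pd i (qn n))) (cls ph)" for n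
  using inner_dder_test[OF qn_approx(1) ph] by (simp add: inner_cls qn_approx(1) test_dder ph)
 moreover have "(%n. - inner (cls (pd i (qn n))) (cls ph)) ----> - inner (gB $ i) (cls ph)"
  unfolding gB_def vec_lambda_beta by (intro tendsto_intros qn_approx(3))
 ultimately have "(LI x. qf x / (4 * pi) * pd i ph x) = - inner (gB $ i) (cls ph)"
  using LIMSEQ_unique by fastforce
 then show "inner (cls Gam) (cls (pd i ph)) = 1 * (LI x. Gr x * pd i ph x) - inner ((- gB) $ i) (cls ph)"
  by (simp add: inner_Gam test_dder ph)
qed

lemma wlp_Gam: "wlp (cls Gam) 1 (- hB)"
 unfolding wlp_def
proof (intro allI impI)
 fix ph :: "R3 => real" assume ph: "test_fn ph"
 have "(%n. LI x. qn n x * lapf ph x) ----> (LI x. qf x / (4 * pi) * lapf ph x)"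
  by (rule qn_approx(5)[OF test_lapf[OF ph]])
 moreover have "(LI x. qn n x * lapf ph x) = inner (cls (lapf (qn n))) (cls ph)" for n
  using inner_lapf_commute[OF qn_approx(1) ph] by (simp add: inner_cls qn_approx(1) test_lapf ph)
 moreover have "(%n. inner (cls (lapf (qn n))) (cls ph)) ----> inner hB (cls ph)"
  by (intro tendsto_intros lapf_qn)
 ultimately have "(LI x. qf x / (4 * pi) * lapf ph x) = inner hB (cls ph)"
  using LIMSEQ_unique by fastforce
 then show "inner (cls Gam) (cls (lapf ph)) = inner (- hB) (cls ph) - 1 * ph 0"
  by (simp add: inner_Gam test_lapf Gr_lapf ph)
qed

text \<open>Near 0 the function is almost everywhere within half of |c - d| of both limits, which is
  impossible; so a small ball would be a null set.\<close>

lemma lim0_unique: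
 assumes "lim0 f c" "lim0 f d" shows "c = d"
proof (rule ccontr)
 assume ne: "c \<noteq> d"
 obtain h k where h: "AE x in lborel. h x = f x" "(h ---> c) (at 0)" and k: "AE x in lborel. k x = f x" "(k ---> d) (at 0)"
  using assms unfolding lim0_def by blast
 define e where "e = \<bar>c - d\<bar> / 2"
 have e: "e > 0" using ne by (simp add: e_def)
 have "eventually (%x. dist (h x) c < e \<and> dist (k x) d < e) (at 0)"
  using tendstoD[OF h(2) e] tendstoD[OF k(2) e] by eventually_elim auto
 then obtain r where r: "r > 0" "!!x. x \<noteq> 0 ==> dist x 0 < r ==> dist (h x) c < e \<and> dist (k x) d < e"
  unfolding eventually_at by blast
 have "AE x in lborel. x \<notin> ball (0::R3) r"
  using h(1) k(1) AE_R3_nonzero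
 proof eventually_elim
  case (elim x)
  show ?case
  proof
   assume "x \<in> ball 0 r"
   then have "dist (f x) c < e \<and> dist (f x) d < e" using r(2)[of x] elim by (simp add: dist_commute)
   then have "\<bar>f x - c\<bar> < \<bar>c - d\<bar> / 2" "\<bar>f x - d\<bar> < \<bar>c - d\<bar> / 2" by (auto simp: e_def dist_real_def)
   moreover have "\<bar>c - d\<bar> \<le> \<bar>f x - c\<bar> + \<bar>f x - d\<bar>" using abs_triangle_ineq4[of "f x - d" "f x - c"] by simp
   ultimately show False using field_sum_of_halves[of "\<bar>c - d\<bar>"] by argo
  qed
 qed
 then have "ball (0::R3) r \<in> null_sets lborel" by (subst (asm) AE_iff_null_sets[symmetric]) auto
 then have "negligible (ball (0::R3) r)" using null_sets_completionI negligible_iff_null_sets by blast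
 then show False using open_not_negligible[of "ball (0::R3) r"] r(1) by auto
qed

lemma lim0_cong: "lim0 f c ==> AE x in lborel. f x = g x ==> lim0 g c"
 unfolding lim0_def by (elim exE conjE, rule_tac x=h in exI) (auto elim: eventually_elim2)

lemma lim0_diff: "lim0 f c ==> lim0 g d ==> lim0 (%x. f x - g x) (c - d)"
 unfolding lim0_def
proof (elim exE conjE)
 fix h k assume a: "AE x in lborel. h x = f x" "(h ---> c) (at 0)" "AE x in lborel. k x = g x" "(k ---> d) (at 0)"
 have e: "AE x in lborel. h x - k x = f x - g x" using a(1,3) by eventually_elim simp
 show "\<exists>h. (AE x in lborel. h x = f x - g x) \<and> (h ---> c - d) (at 0)"
  by (rule exI[of _ "%x. h x - k x"], rule conjI, rule e, rule tendsto_diff[OF a(2,4)])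
qed

lemma lim0_tendsto: "(f ---> c) (at 0) ==> lim0 f c"
 unfolding lim0_def by auto

definition Kreg :: real where "Kreg = 2 + norm (cls Gam) + norm hB + norm gB"

text \<open>Subtract \<open>ze *R cls Gam\<close> and apply \<open>domain_approx\<close> to the
  uncharged rest \<open>u\<close>. Since \<psi> - ze G = u - ze qf / (4 pi), the approximation of
  the regular part is the one of \<open>u\<close> minus \<open>ze * qn\<close>, and all limits and
  bounds are the sums of those of the two pieces.\<close>

lemma structure_wlp:
 assumes w: "wlp \<psi> ze h"
 obtains th g c where "dapprox \<psi> ze g th" "(%n. cls (lapf (th n))) ----> h" "(%n. th n 0) ----> c"
  "lim0 (%x. fn \<psi> x - ze * Gr x) c" "norm g \<le> Kreg * (norm \<psi> + \<bar>ze\<bar> + norm h)"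
proof -
 define u where "u = \<psi> - ze *R cls Gam"
 define k where "k = h + ze *R hB"
 have "wlp u 0 k" using wlp_lin[OF w wlp_Gam, of 1 "- ze"] by (simp add: u_def k_def)
 then obtain ph g0 c0 where ph: "!!n. test_fn (ph n)" "(%n. cls (ph n)) ----> u" "(%n. cls (lapf (ph n))) ----> k"
  "(%n. cgrad (ph n)) ----> g0" "(%n. ph n 0) ----> c0" "norm g0 \<le> norm (u - k)" "\<bar>c0\<bar> \<le> norm (u - k)"
  by (rule domain_approx) blast
 define th where "th n x = ph n x - ze * qn n x" for n x
 note tq = qn_approx(1)
 have t: "test_fn (th n)" for n unfolding th_def[abs_def] by (intro test_diff test_cmult ph tq)
 have l: "cls (lapf (th n)) = cls (lapf (ph n)) - ze *R cls (lapf (qn n))" for n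
  unfolding th_def[abs_def] by (simp add: lapf_diff_fun lapf_cmult_fun test_smooth test_cmult smooth_cmult ph tq cls_diff cls_scale sqi_scale test_lapf)
 have g: "cgrad (th n) = cgrad (ph n) - ze *R cgrad (qn n)" for n
  unfolding th_def[abs_def] by (simp add: cgrad_diff cgrad_cmult test_cmult ph tq)
 have gl: "(%n. cgrad (th n)) ----> g0 - ze *R gB" unfolding g by (intro tendsto_intros ph cgrad_qn)
 have D: "(%n. LI x. th n x * \<rho> x) ----> inner \<psi> (cls \<rho>) - ze * (LI x. Gr x * \<rho> x)" if \<rho>: "test_fn \<rho>" for \<rho>
 proof -
  have e: "(LI x. th n x * \<rho> x) = inner (cls (ph n)) (cls \<rho>) - ze * (LI x. qn n x * \<rho> x)" for n
   using sqi_mult_integrable[OF test_sqi[OF ph(1)] test_sqi[OF \<rho>], of n] sqi_mult_integrable[OF test_sqi[OF tq] test_sqi[OF \<rho>], of n]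
   by (simp add: th_def left_diff_distrib inner_cls ph \<rho> mult.assoc)
  have l: "(%n. inner (cls (ph n)) (cls \<rho>) - ze * (LI x. qn n x * \<rho> x)) ----> inner u (cls \<rho>) - ze * (LI x. qf x / (4 * pi) * \<rho> x)"
   by (intro tendsto_intros ph qn_approx(5) \<rho>)
  show ?thesis unfolding e by (rule tendsto_eq_rhs[OF l]) (simp add: u_def inner_diff_left inner_Gam \<rho> algebra_simps)
 qed
 have l1: "lim0 (fn u) c0" by (rule lim0_approx[OF ph(1,2,3,5)])
 have l2: "((%x. ze * (qf x / (4 * pi))) ---> ze * (qf 0 / (4 * pi))) (at 0)"
  using smooth_continuous[OF smooth_qf, of UNIV] by (intro tendsto_intros) (auto simp: continuous_on_eq_continuous_at isCont_def)
 have "lim0 (%x. fn u x - ze * (qf x / (4 * pi))) (c0 - ze * (qf 0 / (4 * pi)))"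
  by (rule lim0_diff[OF l1 lim0_tendsto[OF l2]])
 moreover have "AE x in lborel. fn u x - ze * (qf x / (4 * pi)) = fn \<psi> x - ze * Gr x"
  using fn_diff[of \<psi> "ze *R cls Gam"] fn_scale[of ze "cls Gam"] fn_cls[OF sqi_Gam]
  by eventually_elim (simp add: u_def Gam_def algebra_simps)
 ultimately have lim: "lim0 (%x. fn \<psi> x - ze * Gr x) (c0 - ze * (qf 0 / (4 * pi)))" by (rule lim0_cong)
 have c: "(%n. th n 0) ----> c0 - ze * (qf 0 / (4 * pi))"
  unfolding th_def qn_approx(2) using tendsto_diff[OF ph(5) tendsto_const[of "ze * (1 / (4 * pi))"]] by (simp add: qf_def)
 have "norm (u - k) \<le> norm \<psi> + norm h + \<bar>ze\<bar> * (norm (cls Gam) + norm hB)"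
 proof -
  have "u - k = \<psi> - h - ze *R (cls Gam + hB)" by (simp add: u_def k_def scaleR_add_right)
  then have "norm (u - k) \<le> norm (\<psi> - h) + \<bar>ze\<bar> * norm (cls Gam + hB)" using norm_triangle_ineq4 by (metis norm_scaleR)
  also have "... \<le> (norm \<psi> + norm h) + \<bar>ze\<bar> * (norm (cls Gam) + norm hB)"
   by (intro add_mono mult_left_mono norm_triangle_ineq norm_triangle_ineq4) simp
  finally show ?thesis .
 qed
 then have "norm (g0 - ze *R gB) \<le> norm \<psi> + norm h + \<bar>ze\<bar> * (norm (cls Gam) + norm hB) + \<bar>ze\<bar> * norm gB"
  using norm_triangle_ineq4[of g0 "ze *R gB"] ph(6) by simp
 also have "... \<le> Kreg * (norm \<psi> + \<bar>ze\<bar> + norm h)"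
 proof -
  have "1 * norm \<psi> \<le> Kreg * norm \<psi>" "1 * norm h \<le> Kreg * norm h"
   "\<bar>ze\<bar> * (norm (cls Gam) + norm hB + norm gB) \<le> \<bar>ze\<bar> * Kreg"
   by (intro mult_right_mono mult_left_mono; simp add: Kreg_def)+
  then show ?thesis by (simp add: algebra_simps)
 qed
 finally show ?thesis using that[of "g0 - ze *R gB" th, OF _ _ c lim] gl D t ph(3) lapf_qn tendsto_diff[OF ph(3) tendsto_scaleR[OF tendsto_const[of ze] lapf_qn]]
  by (simp add: dapprox_def l k_def)
qed

text \<open>Density in the graph of the weak gradient, a closed subspace. If (w, k) in the graph is
  orthogonal to all pairs (ph, grad ph), then moving the gradient gives \<Delta>w = w, so w = 0 and
  with it k = 0.\<close>

lemma wgr_density: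
 assumes w: "wgr u 0 g"
 obtains ph where "!!n::nat. test_fn (ph n)" "(%n. cls (ph n)) ----> u" "(%n. cgrad (ph n)) ----> g"
proof -
 let ?f = "%ph. (cls ph, cgrad ph)"
 let ?V = "{(u, g). wgr u 0 g}"
 have S: "subspace (?f ` Collect test_fn)"
 proof (rule subspaceI)
  show "0 \<in> ?f ` Collect test_fn" by (rule image_eqI[of _ _ "%x. 0"]) (auto simp: cgrad_def vec_eq_iff cls_zero zero_prod_def zero_vec_def)
  fix p q :: "(R3 l2) \<times> ((R3 l2)^3)" and c assume "p \<in> ?f ` Collect test_fn"
  then obtain ph where ph: "test_fn ph" "p = ?f ph" by blast
  show "c *R p \<in> ?f ` Collect test_fn"
   by (rule image_eqI[of _ _ "%x. c * ph x"]) (auto simp: ph cls_scale cgrad_cmult intro: test_cmult)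
  assume "q \<in> ?f ` Collect test_fn"
  then obtain th where th: "test_fn th" "q = ?f th" by blast
  show "p + q \<in> ?f ` Collect test_fn"
   by (rule image_eqI[of _ _ "%x. ph x + th x"]) (auto simp: ph th cls_add cgrad_add intro: test_add)
 qed
 have V: "subspace ?V"
 proof -
  have z: "wgr 0 0 0" by (simp add: wgr_def)
  show ?thesis
   by (rule subspaceI) (use wgr_lin[of _ 0 _ _ 0 _ 1 1] wgr_lin[of _ 0 _ _ 0 _ _ 0] in "auto simp: z zero_prod_def")
 qed
 have Vc: "closed ?V"
  unfolding closed_sequential_limits
 proof (intro allI impI, elim conjE)
  fix x l assume x: "\<forall>n. x n \<in> ?V" "x ----> l"
  have "wgr (fst l) 0 (snd l)"
   by (rule wgr_closed[where u="%n. fst (x n)" and g="%n. snd (x n)" and et="%n. 0" and F=sequentially])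
    (use x in "auto intro!: tendsto_intros simp: split_beta")
  then show "l \<in> ?V" by (simp add: split_beta)
 qed
 have cl: "(u, g) \<in> closure (?f ` Collect test_fn)"
 proof (rule dense_subspace_if_orthogonal_trivial[OF S V Vc])
  show "?f ` Collect test_fn \<subseteq> ?V" by (auto intro: wgr_test)
  fix v assume v: "v \<in> ?V" and o: "!!s. s \<in> ?f ` Collect test_fn ==> inner v s = 0"
  obtain w k where vw: "v = (w, k)" "wgr w 0 k" using v by auto
  have "inner w (cls (lapf ph)) = inner w (cls ph)" if ph: "test_fn ph" for ph
   using o[of "?f ph"] wgr_lapf[OF vw(2) ph] ph by (simp add: vw)
  then have w0: "w = 0" by (rule helmholtz_zero)
  have "wgr 0 0 0" by (simp add: wgr_def)
  then have "k = 0" using wgr_unique vw(2) w0 by blast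
  then show "v = 0" using w0 vw(1) by (simp add: zero_prod_def)
 qed (use w in simp)
 obtain ph where ph: "!!n::nat. ph n \<in> Collect test_fn" "(%n. ?f (ph n)) ----> (u, g)"
  by (rule seq_in_closure_image[OF cl]) blast
 show ?thesis
  by (rule that[of ph]) (use ph tendsto_fst[OF ph(2)] tendsto_snd[OF ph(2)] in auto)
qed

lemma structure_wgr:
 assumes w: "wgr \<psi> et g" obtains th where "dapprox \<psi> et g th"
proof -
 define u where "u = \<psi> - et *R cls Gam"
 have "wgr u 0 (g + et *R gB)" using wgr_lin[OF w wgr_Gam, of 1 "- et"] by (simp add: u_def)
 then obtain ph where ph: "!!n::nat. test_fn (ph n)" "(%n. cls (ph n)) ----> u" "(%n. cgrad (ph n)) ----> g + et *R gB"
  by (rule wgr_density) blast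
 define th where "th n x = ph n x - et * qn n x" for n x
 note tq = qn_approx(1)
 have t: "test_fn (th n)" for n unfolding th_def[abs_def] by (intro test_diff test_cmult ph tq)
 have ge: "cgrad (th n) = cgrad (ph n) - et *R cgrad (qn n)" for n
  unfolding th_def[abs_def] by (simp add: cgrad_diff cgrad_cmult test_cmult ph tq)
 have "(%n. cgrad (th n)) ----> (g + et *R gB) - et *R gB" unfolding ge by (intro tendsto_intros ph cgrad_qn)
 moreover have "(%n. LI x. th n x * \<rho> x) ----> inner \<psi> (cls \<rho>) - et * (LI x. Gr x * \<rho> x)" if \<rho>: "test_fn \<rho>" for \<rho>
 proof -
  have e: "(LI x. th n x * \<rho> x) = inner (cls (ph n)) (cls \<rho>) - et * (LI x. qn n x * \<rho> x)" for n
   using sqi_mult_integrable[OF test_sqi[OF ph(1)] test_sqi[OF \<rho>], of n] sqi_mult_integrable[OF test_sqi[OF tq] test_sqi[OF \<rho>], of n]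
   by (simp add: th_def left_diff_distrib inner_cls ph \<rho> mult.assoc)
  have l: "(%n. inner (cls (ph n)) (cls \<rho>) - et * (LI x. qn n x * \<rho> x)) ----> inner u (cls \<rho>) - et * (LI x. qf x / (4 * pi) * \<rho> x)"
   by (intro tendsto_intros ph qn_approx(5) \<rho>)
  show ?thesis unfolding e by (rule tendsto_eq_rhs[OF l]) (simp add: u_def inner_diff_left inner_Gam \<rho> algebra_simps)
 qed
 ultimately show ?thesis using that[of th] t by (simp add: dapprox_def)
qed

lemma dapprox_wgr: assumes d: "dapprox \<psi> ze g th" shows "wgr \<psi> ze g"
 unfolding wgr_def
proof (intro allI impI)
 fix ph :: "R3 => real" and i :: 3 assume ph: "test_fn ph"
 have t: "test_fn (th n)" for n using d by (simp add: dapprox_def)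
 have "(LI x. th n x * pd i ph x) = - inner (cgrad (th n) $ i) (cls ph)" for n
  using inner_dder_test[OF t ph] by (simp add: cgrad_def inner_cls t test_dder ph)
 moreover have "(%n. - inner (cgrad (th n) $ i) (cls ph)) ----> - inner (g $ i) (cls ph)"
  using d by (intro tendsto_intros) (simp add: dapprox_def)
 moreover have "(%n. LI x. th n x * pd i ph x) ----> inner \<psi> (cls (pd i ph)) - ze * (LI x. Gr x * pd i ph x)"
  using d test_dder[OF ph] by (simp add: dapprox_def)
 ultimately show "inner \<psi> (cls (pd i ph)) = ze * (LI x. Gr x * pd i ph x) - inner (g $ i) (cls ph)"
  using LIMSEQ_unique by fastforce
qed

lemma norm_scale_test:
 fixes f :: "R3 => real"
 assumes f: "test_fn f" and c: "c > 0"
 shows "c^3 * (norm (cls (%x. f (c *R x))))^2 = (norm (cls f))^2"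
proof -
 have e: "ennreal ((norm (cls g))^2) = (NI x. ennreal ((g x)^2))" if "test_fn g" for g :: "R3 => real"
  using test_sqi[OF that] by (simp add: norm_cls_sq nn_integral_eq_integral sqi_def)
 have "ennreal ((norm (cls f))^2) = ennreal (c^3) * ennreal ((norm (cls (%x. f (c *R x))))^2)"
  unfolding e[OF f] e[OF test_scale[OF f c]] by (rule nn_integral_scale_R3[OF _ c]) (use test_borel[OF f] in measurable)
 then show ?thesis using c by (simp add: ennreal_mult'[symmetric])
qed

text \<open>In three dimensions, concentrating a bump by the factor c divides its squared gradient
  norm by c: a point has capacity 0. Such functions read off the charge of a field while ignoring
  its regular part.\<close>

lemma concentrated_test:
 obtains ph where "!!n::nat. test_fn (ph n)" "!!n. ph n 0 = 1" "(%n. cgrad (ph n)) ----> 0"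
proof -
 define ph where "ph n x = bump (real (Suc n) *R x)" for n x
 note sb = test_smooth[OF test_bump]
 have t: "test_fn (ph n)" for n unfolding ph_def[abs_def] by (rule test_scale[OF test_bump]) simp
 have "(%n. cls (pd i (ph n))) ----> 0" for i
 proof -
  define N where "N = norm (cls (pd i bump))"
  have "(norm (cls (pd i (ph n))))^2 = N^2 * inverse (real (Suc n))" for n
  proof -
   let ?c = "real (Suc n)"
   have "cls (pd i (ph n)) = ?c *R cls (%x. pd i bump (?c *R x))"
    unfolding ph_def[abs_def] dder_scale[OF sb] by (rule cls_scale[OF test_sqi[OF test_scale[OF test_dder[OF test_bump]]]]) simp
   then have "?c * (norm (cls (pd i (ph n))))^2 = ?c^3 * (norm (cls (%x. pd i bump (?c *R x))))^2"
    by (simp add: power_mult_distrib power2_eq_square power3_eq_cube)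
   also have "... = N^2" unfolding N_def by (rule norm_scale_test[OF test_dder[OF test_bump]]) simp
   finally show ?thesis by (simp add: field_simps)
  qed
  moreover have "(%n. N^2 * inverse (real (Suc n))) ----> N^2 * 0" by (intro tendsto_intros LIMSEQ_inverse_real_of_nat)
  ultimately have "(%n. (norm (cls (pd i (ph n))))^2) ----> 0" by simp
  from tendsto_real_sqrt[OF this] have "(%n. norm (cls (pd i (ph n)))) ----> 0" by simp
  then show ?thesis by (rule tendsto_norm_zero_cancel)
 qed
 then have "(%n. cgrad (ph n)) ----> 0" by (intro vec_tendstoI) (simp add: cgrad_def)
 then show ?thesis using that[of ph] t by (simp add: ph_def bump_0)
qed

text \<open>The difference of the two descriptions is the zero field, so \<open>wgr_lapf\<close>
  equates \<open>ze - ze'\<close> with an inner product against \<open>cgrad (ph n)\<close>, which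
  tends to 0 along concentrated test functions.\<close>

lemma wgr_coef_unique:
 assumes "wgr \<psi> ze g" "wgr \<psi> ze' g'" shows "ze = ze'"
proof -
 obtain ph where ph: "!!n::nat. test_fn (ph n)" "!!n. ph n 0 = 1" "(%n. cgrad (ph n)) ----> 0"
  by (rule concentrated_test) blast
 have "ze - ze' = - inner (g - g') (cgrad (ph n))" for n
  using wgr_lapf[OF wgr_diff[OF assms] ph(1), of n] ph(2) by simp
 moreover have "(%n. - inner (g - g') (cgrad (ph n))) ----> - inner (g - g') 0" by (intro tendsto_intros ph)
 ultimately have "(%n::nat. ze - ze') ----> 0" by simp
 then show ?thesis by (simp add: LIMSEQ_const_iff)
qed

subsection \<open>Functions and their classes\<close>

lemma L2_sqi: "L2 f \<longleftrightarrow> sqi f" by (simp add: L2_def sqi_def)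

lemma L2norm_norm: "sqi f ==> L2norm f = norm (cls f)" by (simp add: L2norm_def norm_cls)

lemma loc_int_Gr: "sqi f ==> loc_int (%x. f x - ze * Gr x)"
 unfolding loc_int_def
proof (intro allI impI)
 fix K :: "R3 set" assume f: "sqi f" and K: "compact K"
 obtain R where "\<forall>x\<in>K. norm x \<le> R" using compact_imp_bounded[OF K] unfolding bounded_iff by blast
 then have R: "K \<subseteq> cball 0 R" by auto
 have Ks: "K \<in> sets borel" using K by (rule borel_compact)
 have "integrable lborel (%x. f x * (1 * indicator (cball 0 R) x) - ze * (Gr x * indicator (cball 0 R) x))"
  by (intro Bochner_Integration.integrable_diff integrable_mult_right sqi_mult_integrable f sqi_indicator_cball Gr_loc_integrable)
 then have "set_integrable lborel (cball 0 R) (%x. f x - ze * Gr x)"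
  unfolding set_integrable_def by (simp add: algebra_simps)
 then show "set_integrable lborel K (%x. f x - ze * Gr x)"
  by (rule set_integrable_subset) (use Ks R in auto)
qed

text \<open>The regular part is only locally integrable; its pairing with a test function is
  therefore split into those of \<open>f\<close> and of \<open>Gr\<close>, each of which
  converges.\<close>

lemma pair_reg:
 assumes r: "loc_int r" and f: "sqi f" and ae: "AE x in lborel. f x = r x + ze * Gr x" and ph: "test_fn ph"
 shows "(LI x. r x * ph x) = inner (cls f) (cls ph) - ze * (LI x. Gr x * ph x)"
proof -
 obtain R where R: "!!x. R < norm x ==> ph x = 0" using test_support[OF ph] by metis
 have "set_integrable lborel (cball 0 R) r" using r by (simp add: loc_int_def)
 then have [measurable]: "(%x. indicator (cball 0 R) x * r x) \<in> borel_measurable borel" by (auto simp: set_integrable_def)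
 note [measurable] = test_borel[OF ph] sqi_borel[OF f]
 have e: "r x * ph x = (indicator (cball 0 R) x * r x) * ph x" for x using R[of x] by (auto simp: indicator_def)
 have "(LI x. r x * ph x) = (LI x. f x * ph x - ze * (Gr x * ph x))"
  unfolding e
 proof (rule integral_cong_AE)
  show "AE x in lborel. indicator (cball 0 R) x * r x * ph x = f x * ph x - ze * (Gr x * ph x)"
   using ae
  proof eventually_elim
   case (elim x)
   have "indicator (cball 0 R) x * r x * ph x = r x * ph x" by (rule e[symmetric])
   then show ?case using elim by (simp add: algebra_simps)
  qed
 qed measurable
 then show ?thesis
  using sqi_mult_integrable[OF f test_sqi[OF ph]] Gr_test_integrable[OF ph] by (simp add: inner_cls f ph)
qed

lemma wgr_of_wgrad:
 assumes r: "loc_int r" and f: "sqi f" and ae: "AE x in lborel. f x = r x + ze * Gr x" and g: "is_wgrad r g"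
 shows "wgr (cls f) ze (\<chi> i. cls (%x. g x $ i))"
 unfolding wgr_def
proof (intro allI impI)
 fix ph :: "R3 => real" and i :: 3 assume ph: "test_fn ph"
 have "sqi (%x. g x $ i)" using g by (simp add: is_wgrad_def L2_sqi)
 then show "inner (cls f) (cls (pd i ph)) = ze * (LI x. Gr x * pd i ph x) - inner ((\<chi> i. cls (%x. g x $ i)) $ i) (cls ph)"
  using pair_reg[OF r f ae test_dder[OF ph, of "axis i 1"]] g ph by (simp add: is_wgrad_def inner_cls)
qed

lemma wlp_of_wlap:
 assumes r: "loc_int r" and f: "sqi f" and ae: "AE x in lborel. f x = r x + ze * Gr x" and h: "is_wlap r h"
 shows "wlp (cls f) ze (cls h)"
 unfolding wlp_def
proof (intro allI impI)
 fix ph :: "R3 => real" assume ph: "test_fn ph"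
 show "inner (cls f) (cls (lapf ph)) = inner (cls h) (cls ph) - ze * ph 0"
  using pair_reg[OF r f ae test_lapf[OF ph]] h ph by (simp add: is_wlap_def inner_cls L2_sqi Gr_lapf)
qed

lemma LINT_norm_vec:
 fixes a :: "R3 => R3"
 assumes "!!i. sqi (%x. a x $ i)"
 shows "(LI x. (norm (a x))^2) = (norm (\<chi> i. cls (%x. a x $ i)))^2"
proof -
 have "(norm (a x))^2 = (\<Sum>i\<in>UNIV. (a x $ i)^2)" for x
  by (simp add: power2_norm_eq_inner inner_vec_def) (simp add: power2_eq_square)
 moreover have "(LI x. (\<Sum>i\<in>UNIV. (a x $ i)^2)) = (\<Sum>i\<in>UNIV. LI x. (a x $ i)^2)"
  by (rule Bochner_Integration.integral_sum) (use assms in "simp add: sqi_def")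
 ultimately show ?thesis
  by (simp add: norm_cls_sq[OF assms, symmetric]) (simp add: power2_norm_eq_inner inner_vec_def)
qed

lemma reg_is_wgrad:
 assumes f: "sqi f" and w: "wgr (cls f) ze g"
 shows "is_wgrad (%x. f x - ze * Gr x) (%x. \<chi> i. fn (g $ i) x)"
 unfolding is_wgrad_def
proof (intro conjI allI impI)
 show "L2 (%x. (\<chi> i. fn (g $ i) x) $ i)" for i by (simp add: L2_sqi)
 fix ph :: "R3 => real" and i :: 3 assume ph: "test_fn ph"
 show "(LI x. (f x - ze * Gr x) * pd i ph x) = - (LI x. (\<chi> i. fn (g $ i) x) $ i * ph x)"
  using pair_reg[OF loc_int_Gr[OF f, of ze] f _ test_dder[OF ph], where ze=ze] w ph by (simp add: wgr_def inner_fn)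
qed

lemma Hdot1_reg:
 assumes f: "sqi f" and w: "wgr (cls f) ze g"
 shows "Hdot1 (%x. f x - ze * Gr x)"
proof -
 obtain th where d: "dapprox (cls f) ze g th" by (rule structure_wgr[OF w])
 have t: "test_fn (th n)" for n using d by (simp add: dapprox_def)
 have s: "sqi (%x. (gradf (th n) x - (\<chi> i. fn (g $ i) x)) $ i)" for n i
  by (simp add: gradf_def sqi_diff test_dder t)
 have "(%n. (norm (cgrad (th n) - g))^2) ----> (norm (g - g))^2"
  using d by (intro tendsto_intros) (simp add: dapprox_def)
 moreover have "(\<chi> i. cls (%x. (gradf (th n) x - (\<chi> i. fn (g $ i) x)) $ i)) = cgrad (th n) - g" for n
  by (simp add: vec_eq_iff cgrad_def gradf_def cls_diff test_dder t)
 ultimately have "(%n. LI x. (norm (gradf (th n) x - (\<chi> i. fn (g $ i) x)))^2) ----> 0"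
  by (simp only: LINT_norm_vec[OF s]) simp
 moreover have "(LI x. (f x - ze * Gr x) * \<rho> x) = inner (cls f) (cls \<rho>) - ze * (LI x. Gr x * \<rho> x)" if "test_fn \<rho>" for \<rho>
  by (rule pair_reg[OF loc_int_Gr[OF f] f _ that]) auto
 ultimately show ?thesis
  unfolding Hdot1_def using loc_int_Gr[OF f] reg_is_wgrad[OF f w] t d by (auto simp: dapprox_def)
qed

lemma is_wlap_reg:
 assumes f: "sqi f" and w: "wlp (cls f) ze h"
 shows "is_wlap (%x. f x - ze * Gr x) (fn h)"
 unfolding is_wlap_def
proof (intro conjI allI impI)
 show "L2 (fn h)" by (simp add: L2_sqi)
 fix ph :: "R3 => real" assume ph: "test_fn ph"
 show "(LI x. (f x - ze * Gr x) * lapf ph x) = (LI x. fn h x * ph x)"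
  using pair_reg[OF loc_int_Gr[OF f, of ze] f _ test_lapf[OF ph], where ze=ze] w ph by (simp add: wlp_def inner_fn Gr_lapf)
qed

lemma Hdot1D:
 assumes "Hdot1 r" "sqi f" "AE x in lborel. f x = r x + ze * Gr x"
 obtains g where "wgr (cls f) ze g"
 using assms wgr_of_wgrad unfolding Hdot1_def by blast

text \<open>The description operator in \<open>coef\<close> is legitimate because a field determines
  its charge, by \<open>wgr_coef_unique\<close>.\<close>

lemma coef_eq:
 assumes f: "sqi f" and w: "wgr (cls f) ze g" shows "coef f = ze"
 unfolding coef_def
proof (rule the_equality)
 show "\<exists>r. Hdot1 r \<and> (AE x in lborel. f x = r x + ze * Gr x)"
  by (rule exI[of _ "%x. f x - ze * Gr x"]) (simp add: Hdot1_reg[OF f w])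
 fix ze' assume "\<exists>r. Hdot1 r \<and> (AE x in lborel. f x = r x + ze' * Gr x)"
 then obtain g' where "wgr (cls f) ze' g'" using Hdot1D[OF _ f] by metis
 then show "ze' = ze" using wgr_coef_unique w by blast
qed

text \<open>Weak gradients are unique up to null sets, so whichever one the choice operator in
  \<open>grad_norm\<close> returns has the norm of \<open>g\<close>.\<close>

lemma grad_norm_reg:
 assumes f: "sqi f" and w: "wgr (cls f) ze g" shows "grad_norm (%x. f x - ze * Gr x) = norm g"
proof -
 define G where "G = (SOME g. is_wgrad (%x. f x - ze * Gr x) g)"
 have G: "is_wgrad (%x. f x - ze * Gr x) G" unfolding G_def by (rule someI[of "is_wgrad (%x. f x - ze * Gr x)", OF reg_is_wgrad[OF f w]])
 have s: "sqi (%x. G x $ i)" for i using G by (simp add: is_wgrad_def L2_sqi)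
 have "wgr (cls f) ze (\<chi> i. cls (%x. G x $ i))" by (rule wgr_of_wgrad[OF loc_int_Gr[OF f] f _ G]) simp
 then have "(\<chi> i. cls (%x. G x $ i)) = g" using wgr_unique w by blast
 then show ?thesis
  unfolding grad_norm_def G_def[symmetric] L2norm_def using LINT_norm_vec[OF s] by simp
qed

lemma lap_norm_reg:
 assumes f: "sqi f" and w: "wlp (cls f) ze h" shows "lap_norm (%x. f x - ze * Gr x) = norm h"
proof -
 define k where "k = (SOME k. is_wlap (%x. f x - ze * Gr x) k)"
 have k: "is_wlap (%x. f x - ze * Gr x) k" unfolding k_def by (rule someI[of "is_wlap (%x. f x - ze * Gr x)", OF is_wlap_reg[OF f w]])
 have "wlp (cls f) ze (cls k)" by (rule wlp_of_wlap[OF loc_int_Gr[OF f] f _ k]) simp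
 then have "cls k = h" using wlp_unique w by blast
 then show ?thesis
  unfolding lap_norm_def k_def[symmetric] using L2norm_norm[of k] k by (simp add: is_wlap_def L2_sqi)
qed

subsection \<open>The free wave equation\<close>

lemma Sph_diff: "test_fn ph ==> test_fn th ==> Sph (%x. ph x - th x) t x = Sph ph t x - Sph th t x"
 by (simp add: Sph_def Av_diff ksph_integrable algebra_simps)

lemma Cph_diff:
 assumes "test_fn ph" "test_fn th" shows "Cph (%x. ph x - th x) t x = Cph ph t x - Cph th t x"
proof (rule DERIV_unique)
 show "((%t. Sph (%x. ph x - th x) t x) has_real_derivative Cph (%x. ph x - th x) t x) (at t)"
  by (rule Sph_DERIV) (intro test_diff assms)
 show "((%t. Sph (%x. ph x - th x) t x) has_real_derivative Cph ph t x - Cph th t x) (at t)"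
  unfolding Sph_diff[OF assms] by (intro DERIV_diff Sph_DERIV assms)
qed

text \<open>The free wave with Cauchy data (ph, th). Its time derivative is the wave with data (th,
  lapf ph), so velocity and acceleration are again of this form.\<close>

definition Wv :: "(R3 => real) => (R3 => real) => real => R3 => real" where
 "Wv ph th t x = Cph ph t x + Sph th t x"

lemma Wv_test: "test_fn ph ==> test_fn th ==> test_fn (Wv ph th t)"
 unfolding Wv_def[abs_def] by (intro test_add Cph_test Sph_test)

lemma Wv_0: "Wv ph th 0 = ph" by (simp add: Wv_def fun_eq_iff)

lemma Wv_DERIV: "test_fn ph ==> test_fn th ==> ((%t. Wv ph th t x) has_real_derivative Wv th (lapf ph) t x) (at t)"
 unfolding Wv_def by (rule DERIV_cong[OF DERIV_add[OF Cph_DERIV Sph_DERIV]]) auto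

lemma Wv_diff: "test_fn ph ==> test_fn th ==> test_fn ph' ==> test_fn th' ==>
  Wv (%x. ph x - ph' x) (%x. th x - th' x) t = (%x. Wv ph th t x - Wv ph' th' t x)"
 by (simp add: Wv_def fun_eq_iff Cph_diff Sph_diff)

lemma lapf_Wv: "test_fn ph ==> test_fn th ==> lapf (Wv ph th t) = Wv (lapf ph) (lapf th) t"
 unfolding Wv_def[abs_def] by (simp add: lapf_add_fun test_smooth Cph_test Sph_test lapf_Cph lapf_Sph)

lemma Wv_curve:
 assumes "test_fn ph" "test_fn th"
 shows "((%t. cls (Wv ph th t)) has_vector_derivative cls (Wv th (lapf ph) t)) (at t)"
proof -
 have "((%t. cls (Cph ph t) + cls (Sph th t)) has_vector_derivative cls (Sph (lapf ph) t) + cls (Cph th t)) (at t)"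
  by (intro has_vector_derivative_add Sph_curve assms)
 then show ?thesis
  using assms by (simp add: Wv_def[abs_def] cls_add Cph_test Sph_test test_lapf add.commute)
qed

lemma Wv_energy:
 assumes ph: "test_fn ph" and th: "test_fn th"
 shows "(norm (cls (Wv th (lapf ph) t)))^2 + (norm (cgrad (Wv ph th t)))^2 = (norm (cls th))^2 + (norm (cgrad ph))^2"
proof -
 note lph = test_lapf[OF ph] and lth = test_lapf[OF th]
 define a where "a t = cls (Wv ph th t)" for t
 define b where "b t = cls (Wv th (lapf ph) t)" for t
 define c where "c t = cls (Wv (lapf ph) (lapf th) t)" for t
 define d where "d t = cls (Wv (lapf th) (lapf (lapf ph)) t)" for t
 define E where "E t = inner (b t) (b t) - inner (a t) (c t)" for t
 have ab: "(a has_vector_derivative b t) (at t)" "(b has_vector_derivative c t) (at t)" "(c has_vector_derivative d t) (at t)" for t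
  unfolding a_def[abs_def] b_def[abs_def] c_def[abs_def] d_def by (rule Wv_curve; fact)+
 have s: "inner (b t) (c t) = inner (a t) (d t)" for t
  using inner_lapf_commute[OF Wv_test[OF ph th] Wv_test[OF th lph], of t t]
  by (simp add: a_def b_def c_def d_def lapf_Wv ph th lph inner_commute)
 have "(E has_real_derivative 0) (at t)" for t
 proof -
  have "(E has_vector_derivative (inner (b t) (c t) + inner (c t) (b t)) - (inner (a t) (d t) + inner (b t) (c t))) (at t)"
   unfolding E_def[abs_def]
   by (intro has_vector_derivative_diff bounded_bilinear.has_vector_derivative[OF bounded_bilinear_inner] ab)
  then show ?thesis by (simp add: s inner_commute has_real_derivative_iff_has_vector_derivative)
 qed
 then have "E t = E 0" using DERIV_isconst_all by blast
 moreover have "E t = (norm (cls (Wv th (lapf ph) t)))^2 + (norm (cgrad (Wv ph th t)))^2" for t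
  using inner_cgrad[OF Wv_test[OF ph th] Wv_test[OF ph th], of t t]
  by (simp add: E_def a_def b_def c_def power2_norm_eq_inner lapf_Wv ph th)
 ultimately show ?thesis by (simp add: Wv_0)
qed

lemma sum_sq_boundD:
 fixes a b c d :: real
 assumes "a^2 + b^2 = c^2 + d^2" "0 \<le> c" "0 \<le> d" shows "a \<le> c + d" "b \<le> c + d"
proof -
 have "a^2 \<le> (c + d)^2" "b^2 \<le> (c + d)^2" using assms by (simp_all add: power2_sum)
 (smt (verit) mult_nonneg_nonneg zero_le_power2)+
 then show "a \<le> c + d" "b \<le> c + d" using assms by (auto intro: power2_le_imp_le)
qed

text \<open>Energy conservation for the wave and for its time derivative bounds velocity,
  acceleration and the gradient of the velocity uniformly in time. Integrating the velocity gives
  linear growth of the norm, and \<open>test_sup_bound\<close> the pointwise bound.\<close>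

lemma Wv_bounds:
 assumes ph: "test_fn ph" and th: "test_fn th"
 defines "M \<equiv> norm (cls ph) + norm (cls (lapf ph)) + norm (cgrad ph) + norm (cls th) + norm (cgrad th)"
 shows "norm (cls (Wv th (lapf ph) t)) \<le> M" "norm (cls (Wv (lapf ph) (lapf th) t)) \<le> M"
  "norm (cgrad (Wv th (lapf ph) t)) \<le> M" "norm (cls (Wv ph th t)) \<le> (1 + \<bar>t\<bar>) * M"
  "\<bar>Wv ph th t x\<bar> \<le> (2 + \<bar>t\<bar>) * M"
proof -
 note b1 = sum_sq_boundD[OF Wv_energy[OF ph th] norm_ge_zero norm_ge_zero]
  and b2 = sum_sq_boundD[OF Wv_energy[OF th test_lapf[OF ph]] norm_ge_zero norm_ge_zero]
 note n = norm_ge_zero[of "cls ph"] norm_ge_zero[of "cls (lapf ph)"] norm_ge_zero[of "cls th"]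
  norm_ge_zero[of "cgrad th"] norm_ge_zero[of "cgrad ph"]
 show v: "norm (cls (Wv th (lapf ph) t)) \<le> M" for t using b1(1)[of t] n unfolding M_def by linarith
 show h: "norm (cls (Wv (lapf ph) (lapf th) t)) \<le> M" using b2(1)[of t] n unfolding M_def by linarith
 show "norm (cgrad (Wv th (lapf ph) t)) \<le> M" using b2(2)[of t] n unfolding M_def by linarith
 have "norm (cls (Wv ph th t) - cls (Wv ph th 0)) \<le> M * norm (t - 0)"
  by (rule differentiable_bound[of UNIV _ "%s h. h *R cls (Wv th (lapf ph) s)"])
   (use Wv_curve[OF ph th] v in "auto simp: has_vector_derivative_def intro!: onorm_le mult_left_mono simp: mult.commute[of M]")
 moreover have "norm (cls (Wv ph th t)) \<le> norm (cls (Wv ph th t) - cls ph) + norm (cls ph)"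
  using norm_triangle_sub by (simp add: add.commute)
 moreover have "norm (cls ph) \<le> M" using n unfolding M_def by linarith
 ultimately show u: "norm (cls (Wv ph th t)) \<le> (1 + \<bar>t\<bar>) * M"
  by (simp add: Wv_0 algebra_simps)
 show "\<bar>Wv ph th t x\<bar> \<le> (2 + \<bar>t\<bar>) * M"
  using test_sup_bound[OF Wv_test[OF ph th], of t x] norm_triangle_ineq4[of "cls (Wv ph th t)" "cls (lapf (Wv ph th t))"] u h
  by (simp add: lapf_Wv ph th algebra_simps)
qed

section \<open>Free waves with general data\<close>

text \<open>The hypothesis has the shape of \<open>Wv_bounds\<close>: linear growth in time times a
  distance of data. With all norms of the data collected in \<open>D\<close>, every component of the
  wave converges along the same sequence.\<close>

lemma locally_uniform_limit:
 fixes x :: "nat => real => 'b::banach" and D :: "nat => 'c::metric_space"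
 assumes D: "Cauchy D" and b: "!!n m t. norm (x n t - x m t) \<le> (2 + \<bar>t\<bar>) * (K * dist (D n) (D m))"
 obtains X where "!!t. (%n. x n t) ----> X t" "!!T e. e > 0 ==> \<forall>\<^sub>F n in sequentially. \<forall>t\<in>ball 0 T. norm (x n t - X t) < e"
proof -
 define K' where "K' = \<bar>K\<bar> + 1"
 have b': "norm (x n t - x m t) \<le> (2 + \<bar>t\<bar>) * (K' * dist (D n) (D m))" for n m t
  by (rule order_trans[OF b]) (auto intro!: mult_left_mono mult_right_mono simp: K'_def)
 have "uniformly_Cauchy_on (ball 0 T) x" for T
  unfolding uniformly_Cauchy_on_def
 proof (intro allI impI)
  fix e :: real assume e: "e > 0"
  define k where "k = (2 + \<bar>T\<bar>) * K'"
  have k: "k > 0" by (simp add: k_def K'_def add_pos_nonneg)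
  obtain M where M: "!!m n. m \<ge> M ==> n \<ge> M ==> dist (D m) (D n) < e / k"
   using metric_CauchyD[OF D, of "e / k"] e k by auto
  have "dist (x m t) (x n t) < e" if "t \<in> ball 0 T" "m \<ge> M" "n \<ge> M" for t m n
  proof -
   have "dist (x m t) (x n t) \<le> (2 + \<bar>t\<bar>) * (K' * dist (D m) (D n))" using b' by (simp add: dist_norm)
   also have "... \<le> k * dist (D m) (D n)" unfolding k_def mult.assoc
    by (rule mult_right_mono) (use that(1) in "auto simp: K'_def")
   also have "... < e" using M[OF that(2,3)] k by (simp add: field_simps)
   finally show ?thesis .
  qed
  then show "\<exists>M. \<forall>x'\<in>ball 0 T. \<forall>m\<ge>M. \<forall>n\<ge>M. dist (x m x') (x n x') < e" by blast
 qed
 then have "uniformly_convergent_on (ball 0 T) x" for T by (rule Cauchy_uniformly_convergent)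
 then have ul: "uniform_limit (ball 0 T) x (%t. lim (%n. x n t)) sequentially" for T
  by (simp add: uniformly_convergent_uniform_limit_iff)
 show thesis
 proof (rule that)
  show "(%n. x n t) ----> lim (%n. x n t)" for t
   by (rule tendsto_uniform_limitI[OF ul[of "\<bar>t\<bar> + 1"]]) simp
  show "\<forall>\<^sub>F n in sequentially. \<forall>t\<in>ball 0 T. norm (x n t - lim (%n. x n t)) < e" if "e > 0" for T e
   using uniform_limitD[OF ul that] by (simp add: dist_norm)
 qed
qed

lemma continuous_locally_uniform_limit:
 fixes x :: "nat => real => 'b::real_normed_vector"
 assumes c: "!!n. continuous_on UNIV (x n)" and l: "!!T e. e > 0 ==> \<forall>\<^sub>F n in sequentially. \<forall>t\<in>ball 0 T. norm (x n t - X t) < e"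
 shows "continuous_on UNIV X"
proof -
 have "continuous_on (ball 0 T) X" for T
  by (rule uniform_limit_theorem[where f=x and F=sequentially])
   (auto intro!: always_eventually continuous_on_subset[OF c] simp: uniform_limit_iff dist_norm l)
 then have "isCont X t" for t
  using continuous_on_interior[of "ball 0 (\<bar>t\<bar> + 1)" X t] by simp
 then show ?thesis by (simp add: continuous_on_eq_continuous_at)
qed

lemma derivative_locally_uniform_limit:
 fixes x y :: "nat => real => 'b::banach"
 assumes d: "!!n t. (x n has_vector_derivative y n t) (at t)" and X: "!!t. (%n. x n t) ----> X t"
  and l: "!!T e. e > 0 ==> \<forall>\<^sub>F n in sequentially. \<forall>t\<in>ball 0 T. norm (y n t - Y t) < e"
 shows "(X has_vector_derivative Y t) (at t)"
proof -
 define T where "T = \<bar>t\<bar> + 1"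
 have "\<exists>g. \<forall>s\<in>ball 0 T. (%n. x n s) ----> g s \<and> (g has_derivative (%h. h *R Y s)) (at s within ball 0 T)"
 proof (rule has_derivative_sequence)
  show "(x n has_derivative (%h. h *R y n s)) (at s within ball 0 T)" for n s
   using d by (simp add: has_vector_derivative_def has_derivative_at_withinI)
  show "\<forall>\<^sub>F n in sequentially. \<forall>s\<in>ball 0 T. \<forall>h. norm (h *R y n s - h *R Y s) \<le> e * norm h" if "e > 0" for e
   using l[OF that, of T]
  proof eventually_elim
   case (elim n)
   have "norm (h *R y n s - h *R Y s) \<le> e * norm h" if "s \<in> ball 0 T" for s h
   proof -
    have "norm (h *R y n s - h *R Y s) = norm (y n s - Y s) * norm h" by (simp flip: scaleR_diff_right)
    also have "... \<le> e * norm h" by (rule mult_right_mono) (use bspec[OF elim that] in auto)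
    finally show ?thesis .
   qed
   then show ?case by blast
  qed
  show "0 \<in> ball 0 T" by (simp add: T_def add_nonneg_pos)
  show "(%n. x n 0) ----> X 0" by (rule X)
 qed simp
 then obtain g where g: "!!s. s \<in> ball 0 T ==> (%n. x n s) ----> g s"
   "!!s. s \<in> ball 0 T ==> (g has_derivative (%h. h *R Y s)) (at s within ball 0 T)" by blast
 have t: "t \<in> ball 0 T" by (simp add: T_def)
 have "(X has_derivative (%h. h *R Y t)) (at t within ball 0 T)"
  by (rule has_derivative_transform[OF t _ g(2)[OF t]]) (use LIMSEQ_unique[OF X g(1)] in auto)
 then show ?thesis using t by (simp add: has_vector_derivative_def at_within_open[OF t])
qed

lemma sqi_indicator_continuous:
 fixes f :: "real => real"
 assumes "continuous_on UNIV f" shows "sqi (%s. indicator {a..b} s * f s)"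
proof -
 have "compact (f ` {a..b})" by (rule compact_continuous_image[OF continuous_on_subset[OF assms]]) auto
 then obtain C where C: "!!s. s \<in> {a..b} ==> \<bar>f s\<bar> \<le> C" using compact_imp_bounded bounded_iff by (metis imageI real_norm_def)
 show ?thesis
  by (rule sqi_bound[OF sqi_indicator_cball[of C "\<bar>a\<bar> + \<bar>b\<bar>"]])
   (use C borel_measurable_continuous_onI[OF assms] in "auto simp: indicator_def intro!: AE_I2 order_trans[OF C]")
qed

lemma cls_indicator_limit:
 fixes x :: "nat => real => real"
 assumes c: "!!n. continuous_on UNIV (x n)" "continuous_on UNIV X"
  and l: "!!T e. e > 0 ==> \<forall>\<^sub>F n in sequentially. \<forall>t\<in>ball 0 T. norm (x n t - X t) < e"
 shows "(%n. cls (%s. indicator {a..b} s * x n s)) ----> cls (%s. indicator {a..b} s * X s)"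
proof (rule LIM_zero_cancel, rule tendstoI)
 fix e :: real assume e: "e > 0"
 define T where "T = \<bar>a\<bar> + \<bar>b\<bar>"
 define k where "k = sqrt (measure lborel (cball (0::real) T)) + 1"
 have k: "k > 0" by (simp add: k_def add_nonneg_pos)
 note s = sqi_indicator_continuous[OF c(1)] sqi_indicator_continuous[OF c(2)]
 note [measurable] = borel_measurable_continuous_onI[OF c(1)] borel_measurable_continuous_onI[OF c(2)]
 have "\<forall>\<^sub>F n in sequentially. \<forall>t\<in>ball 0 (T + 1). norm (x n t - X t) < e / k" by (rule l) (use e k in simp)
 then show "\<forall>\<^sub>F n in sequentially. dist (cls (%s. indicator {a..b} s * x n s) - cls (%s. indicator {a..b} s * X s)) 0 < e"
 proof eventually_elim
  case (elim n)
  have eq: "cls (%s. indicator {a..b} s * x n s) - cls (%s. indicator {a..b} s * X s) = cls (%s. indicator {a..b} s * (x n s - X s))"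
   by (subst cls_diff[OF s, symmetric]) (simp add: algebra_simps)
  have bd: "\<bar>indicator {a..b} s * (x n s - X s)\<bar> \<le> e / k * indicator (cball 0 T) s" for s
  proof (cases "s \<in> {a..b}")
   case True
   then have "\<bar>s\<bar> \<le> T" by (auto simp: T_def)
   then have "s \<in> ball 0 (T + 1)" "s \<in> cball 0 T" by auto
   then show ?thesis using bspec[OF elim, of s] True by auto
  qed (use e k in "auto simp: indicator_def")
  have "norm (cls (%s. indicator {a..b} s * (x n s - X s))) \<le> e / k * sqrt (measure lborel (cball (0::real) T))"
   by (rule norm_cls_le_cball[OF _ bd]) (use e k in auto)
  also have "... < e / k * k" by (rule mult_strict_left_mono) (use e k in "auto simp: k_def")
  finally show ?case using k unfolding eq by simp
 qed
qed

lemma test_vanishes: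
 fixes ka :: "real => real"
 assumes ka: "test_fn ka"
 obtains R where "R > 0" "!!s. s \<le> - R \<or> R \<le> s ==> ka s = 0 \<and> deriv ka s = 0"
proof -
 obtain r where r: "r > 0" "!!s. r < norm s ==> ka s = 0" using test_support[OF ka] by metis
 obtain r' where r': "r' > 0" "!!s. r' < norm s ==> deriv ka s = 0" using test_support[OF test_deriv[OF ka]] by metis
 show thesis by (rule that[of "max r r' + 1"]) (use r r' in auto)
qed

text \<open>In the second claim the function is frozen at its value at 0 for negative times. It
  remains continuous, so its weak derivative lives on the positive side and has no point mass at
  0.\<close>

lemma C1_weak_derivative:
 assumes l: "!!s. (l has_real_derivative m s) (at s)" and cm: "continuous_on UNIV m" and ka: "test_fn ka"
 shows "(LI s. l s * deriv ka s) = - (LI s. m s * ka s)"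
  and "(LI s. l (max s 0) * deriv ka s) = - (LI s. (indicator {0<..} s * m s) * ka s)"
proof -
 obtain R where R: "R > 0" and z: "!!s. s \<le> - R \<or> R \<le> s ==> ka s = 0 \<and> deriv ka s = 0" using test_vanishes[OF ka] by metis
 note dk = DERIV_smooth[OF test_smooth[OF ka]]
 have cl: "continuous_on A l" for A by (intro DERIV_cont[OF l])
 have ck: "continuous_on A ka" "continuous_on A (deriv ka)" for A
  using smooth_continuous[OF test_smooth[OF ka]] smooth_continuous[OF smooth_deriv[OF test_smooth[OF ka]]] by auto
 have cm': "continuous_on A m" for A by (rule continuous_on_subset[OF cm]) simp
 let ?f = "%s. m s * ka s + deriv ka s * l s"
 have F: "((%s. l s * ka s) has_real_derivative ?f s) (at s)" for s by (rule DERIV_mult[OF l dk])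
 have cf: "continuous_on A ?f" for A by (intro continuous_intros cl ck cm')
 have [measurable]: "l \<in> borel_measurable borel" "m \<in> borel_measurable borel" "ka \<in> borel_measurable borel" "deriv ka \<in> borel_measurable borel"
  using cl ck cm' by (auto intro: borel_measurable_continuous_onI)
 have i: "integrable lborel (%s. m s * ka s)"
  by (rule integrable_continuous_support[of _ R], intro continuous_intros cm' ck) (subst conjunct1[OF z], auto)
 have j: "integrable lborel (%s. (indicator {0<..} s * m s) * ka s)"
  using integrable_real_mult_indicator[OF _ i, of "{0<..}"] by (simp add: ac_simps)
 have a1: "AE s in lborel. s \<notin> {-R..R} --> ?f s = 0" by (rule AE_I2) (use z in "auto simp: not_le")
 have 0: "(LI s. ?f s) = l R * ka R - l (-R) * ka (-R)" "integrable lborel ?f"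
  by (rule LBINT_continuous_support[of "-R" R "%s. l s * ka s" ?f ?f, OF F cf _ a1]; use R in simp)+
 have "(LI s. l s * deriv ka s) = (LI s. ?f s - m s * ka s)" by (simp add: mult.commute)
 also have "... = (LI s. ?f s) - (LI s. m s * ka s)" by (rule Bochner_Integration.integral_diff[OF 0(2) i])
 finally show "(LI s. l s * deriv ka s) = - (LI s. m s * ka s)" using 0(1) z R by simp
 have 1: "(LI s. indicator {..0} s * (l 0 * deriv ka s)) = l 0 * ka 0 - l 0 * ka (-R)"
  "integrable lborel (%s. indicator {..0} s * (l 0 * deriv ka s))"
  by (rule LBINT_continuous_support[where F="%s. l 0 * ka s" and f="%s. l 0 * deriv ka s" and a="-R" and b=0];
   use R z in "auto intro!: DERIV_cmult dk continuous_intros ck AE_I2 simp: indicator_def not_le")+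
 have a1: "AE s in lborel. s \<notin> {0..R} --> indicator {0<..} s * ?f s = 0"
  by (rule AE_I2) (use z in "auto simp: indicator_def not_le")
 have a2: "AE s in lborel. s \<in> {0..R} --> indicator {0<..} s * ?f s = ?f s"
  using AE_lborel_singleton[of 0] by eventually_elim (auto simp: indicator_def)
 have 2: "(LI s. indicator {0<..} s * ?f s) = l R * ka R - l 0 * ka 0" "integrable lborel (%s. indicator {0<..} s * ?f s)"
  by (rule LBINT_continuous_support[where F="%s. l s * ka s" and f="?f" and a=0 and b=R, OF _ _ _ a1 a2]; use R F cf in auto)+
 have e: "l (max s 0) * deriv ka s = indicator {..0} s * (l 0 * deriv ka s) + indicator {0<..} s * ?f s
   - (indicator {0<..} s * m s) * ka s" for s
  by (cases "s \<le> 0") (simp_all add: max_def)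
 have "(LI s. l (max s 0) * deriv ka s) = (l 0 * ka 0 - l 0 * ka (-R)) + (l R * ka R - l 0 * ka 0) - (LI s. (indicator {0<..} s * m s) * ka s)"
  unfolding e 1(1)[symmetric] 2(1)[symmetric] using 1(2) 2(2) j by simp
 then show "(LI s. l (max s 0) * deriv ka s) = - (LI s. (indicator {0<..} s * m s) * ka s)"
  using z R by simp
qed

text \<open>The gain is a derivative in L2 that is controlled by \<open>lapf ph\<close> and the
  gradient of \<open>th\<close>, hence stable under approximation of the data, where classical
  differentiability of the trace may be lost.\<close>

lemma free_trace_weak_derivative:
 assumes ph: "test_fn ph" and th: "test_fn th" and ka: "test_fn ka"
 shows "(LI s. Wv ph th (max s 0) 0 * deriv ka s) = - inner (wS (lapf ph) + wC th) (cls ka)"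
proof -
 let ?m = "%s. Wv th (lapf ph) s 0"
 have cm: "continuous_on UNIV ?m"
  by (intro DERIV_cont[OF Wv_DERIV] th test_lapf ph)
 have sw: "sqi (%r. indicator {0<..} r * Sph (lapf ph) r 0)" "sqi (%r. indicator {0<..} r * Cph th r 0)"
  by (rule sqi_half[OF sqi_Sph0(1)[OF test_lapf[OF ph]]], rule sqi_half[OF sqi_Sph0(2)[OF th]])
 have w: "wS (lapf ph) + wC th = cls (%s. indicator {0<..} s * ?m s)"
  unfolding wS_def wC_def by (subst cls_add[OF sw, symmetric]) (simp add: Wv_def distrib_left add.commute)
 have "sqi (%s. indicator {0<..} s * ?m s)"
  using sqi_add[OF sw] by (simp add: Wv_def distrib_left add.commute)
 then show ?thesis
  unfolding C1_weak_derivative(2)[OF Wv_DERIV[OF ph th, of 0] cm ka] w by (simp add: inner_cls test_sqi[OF ka])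
qed

lemma wS_diff: "test_fn ph ==> test_fn th ==> wS ph - wS th = wS (%x. ph x - th x)"
 and wC_diff: "test_fn ph ==> test_fn th ==> wC ph - wC th = wC (%x. ph x - th x)"
 unfolding wS_def wC_def
 by (subst cls_diff[symmetric]; simp add: sqi_half sqi_Sph0 Sph_diff Cph_diff right_diff_distrib)+

lemma norm_wC_cgrad: "test_fn ph ==> norm (wC ph) \<le> norm (cgrad ph)"
 using norm_wC_le[of ph] by (intro power2_le_imp_le[of "norm (wC ph)"]) (simp_all add: power2_norm_eq_inner inner_vec_def cgrad_def)

text \<open>Approximate the data by test functions; all components of Kirchhoff's waves then
  converge locally uniformly in time. \<open>N\<close> is the weak derivative of the trace frozen at
  negative times, and the last claim is the square integrability of the trace on the half-line,
  obtained from \<open>norm_wC_le\<close> and \<open>norm_wS_le\<close>.\<close>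

lemma free_solution:
 assumes u0: "wlp u0 0 h0" and u1: "wgr u1 0 g1"
 obtains u v h p lam N where "u 0 = u0" "v 0 = u1"
  "!!t. (u has_vector_derivative v t) (at t)" "!!t. (v has_vector_derivative h t) (at t)"
  "continuous_on UNIV h" "continuous_on UNIV p" "continuous_on UNIV lam"
  "!!t. wlp (u t) 0 (h t)" "!!t. wgr (v t) 0 (p t)" "!!t. lim0 (fn (u t)) (lam t)"
  "!!ka. test_fn ka ==> (LI s. lam (max s 0) * deriv ka s) = - inner (N :: real l2) (cls ka)"
  "\<exists>C. \<forall>T\<ge>0. (LI s. indicator {0..T} s * (lam s)^2) \<le> C"
proof -
 obtain ph g0 c0 where ph: "!!n::nat. test_fn (ph n)" "(%n. cls (ph n)) ----> u0" "(%n. cls (lapf (ph n))) ----> h0"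
  "(%n. cgrad (ph n)) ----> g0" by (rule domain_approx[OF u0]) blast
 obtain th where th: "!!n::nat. test_fn (th n)" "(%n. cls (th n)) ----> u1" "(%n. cgrad (th n)) ----> g1"
  by (rule wgr_density[OF u1]) blast
 note tph = ph(1) and tth = th(1) and lph = test_lapf[OF ph(1)] and lth = test_lapf[OF th(1)]
 \<comment> \<open>All five norms that occur in \<open>Wv_bounds\<close>, collected into one
   convergent sequence.\<close>
 define D where "D n = ((cls (ph n), cls (lapf (ph n))), cgrad (ph n), cls (th n), cgrad (th n))" for n
 have "D ----> ((u0, h0), g0, u1, g1)" unfolding D_def[abs_def] by (intro tendsto_Pair ph th)
 then have CD: "Cauchy D" by (rule LIMSEQ_imp_Cauchy)
 define M where "M n m = norm (cls (ph n) - cls (ph m)) + norm (cls (lapf (ph n)) - cls (lapf (ph m))) + norm (cgrad (ph n) - cgrad (ph m))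
   + norm (cls (th n) - cls (th m)) + norm (cgrad (th n) - cgrad (th m))" for n m
 have MD: "M n m \<le> 5 * dist (D n) (D m)" for n m
 proof -
  have "dist (cls (ph n)) (cls (ph m)) \<le> dist (D n) (D m)" "dist (cls (lapf (ph n))) (cls (lapf (ph m))) \<le> dist (D n) (D m)"
   using dist_fst_le[of "fst (D n)" "fst (D m)"] dist_snd_le[of "fst (D n)" "fst (D m)"] dist_fst_le[of "D n" "D m"]
   by (simp_all add: D_def)
  moreover have "dist (cgrad (ph n)) (cgrad (ph m)) \<le> dist (D n) (D m)"
   using dist_fst_le[of "snd (D n)" "snd (D m)"] dist_snd_le[of "D n" "D m"] by (simp add: D_def)
  moreover have "dist (cls (th n)) (cls (th m)) \<le> dist (D n) (D m)" "dist (cgrad (th n)) (cgrad (th m)) \<le> dist (D n) (D m)"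
   using dist_fst_le[of "snd (snd (D n))" "snd (snd (D m))"] dist_snd_le[of "snd (snd (D n))" "snd (snd (D m))"]
    dist_snd_le[of "snd (D n)" "snd (D m)"] dist_snd_le[of "D n" "D m"] by (simp_all add: D_def)
  ultimately show ?thesis unfolding M_def dist_norm[symmetric] by linarith
 qed
 have M0: "M n m \<ge> 0" for n m by (simp add: M_def)
 have mono: "x \<le> M n m ==> x \<le> (2 + \<bar>t\<bar>) * (5 * dist (D n) (D m))" for x t n m
  using MD[of n m] mult_right_mono[of 1 "2 + \<bar>t\<bar>" "5 * dist (D n) (D m)"] by simp
 have mono2: "x \<le> (2 + \<bar>t\<bar>) * M n m ==> x \<le> (2 + \<bar>t\<bar>) * (5 * dist (D n) (D m))" for x t n m
  using mult_left_mono[OF MD[of n m], of "2 + \<bar>t\<bar>"] by simp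
 have td: "test_fn (%x. ph n x - ph m x)" "test_fn (%x. th n x - th m x)" for n m by (intro test_diff ph th)+
 have ld: "lapf (%x. ph n x - ph m x) = (%x. lapf (ph n) x - lapf (ph m) x)" "lapf (%x. th n x - th m x) = (%x. lapf (th n) x - lapf (th m) x)" for n m
  by (simp_all add: lapf_diff_fun test_smooth ph th)
 have bounds: "norm (cls (Wv (th n) (lapf (ph n)) t) - cls (Wv (th m) (lapf (ph m)) t)) \<le> M n m"
  "norm (cls (Wv (lapf (ph n)) (lapf (th n)) t) - cls (Wv (lapf (ph m)) (lapf (th m)) t)) \<le> M n m"
  "norm (cgrad (Wv (th n) (lapf (ph n)) t) - cgrad (Wv (th m) (lapf (ph m)) t)) \<le> M n m"
  "norm (cls (Wv (ph n) (th n) t) - cls (Wv (ph m) (th m) t)) \<le> (1 + \<bar>t\<bar>) * M n m"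
  "\<bar>Wv (ph n) (th n) t 0 - Wv (ph m) (th m) t 0\<bar> \<le> (2 + \<bar>t\<bar>) * M n m" for n m t
  using Wv_bounds[OF td(1)[of n m] td(2)[of n m], of t]
  by (simp_all add: ld Wv_diff tph tth lph lth cls_diff cgrad_diff Wv_test M_def)
 have mono3: "x \<le> (1 + \<bar>t\<bar>) * M n m ==> x \<le> (2 + \<bar>t\<bar>) * M n m" for x t n m
  using M0[of n m] mult_right_mono[of "1 + \<bar>t\<bar>" "2 + \<bar>t\<bar>" "M n m"] by simp
 obtain u where u: "!!t. (%n. cls (Wv (ph n) (th n) t)) ----> u t"
   "!!T e. e > 0 ==> \<forall>\<^sub>F n in sequentially. \<forall>t\<in>ball 0 T. norm (cls (Wv (ph n) (th n) t) - u t) < e"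
  by (rule locally_uniform_limit[OF CD, where K=5 and x="%n t. cls (Wv (ph n) (th n) t)"]) (use mono2[OF mono3[OF bounds(4)]] in blast)+
 obtain v where v: "!!t. (%n. cls (Wv (th n) (lapf (ph n)) t)) ----> v t"
   "!!T e. e > 0 ==> \<forall>\<^sub>F n in sequentially. \<forall>t\<in>ball 0 T. norm (cls (Wv (th n) (lapf (ph n)) t) - v t) < e"
  by (rule locally_uniform_limit[OF CD, where K=5 and x="%n t. cls (Wv (th n) (lapf (ph n)) t)"]) (use mono[OF bounds(1)] in blast)+
 obtain h where h: "!!t. (%n. cls (Wv (lapf (ph n)) (lapf (th n)) t)) ----> h t"
   "!!T e. e > 0 ==> \<forall>\<^sub>F n in sequentially. \<forall>t\<in>ball 0 T. norm (cls (Wv (lapf (ph n)) (lapf (th n)) t) - h t) < e"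
  by (rule locally_uniform_limit[OF CD, where K=5 and x="%n t. cls (Wv (lapf (ph n)) (lapf (th n)) t)"]) (use mono[OF bounds(2)] in blast)+
 obtain p where p: "!!t. (%n. cgrad (Wv (th n) (lapf (ph n)) t)) ----> p t"
   "!!T e. e > 0 ==> \<forall>\<^sub>F n in sequentially. \<forall>t\<in>ball 0 T. norm (cgrad (Wv (th n) (lapf (ph n)) t) - p t) < e"
  by (rule locally_uniform_limit[OF CD, where K=5 and x="%n t. cgrad (Wv (th n) (lapf (ph n)) t)"]) (use mono[OF bounds(3)] in blast)+
 obtain lam where lam: "!!t. (%n. Wv (ph n) (th n) t 0) ----> lam t"
   "!!T e. e > 0 ==> \<forall>\<^sub>F n in sequentially. \<forall>t\<in>ball 0 T. norm (Wv (ph n) (th n) t 0 - lam t) < e"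
  by (rule locally_uniform_limit[OF CD, where K=5 and x="%n t. Wv (ph n) (th n) t 0"]) (use mono2[OF bounds(5)] in "simp; blast")+
 have cW: "continuous_on UNIV (%t. cls (Wv ph th t))" if "test_fn ph" "test_fn th" for ph th
  by (intro continuous_at_imp_continuous_on ballI has_vector_derivative_continuous[OF Wv_curve] that)
 \<comment> \<open>The squared gradient of a test function is minus the inner product with its
   Laplacian. Applied to increments in time, this derives continuity of the gradient from that of
   the wave and of its Laplacian.\<close>
 have cg: "continuous_on UNIV (%t. cgrad (Wv (th n) (lapf (ph n)) t))" for n
 proof -
  let ?w = "%t. Wv (th n) (lapf (ph n)) t"
  have tw: "test_fn (?w t)" for t by (rule Wv_test; fact)
  have cw: "continuous_on UNIV (%t. cls (?w t))" "continuous_on UNIV (%t. cls (lapf (?w t)))"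
   by (simp_all add: lapf_Wv tth lph cW lth test_lapf)
  show ?thesis
  proof (intro continuous_at_imp_continuous_on ballI)
   fix t :: real
   have "((%s. - inner (cls (?w s) - cls (?w t)) (cls (lapf (?w s)) - cls (lapf (?w t)))) --->
     - inner (cls (?w t) - cls (?w t)) (cls (lapf (?w t)) - cls (lapf (?w t)))) (at t)"
    using cw by (intro tendsto_intros) (auto simp: continuous_on_def)
   moreover have "- inner (cls (?w s) - cls (?w t)) (cls (lapf (?w s)) - cls (lapf (?w t))) = (norm (cgrad (?w s) - cgrad (?w t)))^2" for s
    using inner_cgrad[OF test_diff[OF tw[of s] tw[of t]] test_diff[OF tw[of s] tw[of t]]]
    by (simp add: cgrad_diff tw lapf_diff_fun test_smooth cls_diff test_lapf power2_norm_eq_inner)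
   ultimately have "((%s. (norm (cgrad (?w s) - cgrad (?w t)))^2) ---> 0) (at t)" by simp
   then have "((%s. sqrt ((norm (cgrad (?w s) - cgrad (?w t)))^2)) ---> sqrt 0) (at t)" by (rule tendsto_real_sqrt)
   then have "((%s. norm (cgrad (?w s) - cgrad (?w t))) ---> 0) (at t)" by simp
   then have "((%s. cgrad (?w s) - cgrad (?w t)) ---> 0) (at t)" by (simp only: tendsto_norm_zero_iff)
   then show "isCont (%t. cgrad (?w t)) t" by (simp only: isCont_def LIM_zero_iff)
  qed
 qed
 have cl0: "continuous_on UNIV (%t. Wv (ph n) (th n) t 0)" for n
  by (intro DERIV_cont[OF Wv_DERIV] tph tth)
 have clam: "continuous_on UNIV lam" by (rule continuous_locally_uniform_limit[OF cl0 lam(2)])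
 define Nn where "Nn n = wS (lapf (ph n)) + wC (th n)" for n
 have dd: "norm (wS (lapf (ph n)) - wS (lapf (ph m))) \<le> norm (cls (lapf (ph n)) - cls (lapf (ph m)))"
  "norm (wC (th n) - wC (th m)) \<le> norm (cgrad (th n) - cgrad (th m))" for n m
  using norm_wS_le[OF test_diff[OF lph[of n] lph[of m]]] norm_wC_cgrad[OF td(2)[of n m]]
  by (simp_all add: wS_diff wC_diff lph tth cls_diff cgrad_diff)
 have "Cauchy Nn"
  unfolding Cauchy_altdef2
 proof (intro allI impI)
  fix e :: real assume e: "e > 0"
  obtain K where K: "!!m n. m \<ge> K ==> n \<ge> K ==> dist (D m) (D n) < e / 5"
   using metric_CauchyD[OF CD, of "e / 5"] e by auto
  have "dist (Nn n) (Nn K) < e" if "n \<ge> K" for n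
  proof -
   have "Nn n - Nn K = (wS (lapf (ph n)) - wS (lapf (ph K))) + (wC (th n) - wC (th K))" by (simp add: Nn_def)
   then have "norm (Nn n - Nn K) \<le> norm (cls (lapf (ph n)) - cls (lapf (ph K))) + norm (cgrad (th n) - cgrad (th K))"
    using norm_triangle_ineq dd[of n K] by (smt (verit))
   also have "... \<le> M n K" by (simp add: M_def)
   also have "... < e" using MD[of n K] K[OF that, of K] by simp
   finally show ?thesis by (simp add: dist_norm)
  qed
  then show "\<exists>N. \<forall>n\<ge>N. dist (Nn n) (Nn N) < e" by blast
 qed
 then obtain N where N: "Nn ----> N" using Cauchy_convergent convergent_def by blast
 show thesis
 proof (rule that)
  show "u 0 = u0" "v 0 = u1" using LIMSEQ_unique[OF u(1)[of 0]] LIMSEQ_unique[OF v(1)[of 0]] ph(2) th(2) by (simp_all add: Wv_0)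
  show "(u has_vector_derivative v t) (at t)" for t
   by (rule derivative_locally_uniform_limit[OF Wv_curve[OF tph tth] u(1) v(2)])
  show "(v has_vector_derivative h t) (at t)" for t
   by (rule derivative_locally_uniform_limit[OF Wv_curve[OF tth lph] v(1) h(2)])
  show "continuous_on UNIV h" by (rule continuous_locally_uniform_limit[OF cW[OF lph lth] h(2)])
  show "continuous_on UNIV p" by (rule continuous_locally_uniform_limit[OF cg p(2)])
  show "continuous_on UNIV lam" by (rule clam)
  show "wlp (u t) 0 (h t)" for t
   by (rule wlp_closed[OF wlp_test[OF Wv_test[OF tph tth]] u(1) tendsto_const, unfolded lapf_Wv[OF tph tth], OF h(1)]) simp
  show "wgr (v t) 0 (p t)" for t
   by (rule wgr_closed[OF wgr_test[OF Wv_test[OF tth lph]] v(1) tendsto_const p(1)]) simp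
  show "lim0 (fn (u t)) (lam t)" for t
   by (rule lim0_approx[OF Wv_test[OF tph tth] u(1), unfolded lapf_Wv[OF tph tth], OF h(1) lam(1)])
  show "(LI s. lam (max s 0) * deriv ka s) = - inner N (cls ka)" if ka: "test_fn ka" for ka
  proof -
   have ka': "test_fn (deriv ka)" by (rule test_deriv[OF ka])
   obtain R where R: "R > 0" "!!s. R < norm s ==> deriv ka s = 0" using test_support[OF ka'] by metis
   have cm: "continuous_on UNIV (%s. f (max s 0) :: real)" if "continuous_on UNIV f" for f :: "real => real"
    by (rule continuous_on_compose2[OF that]) (auto intro!: continuous_intros)
   have lm: "\<forall>\<^sub>F n in sequentially. \<forall>t\<in>ball 0 T. norm (Wv (ph n) (th n) (max t 0) 0 - lam (max t 0)) < e" if "e > 0" for T e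
    using lam(2)[OF that, of T] by eventually_elim (auto simp: max_def)
   have eq: "inner (cls (%s. indicator {-R..R} s * f (max s 0))) (cls (deriv ka)) = (LI s. f (max s 0) * deriv ka s)"
    if "continuous_on UNIV f" for f :: "real => real"
    unfolding inner_cls[OF sqi_indicator_continuous[OF cm[OF that]] test_sqi[OF ka']]
    by (rule Bochner_Integration.integral_cong[OF refl]) (use R(2) in "force simp: indicator_def")
   have "(%n. inner (cls (%s. indicator {-R..R} s * Wv (ph n) (th n) (max s 0) 0)) (cls (deriv ka)))
    ----> inner (cls (%s. indicator {-R..R} s * lam (max s 0))) (cls (deriv ka))"
    by (intro tendsto_intros cls_indicator_limit cm cl0 clam lm)
   moreover have "inner (cls (%s. indicator {-R..R} s * Wv (ph n) (th n) (max s 0) 0)) (cls (deriv ka)) = - inner (Nn n) (cls ka)" for n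
    unfolding eq[OF cl0] Nn_def by (rule free_trace_weak_derivative[OF tph tth ka])
   moreover have "(%n. - inner (Nn n) (cls ka)) ----> - inner N (cls ka)" by (intro tendsto_intros N)
   ultimately have "inner (cls (%s. indicator {-R..R} s * lam (max s 0))) (cls (deriv ka)) = - inner N (cls ka)"
    using LIMSEQ_unique by simp
   then show ?thesis by (simp add: eq[OF clam])
  qed
  show "\<exists>C. \<forall>T\<ge>0. (LI s. indicator {0..T} s * (lam s)^2) \<le> C"
  proof -
   define k where "k n = norm (cgrad (ph n)) + norm (cls (th n))" for n
   have k: "k ----> norm g0 + norm u1" unfolding k_def[abs_def] by (intro tendsto_intros ph th)
   have "(LI s. indicator {0..T} s * (lam s)^2) \<le> (norm g0 + norm u1)^2" for T
   proof -
    have b: "norm (cls (%s. indicator {0..T} s * Wv (ph n) (th n) s 0)) \<le> k n" for n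
    proof -
     have sw: "sqi (%r. indicator {0<..} r * Cph (ph n) r 0)" "sqi (%r. indicator {0<..} r * Sph (th n) r 0)"
      by (rule sqi_half[OF sqi_Sph0(2)[OF tph]], rule sqi_half[OF sqi_Sph0(1)[OF tth]])
     have "norm (cls (%s. indicator {0..T} s * Wv (ph n) (th n) s 0))
       \<le> norm (cls (%r. indicator {0<..} r * Cph (ph n) r 0 + indicator {0<..} r * Sph (th n) r 0))"
     proof (rule norm_cls_le[OF sqi_add[OF sw]])
      show "(%s. indicator {0..T} s * Wv (ph n) (th n) s 0) \<in> borel_measurable lborel"
       using borel_measurable_continuous_onI[OF cl0] by measurable
      show "AE s in lborel. \<bar>indicator {0..T} s * Wv (ph n) (th n) s 0\<bar> \<le> \<bar>indicator {0<..} s * Cph (ph n) s 0 + indicator {0<..} s * Sph (th n) s 0\<bar>"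
       using AE_lborel_singleton[of 0] by eventually_elim (auto simp: indicator_def Wv_def)
     qed
     also have "... \<le> norm (wC (ph n)) + norm (wS (th n))"
      unfolding cls_add[OF sw] wS_def wC_def by (rule norm_triangle_ineq)
     also have "... \<le> k n" unfolding k_def by (intro add_mono norm_wC_cgrad norm_wS_le tph tth)
     finally show ?thesis .
    qed
    have "norm (cls (%s. indicator {0..T} s * lam s)) \<le> norm g0 + norm u1"
     by (rule LIMSEQ_le[OF tendsto_norm[OF cls_indicator_limit[OF cl0 clam lam(2)]] k]) (use b in auto)
    then have "(norm (cls (%s. indicator {0..T} s * lam s)))^2 \<le> (norm g0 + norm u1)^2" by (intro power_mono) auto
    also have "(norm (cls (%s. indicator {0..T} s * lam s)))^2 = (LI s. indicator {0..T} s * (lam s)^2)"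
     unfolding norm_cls_sq[OF sqi_indicator_continuous[OF clam]]
     by (rule Bochner_Integration.integral_cong) (auto simp: indicator_def)
    finally show ?thesis .
   qed
   then show ?thesis by blast
  qed
 qed
qed

subsection \<open>Retarded potentials\<close>

text \<open>\<open>b\<close> lies in the Sobolev space H^1 of the line and has derivative
  \<open>Q\<close>.\<close>

definition wd1 :: "real l2 => real l2 => bool" where
 "wd1 b Q \<longleftrightarrow> (\<forall>th. test_fn th --> inner b (cls (deriv th)) = - inner Q (cls th))"

lemma wd1_lin: "wd1 b Q ==> wd1 b' Q' ==> wd1 (x *R b + y *R b') (x *R Q + y *R Q')"
 by (simp add: wd1_def inner_add_left)

lemma tr_test_derivative:
 assumes th: "test_fn (th :: real => real)"
 shows "((%t. tr t (cls th)) has_vector_derivative tr t (cls (deriv th))) (at t)"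
proof -
 note d = DERIV_smooth[OF test_smooth[OF th]] and th' = test_deriv[OF th]
 obtain C where C: "!!x. \<bar>deriv (deriv th) x\<bar> \<le> C" by (rule test_bounded[OF test_deriv[OF th']]) blast
 obtain R where R: "!!x. R < norm x ==> th x = 0" by (rule test_support[OF th]) blast
 obtain R' where R': "!!x. R' < norm x ==> deriv th x = 0" by (rule test_support[OF th']) blast
 have sh: "((%s. f (x + s)) has_real_derivative f' (x + s)) (at s)"
  if "!!y. (f has_real_derivative f' y) (at y)" for f f' :: "real => real" and x s
  using DERIV_shift[of f "f' (x + s)" s x] that[of "s + x"] by (simp add: add.commute)
 have "((%t. cls (%x. th (x + t))) has_vector_derivative cls (%x. deriv th (x + t))) (at t)"
 proof (rule has_vector_derivative_cls2[where \<Phi>''="%s x. deriv (deriv th) (x + s)" and C=C and R="max R R' + \<bar>t\<bar> + 1"])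
  show "th (x + s) = 0 \<and> deriv th (x + s) = 0" if "\<bar>s - t\<bar> \<le> 1" "max R R' + \<bar>t\<bar> + 1 < norm x" for s x
  proof -
   have "R < norm (x + s)" "R' < norm (x + s)" using that by auto
   then show ?thesis using R R' by blast
  qed
 qed (use d DERIV_smooth[OF test_smooth[OF th']] in "auto intro!: sh C sqi_translate test_sqi test_translate th th'")
 then show ?thesis by (simp add: tr_cls th th')
qed

lemma norm_le_test:
 fixes u :: "'a::euclidean_space l2"
 assumes "!!th. test_fn th ==> inner u (cls th) \<le> C * norm (cls th)" "0 \<le> C" shows "norm u \<le> C"
proof -
 have "u \<in> closure (cls ` Collect test_fn)" using test_dense by blast
 then obtain th where th: "!!n::nat. th n \<in> Collect test_fn" "(%n. cls (th n)) ----> u"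
  by (rule seq_in_closure_image) blast
 have "inner u u \<le> C * norm u"
  by (rule LIMSEQ_le[of "%n. inner u (cls (th n))" _ "%n. C * norm (cls (th n))"])
   (use th assms(1) in "auto intro!: tendsto_intros exI[of _ 0]")
 then have "norm u * norm u \<le> C * norm u" by (simp add: power2_norm_eq_inner[symmetric] power2_eq_square)
 then show ?thesis using assms(2) by (cases "norm u = 0") auto
qed

text \<open>For each test function the mean value inequality bounds the remainder by the oscillation
  of \<open>y\<close>, uniformly in the norm of the test function; \<open>norm_le_test\<close> turns
  this into a norm bound.\<close>

lemma weak_vector_derivative:
 fixes x y :: "real => 'a::euclidean_space l2"
 assumes d: "!!th t. test_fn th ==> ((%t. inner (x t) (cls th)) has_real_derivative inner (y t) (cls th)) (at t)"
  and c: "continuous_on UNIV y"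
 shows "(x has_vector_derivative y t) (at t)"
 unfolding has_vector_derivative_def has_derivative_at_alt
proof (intro conjI allI impI)
 show "bounded_linear (%h. h *R y t)" by (rule bounded_linear_scaleR_left)
 fix e :: real assume e: "e > 0"
 have "isCont y t" using c by (simp add: continuous_on_eq_continuous_at)
 then obtain \<delta> where \<delta>: "\<delta> > 0" "!!s. dist s t < \<delta> ==> dist (y s) (y t) < e"
  using e unfolding continuous_at_eps_delta by blast
 have "norm (x s - x t - (s - t) *R y t) \<le> e * norm (s - t)" if s: "norm (s - t) < \<delta>" for s
 proof (rule norm_le_test)
  fix th :: "'a => real" assume th: "test_fn th"
  let ?f = "%s. inner (x s) (cls th) - s * inner (y t) (cls th)"
  have "norm (?f s - ?f t) \<le> e * norm (cls th) * norm (s - t)"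
  proof (rule field_differentiable_bound[of "ball t \<delta>"])
   fix r assume r: "r \<in> ball t \<delta>"
   show "(?f has_real_derivative inner (y r) (cls th) - 1 * inner (y t) (cls th)) (at r within ball t \<delta>)"
    by (rule has_field_derivative_at_within, intro DERIV_diff d th DERIV_cmult_right DERIV_ident)
   have "norm (inner (y r - y t) (cls th)) \<le> norm (y r - y t) * norm (cls th)" using Cauchy_Schwarz_ineq2 by simp
   also have "... \<le> e * norm (cls th)"
    by (rule mult_right_mono) (use \<delta>(2)[of r] r in "auto simp: dist_norm abs_minus_commute")
   finally show "norm (inner (y r) (cls th) - 1 * inner (y t) (cls th)) \<le> e * norm (cls th)" by (simp add: inner_diff_left)
  qed (use s \<delta>(1) in "auto simp: dist_norm abs_minus_commute")
  moreover have "inner (x s - x t - (s - t) *R y t) (cls th) = ?f s - ?f t" by (simp add: inner_diff_left algebra_simps)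
  ultimately show "inner (x s - x t - (s - t) *R y t) (cls th) \<le> e * norm (s - t) * norm (cls th)" by (simp add: ac_simps)
 qed (use e in simp)
 then show "\<exists>d>0. \<forall>s. norm (s - t) < d --> norm (x s - x t - (s - t) *R y t) \<le> e * norm (s - t)" using \<delta>(1) by blast
qed

lemma has_vector_derivative_uminus: "(uminus has_vector_derivative (- 1 :: real)) (at t)"
 unfolding has_real_derivative_iff_has_vector_derivative[symmetric] by (auto intro!: derivative_eq_intros)

text \<open>Moving the translation to the test function gives the derivative weakly, and continuity
  of translations in L2 makes it strong.\<close>

lemma tr_derivative:
 assumes w: "wd1 b Q" shows "((%t. tr t b) has_vector_derivative tr t Q) (at t)"
proof -
 have d: "((%t. inner (tr t b) (cls th)) has_real_derivative inner (tr t Q) (cls th)) (at t)" if th: "test_fn th" for th t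
 proof -
  have "((%t. tr (- t) (cls th)) has_vector_derivative (- 1) *R tr (- t) (cls (deriv th))) (at t)"
   using vector_diff_chain_at[OF has_vector_derivative_uminus tr_test_derivative[OF th], of t] unfolding o_def .
  then have "((%t. inner b (tr (- t) (cls th))) has_vector_derivative inner b ((- 1) *R tr (- t) (cls (deriv th)))) (at t)"
   by (rule bounded_linear.has_vector_derivative[OF bounded_linear_inner_right])
  moreover have "inner b ((- 1) *R tr (- t) (cls (deriv th))) = inner (tr t Q) (cls th)"
  proof -
   have tt: "test_fn (%x. th (x + - t))" by (rule test_translate[OF th])
   have "deriv (%x. th (x + - t)) = (%x. deriv th (x + - t))"
    by (rule ext, rule DERIV_imp_deriv) (use DERIV_shift[of th _ _ "- t"] DERIV_smooth[OF test_smooth[OF th]] in blast)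
   then have "tr (- t) (cls (deriv th)) = cls (deriv (%x. th (x + - t)))"
    by (simp add: tr_cls test_deriv[OF th])
   then show ?thesis using w tt by (simp add: wd1_def inner_tr_left[of t] tr_cls th)
  qed
  ultimately show ?thesis
   by (simp add: inner_tr_left[of _ b] has_real_derivative_iff_has_vector_derivative)
 qed
 show ?thesis by (rule weak_vector_derivative[OF d continuous_on_tr])
qed

text \<open>Integration by parts for two H^1 functions: compute the derivative at 0 of the inner
  product of \<open>tr t b\<close> and \<open>W\<close> twice, the second time with the translation
  moved to \<open>W\<close>.\<close>

lemma wd1_pair: assumes "wd1 b Q" "wd1 W V" shows "inner Q W = - inner b V"
proof -
 have "((%t. inner (tr t b) W) has_vector_derivative inner (tr 0 Q) W) (at 0)"
  by (rule bounded_linear.has_vector_derivative[OF bounded_linear_inner_left tr_derivative[OF assms(1)]])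
 moreover have "((%t. inner b (tr t W)) \<circ> uminus has_vector_derivative (- 1) *R inner b (tr 0 V)) (at 0)"
  by (rule vector_diff_chain_at[OF has_vector_derivative_uminus])
   (use bounded_linear.has_vector_derivative[OF bounded_linear_inner_right tr_derivative[OF assms(2), of 0], of b] in simp)
 ultimately show ?thesis using vector_derivative_unique_at by (fastforce simp: o_def inner_tr_left)
qed

text \<open>The retarded potential at time 0 of a charge with history \<open>q\<close>; at time
  \<open>t\<close> it is that of the history shifted by \<open>t\<close>.\<close>

definition Ef :: "(real => real) => R3 => real" where "Ef q x = q (- norm x) / (4 * pi * norm x)"

definition E :: "real l2 => R3 l2" where "E u = cls (Ef (fn u))"

text \<open>The surface factor 4 pi r^2 cancels the square of 1 / (4 pi r) up to a factor 4 pi, so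
  the field carries, up to this constant, the L2 norm of the past of its charge.\<close>

lemma sqi_Ef:
 assumes q: "sqi q"
 shows "sqi (Ef q)" and "(norm (cls (Ef q)))^2 = (LI s. indicator {..<0} s * (q s)^2) / (4 * pi)"
proof -
 note [measurable] = sqi_borel[OF q]
 define k where "k s = indicator {..<0} s * (q s)^2 / (4 * pi)" for s :: real
 have [measurable]: "k \<in> borel_measurable borel" "Ef q \<in> borel_measurable borel" unfolding k_def[abs_def] Ef_def[abs_def] by measurable
 have k0: "0 \<le> k s" for s by (simp add: k_def)
 have ki: "integrable lborel k"
 proof (rule Bochner_Integration.integrable_bound)
  show "integrable lborel (%s. (q s)^2)" using q by (simp add: sqi_def)
  show "AE s in lborel. norm (k s) \<le> norm ((q s)^2)"
  proof (rule AE_I2)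
   fix s have "(q s)^2 / (4 * pi) \<le> (q s)^2 / 1" by (intro divide_left_mono four_pi_ge_1) auto
   then show "norm (k s) \<le> norm ((q s)^2)" by (simp add: k_def indicator_def)
  qed
 qed simp
 have "(NI x. ennreal ((Ef q x)^2)) = (NI r. ennreal (indicator {0<..} r * (4 * pi * r^2)) * ennreal ((q (- r) / (4 * pi * r))^2))"
  unfolding Ef_def by (rule nn_integral_radial[of "%r. ennreal ((q (- r) / (4 * pi * r))^2)"]) measurable
 also have "... = (NI r. ennreal (k (- r)))"
  by (rule nn_integral_cong) (auto simp: k_def indicator_def ennreal_mult[symmetric] power2_eq_square field_simps)
 also have "... = (NI s. ennreal (k s))"
  using nn_integral_real_affine[of "%s. ennreal (k s)" "- 1" 0] by simp
 also have "... = ennreal (LI s. k s)" by (rule nn_integral_eq_integral[OF ki]) (simp add: k0)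
 finally have nn: "(NI x. ennreal ((Ef q x)^2)) = ennreal (LI s. k s)" .
 have i: "integrable lborel (%x. (Ef q x)^2)" by (rule integrableI_nn_integral_finite[OF _ _ nn]) auto
 then show s: "sqi (Ef q)" by (simp add: sqi_def)
 have "ennreal (LI x. (Ef q x)^2) = ennreal (LI s. k s)" using nn nn_integral_eq_integral[OF i] by simp
 then have "(LI x. (Ef q x)^2) = (LI s. k s)" by (simp add: k0)
 then show "(norm (cls (Ef q)))^2 = (LI s. indicator {..<0} s * (q s)^2) / (4 * pi)"
  by (simp add: norm_cls_sq[OF s] k_def)
qed

lemma Ef_add: "Ef (%s. p s + q s) = (%x. Ef p x + Ef q x)" and Ef_diff: "Ef (%s. p s - q s) = (%x. Ef p x - Ef q x)"
 and Ef_cmult: "Ef (%s. c * q s) = (%x. c * Ef q x)"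
 by (simp_all add: Ef_def fun_eq_iff add_divide_distrib diff_divide_distrib)

lemma E_cls: assumes q: "sqi q" shows "E (cls q) = cls (Ef q)"
proof -
 have d: "sqi (%s. fn (cls q) s - q s)" by (intro sqi_diff sqi_fn q)
 have "(LI s. indicator {..<0} s * (fn (cls q) s - q s)^2) = (LI (s::real). (0::real))"
  by (rule integral_cong_AE) (use fn_cls[OF q] sqi_borel[OF d] in "auto elim: eventually_mono")
 then have "norm (cls (Ef (%s. fn (cls q) s - q s))) = 0" using sqi_Ef(2)[OF d] by simp
 then show ?thesis unfolding E_def Ef_diff by (simp add: cls_diff sqi_Ef q)
qed

lemma norm_E_sq: "sqi q ==> (norm (E (cls q)))^2 = (LI s. indicator {..<0} s * (q s)^2) / (4 * pi)"
 by (simp add: E_cls sqi_Ef)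

lemma norm_E: "norm (E u) \<le> norm u"
proof (rule power2_le_imp_le)
 have "(LI s. indicator {..<0} s * (fn u s)^2) \<le> (LI s. (fn u s)^2)"
 proof (rule integral_mono)
  show i: "integrable lborel (%s. (fn u s)^2)" using sqi_fn[of u] by (simp add: sqi_def)
  show "integrable lborel (%s. indicator {..<0} s * (fn u s)^2)"
   using integrable_real_mult_indicator[OF _ i, of "{..<0}"] by (simp add: mult.commute)
 qed (auto simp: indicator_def)
 also have "... = (norm u)^2" using norm_cls_sq[OF sqi_fn[of u]] by simp
 finally have "(norm (E u))^2 \<le> (norm u)^2 / (4 * pi)"
  using norm_E_sq[OF sqi_fn[of u]] by (simp add: divide_right_mono)
 also have "... \<le> (norm u)^2 / 1" by (intro divide_left_mono four_pi_ge_1) auto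
 finally show "(norm (E u))^2 \<le> (norm u)^2" by simp
qed simp

lemma bounded_linear_E: "bounded_linear E"
proof (rule bounded_linear_intro[of _ 1])
 fix u v :: "real l2" and c
 have "E (cls (%s. fn u s + fn v s)) = E u + E v"
  by (subst E_cls[OF sqi_add[OF sqi_fn sqi_fn]]) (simp add: Ef_add cls_add sqi_Ef E_def)
 then show "E (u + v) = E u + E v" by (simp add: cls_add)
 have "E (cls (%s. c * fn u s)) = c *R E u"
  by (subst E_cls[OF sqi_scale[OF sqi_fn]]) (simp add: Ef_cmult cls_scale sqi_Ef E_def)
 then show "E (c *R u) = c *R E u" by (simp add: cls_scale)
qed (simp add: norm_E)

lemma E_diff: "E (u - v) = E u - E v"
 by (simp add: linear_diff bounded_linear.linear[OF bounded_linear_E])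

lemma E_curve: "wd1 b Q ==> ((%t. E (tr t b)) has_vector_derivative E (tr t Q)) (at t)"
 by (rule bounded_linear.has_vector_derivative[OF bounded_linear_E tr_derivative])

lemma sqi_half_neg: assumes "test_fn ph"
 shows "sqi (%s. indicator {..<0} s * Sph ph (- s) 0)" "sqi (%s. indicator {..<0} s * Cph ph (- s) 0)"
proof -
 obtain R where R: "!!x. R < norm x ==> ph x = 0" using test_support[OF assms] by metis
 have c: "continuous_on UNIV (%s. Sph ph (- s) 0)" "continuous_on UNIV (%s. Cph ph (- s) 0)"
  by (rule continuous_on_compose2[OF Sph0_continuous[OF assms, of UNIV]] continuous_on_compose2[OF Cph0_continuous[OF assms, of UNIV]]; auto intro!: continuous_intros)+
 have "sqi (%s. Sph ph (- s) 0)" "sqi (%s. Cph ph (- s) 0)"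
  by (rule sqi_continuous_support[of _ R]; use Sph_support0[of R ph, OF R] c in auto)+
 note s = this
 show "sqi (%s. indicator {..<0} s * Sph ph (- s) 0)"
  by (rule sqi_bound[OF s(1)]) (use sqi_borel[OF s(1)] in "auto simp: indicator_def")
 show "sqi (%s. indicator {..<0} s * Cph ph (- s) 0)"
  by (rule sqi_bound[OF s(2)]) (use sqi_borel[OF s(2)] in "auto simp: indicator_def")
qed

text \<open>In polar coordinates the spherical mean of \<open>ph\<close> appears, so the adjoint of
  \<open>E\<close> is the trace of a Kirchhoff wave at the origin, read backwards in time.
  Distributional statements about radiated fields thereby become integrals over the time
  line.\<close>

lemma inner_E:
 assumes ph: "test_fn ph"
 shows "inner (E u) (cls ph) = inner u (cls (%s. indicator {..<0} s * Sph ph (- s) 0))"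
proof -
 let ?q = "fn u"
 note [measurable] = sqi_borel[OF sqi_fn[of u]] test_borel[OF ph]
 have s: "sqi (Ef ?q)" by (rule sqi_Ef[OF sqi_fn])
 have "inner (E u) (cls ph) = (LI x. Ef ?q x * ph x)" unfolding E_def by (rule inner_cls) (use s ph in auto)
 also have "... = (LI r. indicator {0<..} r * (4 * pi * r^2) * (LI y. ksph y * (Ef ?q (r *R dirv y) * ph (r *R dirv y))))"
  by (rule integral_polar(1)) (use s ph in "auto intro: sqi_mult_integrable")
 also have "... = (LI r. indicator {0<..} r * ?q (- r) * Sph ph r 0)"
 proof (rule Bochner_Integration.integral_cong[OF refl])
  fix r :: real
  show "indicator {0<..} r * (4 * pi * r^2) * (LI y. ksph y * (Ef ?q (r *R dirv y) * ph (r *R dirv y))) = indicator {0<..} r * ?q (- r) * Sph ph r 0"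
  proof (cases "r > 0")
   case True
   have [measurable]: "Ef ?q \<in> borel_measurable borel" unfolding Ef_def[abs_def] by measurable
   have [measurable]: "ksph \<in> borel_measurable borel" unfolding ksph_def[abs_def] by measurable
   have "(LI y. ksph y * (Ef ?q (r *R dirv y) * ph (r *R dirv y))) = (LI y. ?q (- r) / (4 * pi * r) * (ksph y * ph (0 + r *R dirv y)))"
   proof (rule integral_cong_AE)
    show "AE y in lborel. ksph y * (Ef ?q (r *R dirv y) * ph (r *R dirv y)) = ?q (- r) / (4 * pi * r) * (ksph y * ph (0 + r *R dirv y))"
     using AE_R3_nonzero by eventually_elim (use True in "simp add: Ef_def norm_dirv")
   qed measurable
   also have "... = ?q (- r) / (4 * pi * r) * Av ksph ph r 0" by (simp add: Av_def)
   finally show ?thesis using True by (simp add: Sph_def power2_eq_square)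
  qed simp
 qed
 also have "... = (LI s. ?q s * (indicator {..<0} s * Sph ph (- s) 0))"
  using lborel_integral_real_affine[of "- 1" "%s. ?q s * (indicator {..<0} s * Sph ph (- s) 0)" 0]
  by (simp add: indicator_def ac_simps)
 also have "... = inner u (cls (%s. indicator {..<0} s * Sph ph (- s) 0))"
  by (simp add: inner_fn sqi_half_neg ph)
 finally show ?thesis .
qed

lemma LBINT_half_line:
 fixes f F :: "real => real"
 assumes F: "!!s. (F has_real_derivative f s) (at s)" and c: "continuous_on UNIV f" and R: "!!s. s < - R ==> f s = 0" "F (- R) = 0" "R \<ge> 0"
 shows "(LI s. indicator {..<0} s * f s) = F 0" "integrable lborel (%s. indicator {..<0} s * f s)"
proof -
 have a1: "AE s in lborel. s \<notin> {-R..0} --> indicator {..<0} s * f s = 0"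
  by (rule AE_I2) (use R(1) in "auto simp: indicator_def not_le")
 have a2: "AE s in lborel. s \<in> {-R..0} --> indicator {..<0} s * f s = f s"
  using AE_lborel_singleton[of 0] by eventually_elim (auto simp: indicator_def)
 have m: "(%s. indicator {..<0} s * f s) \<in> borel_measurable borel" using borel_measurable_continuous_onI[OF c] by measurable
 note L = LBINT_continuous_support[of "- R" 0 F f "%s. indicator {..<0} s * f s", OF F continuous_on_subset[OF c subset_UNIV] _ a1 a2 m]
 show "(LI s. indicator {..<0} s * f s) = F 0" "integrable lborel (%s. indicator {..<0} s * f s)"
  using L R by auto
qed

text \<open>Cutting the trace off at time 0 creates no jump because \<open>Sph ph 0 0 = 0\<close>,
  so the pointwise derivative is also the weak one.\<close>

lemma wd1_half:
 assumes ph: "test_fn ph"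
 shows "wd1 (cls (%s. indicator {..<0} s * Sph ph (- s) 0)) (- cls (%s. indicator {..<0} s * Cph ph (- s) 0))"
 unfolding wd1_def
proof (intro allI impI)
 fix th :: "real => real" assume th: "test_fn th"
 note th' = test_deriv[OF th] and sn = sqi_half_neg[OF ph]
 obtain R where R: "R > 0" "!!x. R < norm x ==> ph x = 0" using test_support[OF ph] by metis
 note z = Sph_support0[of R ph, OF R(2)]
 let ?f = "%s. deriv th s * Sph ph (- s) 0 - th s * Cph ph (- s) 0"
 have n: "(uminus has_real_derivative - 1) (at s)" for s :: real by (auto intro!: derivative_eq_intros)
 have d: "((%s. th s * Sph ph (- s) 0) has_real_derivative ?f s) (at s)" for s
  using DERIV_mult[OF DERIV_smooth[OF test_smooth[OF th]] DERIV_chain2[OF Sph_DERIV[OF ph, of 0] n], of s]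
  by (rule DERIV_cong) (simp add: algebra_simps)
 have c: "continuous_on UNIV ?f"
  by (intro continuous_intros smooth_continuous test_smooth th th' continuous_on_compose2[OF Sph0_continuous[OF ph, of UNIV]] continuous_on_compose2[OF Cph0_continuous[OF ph, of UNIV]]) auto
 have L: "(LI s. indicator {..<0} s * ?f s) = th 0 * Sph ph (- 0) 0"
  by (rule LBINT_half_line(1)[OF d c, of "R + 1"]) (use R z in auto)
 have "(LI s. indicator {..<0} s * Sph ph (- s) 0 * deriv th s - indicator {..<0} s * Cph ph (- s) 0 * th s) = 0"
  using L by (simp add: algebra_simps)
 moreover have "(LI s. indicator {..<0} s * Sph ph (- s) 0 * deriv th s - indicator {..<0} s * Cph ph (- s) 0 * th s)
  = inner (cls (%s. indicator {..<0} s * Sph ph (- s) 0)) (cls (deriv th)) - inner (cls (%s. indicator {..<0} s * Cph ph (- s) 0)) (cls th)"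
  unfolding inner_cls[OF sn(1) test_sqi[OF th']] inner_cls[OF sn(2) test_sqi[OF th]]
  by (rule Bochner_Integration.integral_diff) (intro sqi_mult_integrable sn test_sqi th th')+
 ultimately show "inner (cls (%s. indicator {..<0} s * Sph ph (- s) 0)) (cls (deriv th)) = - inner (- cls (%s. indicator {..<0} s * Cph ph (- s) 0)) (cls th)"
  by simp
qed

text \<open>The charge histories: \<open>a\<close> is continuously differentiable with compact support, \<open>b\<close> is its derivative and
  \<open>Q\<close> the weak derivative of \<open>b\<close>. By Huygens' principle \<open>E (tr t a)\<close> is the wave radiated up to time \<open>t\<close>.\<close>

definition hist :: "(real => real) => (real => real) => real l2 => bool" where
 "hist a b Q \<longleftrightarrow> (\<forall>s. (a has_real_derivative b s) (at s)) \<and> continuous_on UNIV b \<and>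
  (\<exists>R\<ge>0. \<forall>s. R < \<bar>s\<bar> --> a s = 0 \<and> b s = 0) \<and> wd1 (cls b) Q"

lemma histD:
 assumes "hist a b Q"
 shows "(a has_real_derivative b s) (at s)" "continuous_on UNIV a" "continuous_on UNIV b" "sqi a" "sqi b" "wd1 (cls b) Q"
  "wd1 (cls a) (cls b)"
proof -
 show d: "(a has_real_derivative b s) (at s)" for s using assms by (simp add: hist_def)
 show ca: "continuous_on UNIV a" by (intro DERIV_cont[OF d])
 show cb: "continuous_on UNIV b" using assms by (simp add: hist_def)
 obtain R where R: "R \<ge> 0" "!!s. R < \<bar>s\<bar> ==> a s = 0 \<and> b s = 0" using assms by (auto simp: hist_def)
 show sa: "sqi a" and sb: "sqi b" by (rule sqi_continuous_support[of _ R]; use R ca cb in simp)+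
 show "wd1 (cls b) Q" using assms by (simp add: hist_def)
 show "wd1 (cls a) (cls b)"
  unfolding wd1_def
 proof (intro allI impI)
  fix th :: "real => real" assume th: "test_fn th"
  note th' = test_deriv[OF th]
  show "inner (cls a) (cls (deriv th)) = - inner (cls b) (cls th)"
   unfolding inner_cls[OF sa test_sqi[OF th']] inner_cls[OF sb test_sqi[OF th]] by (rule C1_weak_derivative(1)[OF d cb th])
 qed
qed

lemma hist_shift:
 assumes h: "hist a b Q" shows "hist (%s. a (s + t)) (%s. b (s + t)) (tr t Q)"
 unfolding hist_def
proof (intro conjI allI)
 note H = histD[OF h]
 show "((%s. a (s + t)) has_real_derivative b (s + t)) (at s)" for s using H(1) by (simp add: DERIV_shift[symmetric])
 show "continuous_on UNIV (%s. b (s + t))" by (rule continuous_on_compose2[OF H(3)]) (auto intro!: continuous_intros)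
 obtain R where R: "R \<ge> 0" "!!s. R < \<bar>s\<bar> ==> a s = 0 \<and> b s = 0" using h by (auto simp: hist_def)
 show "\<exists>R\<ge>0. \<forall>s. R < \<bar>s\<bar> --> a (s + t) = 0 \<and> b (s + t) = 0"
  by (rule exI[of _ "R + \<bar>t\<bar>"]) (use R in auto)
 have "wd1 (tr t (cls b)) (tr t Q)"
  unfolding wd1_def
 proof (intro allI impI)
  fix th :: "real => real" assume th: "test_fn th"
  have tt: "test_fn (%x. th (x + - t))" by (rule test_translate[OF th])
  have "deriv (%x. th (x + - t)) = (%x. deriv th (x + - t))"
   by (rule ext, rule DERIV_imp_deriv) (use DERIV_shift[of th _ _ "- t"] DERIV_smooth[OF test_smooth[OF th]] in blast)
  then have "tr (- t) (cls (deriv th)) = cls (deriv (%x. th (x + - t)))" by (simp add: tr_cls test_deriv[OF th])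
  then show "inner (tr t (cls b)) (cls (deriv th)) = - inner (tr t Q) (cls th)"
   using H(6) tt by (simp add: wd1_def inner_tr_left[of t] tr_cls th)
 qed
 then show "wd1 (cls (%s. b (s + t))) (tr t Q)" by (simp add: tr_cls H(5))
qed

lemma hist_lin:
 assumes h: "hist a b Q" "hist a' b' Q'"
 shows "hist (%s. x * a s + y * a' s) (%s. x * b s + y * b' s) (x *R Q + y *R Q')"
 unfolding hist_def
proof (intro conjI allI)
 note H = histD[OF h(1)] and H' = histD[OF h(2)]
 show "((%s. x * a s + y * a' s) has_real_derivative x * b s + y * b' s) (at s)" for s by (intro DERIV_add DERIV_cmult H H')
 show "continuous_on UNIV (%s. x * b s + y * b' s)" by (intro continuous_intros H H')
 obtain R where R: "R \<ge> 0" "!!s. R < \<bar>s\<bar> ==> a s = 0 \<and> b s = 0" using h by (auto simp: hist_def)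
 obtain R' where R': "R' \<ge> 0" "!!s. R' < \<bar>s\<bar> ==> a' s = 0 \<and> b' s = 0" using h by (auto simp: hist_def)
 show "\<exists>R\<ge>0. \<forall>s. R < \<bar>s\<bar> --> x * a s + y * a' s = 0 \<and> x * b s + y * b' s = 0"
  by (rule exI[of _ "max R R'"]) (use R R' in auto)
 show "wd1 (cls (%s. x * b s + y * b' s)) (x *R Q + y *R Q')"
  using wd1_lin[OF H(6) H'(6), of x y] by (simp add: cls_add cls_scale sqi_scale H H')
qed

text \<open>Through \<open>inner_E\<close> this is integration by parts of
  \<open>a s * Cph ph (- s) 0\<close> over negative times. The boundary term at 0 is the point
  charge; the second derivative \<open>Q\<close> of the history is only weak and is reached by
  \<open>wd1_pair\<close>.\<close>

lemma hist_wlp: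
 assumes h: "hist a b Q" shows "wlp (E (cls a)) (a 0) (E Q)"
 unfolding wlp_def
proof (intro allI impI)
 fix ph :: "R3 => real" assume ph: "test_fn ph"
 note H = histD[OF h] and l = test_lapf[OF ph]
 note sn = sqi_half_neg[OF ph] sqi_half_neg[OF l]
 obtain R where R: "R \<ge> 0" "!!s. R < \<bar>s\<bar> ==> a s = 0 \<and> b s = 0" using h by (auto simp: hist_def)
 let ?f = "%s. b s * Cph ph (- s) 0 - a s * Sph (lapf ph) (- s) 0"
 have n: "(uminus has_real_derivative - 1) (at s)" for s :: real by (auto intro!: derivative_eq_intros)
 have d: "((%s. a s * Cph ph (- s) 0) has_real_derivative ?f s) (at s)" for s
  using DERIV_mult[OF H(1) DERIV_chain2[OF Cph_DERIV[OF ph, of 0] n], of s]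
  by (rule DERIV_cong) (simp add: algebra_simps)
 have c: "continuous_on UNIV ?f"
  by (intro continuous_intros H continuous_on_compose2[OF Sph0_continuous[OF l, of UNIV]] continuous_on_compose2[OF Cph0_continuous[OF ph, of UNIV]]) auto
 have "(LI s. indicator {..<0} s * ?f s) = a 0 * Cph ph (- 0) 0"
  by (rule LBINT_half_line(1)[OF d c, of "R + 1"]) (use R in auto)
 then have "(LI s. b s * (indicator {..<0} s * Cph ph (- s) 0) - a s * (indicator {..<0} s * Sph (lapf ph) (- s) 0)) = a 0 * ph 0"
  by (simp add: algebra_simps)
 moreover have "(LI s. b s * (indicator {..<0} s * Cph ph (- s) 0) - a s * (indicator {..<0} s * Sph (lapf ph) (- s) 0))
   = inner (cls b) (cls (%s. indicator {..<0} s * Cph ph (- s) 0)) - inner (cls a) (cls (%s. indicator {..<0} s * Sph (lapf ph) (- s) 0))"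
  unfolding inner_cls[OF H(5) sn(2)] inner_cls[OF H(4) sn(3)]
  by (rule Bochner_Integration.integral_diff) (intro sqi_mult_integrable sn H)+
 moreover have "inner (E Q) (cls ph) = inner (cls b) (cls (%s. indicator {..<0} s * Cph ph (- s) 0))"
  unfolding inner_E[OF ph] using wd1_pair[OF H(6) wd1_half[OF ph]] by simp
 ultimately show "inner (E (cls a)) (cls (lapf ph)) = inner (E Q) (cls ph) - a 0 * ph 0"
  unfolding inner_E[OF l] by simp
qed

text \<open>The field minus \<open>a 0 * Gr\<close> is the difference quotient of \<open>a\<close>
  at 0 with step \<open>- norm x\<close>, divided by -4 pi.\<close>

lemma hist_lim0:
 assumes h: "hist a b Q" shows "lim0 (%x. fn (E (cls a)) x - a 0 * Gr x) (- b 0 / (4 * pi))"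
proof (rule lim0_cong[OF lim0_tendsto])
 note H = histD[OF h]
 have "((%h. (a (0 + h) - a 0) / h) ---> b 0) (at 0)" using H(1)[of 0] by (simp add: DERIV_def)
 moreover have "filterlim (%x::R3. - norm x) (at 0) (at 0)"
  by (rule filterlim_atI) (auto intro!: tendsto_eq_intros simp: eventually_at_filter)
 ultimately have "((%x::R3. (a (0 + (- norm x)) - a 0) / (- norm x)) ---> b 0) (at 0)" by (rule filterlim_compose)
 then have "((%x::R3. - ((a (0 + (- norm x)) - a 0) / (- norm x)) / (4 * pi)) ---> - b 0 / (4 * pi)) (at 0)"
  by (intro tendsto_intros) auto
 then show "((%x. Ef a x - a 0 * Gr x) ---> - b 0 / (4 * pi)) (at 0)"
  by (rule Lim_transform_eventually) (auto simp: Ef_def Gr_def eventually_at_filter field_simps)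
 show "AE x in lborel. Ef a x - a 0 * Gr x = fn (E (cls a)) x - a 0 * Gr x"
  using fn_cls[OF sqi_Ef(1)[OF H(4)]] unfolding E_cls[OF H(4)] by eventually_elim simp
qed

text \<open>By \<open>sqi_Ef\<close> the squared norm of the field at time \<open>t\<close> is the
  integral of a^2 up to \<open>t\<close>, divided by 4 pi. Differentiate at time 0.\<close>

lemma hist_inner:
 assumes h: "hist a b Q" shows "inner (E (cls a)) (E (cls b)) = (a 0)^2 / (8 * pi)"
proof -
 note H = histD[OF h]
 obtain R where R: "R \<ge> 0" "!!s. R < \<bar>s\<bar> ==> a s = 0 \<and> b s = 0" using h by (auto simp: hist_def)
 have ca: "continuous_on UNIV (%s. (a s)^2)" by (intro continuous_intros H)
 obtain K where K: "!!s. (K has_real_derivative (a s)^2) (at s)" using antiderivative_continuous_real[OF ca] by blast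
 define Y where "Y t = inner (E (tr t (cls a))) (E (tr t (cls a)))" for t
 have Y: "Y t = (K t - K (- R - 1)) / (4 * pi)" if "\<bar>t\<bar> < 1" for t
 proof -
  have "Y t = (LI s. indicator {..<0} s * (a (s + t))^2) / (4 * pi)"
   unfolding Y_def tr_cls[OF H(4)] using norm_E_sq[OF sqi_translate[OF H(4), of t]] by (simp add: power2_norm_eq_inner)
  also have "(LI s. indicator {..<0} s * (a (s + t))^2) = (LI s. indicator {..<t} s * (a s)^2)"
   using lborel_integral_real_affine[of 1 "%s. indicator {..<t} s * (a s)^2" t] by (simp add: indicator_def add.commute)
  also have "... = K t - K (- R - 1)"
  proof (rule LBINT_continuous_support(1)[where F=K and f="%s. (a s)^2" and a="- R - 1" and b=t])
   show "AE s in lborel. s \<notin> {- R - 1..t} --> indicator {..<t} s * (a s)^2 = 0"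
    by (rule AE_I2) (use R that in "auto simp: indicator_def not_le")
   show "AE s in lborel. s \<in> {- R - 1..t} --> indicator {..<t} s * (a s)^2 = (a s)^2"
    using AE_lborel_singleton[of t] by eventually_elim (auto simp: indicator_def)
   show "(%s. indicator {..<t} s * (a s)^2) \<in> borel_measurable borel"
    using borel_measurable_continuous_onI[OF ca] by measurable
  qed (use K continuous_on_subset[OF ca] R that in auto)
  finally show ?thesis .
 qed
 have "(Y has_real_derivative (a 0)^2 / (4 * pi)) (at 0)"
 proof (rule has_field_derivative_transform_within_open[of "%t. (K t - K (- R - 1)) / (4 * pi)"])
  show "((%t. (K t - K (- R - 1)) / (4 * pi)) has_real_derivative (a 0)^2 / (4 * pi)) (at 0)"
   by (auto intro!: derivative_eq_intros K)
  show "open (ball (0::real) 1)" by simp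
 qed (use Y in auto)
 moreover have "(Y has_vector_derivative inner (E (tr 0 (cls a))) (E (tr 0 (cls b))) + inner (E (tr 0 (cls b))) (E (tr 0 (cls a)))) (at 0)"
  unfolding Y_def[abs_def] by (intro bounded_bilinear.has_vector_derivative[OF bounded_bilinear_inner] E_curve H)
 ultimately have "(a 0)^2 / (4 * pi) = 2 * inner (E (cls a)) (E (cls b))"
  using DERIV_unique by (fastforce simp: has_real_derivative_iff_has_vector_derivative[symmetric] inner_commute)
 then show ?thesis by (simp add: field_simps)
qed

text \<open>Two expressions for the inner product of \<open>E (cls a)\<close> and
  \<open>E Q\<close>: testing with approximations of the regular part gives a b / (4 pi) minus the
  squared gradient; differentiating \<open>hist_inner\<close> in time gives a b / (4 pi) minus the
  squared norm of \<open>E (cls b)\<close>.\<close>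

lemma hist_grad_norm:
 assumes h: "hist a b Q" and g: "wgr (E (cls a)) (a 0) g" shows "norm g = norm (E (cls b))"
proof -
 note H = histD[OF h]
 obtain th g' c where th: "dapprox (E (cls a)) (a 0) g' th" "(%n. cls (lapf (th n))) ----> E Q" "(%n. th n 0) ----> c"
  "lim0 (%x. fn (E (cls a)) x - a 0 * Gr x) c" by (rule structure_wlp[OF hist_wlp[OF h]]) blast
 have c: "c = - b 0 / (4 * pi)" by (rule lim0_unique[OF th(4) hist_lim0[OF h]])
 have g': "g' = g" by (rule wgr_unique[OF dapprox_wgr[OF th(1)] g])
 have t: "test_fn (th n)" "(%n. cgrad (th n)) ----> g" for n using th(1) by (simp_all add: dapprox_def g')
 have "(%n. inner (E (cls a)) (cls (lapf (th n)))) ----> inner (E (cls a)) (E Q)" by (intro tendsto_intros th)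
 moreover have "(%n. inner (E (cls a)) (cls (lapf (th n)))) ----> - a 0 * c - inner g g"
  unfolding wgr_lapf[OF g t(1)] by (intro tendsto_intros th t)
 ultimately have 1: "inner (E (cls a)) (E Q) = a 0 * b 0 / (4 * pi) - inner g g" using LIMSEQ_unique c by fastforce
 define Y where "Y t = inner (E (tr t (cls a))) (E (tr t (cls b)))" for t
 have "Y = (%t. (a t)^2 / (8 * pi))"
  unfolding Y_def using hist_inner[OF hist_shift[OF h]] by (simp add: fun_eq_iff tr_cls H)
 then have "(Y has_real_derivative a 0 * b 0 / (4 * pi)) (at 0)"
  by (auto intro!: derivative_eq_intros H(1) simp: field_simps)
 moreover have "(Y has_vector_derivative inner (E (tr 0 (cls a))) (E (tr 0 Q)) + inner (E (tr 0 (cls b))) (E (tr 0 (cls b)))) (at 0)"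
  unfolding Y_def[abs_def] by (intro bounded_bilinear.has_vector_derivative[OF bounded_bilinear_inner] E_curve H)
 ultimately have "a 0 * b 0 / (4 * pi) = inner (E (cls a)) (E Q) + inner (E (cls b)) (E (cls b))"
  using DERIV_unique by (fastforce simp: has_real_derivative_iff_has_vector_derivative[symmetric])
 then show ?thesis using 1 by (simp add: norm_eq_sqrt_inner)
qed

lemma difference_quotient:
 fixes f :: "real => 'b::real_normed_vector"
 assumes "(f has_vector_derivative D) (at x)"
 shows "((%h. inverse h *R (f (x + h) - f x)) ---> D) (at 0)"
proof -
 have "((%h. norm (f (x + h) - f x - h *R D) / norm h) ---> 0) (at 0)"
  using assms unfolding has_vector_derivative_def has_derivative_at by blast
 moreover have "\<forall>\<^sub>F h in at 0. norm (f (x + h) - f x - h *R D) / norm h = norm (inverse h *R (f (x + h) - f x) - D)"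
  unfolding eventually_at_filter
 proof (rule always_eventually, intro allI impI)
  fix h :: real assume "h \<noteq> 0"
  then have "inverse h *R (f (x + h) - f x) - D = inverse h *R (f (x + h) - f x - h *R D)" by (simp add: scaleR_diff_right)
  then show "norm (f (x + h) - f x - h *R D) / norm h = norm (inverse h *R (f (x + h) - f x) - D)" by (simp add: divide_inverse mult.commute)
 qed
 ultimately have "((%h. norm (inverse h *R (f (x + h) - f x) - D)) ---> 0) (at 0)" by (rule Lim_transform_eventually)
 then show ?thesis by (simp only: tendsto_norm_zero_iff LIM_zero_iff)
qed

lemma difference_quotient_sequence:
 fixes f :: "real => 'b::real_normed_vector"
 assumes "(f has_vector_derivative D) (at x)"
 shows "(%n. real (Suc n) *R (f (x + inverse (real (Suc n))) - f x)) ----> D"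
 using filterlim_compose[OF difference_quotient[OF assms] filterlim_atI[OF LIMSEQ_inverse_real_of_nat]]
 by (simp del: of_nat_Suc)

lemma cls_difference_quotient:
 fixes f :: "real => real"
 assumes f: "sqi f" shows "cls (%s. c * f (s + k) + - c * f s) = c *R (tr (0 + k) (cls f) - tr 0 (cls f))"
proof -
 have "cls (%s. c * f (s + k) - c * f s) = c *R (tr (0 + k) (cls f) - tr 0 (cls f))"
  by (simp add: f cls_diff cls_scale sqi_scale sqi_translate tr_cls scaleR_diff_right)
 then show ?thesis by simp
qed

text \<open>\<open>b\<close> has only a weak derivative and so is not treated as a history itself.
  Difference quotients of \<open>a\<close> are histories that converge to it, and
  \<open>hist_grad_norm\<close>, applied to their differences, makes the gradients of their fields
  Cauchy.\<close>

lemma hist_grad: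
 assumes h: "hist a b Q" obtains g where "wgr (E (cls b)) (b 0) g" "norm g \<le> norm Q"
proof -
 note H = histD[OF h]
 define k where "k n = inverse (real (Suc n))" for n
 define A where "A n s = real (Suc n) * a (s + k n) + - real (Suc n) * a s" for n s
 define B where "B n s = real (Suc n) * b (s + k n) + - real (Suc n) * b s" for n s
 define q where "q n = real (Suc n) *R tr (k n) Q + - real (Suc n) *R Q" for n
 have hn: "hist (A n) (B n) (q n)" for n
  unfolding A_def[abs_def] B_def[abs_def] q_def by (rule hist_lin[OF hist_shift[OF h] h])
 have cA: "cls (A n) = real (Suc n) *R (tr (0 + k n) (cls a) - tr 0 (cls a))" for n
  unfolding A_def[abs_def] by (rule cls_difference_quotient[OF H(4)])
 have cB: "cls (B n) = real (Suc n) *R (tr (0 + k n) (cls b) - tr 0 (cls b))" for n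
  unfolding B_def[abs_def] by (rule cls_difference_quotient[OF H(5)])
 have lA: "(%n. cls (A n)) ----> tr 0 (cls b)" unfolding cA k_def by (rule difference_quotient_sequence[OF tr_derivative[OF H(7)]])
 have lB: "(%n. cls (B n)) ----> tr 0 Q" unfolding cB k_def by (rule difference_quotient_sequence[OF tr_derivative[OF H(6)]])
 have l0: "(%n. A n 0) ----> b 0"
  using difference_quotient_sequence[of a "b 0" 0] H(1)[of 0]
  by (simp add: A_def k_def has_real_derivative_iff_has_vector_derivative right_diff_distrib del: of_nat_Suc)
 have "\<exists>g. wgr (E (cls (A n))) (A n 0) g" for n by (rule structure_wlp[OF hist_wlp[OF hn[of n]]]) (use dapprox_wgr in blast)
 then obtain g where g: "!!n. wgr (E (cls (A n))) (A n 0) (g n)" by metis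
 have gd: "norm (g n - g m) \<le> norm (cls (B n) - cls (B m))" for n m
 proof -
  note hd = hist_lin[OF hn[of n] hn[of m], of 1 "- 1"]
  have "E (cls (%s. 1 * A n s + - 1 * A m s)) = E (cls (A n)) - E (cls (A m))"
   by (simp add: cls_diff histD(4)[OF hn] E_diff)
  then have "wgr (E (cls (%s. 1 * A n s + - 1 * A m s))) (1 * A n 0 + - 1 * A m 0) (g n - g m)"
   using wgr_diff[OF g[of n] g[of m]] by simp
  from hist_grad_norm[OF hd this] have "norm (g n - g m) = norm (E (cls (B n) - cls (B m)))"
   by (simp add: cls_diff histD(5)[OF hn])
  then show ?thesis using norm_E by simp
 qed
 have "Cauchy g"
  unfolding Cauchy_altdef2
 proof (intro allI impI)
  fix e :: real assume "e > 0"
  then obtain N where N: "\<forall>n\<ge>N. dist (cls (B n)) (cls (B N)) < e"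
   using LIMSEQ_imp_Cauchy[OF lB] unfolding Cauchy_altdef2 by blast
  have "dist (g n) (g N) < e" if "n \<ge> N" for n
   using le_less_trans[OF gd[of n N]] N that by (simp add: dist_norm)
  then show "\<exists>N. \<forall>n\<ge>N. dist (g n) (g N) < e" by blast
 qed
 then obtain g' where g': "g ----> g'" using Cauchy_convergent convergent_def by blast
 have "wgr (E (tr 0 (cls b))) (b 0) g'"
  by (rule wgr_closed[OF g bounded_linear.tendsto[OF bounded_linear_E lA] l0 g']) simp
 moreover have "norm g' \<le> norm (E (tr 0 Q))"
  by (rule LIMSEQ_le[OF tendsto_norm[OF g'] tendsto_norm[OF bounded_linear.tendsto[OF bounded_linear_E lB]]])
   (use hist_grad_norm[OF hn g] in auto)
 ultimately show thesis using that norm_E[of Q] by (simp add: order_trans)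
qed

text \<open>By uniqueness, the increment of the gradient between two times is the gradient for the
  difference of the shifted histories, which \<open>hist_grad\<close> bounds by the increment of the
  translates of \<open>Q\<close>.\<close>

lemma hist_grad_curve:
 assumes h: "hist a b Q"
 obtains g where "!!t. wgr (E (tr t (cls b))) (b t) (g t)" "continuous_on UNIV g"
proof -
 note H = histD[OF h]
 have "\<exists>g. wgr (E (tr t (cls b))) (b t) g" for t
  by (rule hist_grad[OF hist_shift[OF h, of t]]) (auto simp: tr_cls H)
 then obtain g where g: "!!t. wgr (E (tr t (cls b))) (b t) (g t)" by metis
 have gd: "norm (g t - g s) \<le> norm (tr t Q - tr s Q)" for s t
 proof -
  obtain g' where g': "wgr (E (cls (%r. 1 * b (r + t) + - 1 * b (r + s)))) (1 * b (0 + t) + - 1 * b (0 + s)) g'" "norm g' \<le> norm (1 *R tr t Q + - 1 *R tr s Q)"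
   by (rule hist_grad[OF hist_lin[OF hist_shift[OF h, of t] hist_shift[OF h, of s], of 1 "- 1"]])
  have "wgr (E (tr t (cls b)) - E (tr s (cls b))) (b t - b s) g'"
   using g'(1) by (simp add: cls_diff sqi_translate H tr_cls E_diff)
  then have "g' = g t - g s" using wgr_unique[OF wgr_diff[OF g g]] by blast
  then show ?thesis using g'(2) by simp
 qed
 have "isCont g t" for t
 proof -
  have "((%s. tr s Q) ---> tr t Q) (at t)" using continuous_on_tr[of UNIV Q] by (simp add: continuous_on_def)
  then have "((%s. norm (tr s Q - tr t Q)) ---> 0) (at t)" by (simp add: tendsto_norm_zero_iff LIM_zero_iff)
  then have "((%s. g s - g t) ---> 0) (at t)" by (rule Lim_null_comparison[rotated]) (simp add: gd)
  then show ?thesis by (simp add: isCont_def LIM_zero_iff)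
 qed
 then have "continuous_on UNIV g" by (simp add: continuous_on_eq_continuous_at)
 then show thesis using that g by blast
qed

subsection \<open>The equation for the charge\<close>

lemma continuous_on_max0: "continuous_on UNIV f ==> continuous_on UNIV (%s::real. f (max s 0))"
 by (rule continuous_on_compose2[of UNIV f]) (auto intro!: continuous_intros)

text \<open>Picard iteration with an exponential weight. Freezing the right-hand side at negative
  times places the problem on the whole line, as bounded continuous functions and histories
  require.\<close>

lemma ode_lipschitz:
 fixes G lam :: "real => real"
 assumes lam: "continuous_on UNIV lam" and G: "!!x y. \<bar>G x - G y\<bar> \<le> L * \<bar>x - y\<bar>" "!!x. \<bar>G x\<bar> \<le> B" and L: "L > 0"
 obtains z where "!!t. (z has_real_derivative 4 * pi * (lam (max t 0) - G (z (max t 0)))) (at t)" "z 0 = z0"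
proof -
 have "continuous_on UNIV (%s. 4 * pi * lam s)" by (intro continuous_intros lam)
 then obtain P0 where P0: "!!s. (P0 has_real_derivative 4 * pi * lam s) (at s)" "P0 0 = 0" using antiderivative_continuous_real by metis
 define P where "P s = z0 + P0 s" for s
 have P: "(P has_real_derivative 4 * pi * lam s) (at s)" for s unfolding P_def by (auto intro!: derivative_eq_intros P0)
 have cP: "continuous_on A P" for A by (intro DERIV_cont[OF P])
 have cG: "continuous_on A G" for A
 proof -
  have "\<bar>L\<bar>-lipschitz_on A G" by (rule lipschitz_onI) (use G(1) L in "auto simp: dist_real_def")
  then show ?thesis by (rule lipschitz_on_continuous_on)
 qed
 have B0: "B \<ge> 0" using G(2)[of 0] by linarith
 \<comment> \<open>The right-hand side has Lipschitz constant 4 pi L and the weight exp (-w t)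
   divides it by \<open>w\<close>; this value gives the contraction constant 1/2.\<close>
 define w where "w = 8 * pi * L"
 have w: "w > 0" using L by (simp add: w_def)
 define f where "f Z s = - 4 * pi * G (P s + exp (w * s) * Z s)" for Z :: "real => real" and s
 define K where "K Z = (SOME k. (\<forall>s. (k has_real_derivative f Z s) (at s)) \<and> k 0 = 0)" for Z
 have K: "(K Z has_real_derivative f Z s) (at s)" "K Z 0 = 0" if "continuous_on UNIV Z" for Z s
 proof -
  have "continuous_on UNIV (f Z)"
   unfolding f_def[abs_def] by (intro continuous_intros continuous_on_compose2[OF cG[of UNIV]] cP that) auto
  then have "\<exists>k. (\<forall>s. (k has_real_derivative f Z s) (at s)) \<and> k 0 = 0" using antiderivative_continuous_real by metis
  then have "(\<forall>s. (K Z has_real_derivative f Z s) (at s)) \<and> K Z 0 = 0" unfolding K_def by (rule someI_ex)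
  then show "(K Z has_real_derivative f Z s) (at s)" "K Z 0 = 0" by auto
 qed
 \<comment> \<open>The Picard integral grows at most linearly because \<open>G\<close> is bounded,
   so its weighted form is bounded. The part \<open>P\<close> driven by \<open>lam\<close> is kept
   outside, as no growth bound on it is available.\<close>
 define \<Phi> where "\<Phi> Z t = exp (- w * max t 0) * K Z (max t 0)" for Z and t :: real
 have bc: "\<Phi> Z \<in> bcontfun" if Z: "continuous_on UNIV Z" for Z
 proof (rule bcontfun_normI)
  have "continuous_on UNIV (K Z)" by (intro DERIV_cont[OF K(1)[OF Z]])
  then show "continuous_on UNIV (\<Phi> Z)" unfolding \<Phi>_def by (intro continuous_on_mult continuous_on_max0) (intro continuous_intros)
  fix t :: real
  define \<tau> where "\<tau> = max t 0"
  have "norm (K Z \<tau> - K Z 0) \<le> 4 * pi * B * norm (\<tau> - 0)"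
   by (rule field_differentiable_bound[of UNIV]) (use K[OF Z] G(2) in "auto simp: f_def abs_mult")
  then have "\<bar>K Z \<tau>\<bar> \<le> 4 * pi * B * \<tau>" using K(2)[OF Z] by (simp add: \<tau>_def)
  moreover have "w * \<tau> \<le> exp (w * \<tau>)" using exp_ge_add_one_self[of "w * \<tau>"] by linarith
  ultimately have "w * \<bar>K Z \<tau>\<bar> \<le> w * (4 * pi * B * \<tau>)" "4 * pi * B * (w * \<tau>) \<le> 4 * pi * B * exp (w * \<tau>)"
   using B0 w by (intro mult_left_mono; simp)+
  then have "w * \<bar>K Z \<tau>\<bar> \<le> 4 * pi * B * exp (w * \<tau>)" by (simp only: ac_simps)
  then have "\<bar>K Z \<tau>\<bar> / exp (w * \<tau>) \<le> 4 * pi * B / w" using w by (simp add: field_simps)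
  then show "norm (\<Phi> Z t) \<le> 4 * pi * B / w" by (simp add: \<Phi>_def \<tau>_def[symmetric] abs_mult exp_minus field_simps)
 qed
 define T where "T Z = Bcontfun (\<Phi> (apply_bcontfun Z))" for Z :: "real \<Rightarrow>\<^sub>C real"
 have T: "apply_bcontfun (T Z) = \<Phi> (apply_bcontfun Z)" for Z unfolding T_def by (rule Bcontfun_inverse[OF bc]) simp
 have "dist (T Z) (T Z') \<le> 1 / 2 * dist Z Z'" for Z Z'
 proof (rule dist_bound)
  fix t :: real
  define \<tau> where "\<tau> = max t 0"
  define D where "D = dist Z Z'"
  let ?Z = "apply_bcontfun Z" and ?Z' = "apply_bcontfun Z'"
  note KZ = K[of ?Z, simplified] K[of ?Z', simplified]
  have df: "\<bar>f ?Z s - f ?Z' s\<bar> \<le> w / 2 * (exp (w * s) * D)" for s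
  proof -
   have "f ?Z s - f ?Z' s = - (4 * pi) * (G (P s + exp (w * s) * ?Z s) - G (P s + exp (w * s) * ?Z' s))"
    by (simp add: f_def right_diff_distrib)
   then have "\<bar>f ?Z s - f ?Z' s\<bar> = 4 * pi * \<bar>G (P s + exp (w * s) * ?Z s) - G (P s + exp (w * s) * ?Z' s)\<bar>"
    by (simp only: abs_mult abs_minus_cancel) simp
   also have "... \<le> 4 * pi * (L * \<bar>exp (w * s) * (?Z s - ?Z' s)\<bar>)"
    using G(1)[of "P s + exp (w * s) * ?Z s" "P s + exp (w * s) * ?Z' s"] by (simp add: right_diff_distrib)
   also have "... \<le> 4 * pi * (L * (exp (w * s) * D))"
    using dist_bounded[of Z s Z'] L by (intro mult_left_mono) (auto simp: abs_mult D_def dist_real_def)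
   also have "... = w / 2 * (exp (w * s) * D)" by (simp add: w_def ac_simps)
   finally show ?thesis .
  qed
  have "\<bar>K ?Z \<tau> - K ?Z' \<tau>\<bar> \<le> D / 2 * exp (w * \<tau>)"
  proof -
   have st: "D / 2 * exp (w * 0) - c * (K ?Z 0 - K ?Z' 0) \<le> D / 2 * exp (w * \<tau>) - c * (K ?Z \<tau> - K ?Z' \<tau>)" if c: "\<bar>c\<bar> = 1" for c
   proof (rule DERIV_nonneg_imp_nondecreasing[of 0 \<tau> "%s. D / 2 * exp (w * s) - c * (K ?Z s - K ?Z' s)"])
    fix s
    have d1: "((%s. D / 2 * exp (w * s) - c * (K ?Z s - K ?Z' s)) has_real_derivative D / 2 * (exp (w * s) * w) - c * (f ?Z s - f ?Z' s)) (at s)"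
     by (auto intro!: derivative_eq_intros KZ)
    have "c * (f ?Z s - f ?Z' s) \<le> \<bar>f ?Z s - f ?Z' s\<bar>" using abs_ge_self[of "c * (f ?Z s - f ?Z' s)"] c by (simp add: abs_mult)
    then have "c * (f ?Z s - f ?Z' s) \<le> w / 2 * (exp (w * s) * D)" using df[of s] by (rule order_trans)
    moreover have "w / 2 * (exp (w * s) * D) = D / 2 * (exp (w * s) * w)" by simp
    ultimately have "0 \<le> D / 2 * (exp (w * s) * w) - c * (f ?Z s - f ?Z' s)" by linarith
    then show "\<exists>y. ((%s. D / 2 * exp (w * s) - c * (K ?Z s - K ?Z' s)) has_real_derivative y) (at s) \<and> 0 \<le> y"
     using d1 by blast
   qed (simp add: \<tau>_def)
   have "0 \<le> D" by (simp add: D_def)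
   then show ?thesis using KZ(2,4) st[of 1] st[of "-1"] by (intro abs_leI) auto
  qed
  then have "exp (- w * \<tau>) * \<bar>K ?Z \<tau> - K ?Z' \<tau>\<bar> \<le> exp (- w * \<tau>) * (D / 2 * exp (w * \<tau>))" by (intro mult_left_mono) auto
  also have "... = 1 / 2 * D" by (simp add: exp_minus)
  finally show "dist (apply_bcontfun (T Z) t) (apply_bcontfun (T Z') t) \<le> 1 / 2 * dist Z Z'"
   unfolding T \<Phi>_def \<tau>_def[symmetric] D_def[symmetric] dist_real_def right_diff_distrib[symmetric] by (simp add: abs_mult)
 qed
 then have "\<exists>!Z. T Z = Z" by (intro banach_fix_type[of "1 / 2"]) auto
 then obtain Z where Z: "T Z = Z" by blast
 let ?Z = "apply_bcontfun Z"
 have Zc: "continuous_on UNIV ?Z" by simp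
 have ZK: "exp (w * s) * ?Z s = K ?Z s" if "s \<ge> 0" for s
  using fun_cong[OF T[of Z], of s] that unfolding Z \<Phi>_def by (simp add: max_def exp_minus)
 define y where "y s = P s + K ?Z s" for s
 have y: "(y has_real_derivative 4 * pi * (lam s - G (y s))) (at s)" if "s \<ge> 0" for s
  unfolding y_def by (rule DERIV_cong[OF DERIV_add[OF P K(1)[OF Zc]]]) (simp add: f_def ZK[OF that] right_diff_distrib)
 have cy: "continuous_on UNIV y" unfolding y_def
  by (intro continuous_on_add cP DERIV_cont[OF K(1)[OF Zc]])
 have "continuous_on UNIV (%s. 4 * pi * (lam (max s 0) - G (y (max s 0))))"
  by (intro continuous_on_mult_left continuous_on_diff continuous_on_max0[OF lam] continuous_on_max0[of "%s. G (y s)"] continuous_on_compose2[OF cG cy]) auto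
 then obtain z1 where z1: "!!s. (z1 has_real_derivative 4 * pi * (lam (max s 0) - G (y (max s 0)))) (at s)" "z1 0 = 0"
  by (rule antiderivative_continuous_real[where a=0]) blast
 define z where "z s = z0 + z1 s" for s
 have z: "(z has_real_derivative 4 * pi * (lam (max s 0) - G (y (max s 0)))) (at s)" for s
  unfolding z_def by (auto intro!: derivative_eq_intros z1)
 have zy: "z s = y s" if "s \<ge> 0" for s
 proof (cases "s = 0")
  case True then show ?thesis using K(2)[OF Zc] by (simp add: z_def y_def P_def P0 z1)
 next
  case False
  have d: "((%s. z s - y s) has_real_derivative 0) (at r)" if "r \<ge> 0" for r
   using DERIV_diff[OF z y[OF that]] that by (simp add: max_def)
  have "z s - y s = z 0 - y 0"
  proof (rule DERIV_isconst2[of 0 s])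
   show "continuous_on {0..s} (%s. z s - y s)"
    by (auto intro!: continuous_at_imp_continuous_on DERIV_isCont[OF d])
  qed (use d False that in auto)
  then show ?thesis using K(2)[OF Zc] by (simp add: z_def y_def P_def P0 z1)
 qed
 show thesis
 proof (rule that)
  show "(z has_real_derivative 4 * pi * (lam (max t 0) - G (z (max t 0)))) (at t)" for t using z[of t] zy[of "max t 0"] by simp
  show "z 0 = z0" by (simp add: z_def z1)
 qed
qed

text \<open>The force is made Lipschitz by clipping its argument at \<open>M\<close>. While the
  solution stays inside, the completed square in the derivative of \<open>U\<close> along it keeps
  \<open>U\<close> below \<open>k\<close>; but \<open>U\<close> exceeds \<open>k\<close> at distance
  \<open>M\<close>, so the clipping never acts.\<close>

lemma charge_equation:
 fixes U F F' lam :: "real => real"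
 assumes U: "!!z. (U has_real_derivative F z) (at z)" and F: "!!z. (F has_real_derivative F' z) (at z)" and F': "continuous_on UNIV F'"
  and U_top: "filterlim U at_top at_top" and U_bot: "filterlim U at_top at_bot"
  and lam: "continuous_on UNIV lam" and C: "\<exists>C. \<forall>T\<ge>0. (LI s. indicator {0..T} s * (lam s)^2) \<le> C"
 obtains z where "!!t. (z has_real_derivative 4 * pi * (lam (max t 0) - F (z (max t 0)))) (at t)" "z 0 = z0"
proof -
 obtain C where C: "!!T. T \<ge> 0 ==> (LI s. indicator {0..T} s * (lam s)^2) \<le> C" using C by blast
 have cl: "continuous_on UNIV (%s. (lam s)^2)" by (intro continuous_intros lam)
 obtain H where H: "!!s. (H has_real_derivative (lam s)^2) (at s)" "H 0 = 0" using antiderivative_continuous_real[OF cl] by metis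
 have HC: "H T \<le> C" if "T \<ge> 0" for T
 proof -
  have "(LI s. indicator {0..T} s * (lam s)^2) = H T - H 0"
   by (rule LBINT_continuous_support(1)[where f="%s. (lam s)^2"])
    (use H that borel_measurable_continuous_onI[OF cl] in "auto intro: continuous_on_subset[OF cl]")
  then show ?thesis using C[OF that] H by simp
 qed
 \<comment> \<open>The level that \<open>U\<close> cannot exceed along the solution: the initial
   value plus pi times a bound for the integral of lam^2.\<close>
 define k where "k = U z0 + pi * C"
 obtain M1 where M1: "!!z. z \<ge> M1 ==> U z > k" using U_top unfolding filterlim_at_top_dense eventually_at_top_linorder by blast
 obtain M2 where M2: "!!z. z \<le> M2 ==> U z > k" using U_bot unfolding filterlim_at_top_dense eventually_at_bot_linorder by blast
 define M where "M = max \<bar>M1\<bar> \<bar>M2\<bar> + \<bar>z0\<bar> + 1"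
 have M: "M > 0" "\<bar>z0\<bar> < M" "!!z. \<bar>z\<bar> \<ge> M ==> U z > k"
 proof -
  show "U z > k" if "\<bar>z\<bar> \<ge> M" for z using M1[of z] M2[of z] that unfolding M_def by argo
 qed (auto simp: M_def)
 have "compact (F' ` {-M..M})" by (rule compact_continuous_image[OF continuous_on_subset[OF F']]) auto
 then obtain L0 where L0: "!!z. z \<in> {-M..M} ==> \<bar>F' z\<bar> \<le> L0" using compact_imp_bounded bounded_iff by (metis imageI real_norm_def)
 define L where "L = \<bar>L0\<bar> + 1"
 have Lip: "\<bar>F x - F y\<bar> \<le> L * \<bar>x - y\<bar>" if "x \<in> {-M..M}" "y \<in> {-M..M}" for x y
 proof -
  have "norm (F x - F y) \<le> L * norm (x - y)"
  proof (rule field_differentiable_bound[of "{-M..M}"])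
   show "(F has_real_derivative F' z) (at z within {-M..M})" for z using F by (rule has_field_derivative_at_within)
   show "norm (F' z) \<le> L" if "z \<in> {-M..M}" for z using L0[OF that] by (simp add: L_def)
  qed (use that in auto)
  then show ?thesis by simp
 qed
 define c where "c x = max (- M) (min M x)" for x
 have c: "c x \<in> {-M..M}" "\<bar>c x - c y\<bar> \<le> \<bar>x - y\<bar>" for x y using M(1) by (auto simp: c_def max_def min_def)
 obtain z where z: "!!t. (z has_real_derivative 4 * pi * (lam (max t 0) - F (c (z (max t 0))))) (at t)" "z 0 = z0"
 proof (rule ode_lipschitz[OF lam, of "%x. F (c x)" L "\<bar>F 0\<bar> + L * M" z0])
  show "\<bar>F (c x) - F (c y)\<bar> \<le> L * \<bar>x - y\<bar>" for x y
   using Lip[OF c(1)[of x] c(1)[of y]] mult_left_mono[OF c(2)[of x y], of L] by (simp add: L_def)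
  show "\<bar>F (c x)\<bar> \<le> \<bar>F 0\<bar> + L * M" for x
  proof -
   have "\<bar>F (c x) - F 0\<bar> \<le> L * \<bar>c x - 0\<bar>" by (rule Lip[OF c(1)]) (use M in auto)
   also have "... \<le> L * M" by (rule mult_left_mono) (use c(1)[of x] in "auto simp: L_def")
   finally show ?thesis by linarith
  qed
 qed (auto simp: L_def)
 have cz: "continuous_on A z" for A by (intro DERIV_cont[OF z(1)])
 have bd: "\<bar>z t\<bar> < M" if t: "t \<ge> 0" for t
 proof (rule ccontr)
  assume "\<not> \<bar>z t\<bar> < M"
  \<comment> \<open>Its least element is the first time at which \<open>z\<close> reaches the level
    \<open>M\<close>; before that time the clipped equation is the true one.\<close>
  define S where "S = {s\<in>{0..t}. M \<le> \<bar>z s\<bar>}"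
  have "closed ({0..t} \<inter> {s. M \<le> \<bar>z s\<bar>})" by (intro closed_Int closed_Collect_le continuous_intros cz)
  then have "closed S" by (simp add: S_def Int_def)
  then have "compact S" unfolding compact_eq_bounded_closed by (auto simp: S_def intro: bounded_subset[OF bounded_closed_interval[of 0 t]])
  moreover have "S \<noteq> {}" using \<open>\<not> \<bar>z t\<bar> < M\<close> t by (auto simp: S_def)
  ultimately obtain r where r: "r \<in> S" "!!s. s \<in> S ==> r \<le> s" using compact_attains_inf by metis
  have r0: "0 \<le> r" "M \<le> \<bar>z r\<bar>" "r \<le> t" using r(1) by (auto simp: S_def)
  have lt: "\<bar>z s\<bar> < M" if "0 \<le> s" "s < r" for s using r(2)[of s] that r0 by (force simp: S_def)
  have a: "U (z r) - pi * H r \<le> U (z 0) - pi * H 0"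
  proof (rule DERIV_nonpos_imp_decreasing_open[OF r0(1)])
   fix s assume s: "0 < s" "s < r"
   have cs: "c (z s) = z s" using lt[of s] s by (auto simp: c_def)
   have "((%s. U (z s) - pi * H s) has_real_derivative F (z s) * (4 * pi * (lam s - F (z s))) - pi * (lam s)^2) (at s)"
    by (intro DERIV_diff DERIV_cmult H DERIV_chain2[OF U]) (use z(1)[of s] s cs in "simp add: max_def")
   moreover have "F (z s) * (4 * pi * (lam s - F (z s))) - pi * (lam s)^2 = - pi * (lam s - 2 * F (z s))^2"
    by (simp add: power2_eq_square algebra_simps)
   ultimately show "\<exists>y. ((%s. U (z s) - pi * H s) has_real_derivative y) (at s) \<and> y \<le> 0"
    by (intro exI[of _ "- pi * (lam s - 2 * F (z s))^2"]) simp
  next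
   have cU: "continuous_on UNIV U" "continuous_on A H" for A by (intro DERIV_cont[OF U] DERIV_cont[OF H(1)])+
   show "continuous_on {0..r} (%s. U (z s) - pi * H s)" by (intro continuous_intros continuous_on_compose2[OF cU(1)] cz cU(2)) auto
  qed
  have "pi * H r \<le> pi * C" by (rule mult_left_mono[OF HC[OF r0(1)]]) simp
  then have "U (z r) \<le> k" using a[unfolded z(2) H(2)] unfolding k_def by linarith
  then show False using M(3)[OF r0(2)] by simp
 qed
 show thesis
 proof (rule that[of z])
  show "(z has_real_derivative 4 * pi * (lam (max t 0) - F (z (max t 0)))) (at t)" for t
   using z(1)[of t] bd[of "max t 0"] by (simp add: c_def)
 qed (rule z(2))
qed

text \<open>Cut-offs for the charge. The third property makes histories cut off at different
  \<open>T\<close> agree in their common past, so that the radiated field does not depend on the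
  choice of \<open>T\<close>.\<close>

lemma plateau:
 obtains ka :: "real => real => real" where "!!T. T \<ge> 0 ==> test_fn (ka T)" "!!T s. -1 \<le> s ==> s \<le> T ==> ka T s = 1"
  "!!T T' s. s \<le> T ==> s \<le> T' ==> ka T s = ka T' s"
proof -
 define f where "f x = flat 0 (x + 1) * flat 0 (1 - x)" for x :: real
 have sf: "smooth f" unfolding f_def[abs_def]
  by (intro smooth_mult smooth_affine[OF bounded_linear_ident smooth_flat, of 0 1] smooth_affine[OF bounded_linear_minus[OF bounded_linear_ident] smooth_flat, of 0 1, simplified])
 obtain K where K: "smooth K" "!!s. (K has_real_derivative f s) (at s)" "K (-1) = 0" using smooth_antiderivative[OF sf] by metis
 have fz: "f x = 0" if "x \<le> -1 \<or> 1 \<le> x" for x using that by (auto simp: f_def flat_def)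
 have fp: "f x \<ge> 0" "f 0 > 0" for x by (auto simp: f_def flat_def)
 have Kz: "(K has_real_derivative 0) (at x)" if "x \<le> -1 \<or> 1 \<le> x" for x using K(2)[of x] fz[OF that] by simp
 have cK: "continuous_on A K" for A by (intro DERIV_cont[OF K(2)])
 have K0: "K s = 0" if "s \<le> -1" for s
 proof (cases "s = -1")
  case False
  have "K (-1) = K s" by (rule DERIV_isconst_end[of s "-1"]) (use that False Kz cK in auto)
  then show ?thesis using K by simp
 qed (use K in simp)
 have K1: "K s = K 1" if "s \<ge> 1" for s
 proof (cases "s = 1")
  case False
  show ?thesis by (rule DERIV_isconst_end[of 1 s]) (use that False Kz cK in auto)
 qed simp
 have "K 1 > 0"
 proof -
  have m: "K x \<le> K y" if "x \<le> y" for x y by (rule DERIV_nonneg_imp_nondecreasing[OF that]) (use K fp in blast)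
  have "K 1 \<noteq> 0"
  proof
   assume "K 1 = 0"
   then have K00: "K s = 0" if "s \<in> ball 0 1" for s using m[of "-1" s] m[of s 1] K(3) that by (intro antisym) auto
   have "(K has_real_derivative 0) (at 0)"
    by (rule has_field_derivative_transform_within_open[of "%_. 0" 0 0 "ball 0 1"]) (simp_all add: K00)
   then have "f 0 = 0" by (rule DERIV_unique[OF K(2)])
   then show False using fp(2) by simp
  qed
  then show ?thesis using m[of "-1" 1] K(3) by simp
 qed
 note Kp = this
 \<comment> \<open>\<open>K\<close> rises from 0 to \<open>K 1\<close> between -1 and 1. The factor
   containing \<open>T\<close> is constant for s up to T + 1, whence the agreement of different
   cut-offs.\<close>
 define ka where "ka T s = K (s + 2) * K (T + 2 - s) / (K 1)^2" for T s :: real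
 show thesis
 proof (rule that)
  show "test_fn (ka T)" if "T \<ge> 0" for T
  proof (rule test_fnI)
   have "smooth (%s. K (s + 2))" using smooth_affine[OF bounded_linear_ident K(1), of 2] by simp
   moreover have "smooth (%s. K (- s + (T + 2)))" using smooth_affine[OF bounded_linear_minus[OF bounded_linear_ident] K(1), of "T + 2"] by simp
   ultimately have "smooth (%s. 1 / (K 1)^2 * (K (s + 2) * K (- s + (T + 2))))" by (intro smooth_cmult smooth_mult)
   then show "smooth (ka T)" unfolding ka_def[abs_def] by (simp add: add.commute algebra_simps)
   show "norm s \<le> T + 3" if "ka T s \<noteq> 0" for s
   proof -
    have "\<not> s + 2 \<le> -1" "\<not> T + 2 - s \<le> -1" using that K0[of "s + 2"] K0[of "T + 2 - s"] unfolding ka_def by auto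
    then show ?thesis using \<open>T \<ge> 0\<close> by auto
   qed
  qed
  show "ka T s = 1" if "-1 \<le> s" "s \<le> T" for T s
   using that Kp by (simp add: ka_def K1[of "s + 2"] K1[of "T + 2 - s"] power2_eq_square)
  show "ka T s = ka T' s" if "s \<le> T" "s \<le> T'" for T T' s
   using that by (simp add: ka_def K1[of "T + 2 - s"] K1[of "T' + 2 - s"])
 qed
qed

subsection \<open>Existence of strong solutions\<close>

text \<open>The wave equation is encoded in \<open>h\<close>, which is both the derivative of \<pi>
  and the Laplacian of the regular part of \<psi>. The derivatives are taken within \<open>I\<close>
  because solutions are first built on the half-line and then glued.\<close>

definition strong :: "(real => real) => real set => (real => R3 l2) => (real => R3 l2) => (real => R3 l2)
  => (real => (R3 l2)^3) => (real => real) => (real => real) => bool" where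
 "strong F I \<psi> \<pi> h p ze et \<longleftrightarrow> (\<forall>t\<in>I. (\<psi> has_vector_derivative \<pi> t) (at t within I) \<and> (\<pi> has_vector_derivative h t) (at t within I) \<and>
  wlp (\<psi> t) (ze t) (h t) \<and> wgr (\<pi> t) (et t) (p t) \<and> lim0 (%x. fn (\<psi> t) x - ze t * Gr x) (F (ze t))) \<and>
  continuous_on I h \<and> continuous_on I p \<and> continuous_on I ze \<and> continuous_on I et"

text \<open>The local form of \<open>wd1\<close>, for charges that need not decay: \<open>n\<close>
  is square integrable only after multiplication by a test function.\<close>

definition locw :: "(real => real) => (real => real) => bool" where
 "locw f n \<longleftrightarrow> continuous_on UNIV f \<and> (\<forall>ka. test_fn ka --> sqi (%s. n s * ka s) \<and>
  (LI s. f s * deriv ka s) = - (LI s. n s * ka s))"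

lemma sqi_continuous_test:
 fixes f :: "real => real"
 assumes f: "continuous_on UNIV f" and ka: "test_fn ka" shows "sqi (%s. f s * ka s)" "integrable lborel (%s. f s * ka s)"
proof -
 obtain R where R: "!!s. R < norm s ==> ka s = 0" using test_support[OF ka] by metis
 have c: "continuous_on UNIV (%s. f s * ka s)" by (intro continuous_intros f smooth_continuous test_smooth ka)
 show "sqi (%s. f s * ka s)" by (rule sqi_continuous_support[OF c, of R]) (simp add: R)
 show "integrable lborel (%s. f s * ka s)" by (rule integrable_continuous_support[OF c, of R]) (simp add: R)
qed

lemma locw_C1:
 assumes "!!s. (f has_real_derivative f' s) (at s)" "continuous_on UNIV f'"
 shows "locw f f'" and "locw (%s. f (max s 0)) (%s. indicator {0<..} s * f' s)"
proof -
 have cf: "continuous_on UNIV f" by (intro DERIV_cont[OF assms(1)])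
 show "locw f f'" using cf by (simp add: locw_def sqi_continuous_test(1)[OF assms(2)] C1_weak_derivative(1)[OF assms])
 have "sqi (%s. indicator {0<..} s * f' s * ka s)" if ka: "test_fn ka" for ka
  using sqi_half[OF sqi_continuous_test(1)[OF assms(2) ka]] by (simp add: mult.assoc)
 then show "locw (%s. f (max s 0)) (%s. indicator {0<..} s * f' s)"
  by (simp add: locw_def continuous_on_max0[OF cf] C1_weak_derivative(2)[OF assms])
qed

lemma locw_lin:
 assumes "locw f n" "locw g m" shows "locw (%s. c * (f s - g s)) (%s. c * (n s - m s))"
 unfolding locw_def
proof (intro conjI allI impI)
 have c: "continuous_on UNIV f" "continuous_on UNIV g" using assms by (auto simp: locw_def)
 show "continuous_on UNIV (%s. c * (f s - g s))" by (intro continuous_intros c)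
 fix ka :: "real => real" assume ka: "test_fn ka"
 have s: "sqi (%s. n s * ka s)" "sqi (%s. m s * ka s)" using assms ka by (auto simp: locw_def)
 show "sqi (%s. c * (n s - m s) * ka s)" using sqi_scale[OF sqi_diff[OF s], of c] by (simp add: algebra_simps)
 obtain R where R: "!!s. R < norm s ==> ka s = 0" using test_support[OF ka] by metis
 have i: "integrable lborel (%s. k s * ka s)" if "sqi (%s. k s * ka s)" for k
 proof -
  have "k s * ka s * (1 * indicator (cball 0 R) s) = k s * ka s" for s using R[of s] by (auto simp: indicator_def)
  then show ?thesis using sqi_mult_integrable[OF that sqi_indicator_cball[of 1 R]] by (simp only:)
 qed
 note j = sqi_continuous_test(2)[OF _ test_deriv[OF ka]]
 have "(LI s. c * (f s - g s) * deriv ka s) = c * ((LI s. f s * deriv ka s) - (LI s. g s * deriv ka s))"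
  by (simp add: j[OF c(1)] j[OF c(2)] mult.assoc left_diff_distrib)
 also have "... = - (c * ((LI s. n s * ka s) - (LI s. m s * ka s)))" using assms ka by (simp add: locw_def algebra_simps)
 also have "... = - (LI s. c * (n s - m s) * ka s)" by (simp add: i[OF s(1)] i[OF s(2)] mult.assoc left_diff_distrib)
 finally show "(LI s. c * (f s - g s) * deriv ka s) = - (LI s. c * (n s - m s) * ka s)" .
qed

lemma locw_wd1:
 assumes f: "locw f n" and ka: "test_fn ka" shows "wd1 (cls (%s. f s * ka s)) (cls (%s. n s * ka s + f s * deriv ka s))"
 unfolding wd1_def
proof (intro allI impI)
 fix th :: "real => real" assume th: "test_fn th"
 have c: "continuous_on UNIV f" and s: "sqi (%s. n s * ka s)" using f ka by (auto simp: locw_def)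
 note s1 = sqi_continuous_test(1)[OF c ka] and s2 = sqi_continuous_test(1)[OF c test_deriv[OF ka]]
 have t: "test_fn (%s. ka s * th s)" by (rule test_mult[OF ka test_smooth[OF th]])
 have d: "deriv (%s. ka s * th s) = (%s. deriv ka s * th s + deriv th s * ka s)"
  by (rule ext, rule DERIV_imp_deriv, intro DERIV_mult DERIV_smooth test_smooth ka th)
 have "(LI s. f s * deriv (%s. ka s * th s) s) = - (LI s. n s * (ka s * th s))" using f t unfolding locw_def by blast
 then have "(LI s. f s * deriv ka s * th s + f s * ka s * deriv th s) = - (LI s. n s * ka s * th s)"
  unfolding d by (simp add: algebra_simps)
 moreover have "(LI s. f s * deriv ka s * th s + f s * ka s * deriv th s) = inner (cls (%s. f s * deriv ka s)) (cls th) + inner (cls (%s. f s * ka s)) (cls (deriv th))"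
  unfolding inner_cls[OF s2 test_sqi[OF th]] inner_cls[OF s1 test_sqi[OF test_deriv[OF th]]]
  by (rule Bochner_Integration.integral_add) (intro sqi_mult_integrable s1 s2 test_sqi test_deriv th)+
 ultimately show "inner (cls (%s. f s * ka s)) (cls (deriv th)) = - inner (cls (%s. n s * ka s + f s * deriv ka s)) (cls th)"
  by (simp add: cls_add s s2 inner_add_left inner_cls[OF s] th)
qed

text \<open>A charge with locally H^1 derivative becomes an admissible history after cutting off;
  the weak second derivative comes from the product rule \<open>locw_wd1\<close>, applied to both
  terms of the first derivative.\<close>

lemma locw_hist:
 assumes z: "!!s. (z has_real_derivative y s) (at s)" and y: "locw y n" and ka: "test_fn ka"
 shows "\<exists>Q. hist (%s. z s * ka s) (%s. y s * ka s + z s * deriv ka s) Q"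
proof -
 have cy: "continuous_on UNIV y" using y by (simp add: locw_def)
 have cz: "continuous_on UNIV z" by (intro DERIV_cont[OF z])
 note ka' = test_deriv[OF ka]
 obtain R where R: "R > 0" "!!s. s \<le> - R \<or> R \<le> s ==> ka s = 0 \<and> deriv ka s = 0" using test_vanishes[OF ka] by metis
 have "wd1 (cls (%s. y s * ka s + z s * deriv ka s)) (1 *R cls (%s. n s * ka s + y s * deriv ka s) + 1 *R cls (%s. y s * deriv ka s + z s * deriv (deriv ka) s))"
  using wd1_lin[OF locw_wd1[OF y ka] locw_wd1[OF locw_C1(1)[OF z cy] ka'], of 1 1]
  by (simp add: cls_add sqi_continuous_test(1)[OF cy ka] sqi_continuous_test(1)[OF cz ka'])
 moreover have "((%s. z s * ka s) has_real_derivative y s * ka s + z s * deriv ka s) (at s)" for s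
  using DERIV_mult[OF z DERIV_smooth[OF test_smooth[OF ka]]] by (simp add: mult.commute)
 moreover have "continuous_on UNIV (%s. y s * ka s + z s * deriv ka s)" by (intro continuous_intros cy cz smooth_continuous test_smooth ka ka')
 moreover have "\<exists>R\<ge>0. \<forall>s. R < \<bar>s\<bar> --> z s * ka s = 0 \<and> y s * ka s + z s * deriv ka s = 0"
  by (rule exI[of _ R]) (use R in "auto simp: abs_if not_less split: if_splits")
 ultimately show ?thesis unfolding hist_def by blast
qed

lemma E_local:
 assumes "sqi p" "sqi q" "!!s. s < 0 ==> p s = q s" shows "E (cls p) = E (cls q)"
proof -
 have "(norm (E (cls (%s. p s - q s))))^2 = (LI (s::real). (0::real)) / (4 * pi)"
  unfolding norm_E_sq[OF sqi_diff[OF assms(1,2)]]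
  by (rule arg_cong[of _ _ "%x. x / (4 * pi)"], rule Bochner_Integration.integral_cong) (auto simp: indicator_def assms(3))
 then show ?thesis using assms by (simp add: cls_diff E_diff)
qed

text \<open>\<open>E\<close> sees only the past, which settles \<open>a\<close> and \<open>b\<close>
  pointwise. \<open>Q\<close> is a mere class, so its fields are compared as Laplacians of the same
  field, which are unique.\<close>

lemma hist_local:
 assumes h: "hist a b Q" "hist a' b' Q'" and e: "!!s. s \<le> t ==> a s = a' s"
 shows "E (tr t (cls a)) = E (tr t (cls a'))" "E (tr t (cls b)) = E (tr t (cls b'))" "E (tr t Q) = E (tr t Q')"
proof -
 note H = histD[OF h(1)] and H' = histD[OF h(2)]
 show 1: "E (tr t (cls a)) = E (tr t (cls a'))" unfolding tr_cls[OF H(4)] tr_cls[OF H'(4)]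
  by (rule E_local) (auto intro: sqi_translate H H' e)
 have "b s = b' s" if "s < t" for s
 proof (rule DERIV_unique[OF H(1)])
  show "(a has_real_derivative b' s) (at s)"
   by (rule has_field_derivative_transform_within_open[OF H'(1), where S="{..<t}"]) (use that e in auto)
 qed
 then show "E (tr t (cls b)) = E (tr t (cls b'))" unfolding tr_cls[OF H(5)] tr_cls[OF H'(5)]
  by (intro E_local) (auto intro: sqi_translate H H')
 show "E (tr t Q) = E (tr t Q')"
  using hist_wlp[OF hist_shift[OF h(1), of t]] hist_wlp[OF hist_shift[OF h(2), of t]] e[of t] 1
  by (intro wlp_unique[of "E (tr t (cls a))" "a t"]) (simp_all add: tr_cls H H')
qed

lemma lim0_add: assumes "lim0 f c" "lim0 g d" shows "lim0 (%x. f x + g x) (c + d)"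
proof -
 have "lim0 (%x. 0) 0" by (rule lim0_tendsto) simp
 from lim0_diff[OF assms(1) lim0_diff[OF this assms(2)]] show ?thesis by simp
qed

lemma strong_forward:
 fixes U F F' :: "real => real"
 assumes U: "!!z. (U has_real_derivative F z) (at z)" and F: "!!z. (F has_real_derivative F' z) (at z)" and F': "continuous_on UNIV F'"
  and U_top: "filterlim U at_top at_top" and U_bot: "filterlim U at_top at_bot"
  and \<psi>0: "wlp \<psi>0 ze0 h0" and \<pi>0: "wgr \<pi>0 et0 p0" and bc: "lim0 (%x. fn \<psi>0 x - ze0 * Gr x) (F ze0)"
 obtains \<psi> \<pi> h p ze et where "strong F {0..} \<psi> \<pi> h p ze et" "\<psi> 0 = \<psi>0" "\<pi> 0 = \<pi>0"
proof -
 obtain ka :: "real => real => real" where ka: "!!T. T \<ge> 0 ==> test_fn (ka T)" "!!T s. -1 \<le> s ==> s \<le> T ==> ka T s = 1"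
  "!!T T' s. s \<le> T ==> s \<le> T' ==> ka T s = ka T' s" by (rule plateau) blast
 have dka: "deriv (ka T) s = 0" if "-1 < s" "s < T" for T s
  by (rule DERIV_imp_deriv, rule has_field_derivative_transform_within_open[of "%_. 1" 0 s "{-1<..<T}"]) (use that ka(2) in auto)
 \<comment> \<open>The invented past of the charge. Its value and slope at time 0 are the charges of
   \<psi>0 and \<pi>0, so removing its radiated field leaves uncharged data for the free
   wave.\<close>
 define l where "l s = ze0 + et0 * s" for s
 have dl: "(l has_real_derivative et0) (at s)" for s unfolding l_def by (auto intro!: derivative_eq_intros)
 have "locw (%s. et0) (%s. 0)" by (rule locw_C1(1)) (auto intro!: derivative_eq_intros)
 from locw_hist[OF dl this ka(1)[of 1]] obtain Q0 where
  h0: "hist (%s. l s * ka 1 s) (%s. et0 * ka 1 s + l s * deriv (ka 1) s) Q0" by auto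
 define a0 where "a0 s = l s * ka 1 s" for s
 define b0 where "b0 s = et0 * ka 1 s + l s * deriv (ka 1) s" for s
 note h0 = h0[folded a0_def[abs_def] b0_def[abs_def]]
 have ab0: "a0 0 = ze0" "b0 0 = et0" using ka(2)[of 0 1] dka[of 0 1] by (auto simp: a0_def b0_def l_def)
 obtain g0 where g0: "wgr (E (cls b0)) (b0 0) g0" by (rule hist_grad[OF h0])
 have u0: "wlp (\<psi>0 - E (cls a0)) 0 (h0 - E Q0)" using wlp_diff[OF \<psi>0 hist_wlp[OF h0]] by (simp add: ab0)
 have u1: "wgr (\<pi>0 - E (cls b0)) 0 (p0 - g0)" using wgr_diff[OF \<pi>0 g0] by (simp add: ab0)
 obtain u v hu pu lam N where u: "u 0 = \<psi>0 - E (cls a0)" "v 0 = \<pi>0 - E (cls b0)"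
  "!!t. (u has_vector_derivative v t) (at t)" "!!t. (v has_vector_derivative hu t) (at t)"
  "continuous_on UNIV hu" "continuous_on UNIV pu" "continuous_on UNIV lam"
  "!!t. wlp (u t) 0 (hu t)" "!!t. wgr (v t) 0 (pu t)" "!!t. lim0 (fn (u t)) (lam t)"
  "!!ka. test_fn ka ==> (LI s. lam (max s 0) * deriv ka s) = - inner (N :: real l2) (cls ka)"
  "\<exists>C. \<forall>T\<ge>0. (LI s. indicator {0..T} s * (lam s)^2) \<le> C"
  by (rule free_solution[OF u0 u1]) blast
 have "lim0 (fn (u 0)) (F ze0 - (- b0 0 / (4 * pi)))"
  by (rule lim0_cong[OF lim0_diff[OF bc hist_lim0[OF h0]]]) (use fn_diff[of \<psi>0 "E (cls a0)"] in "auto simp: u(1) ab0")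
 \<comment> \<open>Compatibility at time 0: the boundary condition of the data minus the limit of
   the radiated field is the differential equation at 0. So the charge starts with slope
   \<open>et0\<close> and joins its past in a continuously differentiable way.\<close>
 then have lam0: "lam 0 = F ze0 + et0 / (4 * pi)" using lim0_unique[OF u(10)] by (fastforce simp: ab0)
 obtain z where z: "!!t. (z has_real_derivative 4 * pi * (lam (max t 0) - F (z (max t 0)))) (at t)" "z 0 = ze0"
  by (rule charge_equation[OF U F F' U_top U_bot u(7) u(12)]) blast
 define y where "y t = 4 * pi * (lam (max t 0) - F (z (max t 0)))" for t
 note zy = z(1)[folded y_def]
 have cz: "continuous_on A z" and cF: "continuous_on UNIV F" for A
  by (intro DERIV_cont[OF zy] DERIV_cont[OF F])+
 have cy: "continuous_on UNIV y" unfolding y_def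
  by (intro continuous_on_mult_left continuous_on_diff continuous_on_max0[OF u(7)] continuous_on_max0[of "%s. F (z s)"] continuous_on_compose2[OF cF cz]) auto
 have y0: "y s = et0" if "s \<le> 0" for s using that by (simp add: y_def z lam0 max_def)
 have zl: "z s = l s" if "s \<le> 0" for s
 proof (cases "s = 0")
  case False
  have d: "((%r. z r - l r) has_real_derivative 0) (at r)" if "r \<le> 0" for r using DERIV_diff[OF zy dl, of r] y0[OF that] by simp
  have "z 0 - l 0 = z s - l s"
   by (rule DERIV_isconst_end[of s 0]) (use that False d in "auto intro!: continuous_at_imp_continuous_on DERIV_isCont[OF d]")
  then show ?thesis using z(2) by (simp add: l_def)
 qed (simp add: z l_def)
 have "locw (%s. lam (max s 0)) (fn N)"
  unfolding locw_def
 proof (intro conjI allI impI)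
  fix ka :: "real => real" assume ka: "test_fn ka"
  obtain C where C: "!!x. \<bar>ka x\<bar> \<le> C" using test_bounded[OF ka] by metis
  note [measurable] = test_borel[OF ka]
  show "sqi (%s. fn N s * ka s)"
   by (rule sqi_bound[OF sqi_scale[OF sqi_fn[of N], of C]])
    (use sqi_borel[OF sqi_fn[of N]] C in "auto simp: abs_mult mult.commute intro!: AE_I2 mult_right_mono order_trans[OF C]")
  show "(LI s. lam (max s 0) * deriv ka s) = - (LI s. fn N s * ka s)"
   unfolding u(11)[OF ka] by (simp add: inner_fn ka)
 qed (rule continuous_on_max0[OF u(7)])
 moreover have "locw (%s. F (z (max s 0))) (%s. indicator {0<..} s * (F' (z s) * y s))"
  by (rule locw_C1(2)[of "%s. F (z s)"]) (rule DERIV_chain2[OF F zy], intro continuous_on_mult cy continuous_on_compose2[OF F' cz] subset_UNIV)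
 ultimately have wy: "locw y (%s. 4 * pi * (fn N s - indicator {0<..} s * (F' (z s) * y s)))" unfolding y_def[abs_def] by (rule locw_lin)
 \<comment> \<open>Histories must have compact support, while the charge has none; up to time
   \<open>T\<close> the cut-off does not affect the radiated field.\<close>
 define a where "a T s = z s * ka T s" for T s
 define b where "b T s = y s * ka T s + z s * deriv (ka T) s" for T s
 have "\<forall>T\<in>{0..}. \<exists>Q. hist (a T) (b T) Q" using locw_hist[OF zy wy ka(1)] by (simp add: a_def[abs_def] b_def[abs_def])
 then obtain Q where Q: "!!T. T \<ge> 0 ==> hist (a T) (b T) (Q T)" unfolding bchoice_iff by auto
 have "\<forall>T\<in>{0..}. \<exists>g. (\<forall>t. wgr (E (tr t (cls (b T)))) (b T t) (g t)) \<and> continuous_on UNIV g"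
 proof
  fix T :: real assume "T \<in> {0..}"
  then obtain g where "!!t. wgr (E (tr t (cls (b T)))) (b T t) (g t)" "continuous_on UNIV g" using hist_grad_curve[OF Q[of T]] by auto
  then show "\<exists>g. (\<forall>t. wgr (E (tr t (cls (b T)))) (b T t) (g t)) \<and> continuous_on UNIV g" by blast
 qed
 then obtain g where g: "!!T t. T \<ge> 0 ==> wgr (E (tr t (cls (b T)))) (b T t) (g T t)" "!!T. T \<ge> 0 ==> continuous_on UNIV (g T)"
  unfolding bchoice_iff by auto
 have ab: "a T s = z s" "b T s = y s" if "-1 < s" "s < T" for T s using that dka ka(2) by (auto simp: a_def b_def)
 have loc: "E (tr s (cls (a T))) = E (tr s (cls (a T')))" "E (tr s (cls (b T))) = E (tr s (cls (b T')))" "E (tr s (Q T)) = E (tr s (Q T'))"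
  if T: "T \<ge> 0" "T' \<ge> 0" "s \<le> T" "s \<le> T'" for s T T'
 proof -
  have e: "a T r = a T' r" if "r \<le> s" for r using ka(3)[of r T T'] that T by (simp add: a_def)
  show "E (tr s (cls (a T))) = E (tr s (cls (a T')))" "E (tr s (cls (b T))) = E (tr s (cls (b T')))" "E (tr s (Q T)) = E (tr s (Q T'))"
   by (rule hist_local[OF Q[OF T(1)] Q[OF T(2)] e]; assumption)+
 qed
 \<comment> \<open>At time \<open>t\<close> the cut-off at \<open>t + 1\<close> is used. The facts
   \<open>near\<close> replace it by a fixed one around \<open>t\<close>, so that the curves can be
   differentiated; they reach below 0, which gives two-sided derivatives there.\<close>
 define \<psi> where "\<psi> t = u t + E (tr t (cls (a (t + 1))))" for t
 define \<pi> where "\<pi> t = v t + E (tr t (cls (b (t + 1))))" for t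
 define h where "h t = hu t + E (tr t (Q (t + 1)))" for t
 define p where "p t = pu t + g (t + 1) t" for t
 have near: "\<psi> s = u s + E (tr s (cls (a (t + 1))))" "\<pi> s = v s + E (tr s (cls (b (t + 1))))" "h s = hu s + E (tr s (Q (t + 1)))"
  "p s = pu s + g (t + 1) s" if "t \<ge> 0" "s \<in> {-1<..<t + 1}" for s t
 proof -
  note L = loc[of "s + 1" "t + 1" s]
  show "\<psi> s = u s + E (tr s (cls (a (t + 1))))" "\<pi> s = v s + E (tr s (cls (b (t + 1))))" "h s = hu s + E (tr s (Q (t + 1)))"
   using L that by (simp_all add: \<psi>_def \<pi>_def h_def)
  have "g (s + 1) s = g (t + 1) s"
   using g(1)[of "s + 1" s] g(1)[of "t + 1" s] that L(2) ab(2)[of s "s + 1"] ab(2)[of s "t + 1"]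
   by (intro wgr_unique[of "E (tr s (cls (b (t + 1))))" "y s"]) auto
  then show "p s = pu s + g (t + 1) s" by (simp add: p_def)
 qed
 have nb: "t \<in> {-1<..<t + 1}" if "t \<ge> 0" for t :: real using that by simp
 have cont: "isCont f t" if "t \<ge> 0" "!!s. s \<in> {-1<..<t + 1} ==> f s = k s" "continuous_on UNIV k" for f k :: "real => 'z::real_normed_vector" and t
 proof -
  have "continuous_on {-1<..<t + 1} f" using continuous_on_subset[OF that(3)] by (subst continuous_on_cong[OF refl that(2)]) auto
  then show ?thesis using nb[OF that(1)] by (simp add: continuous_on_eq_continuous_at)
 qed
 have cE: "continuous_on UNIV (%s. E (tr s q))" for q by (rule bounded_linear.continuous_on[OF bounded_linear_E continuous_on_tr])
 show thesis
 proof (rule that[of \<psi> \<pi> h p z y])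
  have "isCont h t" if t: "t \<ge> 0" for t by (rule cont[OF t near(3)[OF t] continuous_on_add[OF u(5) cE]])
  then have "continuous_on {0..} h" by (auto intro: continuous_at_imp_continuous_on)
  moreover have "isCont p t" if t: "t \<ge> 0" for t by (rule cont[OF t near(4)[OF t] continuous_on_add[OF u(6) g(2)]]) (use t in auto)
  then have "continuous_on {0..} p" by (auto intro: continuous_at_imp_continuous_on)
  moreover have "(\<psi> has_vector_derivative \<pi> t) (at t within {0..}) \<and> (\<pi> has_vector_derivative h t) (at t within {0..}) \<and>
   wlp (\<psi> t) (z t) (h t) \<and> wgr (\<pi> t) (y t) (p t) \<and> lim0 (%x. fn (\<psi> t) x - z t * Gr x) (F (z t))" if t: "t \<in> {0..}" for t
  proof (intro conjI)
   have t0: "t \<ge> 0" using t by simp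
   then have hT: "hist (a (t + 1)) (b (t + 1)) (Q (t + 1))" by (intro Q) simp
   note H = histD[OF hT] and n = near[OF t0] and tn = nb[OF t0] and abt = ab[of t "t + 1"]
   note sh = hist_shift[OF hT, of t]
   show "(\<psi> has_vector_derivative \<pi> t) (at t within {0..})"
    by (rule has_vector_derivative_at_within, rule has_vector_derivative_transform_within_open[OF _ open_greaterThanLessThan tn n(1)[symmetric]])
     (auto simp: n(2)[OF tn] intro!: has_vector_derivative_add u E_curve H)
   show "(\<pi> has_vector_derivative h t) (at t within {0..})"
    by (rule has_vector_derivative_at_within, rule has_vector_derivative_transform_within_open[OF _ open_greaterThanLessThan tn n(2)[symmetric]])
     (auto simp: n(3)[OF tn] intro!: has_vector_derivative_add u E_curve H)
   show "wlp (\<psi> t) (z t) (h t)"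
    using wlp_lin[OF u(8)[of t] hist_wlp[OF sh], of 1 1] abt(1) t0 by (simp add: n(1,3)[OF tn] tr_cls H)
   show "wgr (\<pi> t) (y t) (p t)"
    using wgr_lin[OF u(9)[of t] g(1)[of "t + 1" t], of 1 1] abt(2) t0 by (simp add: n(2,4)[OF tn])
   have "lim0 (%x. fn (u t) x + (fn (E (tr t (cls (a (t + 1))))) x - z t * Gr x)) (lam t + - y t / (4 * pi))"
    using lim0_add[OF u(10)[of t] hist_lim0[OF sh]] abt t0 by (simp add: tr_cls H)
   then have "lim0 (%x. fn (\<psi> t) x - z t * Gr x) (lam t + - y t / (4 * pi))"
    by (rule lim0_cong) (use fn_add[of "u t" "E (tr t (cls (a (t + 1))))"] in "auto simp: n(1)[OF tn]")
   then show "lim0 (%x. fn (\<psi> t) x - z t * Gr x) (F (z t))" using t0 by (simp add: y_def max_def)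
  qed
  ultimately show "strong F {0..} \<psi> \<pi> h p z y" unfolding strong_def using continuous_on_subset[OF cy subset_UNIV] cz by blast
  have i: "E (tr 0 (cls a0)) = E (tr 0 (cls (a 1)))" "E (tr 0 (cls b0)) = E (tr 0 (cls (b 1)))"
   by (rule hist_local[OF h0 Q[of 1]]; simp add: a0_def a_def zl)+
  then show "\<psi> 0 = \<psi>0" "\<pi> 0 = \<pi>0" by (simp_all add: \<psi>_def \<pi>_def u)
 qed
qed

lemma wlp_coef_unique: assumes "wlp \<psi> ze h" "wlp \<psi> ze' h'" shows "ze = ze'"
 by (rule structure_wlp[OF assms(1)], rule structure_wlp[OF assms(2)]) (use dapprox_wgr wgr_coef_unique in blast)

lemma derivative_reverse:
 assumes "(f has_vector_derivative f') (at (- t) within {0..})"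
 shows "((%t. f (- t)) has_vector_derivative - f') (at t within {..(0::real)})"
proof -
 have "(f \<circ> uminus has_vector_derivative (- 1) *R f') (at t within {..0})"
  by (rule vector_diff_chain_within) (use assms in "auto intro!: has_vector_derivative_at_within has_vector_derivative_uminus")
 then show ?thesis by (simp add: o_def)
qed

text \<open>Negative times come from a forward solution with reversed velocity. At time 0 both
  halves carry the same fields, so charges, Laplacian and gradient agree there by uniqueness, which
  makes the glued curves continuous.\<close>

lemma strong_glue:
 assumes s: "strong F {0..} \<psi> \<pi> h p ze et" and s': "strong F {0..} \<psi>' \<pi>' h' p' ze' et'" and 0: "\<psi> 0 = \<psi>' 0" "\<pi> 0 = - \<pi>' 0"
 shows "strong F UNIV (%t. if t \<in> {0..} then \<psi> t else \<psi>' (- t)) (%t. if t \<in> {0..} then \<pi> t else - \<pi>' (- t))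
  (%t. if t \<in> {0..} then h t else h' (- t)) (%t. if t \<in> {0..} then p t else - p' (- t))
  (%t. if t \<in> {0..} then ze t else ze' (- t)) (%t. if t \<in> {0..} then et t else - et' (- t))"
proof -
 note S = s[unfolded strong_def] and S' = s'[unfolded strong_def]
 have w1: "wlp (\<psi> 0) (ze 0) (h 0)" "wgr (\<pi> 0) (et 0) (p 0)" using S by auto
 have w2: "wlp (\<psi>' 0) (ze' 0) (h' 0)" "wgr (\<pi>' 0) (et' 0) (p' 0)" using S' by auto
 note w = w1(1) w2(1)[folded 0] w1(2) w2(2)
 have w': "wgr (\<pi> 0) (- et' 0) (- p' 0)" using wgr_lin[OF w(4) w(4), of "-1" 0] 0 by simp
 have ze: "ze 0 = ze' 0" by (rule wlp_coef_unique[OF w(1,2)])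
 have h: "h 0 = h' 0" using wlp_unique w(1,2) ze by metis
 have et: "et 0 = - et' 0" by (rule wgr_coef_unique[OF w(3) w'])
 have p: "p 0 = - p' 0" using wgr_unique w(3) w' et by metis
 have u: "{0..} \<union> {..0::real} = UNIV" "{0..} \<union> {0..} \<inter> {..0::real} = {0..}" "{..0} \<union> {0..} \<inter> {..0::real} = {..0}" by auto
 have C: "continuous_on UNIV (%t. if t \<in> {0..} then f t else g (- t))" if "continuous_on {0..} f" "continuous_on {0..} g" "f 0 = g 0"
  for f g :: "real => 'z::real_normed_vector"
  unfolding u(1)[symmetric]
  by (rule continuous_on_If[OF closed_atLeast closed_atMost that(1) continuous_on_compose2[OF that(2)]])
   (use that(3) in "auto intro!: continuous_intros simp: le_less")
 have D: "((%t. if t \<in> {0..} then f t else g (- t)) has_vector_derivative (if t \<in> {0..} then f' t else - g' (- t))) (at t)"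
  if "!!t. t \<in> {0..} ==> (f has_vector_derivative f' t) (at t within {0..})" "!!t. t \<in> {0..} ==> (g has_vector_derivative g' t) (at t within {0..})"
   "f 0 = g 0" "f' 0 = - g' 0" for f f' g g' :: "real => R3 l2" and t
 proof (rule has_vector_derivative_If_within_closures[where S="{0..}" and T="{..0}" and u=UNIV, unfolded closure_closed[OF closed_atLeast] closure_closed[OF closed_atMost] u])
  show "((%t. g (- t)) has_vector_derivative - g' (- t)) (at t within {..0})" if "t \<in> {..0}"
   by (rule derivative_reverse) (use that \<open>!!t. t \<in> {0..} ==> (g has_vector_derivative g' t) (at t within {0..})\<close> in auto)
  show "f t = g (- t)" "f' t = - g' (- t)" if "t \<in> {0..}" "t \<in> {..0}"
   using that \<open>f 0 = g 0\<close> \<open>f' 0 = - g' 0\<close> by auto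
 qed (use that u in auto)
 have n: "wgr (- \<pi>' s) (- et' s) (- p' s)" if "s \<ge> 0" for s using S' that wgr_lin[of "\<pi>' s" "et' s" "p' s" "\<pi>' s" "et' s" "p' s" "-1" 0] by simp
 have dn: "((%t. - \<pi>' t) has_vector_derivative - h' t) (at t within {0..})" if "t \<in> {0..}" for t
  using S' that by (auto intro: has_vector_derivative_minus)
 show ?thesis
  unfolding strong_def
 proof (intro conjI ballI)
  fix t :: real
  show "((%t. if t \<in> {0..} then \<psi> t else \<psi>' (- t)) has_vector_derivative (if t \<in> {0..} then \<pi> t else - \<pi>' (- t))) (at t)"
   by (rule D) (use S S' 0 in auto)
  show "((%t. if t \<in> {0..} then \<pi> t else - \<pi>' (- t)) has_vector_derivative (if t \<in> {0..} then h t else h' (- t))) (at t)"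
   using D[of \<pi> h "%t. - \<pi>' t" "%t. - h' t" t] S dn 0 h by auto
  show "wlp (if t \<in> {0..} then \<psi> t else \<psi>' (- t)) (if t \<in> {0..} then ze t else ze' (- t)) (if t \<in> {0..} then h t else h' (- t))" using S S' by simp
  show "wgr (if t \<in> {0..} then \<pi> t else - \<pi>' (- t)) (if t \<in> {0..} then et t else - et' (- t)) (if t \<in> {0..} then p t else - p' (- t))" using S n by simp
  show "lim0 (%x. fn (if t \<in> {0..} then \<psi> t else \<psi>' (- t)) x - (if t \<in> {0..} then ze t else ze' (- t)) * Gr x) (F (if t \<in> {0..} then ze t else ze' (- t)))"
   using S S' by simp
 next
  show "continuous_on UNIV (%t. if t \<in> {0..} then h t else h' (- t))" "continuous_on UNIV (%t. if t \<in> {0..} then ze t else ze' (- t))"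
   by (rule C; use S S' h ze in auto)+
  show "continuous_on UNIV (%t. if t \<in> {0..} then p t else - p' (- t))" "continuous_on UNIV (%t. if t \<in> {0..} then et t else - et' (- t))"
   by (rule C[of _ "%t. - p' t"] C[of _ "%t. - et' t"]; use S S' p et in "auto intro!: continuous_intros")+
 qed
qed

subsection \<open>Energy and uniqueness for strong solutions\<close>

lemma strongD:
 assumes "strong F UNIV \<psi> \<pi> h p ze et"
 shows "(\<psi> has_vector_derivative \<pi> t) (at t)" "(\<pi> has_vector_derivative h t) (at t)" "wlp (\<psi> t) (ze t) (h t)" "wgr (\<pi> t) (et t) (p t)"
  "lim0 (%x. fn (\<psi> t) x - ze t * Gr x) (F (ze t))"
  "continuous_on UNIV h" "continuous_on UNIV p" "continuous_on UNIV ze" "continuous_on UNIV et"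
 using assms by (auto simp: strong_def)

lemma wlp_gradient: assumes "wlp \<psi> ze h" obtains g where "wgr \<psi> ze g" "norm g \<le> Kreg * (norm \<psi> + \<bar>ze\<bar> + norm h)"
 by (rule structure_wlp[OF assms]) (use dapprox_wgr in blast)

text \<open>Against concentrated test functions, minus the pairing of \<psi> with the Laplacian
  converges to the charge, and its time derivative to the charge of \<pi>. The latter convergence is
  locally uniform because \<open>p\<close> is bounded on compact intervals.\<close>

lemma strong_charge_derivative:
 assumes s: "strong F UNIV \<psi> \<pi> h p ze et" shows "(ze has_real_derivative et t) (at t)"
proof -
 note S = strongD[OF s]
 obtain ph where ph: "!!n::nat. test_fn (ph n)" "!!n. ph n 0 = 1" "(%n. cgrad (ph n)) ----> 0" by (rule concentrated_test) blast
 have d: "((%t. - inner (\<psi> t) (cls (lapf (ph n)))) has_vector_derivative - inner (\<pi> t) (cls (lapf (ph n)))) (at t)" for n t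
  by (intro has_vector_derivative_minus bounded_linear.has_vector_derivative[OF bounded_linear_inner_left] S)
 have e: "- inner (\<pi> t) (cls (lapf (ph n))) = et t + inner (p t) (cgrad (ph n))" for n t using wgr_lapf[OF S(4) ph(1)] ph(2) by simp
 have l: "(%n. - inner (\<psi> t) (cls (lapf (ph n)))) ----> ze t" for t
 proof -
  obtain g where g: "wgr (\<psi> t) (ze t) g" by (rule wlp_gradient[OF S(3)])
  have "(%n. ze t + inner g (cgrad (ph n))) ----> ze t + inner g 0" by (intro tendsto_intros ph)
  then show ?thesis using wgr_lapf[OF g ph(1)] ph(2) by (simp add: add.commute)
 qed
 have "(ze has_vector_derivative et t) (at t)"
 proof (rule derivative_locally_uniform_limit[OF d l])
  fix T e0 :: real assume e0: "e0 > 0"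
  have "compact (p ` cball 0 T)" by (rule compact_continuous_image[OF continuous_on_subset[OF S(7)]]) auto
  then obtain B where B: "!!t. t \<in> cball 0 T ==> norm (p t) \<le> B" using compact_imp_bounded bounded_iff by (metis imageI)
  have "(%n. (\<bar>B\<bar> + 1) * norm (cgrad (ph n))) ----> (\<bar>B\<bar> + 1) * norm (0 :: (R3 l2)^3)" by (intro tendsto_intros ph)
  then have "\<forall>\<^sub>F n in sequentially. (\<bar>B\<bar> + 1) * norm (cgrad (ph n)) < e0" using e0 by (intro order_tendstoD(2)) auto
  then show "\<forall>\<^sub>F n in sequentially. \<forall>t\<in>ball 0 T. norm (- inner (\<pi> t) (cls (lapf (ph n))) - et t) < e0"
  proof eventually_elim
   case (elim n)
   have "norm (- inner (\<pi> t) (cls (lapf (ph n))) - et t) < e0" if "t \<in> ball 0 T" for t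
   proof -
    have "norm (- inner (\<pi> t) (cls (lapf (ph n))) - et t) \<le> norm (p t) * norm (cgrad (ph n))" unfolding e using Cauchy_Schwarz_ineq2 by simp
    also have "... \<le> (\<bar>B\<bar> + 1) * norm (cgrad (ph n))" by (rule mult_right_mono) (use B[of t] that in auto)
    finally show ?thesis using elim by linarith
   qed
   then show ?case by blast
  qed
 qed
 then show ?thesis by (simp add: has_real_derivative_iff_has_vector_derivative)
qed

text \<open>Approximate the second field by the functions of \<open>dapprox\<close> and apply
  \<open>wgr_lapf\<close> to the first. The boundary term is the charge of the first field times the
  limit at 0 of the regular part of the second.\<close>

lemma Green:
 assumes w: "wlp \<psi> ze h" "wlp \<psi>' ze' h'" and g: "wgr \<psi> ze g" "wgr \<psi>' ze' g'" and c: "lim0 (%x. fn \<psi>' x - ze' * Gr x) c'"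
 shows "inner \<psi> h' = - ze * c' - inner g g'"
proof -
 obtain th k c where th: "dapprox \<psi>' ze' k th" "(%n. cls (lapf (th n))) ----> h'" "(%n. th n 0) ----> c"
  "lim0 (%x. fn \<psi>' x - ze' * Gr x) c" by (rule structure_wlp[OF w(2)]) blast
 have c: "c = c'" by (rule lim0_unique[OF th(4) assms(5)])
 have k: "k = g'" by (rule wgr_unique[OF dapprox_wgr[OF th(1)] g(2)])
 have t: "test_fn (th n)" "(%n. cgrad (th n)) ----> g'" for n using th(1) by (simp_all add: dapprox_def k)
 have "(%n. inner \<psi> (cls (lapf (th n)))) ----> inner \<psi> h'" by (intro tendsto_intros th)
 moreover have "(%n. inner \<psi> (cls (lapf (th n)))) ----> - ze * c' - inner g g'"
  unfolding wgr_lapf[OF g(1) t(1)] c[symmetric] by (intro tendsto_intros th t)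
 ultimately show ?thesis using LIMSEQ_unique by blast
qed

text \<open>Differentiability of the gradient curve is not at hand, but its squared norm can be
  differentiated: \<open>Green\<close>, polarised between two times, expresses the increment of the
  square through those of \<psi> and of the charge.\<close>

lemma strong_energy:
 assumes s: "strong F UNIV \<psi> \<pi> h p ze et" and U: "!!z. (U has_real_derivative F z) (at z)" and cF: "continuous_on UNIV F"
  and g: "!!t. wgr (\<psi> t) (ze t) (g t)"
 shows "(norm (\<pi> t))^2 / 2 + (norm (g t))^2 / 2 + U (ze t) = (norm (\<pi> 0))^2 / 2 + (norm (g 0))^2 / 2 + U (ze 0)"
proof -
 note S = strongD[OF s] and dze = strong_charge_derivative[OF s]
 have G: "inner (\<psi> r) (h s) = - ze r * F (ze s) - inner (g r) (g s)" for r s by (rule Green[OF S(3,3) g g S(5)])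
 have gd: "((%t. (norm (g t))^2) has_real_derivative - et t * (2 * F (ze t)) - inner (\<pi> t) (2 *R h t)) (at t)" for t
 proof -
  have e: "((norm (g (t + k)))^2 - (norm (g t))^2) / k = - (inverse k *R (ze (t + k) - ze t)) * (F (ze (t + k)) + F (ze t))
    - inner (inverse k *R (\<psi> (t + k) - \<psi> t)) (h (t + k) + h t)" for k
  proof -
   have "(norm (g (t + k)))^2 - (norm (g t))^2 = - (ze (t + k) - ze t) * (F (ze (t + k)) + F (ze t)) - inner (\<psi> (t + k) - \<psi> t) (h (t + k) + h t)"
    by (simp add: power2_norm_eq_inner inner_diff_left inner_add_right G algebra_simps) (rule inner_commute)
   moreover have "(- a * c - b) / k = - (inverse k *R a) * c - inverse k * b" for a b c :: real by (simp add: divide_inverse algebra_simps)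
   ultimately show ?thesis by (simp only: inner_scaleR_left)
  qed
  have ch: "((%k. h (t + k)) ---> h t) (at 0)" and cz: "((%k. F (ze (t + k))) ---> F (ze t)) (at 0)"
   using S(6) continuous_on_compose2[OF cF S(8)] by (auto simp: continuous_on_eq_continuous_at isCont_def LIM_offset_zero_iff)
  have "((%k. ((norm (g (t + k)))^2 - (norm (g t))^2) / k) ---> - et t * (F (ze t) + F (ze t)) - inner (\<pi> t) (h t + h t)) (at 0)"
   unfolding e
   by (intro tendsto_intros ch cz difference_quotient S dze[unfolded has_real_derivative_iff_has_vector_derivative])
  then show ?thesis unfolding DERIV_def by (simp add: scaleR_2)
 qed
 have "((%t. inner (\<pi> t) (\<pi> t)) has_vector_derivative inner (\<pi> t) (h t) + inner (h t) (\<pi> t)) (at t)" for t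
  by (rule bounded_bilinear.has_vector_derivative[OF bounded_bilinear_inner S(2) S(2)])
 then have pd: "((%t. (norm (\<pi> t))^2) has_real_derivative inner (\<pi> t) (h t) + inner (h t) (\<pi> t)) (at t)" for t
  by (simp add: power2_norm_eq_inner has_real_derivative_iff_has_vector_derivative)
 have "((%t. (norm (\<pi> t))^2 / 2 + (norm (g t))^2 / 2 + U (ze t)) has_real_derivative 0) (at t)" for t
  by (rule DERIV_cong[OF DERIV_add[OF DERIV_add[OF DERIV_cdivide[OF pd] DERIV_cdivide[OF gd]] DERIV_chain2[OF U dze]]])
   (simp add: inner_commute field_simps)
 then show ?thesis using DERIV_isconst_all by blast
qed

lemma strong_reverse:
 assumes "strong F UNIV \<psi> \<pi> h p ze et"
 shows "strong F UNIV (%t. \<psi> (- t)) (%t. - \<pi> (- t)) (%t. h (- t)) (%t. - p (- t)) (%t. ze (- t)) (%t. - et (- t))"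
proof -
 note S = strongD[OF assms]
 have d: "((%t. f (- t)) has_vector_derivative - f' (- t)) (at t)" if "!!t. (f has_vector_derivative f' t) (at t)" for f f' :: "real => R3 l2" and t
  using vector_diff_chain_at[OF has_vector_derivative_uminus that, of t] by (simp add: o_def)
 have c: "continuous_on UNIV (%t. f (- t))" if "continuous_on UNIV f" for f :: "real => 'z::real_normed_vector"
  by (rule continuous_on_compose2[OF that]) (auto intro!: continuous_intros)
 have n: "wgr (- \<pi> s) (- et s) (- p s)" for s using wgr_lin[OF S(4) S(4), where a="-1" and b=0] by simp
 have "((%t. - \<pi> (- t)) has_vector_derivative h (- t)) (at t)" for t using has_vector_derivative_minus[OF d[OF S(2)]] by simp
 then show ?thesis
  unfolding strong_def using d[OF S(1)] S(3,5) n c[OF S(6)] c[OF S(8)] continuous_on_minus[OF c[OF S(7)]] continuous_on_minus[OF c[OF S(9)]] by simp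
qed

text \<open>Testing against the backward free solution \<open>Sph th (T - t)\<close> shows that a difference of two solutions with the same
  data is the retarded potential of the difference of their charges.\<close>

lemma duality:
 assumes d: "!!t. (\<psi> has_vector_derivative \<pi> t) (at t)" "!!t. (\<pi> has_vector_derivative h t) (at t)" and w: "!!t. wlp (\<psi> t) (ze t) (h t)"
  and c: "continuous_on UNIV ze" and 0: "\<psi> 0 = 0" "\<pi> 0 = 0" and T: "T \<ge> 0"
 shows "\<psi> T = E (tr T (cls (%s. indicator {0..T} s * ze s)))"
proof (rule l2_eqI_test)
 fix th :: "R3 => real" assume th: "test_fn th"
 define J where "J t = inner (\<pi> t) (cls (Sph th (T - t))) + inner (\<psi> t) (cls (Cph th (T - t)))" for t
 have r: "((%t. f (T - t)) has_vector_derivative - f') (at t)" if "(f has_vector_derivative f') (at (T - t))" for f :: "real => R3 l2" and f' t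
 proof -
  have "((%t. T - t) has_vector_derivative - 1) (at t)" unfolding has_real_derivative_iff_has_vector_derivative[symmetric] by (auto intro!: derivative_eq_intros)
  from vector_diff_chain_at[OF this that] show ?thesis by (simp add: o_def)
 qed
 have Jd: "(J has_real_derivative ze t * Sph th (T - t) 0) (at t)" for t
 proof -
  have "(J has_vector_derivative (inner (\<pi> t) (- cls (Cph th (T - t))) + inner (h t) (cls (Sph th (T - t))))
   + (inner (\<psi> t) (- cls (Sph (lapf th) (T - t))) + inner (\<pi> t) (cls (Cph th (T - t))))) (at t)"
   unfolding J_def by (intro has_vector_derivative_add bounded_bilinear.has_vector_derivative[OF bounded_bilinear_inner] d r Sph_curve th)
  moreover have "inner (\<psi> t) (cls (Sph (lapf th) (T - t))) = inner (h t) (cls (Sph th (T - t))) - ze t * Sph th (T - t) 0"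
   using w[of t] Sph_test[OF th, of "T - t"] unfolding wlp_def by (simp add: lapf_Sph[OF th, symmetric])
  ultimately show ?thesis by (simp add: has_real_derivative_iff_has_vector_derivative)
 qed
 have cf: "continuous_on UNIV (%t. ze t * Sph th (T - t) 0)"
  by (intro continuous_on_mult c continuous_on_compose2[OF Sph0_continuous[OF th, of UNIV]] continuous_intros) auto
 have "inner (\<psi> T) (cls th) = J T - J 0"
 proof -
  have "Sph th 0 = (%x. 0)" "Cph th 0 = th" by (simp_all add: fun_eq_iff)
  then show ?thesis using 0 by (simp add: J_def cls_zero)
 qed
 also have "... = (LI t. indicator {0..T} t * (ze t * Sph th (T - t) 0))"
  by (rule LBINT_continuous_support(1)[where f="%t. ze t * Sph th (T - t) 0", symmetric])
   (use Jd T borel_measurable_continuous_onI[OF cf] in "auto intro: continuous_on_subset[OF cf]")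
 also have "... = (LI t. (indicator {0..T} (t + T) * ze (t + T)) * (indicator {..<0} t * Sph th (- t) 0))"
 proof -
  have "(LI t. indicator {0..T} t * (ze t * Sph th (T - t) 0)) = (LI t. indicator {0..T} (T + t) * (ze (T + t) * Sph th (T - (T + t)) 0))"
   using lborel_integral_real_affine[of 1 "%t. indicator {0..T} t * (ze t * Sph th (T - t) 0)" T] by simp
  also have "... = (LI t. (indicator {0..T} (t + T) * ze (t + T)) * (indicator {..<0} t * Sph th (- t) 0))"
   by (rule Bochner_Integration.integral_cong[OF refl]) (auto simp: indicator_def add.commute not_less)
  finally show ?thesis .
 qed
 also have "... = inner (E (tr T (cls (%s. indicator {0..T} s * ze s)))) (cls th)"
  unfolding inner_E[OF th] tr_cls[OF sqi_indicator_continuous[OF c]]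
  by (rule inner_cls[symmetric]) (intro sqi_translate[OF sqi_indicator_continuous[OF c]] sqi_half_neg th)+
 finally show "inner (\<psi> T) (cls th) = inner (E (tr T (cls (%s. indicator {0..T} s * ze s)))) (cls th)" .
qed

text \<open>By \<open>duality\<close> the difference is the retarded potential of \<open>ze\<close>
  cut off to [0, t]. The cut-off may jump, so \<open>hist_lim0\<close> is replaced by a difference
  quotient formed directly for norm x < t; the boundary conditions then give et = -4 pi (F ze1 - F
  ze2). With k = 4 pi L, exp (-2 k t) ze^2 does not increase and starts at 0.\<close>

lemma strong_unique_forward:
 assumes F: "!!z. (F has_real_derivative F' z) (at z)" and F': "continuous_on UNIV F'"
  and s: "strong F UNIV \<psi>1 \<pi>1 h1 p1 ze1 et1" "strong F UNIV \<psi>2 \<pi>2 h2 p2 ze2 et2" and 0: "\<psi>1 0 = \<psi>2 0" "\<pi>1 0 = \<pi>2 0" and T: "T \<ge> 0"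
 shows "\<psi>1 T = \<psi>2 T"
proof -
 note A = strongD[OF s(1)] and B = strongD[OF s(2)]
 note dA = strong_charge_derivative[OF s(1)] and dB = strong_charge_derivative[OF s(2)]
 define ze where "ze t = ze1 t - ze2 t" for t
 define et where "et t = et1 t - et2 t" for t
 have dze: "(ze has_real_derivative et t) (at t)" for t unfolding ze_def et_def by (intro DERIV_diff dA dB)
 have cze: "continuous_on A ze" for A by (intro DERIV_cont[OF dze])
 have rep: "\<psi>1 t - \<psi>2 t = cls (Ef (%s. indicator {0..t} (s + t) * ze (s + t)))" if "t \<ge> 0" for t
 proof -
  have "\<psi>1 t - \<psi>2 t = E (tr t (cls (%s. indicator {0..t} s * ze s)))"
   by (rule duality[where \<pi>="%t. \<pi>1 t - \<pi>2 t" and h="%t. h1 t - h2 t"])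
    (use that 0 cze in "auto simp: ze_def intro!: has_vector_derivative_diff A B wlp_diff")
  then show ?thesis by (simp only: tr_cls[OF sqi_indicator_continuous[OF cze]] E_cls[OF sqi_translate[OF sqi_indicator_continuous[OF cze]]])
 qed
 have et: "et t = - 4 * pi * (F (ze1 t) - F (ze2 t))" if t: "t > 0" for t
 proof -
  let ?q = "%s. indicator {0..t} (s + t) * ze (s + t)"
  have sq: "sqi ?q" by (rule sqi_translate[OF sqi_indicator_continuous[OF cze]])
  have l: "lim0 (%x. fn (\<psi>1 t - \<psi>2 t) x - ze t * Gr x) (F (ze1 t) - F (ze2 t))"
   by (rule lim0_cong[OF lim0_diff[OF A(5)[of t] B(5)[of t]]])
    (use fn_diff[of "\<psi>1 t" "\<psi>2 t"] in "auto simp: ze_def algebra_simps elim!: eventually_mono")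
  have "((%h. (ze (t + h) - ze t) / h) ---> et t) (at 0)" using dze[of t] by (simp add: DERIV_def)
  moreover have "filterlim (%x::R3. - norm x) (at 0) (at 0)"
   by (rule filterlim_atI) (auto intro!: tendsto_eq_intros simp: eventually_at_filter)
  ultimately have "((%x::R3. (ze (t + - norm x) - ze t) / (- norm x)) ---> et t) (at 0)" by (rule filterlim_compose)
  then have "((%x::R3. - ((ze (t + - norm x) - ze t) / (- norm x)) / (4 * pi)) ---> - et t / (4 * pi)) (at 0)" by (intro tendsto_intros) auto
  then have "((%x. Ef ?q x - ze t * Gr x) ---> - et t / (4 * pi)) (at 0)"
  proof (rule Lim_transform_eventually)
   show "\<forall>\<^sub>F x in at (0::R3). - ((ze (t + - norm x) - ze t) / (- norm x)) / (4 * pi) = Ef ?q x - ze t * Gr x"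
    unfolding eventually_at by (rule exI[of _ t]) (use t in "auto simp: Ef_def Gr_def field_simps")
  qed
  then have "lim0 (%x. fn (\<psi>1 t - \<psi>2 t) x - ze t * Gr x) (- et t / (4 * pi))"
   by (rule lim0_cong[OF lim0_tendsto]) (use t fn_cls[OF sqi_Ef(1)[OF sq]] in "auto simp: rep elim!: eventually_mono")
  from lim0_unique[OF l this] show ?thesis by (simp add: field_simps)
 qed
 have "compact (ze1 ` {0..T} \<union> ze2 ` {0..T})" by (intro compact_Un compact_continuous_image continuous_on_subset[OF A(8)] continuous_on_subset[OF B(8)]) auto
 then obtain M where M: "!!z. z \<in> ze1 ` {0..T} \<union> ze2 ` {0..T} ==> \<bar>z\<bar> \<le> M" using compact_imp_bounded bounded_iff by (metis real_norm_def)
 have "compact (F' ` {-M..M})" by (rule compact_continuous_image[OF continuous_on_subset[OF F']]) auto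
 then obtain L where L: "!!z. z \<in> {-M..M} ==> \<bar>F' z\<bar> \<le> L" using compact_imp_bounded bounded_iff by (metis imageI real_norm_def)
 have Lip: "\<bar>F (ze1 t) - F (ze2 t)\<bar> \<le> L * \<bar>ze t\<bar>" if "t \<in> {0..T}" for t
 proof -
  have "ze1 t \<in> {-M..M}" "ze2 t \<in> {-M..M}" using M[of "ze1 t"] M[of "ze2 t"] that by auto
  then have "norm (F (ze1 t) - F (ze2 t)) \<le> L * norm (ze1 t - ze2 t)"
   by (intro field_differentiable_bound[of "{-M..M}" F F']) (use F L in "auto intro: has_field_derivative_at_within")
  then show ?thesis by (simp add: ze_def)
 qed
 define k where "k = 4 * pi * L"
 have "ze r = 0" if r: "r \<in> {0..T}" for r
 proof -
  have "exp (- 2 * k * r) * (ze r)^2 \<le> exp (- 2 * k * 0) * (ze 0)^2"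
  proof (rule DERIV_nonpos_imp_decreasing_open[of 0 r "%t. exp (- 2 * k * t) * (ze t)^2"])
   fix t assume t: "0 < t" "t < r"
   have "ze t * et t \<le> \<bar>ze t * et t\<bar>" by (rule abs_ge_self)
   also have "... = \<bar>ze t\<bar> * (4 * pi * \<bar>F (ze1 t) - F (ze2 t)\<bar>)" unfolding et[OF t(1)] by (simp add: abs_mult)
   also have "... \<le> \<bar>ze t\<bar> * (4 * pi * (L * \<bar>ze t\<bar>))" using Lip[of t] t r by (intro mult_left_mono) auto
   also have "... = k * (\<bar>ze t\<bar> * \<bar>ze t\<bar>)" by (simp only: k_def ac_simps)
   also have "... = k * (ze t)^2" by (simp add: power2_eq_square)
   finally have le: "ze t * et t \<le> k * (ze t)^2" .
   have "((%t. exp (- 2 * k * t) * (ze t)^2) has_real_derivative exp (- 2 * k * t) * (2 * (ze t * et t - k * (ze t)^2))) (at t)"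
    by (auto intro!: derivative_eq_intros dze simp: algebra_simps power2_eq_square)
   moreover have "exp (- 2 * k * t) * (2 * (ze t * et t - k * (ze t)^2)) \<le> 0" using le by (intro mult_nonneg_nonpos) auto
   ultimately show "\<exists>y. ((%t. exp (- 2 * k * t) * (ze t)^2) has_real_derivative y) (at t) \<and> y \<le> 0" by blast
  qed (use r in "auto intro!: continuous_intros cze")
  moreover have "ze 0 = 0" using wlp_coef_unique[OF A(3)[of 0]] B(3)[of 0] 0 by (simp add: ze_def)
  ultimately have "exp (- 2 * k * r) * (ze r)^2 \<le> 0" by simp
  then show ?thesis by (simp add: mult_le_0_iff)
 qed
 then have "(%s. indicator {0..T} (s + T) * ze (s + T)) = (%s. 0)" by (auto simp: fun_eq_iff indicator_def)
 then have "\<psi>1 T - \<psi>2 T = 0" using rep[OF T] by (simp add: Ef_def[abs_def] cls_zero)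
 then show ?thesis by simp
qed

lemma strong_unique:
 assumes F: "!!z. (F has_real_derivative F' z) (at z)" "continuous_on UNIV F'"
  and s: "strong F UNIV \<psi>1 \<pi>1 h1 p1 ze1 et1" "strong F UNIV \<psi>2 \<pi>2 h2 p2 ze2 et2" and 0: "\<psi>1 0 = \<psi>2 0" "\<pi>1 0 = \<pi>2 0"
 shows "\<psi>1 t = \<psi>2 t" "\<pi>1 t = \<pi>2 t"
proof -
 have e: "\<psi>1 t = \<psi>2 t" for t
  using strong_unique_forward[OF F s 0, of t] strong_unique_forward[OF F strong_reverse[OF s(1)] strong_reverse[OF s(2)], of "- t"] 0 by (cases "t \<ge> 0") auto
 then show "\<psi>1 t = \<psi>2 t" .
 have "\<psi>1 = \<psi>2" using e by (rule ext)
 then show "\<pi>1 t = \<pi>2 t" using vector_derivative_unique_at strongD(1)[OF s(1)] strongD(1)[OF s(2)] by blast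
qed

subsection \<open>Strong and distributional solutions\<close>

lemma slice_test: assumes ph: "test_fn (ph :: R3 \<times> real => real)" shows "test_fn (%x. ph (x, t))"
proof -
 obtain R where R: "!!z. R < norm z ==> ph z = 0" using test_support[OF ph] by metis
 have "bounded_linear (%x::R3. (x, 0::real))" by (intro bounded_linear_Pair bounded_linear_ident bounded_linear_zero)
 from smooth_affine[OF this test_smooth[OF ph], of "(0, t)"] have "smooth (%x. ph (x, t))" by simp
 moreover have "norm x \<le> R" if "ph (x, t) \<noteq> 0" for x using R[of "(x, t)"] norm_fst_le[of x t] that by (meson not_le order_less_le_trans)
 ultimately show ?thesis by (rule test_fnI)
qed

lemma slice_support: assumes "test_fn (ph :: R3 \<times> real => real)" obtains R where "R > 0" "!!x t. R \<le> norm x \<or> R \<le> \<bar>t\<bar> ==> ph (x, t) = 0"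
proof -
 obtain R where R: "R > 0" "!!z. R < norm z ==> ph z = 0" using test_support[OF assms] by metis
 have "ph (x, t) = 0" if "R + 1 \<le> norm x \<or> R + 1 \<le> \<bar>t\<bar>" for x t
  using R(2)[of "(x, t)"] norm_fst_le[of x t] norm_snd_le[of t x] that by auto
 then show thesis using that[of "R + 1"] R by auto
qed

lemma dder_slice:
 assumes ph: "test_fn (ph :: R3 \<times> real => real)"
 shows "((%t. ph (x, t)) has_real_derivative dt ph (x, t)) (at t)" "dder (v, 0) ph (x, t) = dder v (%x. ph (x, t)) x"
proof -
 show "((%t. ph (x, t)) has_real_derivative dt ph (x, t)) (at t)"
  using dder_line[of ph "(x, 0)" t "(0, 1)"] test_differentiable[OF ph] by (simp add: dt_def)
 show "dder (v, 0) ph (x, t) = dder v (%x. ph (x, t)) x"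
  by (rule DERIV_unique[of "%s. ph (x + s *R v, t)" _ 0])
   (use dder_line[of ph "(x, t)" 0 "(v, 0)"] dder_line[of "%x. ph (x, t)" x 0 v] test_differentiable[OF ph] test_differentiable[OF slice_test[OF ph]] in simp_all)
qed

lemma lapx_slice: assumes ph: "test_fn ph" shows "lapx ph (x, t) = lapf (%x. ph (x, t)) x"
 unfolding lapx_def lapf_def dder_slice(2)[OF test_dder[OF ph]] unfolding dder_slice(2)[OF ph] by simp

lemma slice_curve:
 assumes ph: "test_fn ph" shows "((%t. cls (%x::R3. ph (x, t))) has_vector_derivative cls (%x. dt ph (x, t))) (at t)"
proof -
 have ph': "test_fn (dt ph)" using test_dder[OF ph] by (simp add: dt_def[abs_def])
 have ph'': "test_fn (dt (dt ph))" using test_dder[OF ph'] by (simp add: dt_def[of "dt ph", abs_def])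
 obtain C where C: "!!z. \<bar>dt (dt ph) z\<bar> \<le> C" using test_bounded[OF ph''] by metis
 obtain R where R: "!!x t. R \<le> norm x \<or> R \<le> \<bar>t\<bar> ==> ph (x, t) = 0" using slice_support[OF ph] by metis
 obtain R' where R': "!!x t. R' \<le> norm x \<or> R' \<le> \<bar>t\<bar> ==> dt ph (x, t) = 0" using slice_support[OF ph'] by metis
 show ?thesis
  by (rule has_vector_derivative_cls2[OF dder_slice(1)[OF ph] dder_slice(1)[OF ph'] C, of _ "max R R'"])
   (auto intro: R R' test_sqi slice_test ph ph')
qed

lemma LINT_derivative_0:
 fixes f f' :: "real => real"
 assumes f: "!!t. (f has_real_derivative f' t) (at t)" and c: "continuous_on UNIV f'" and z: "!!t. R \<le> \<bar>t\<bar> ==> f t = 0 \<and> f' t = 0" and R: "R > 0"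
 shows "(LI t. f' t) = 0"
proof -
 have "(LI t. f' t) = f R - f (- R)"
  by (rule LBINT_continuous_support(1)[where f=f'])
   (use f c z R borel_measurable_continuous_onI[OF c] in "auto intro!: AE_I2 continuous_on_subset[OF c]")
 then show ?thesis using z[of R] z[of "- R"] R by simp
qed

lemma regp_fun: "regp f = (%x. f x - coef f * Gr x)" by (rule ext) (simp add: regp_def)

text \<open>Continuity in \<open>Ddist\<close> thereby becomes continuity of each component in a
  normed space, which is how it is used in both directions below.\<close>

lemma Ddist_eq:
 assumes s: "sqi f" "sqi f'" "sqi k" "sqi k'" and w: "wlp (cls f) ze h" "wlp (cls f') ze' h'"
  and g: "wgr (cls f) ze g" "wgr (cls f') ze' g'" "wgr (cls k) et p" "wgr (cls k') et' p'"
 shows "Ddist (f, k) (f', k') = norm (cls f - cls f') + norm (g - g') + norm (h - h') + \<bar>ze - ze'\<bar> + norm (cls k - cls k') + norm (p - p') + \<bar>et - et'\<bar>"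
proof -
 have c: "coef f = ze" "coef f' = ze'" "coef k = et" "coef k' = et'" using s g coef_eq by auto
 have e: "(%x. regp a x - regp b x) = (%x. (a x - b x) - (coef a - coef b) * Gr x)" for a b by (simp add: regp_def fun_eq_iff algebra_simps)
 have "wgr (cls (%x. f x - f' x)) (ze - ze') (g - g')" "wlp (cls (%x. f x - f' x)) (ze - ze') (h - h')" "wgr (cls (%x. k x - k' x)) (et - et') (p - p')"
  unfolding cls_diff[OF s(1,2)] cls_diff[OF s(3,4)] by (intro wgr_diff wlp_diff w g)+
 then show ?thesis
  unfolding Ddist_def Let_def prod.case e c
  using grad_norm_reg[OF sqi_diff[OF s(1,2)]] lap_norm_reg[OF sqi_diff[OF s(1,2)]] grad_norm_reg[OF sqi_diff[OF s(3,4)]]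
  by (simp add: L2norm_norm sqi_diff s cls_diff)
qed

lemma strong_is_solution:
 assumes st: "strong F UNIV \<psi> \<pi> h p ze et" shows "is_solution F (%t. fn (\<psi> t)) (%t. fn (\<pi> t))"
proof -
 note S = strongD[OF st]
 have "\<forall>t. \<exists>g. wgr (\<psi> t) (ze t) g" using wlp_gradient[OF S(3)] by metis
 then obtain g where g: "!!t. wgr (\<psi> t) (ze t) (g t)" by metis
 have c\<psi>: "isCont \<psi> t" "isCont \<pi> t" "isCont h t" "isCont p t" "isCont ze t" "isCont et t" for t
  using has_vector_derivative_continuous[OF S(1)] has_vector_derivative_continuous[OF S(2)] S(6,7,8,9) by (auto simp: continuous_on_eq_continuous_at)
 have C: "continuous_on UNIV \<psi>" "continuous_on UNIV \<pi>" using c\<psi> by (auto simp: continuous_on_eq_continuous_at)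
 have D: "Ddist (fn (\<psi> s), fn (\<pi> s)) (fn (\<psi> t), fn (\<pi> t)) = norm (\<psi> s - \<psi> t) + norm (g s - g t) + norm (h s - h t) + \<bar>ze s - ze t\<bar>
   + norm (\<pi> s - \<pi> t) + norm (p s - p t) + \<bar>et s - et t\<bar>" for s t
  using Ddist_eq[of "fn (\<psi> s)" "fn (\<psi> t)" "fn (\<pi> s)" "fn (\<pi> t)" "ze s" "h s" "ze t" "h t" "g s" "g t"] S g by simp
 have lim: "((%s. norm (f s - f t)) ---> 0) (at t)" if "isCont f t" for f :: "real => 'z::real_normed_vector" and t
  using that by (simp add: isCont_def tendsto_norm_zero_iff LIM_zero_iff)
 \<comment> \<open>The gradient of the regular part of \<psi> is not a component of
   \<open>strong\<close>; its continuity follows from that of \<psi>, the charge and the Laplacian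
   by the bound with \<open>Kreg\<close>.\<close>
 have gl: "((%s. norm (g s - g t)) ---> 0) (at t)" for t
 proof (rule Lim_null_comparison)
  have "((%s. Kreg * (norm (\<psi> s - \<psi> t) + \<bar>ze s - ze t\<bar> + norm (h s - h t))) ---> Kreg * (0 + 0 + 0)) (at t)"
   by (intro tendsto_intros lim c\<psi> lim[of _ ze, unfolded real_norm_def])
  then show "((%s. Kreg * (norm (\<psi> s - \<psi> t) + \<bar>ze s - ze t\<bar> + norm (h s - h t))) ---> 0) (at t)" by simp
  have "norm (g s - g t) \<le> Kreg * (norm (\<psi> s - \<psi> t) + \<bar>ze s - ze t\<bar> + norm (h s - h t))" for s
   by (rule wlp_gradient[OF wlp_diff[OF S(3)[of s] S(3)[of t]]]) (metis wgr_unique wgr_diff g)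
  then show "\<forall>\<^sub>F s in at t. norm (norm (g s - g t)) \<le> Kreg * (norm (\<psi> s - \<psi> t) + \<bar>ze s - ze t\<bar> + norm (h s - h t))" by simp
 qed
 have coef: "coef (fn (\<psi> t)) = ze t" for t using coef_eq[OF sqi_fn[of "\<psi> t"], of "ze t" "g t"] g by simp
 show ?thesis
  unfolding is_solution_def
 proof (intro conjI allI impI)
  fix t
  have sp: "sqi (fn (\<psi> t))" "wgr (cls (fn (\<psi> t))) (ze t) (g t)" "wlp (cls (fn (\<psi> t))) (ze t) (h t)" "sqi (fn (\<pi> t))" "wgr (cls (fn (\<pi> t))) (et t) (p t)" using S g by simp_all
  show "inD F (fn (\<psi> t))"
   unfolding inD_def Hdot2_def
   by (rule conjI, simp add: L2_sqi, rule exI[of _ "%x. fn (\<psi> t) x - ze t * Gr x"], rule exI[of _ "ze t"])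
    (use Hdot1_reg[OF sp(1,2)] is_wlap_reg[OF sp(1,3)] S(5) in auto)
  show "inDdot (fn (\<pi> t))"
   unfolding inDdot_def
   by (rule conjI, simp add: L2_sqi, rule exI[of _ "%x. fn (\<pi> t) x - et t * Gr x"], rule exI[of _ "et t"])
    (use Hdot1_reg[OF sp(4,5)] in auto)
  have "((%s. Ddist (fn (\<psi> s), fn (\<pi> s)) (fn (\<psi> t), fn (\<pi> t))) ---> 0 + 0 + 0 + 0 + 0 + 0 + 0) (at t)"
   unfolding D by (intro tendsto_add lim c\<psi> gl lim[of _ ze, unfolded real_norm_def] lim[of _ et, unfolded real_norm_def])
  then show "((%s. Ddist (fn (\<psi> s), fn (\<pi> s)) (fn (\<psi> t), fn (\<pi> t))) ---> 0) (at t)" by simp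
 next
  fix ph :: "R3 \<times> real => real" assume ph: "test_fn ph"
  have ph': "test_fn (dt ph)" using test_dder[OF ph] by (simp add: dt_def[abs_def])
  have ph'': "test_fn (dt (dt ph))" using test_dder[OF ph'] by (simp add: dt_def[of "dt ph", abs_def])
  have dtt: "dtt ph = dt (dt ph)" by (rule ext) (simp add: dtt_def dt_def[abs_def])
  let ?P = "%ph t. cls (%x. ph (x, t))"
  note t = test_sqi[OF slice_test[OF ph]] test_sqi[OF slice_test[OF ph']] test_sqi[OF slice_test[OF ph'']]
  obtain R where R: "R > 0" "!!x t. R \<le> norm x \<or> R \<le> \<bar>t\<bar> ==> ph (x, t) = 0" using slice_support[OF ph] by metis
  obtain R' where R': "R' > 0" "!!x t. R' \<le> norm x \<or> R' \<le> \<bar>t\<bar> ==> dt ph (x, t) = 0" using slice_support[OF ph'] by metis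
  obtain R'' where R'': "R'' > 0" "!!x t. R'' \<le> norm x \<or> R'' \<le> \<bar>t\<bar> ==> dt (dt ph) (x, t) = 0" using slice_support[OF ph''] by metis
  define r where "r = max R (max R' R'')"
  have z: "?P ph t = 0" "?P (dt ph) t = 0" "?P (dt (dt ph)) t = 0" "ph (0, t) = 0" if "r \<le> \<bar>t\<bar>" for t
   using that R R' R'' by (simp_all add: r_def cls_zero)
  have cP: "continuous_on UNIV (?P th)" if "test_fn th" for th :: "R3 \<times> real => real"
   by (intro continuous_at_imp_continuous_on ballI has_vector_derivative_continuous[OF slice_curve[OF that]])
  have i: "integrable lborel f" if "continuous_on UNIV f" "!!t. r \<le> \<bar>t\<bar> ==> f t = 0" for f :: "real => real"
   by (rule integrable_continuous_support[OF that(1), of r]) (use that(2) in auto)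
  note d = slice_curve[OF ph] slice_curve[OF ph'] and bb = bounded_bilinear.has_vector_derivative[OF bounded_bilinear_inner]
  have r0: "r > 0" using R by (simp add: r_def)
  note cc = continuous_on_inner C S(6) cP ph ph' ph''
  have "(LI t. inner (\<psi> t) (?P (dt ph) t) + inner (\<pi> t) (?P ph t)) = 0"
  proof (rule LINT_derivative_0[of "%t. inner (\<psi> t) (?P ph t)" _ r])
   show "((%t. inner (\<psi> t) (?P ph t)) has_real_derivative inner (\<psi> t) (?P (dt ph) t) + inner (\<pi> t) (?P ph t)) (at t)" for t
    unfolding has_real_derivative_iff_has_vector_derivative by (rule bb[OF S(1) d(1)])
  qed (use r0 z in "auto intro!: continuous_on_add cc")
  moreover have "(LI t. inner (\<psi> t) (?P (dt ph) t) + inner (\<pi> t) (?P ph t)) = (LI t. inner (\<psi> t) (?P (dt ph) t)) + (LI t. inner (\<pi> t) (?P ph t))"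
   by (rule Bochner_Integration.integral_add; rule i; (intro cc)?) (simp_all add: z)
  ultimately show "(LI t. LI x. fn (\<psi> t) x * dt ph (x, t)) = - (LI t. LI x. fn (\<pi> t) x * ph (x, t))"
   by (simp add: inner_fn t)
  have J: "(LI t. inner (\<psi> t) (?P (dt (dt ph)) t) - inner (h t) (?P ph t)) = 0"
  proof (rule LINT_derivative_0[of "%t. inner (\<psi> t) (?P (dt ph) t) - inner (\<pi> t) (?P ph t)" _ r])
   show "((%t. inner (\<psi> t) (?P (dt ph) t) - inner (\<pi> t) (?P ph t)) has_real_derivative inner (\<psi> t) (?P (dt (dt ph)) t) - inner (h t) (?P ph t)) (at t)" for t
    using has_vector_derivative_diff[OF bb[OF S(1) d(2), of t] bb[OF S(2) d(1), of t]]
    unfolding has_real_derivative_iff_has_vector_derivative by simp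
  qed (use r0 z in "auto intro!: continuous_on_diff cc")
  have e: "(LI x. fn (\<psi> t) x * (dtt ph (x, t) - lapx ph (x, t))) = (inner (\<psi> t) (?P (dt (dt ph)) t) - inner (h t) (?P ph t)) + ze t * ph (0, t)" for t
  proof -
   note tl = test_sqi[OF test_lapf[OF slice_test[OF ph]]]
   have "(LI x. fn (\<psi> t) x * (dtt ph (x, t) - lapx ph (x, t))) = inner (\<psi> t) (cls (%x. dt (dt ph) (x, t) - lapf (%x. ph (x, t)) x))"
    unfolding dtt lapx_slice[OF ph] by (rule inner_fn[symmetric]) (intro sqi_diff t tl)
   also have "... = inner (\<psi> t) (?P (dt (dt ph)) t) - inner (\<psi> t) (cls (lapf (%x. ph (x, t))))" by (simp add: cls_diff t tl inner_diff_right)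
   also have "inner (\<psi> t) (cls (lapf (%x. ph (x, t)))) = inner (h t) (?P ph t) - ze t * ph (0, t)" using S(3)[of t] slice_test[OF ph] unfolding wlp_def by blast
   finally show ?thesis by simp
  qed
  have c0: "continuous_on UNIV (%t. ph (0, t))" by (intro DERIV_cont[OF dder_slice(1)[OF ph]])
  have "(LI t. (inner (\<psi> t) (?P (dt (dt ph)) t) - inner (h t) (?P ph t)) + ze t * ph (0, t))
   = (LI t. inner (\<psi> t) (?P (dt (dt ph)) t) - inner (h t) (?P ph t)) + (LI t. ze t * ph (0, t))"
   by (rule Bochner_Integration.integral_add; rule i; (intro continuous_on_diff continuous_on_mult S(8) c0 cc)?) (simp_all add: z)
  then show "(LI t. LI x. fn (\<psi> t) x * (dtt ph (x, t) - lapx ph (x, t))) = (LI t. coef (fn (\<psi> t)) * ph (0, t))"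
   unfolding e coef J by simp
 qed
qed

lemma inD_weak:
 assumes "inD F f" obtains h g where "sqi f" "wlp (cls f) (coef f) h" "wgr (cls f) (coef f) g" "lim0 (%x. fn (cls f) x - coef f * Gr x) (F (coef f))"
proof -
 obtain r ze k where r: "sqi f" "Hdot1 r" "is_wlap r k" "AE x in lborel. f x = r x + ze * Gr x" "lim0 r (F ze)"
  using assms by (auto simp: inD_def Hdot2_def L2_sqi)
 obtain g where g: "wgr (cls f) ze g" using Hdot1D[OF r(2,1,4)] by metis
 have c: "coef f = ze" by (rule coef_eq[OF r(1) g])
 have li: "loc_int r" using r(2) by (simp add: Hdot1_def)
 have "lim0 (%x. fn (cls f) x - ze * Gr x) (F ze)"
  by (rule lim0_cong[OF r(5)]) (use r(4) fn_cls[OF r(1)] in "eventually_elim, simp")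
 then show thesis using that r(1) wlp_of_wlap[OF li r(1,4,3)] g by (simp add: c)
qed

lemma inDdot_weak:
 assumes "inDdot f" obtains g where "sqi f" "wgr (cls f) (coef f) g"
proof -
 obtain r et where r: "sqi f" "Hdot1 r" "AE x in lborel. f x = r x + et * Gr x" using assms by (auto simp: inDdot_def L2_sqi)
 obtain g where g: "wgr (cls f) et g" using Hdot1D[OF r(2,1,3)] by metis
 then show thesis using that coef_eq[OF r(1) g] r(1) by simp
qed

text \<open>Subtract an antiderivative of \<open>k\<close>; by the lemma of du Bois-Reymond the rest
  is constant.\<close>

lemma derivative_if_weak:
 fixes f k :: "real => real"
 assumes f: "continuous_on UNIV f" and k: "continuous_on UNIV k"
  and w: "!!ka. test_fn ka ==> (LI s. f s * deriv ka s) = - (LI s. k s * ka s)"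
 shows "(f has_real_derivative k t) (at t)"
proof -
 obtain K where K: "!!s. (K has_real_derivative k s) (at s)" using antiderivative_continuous_real[OF k] by blast
 have cK: "continuous_on UNIV K" by (intro DERIV_cont[OF K])
 have "f s - K s = f 0 - K 0" for s
 proof (rule du_Bois_Reymond[of "%s. f s - K s"])
  show "continuous_on UNIV (%s. f s - K s)" by (intro continuous_intros f cK)
  fix ka :: "real => real" assume ka: "test_fn ka"
  show "(LI s. (f s - K s) * deriv ka s) = 0"
   unfolding left_diff_distrib using w[OF ka] C1_weak_derivative(1)[OF K k ka]
   by (simp add: sqi_continuous_test(2)[OF f test_deriv[OF ka]] sqi_continuous_test(2)[OF cK test_deriv[OF ka]])
 qed
 then have "f = (%s. K s + (f 0 - K 0))" by (simp add: fun_eq_iff algebra_simps)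
 moreover have "((%s. K s + (f 0 - K 0)) has_real_derivative k t) (at t)" by (auto intro!: derivative_eq_intros K)
 ultimately show ?thesis by simp
qed

lemma product_test:
 fixes th :: "R3 => real" and ka :: "real => real"
 assumes th: "test_fn th" and ka: "test_fn ka"
 defines "ph \<equiv> %z. th (fst z) * ka (snd z)"
 shows "test_fn ph" "dt ph = (%z. th (fst z) * deriv ka (snd z))"
proof -
 obtain R where R: "R > 0" "!!x. R < norm x ==> th x = 0" using test_support[OF th] by metis
 obtain R' where R': "R' > 0" "!!x. R' < norm x ==> ka x = 0" using test_support[OF ka] by metis
 have "smooth ph" unfolding ph_def
  using smooth_mult[OF smooth_affine[OF bounded_linear_fst test_smooth[OF th], of 0] smooth_affine[OF bounded_linear_snd test_smooth[OF ka], of 0]] by simp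
 moreover have "norm z \<le> R + R'" if "ph z \<noteq> 0" for z
 proof -
  have "norm (fst z) \<le> R" "norm (snd z) \<le> R'" using that R R' unfolding ph_def by (metis mult_zero_left mult_zero_right not_le)+
  then show ?thesis using norm_Pair_le[of "fst z" "snd z"] by simp
 qed
 ultimately show t: "test_fn ph" by (rule test_fnI)
 show "dt ph = (%z. th (fst z) * deriv ka (snd z))"
 proof
  fix z :: "R3 \<times> real"
  have "((%s. ph (fst z, s)) has_real_derivative th (fst z) * deriv ka (snd z)) (at (snd z))"
   unfolding ph_def by (simp add: DERIV_cmult DERIV_smooth test_smooth ka)
  from DERIV_unique[OF dder_slice(1)[OF t, of "fst z" "snd z"] this] show "dt ph z = th (fst z) * deriv ka (snd z)" by simp
 qed
qed

text \<open>\<open>Ddist\<close> dominates the increments of every component, so all are continuous.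
  Testing with products of a function of x and a function of t turns the distributional equations
  into weak derivatives in t, one for each test function of x; continuity upgrades these first to
  classical scalar derivatives and then to derivatives in L2.\<close>

lemma solution_strong:
 assumes sol: "is_solution F \<psi> \<pi>"
 obtains h p et where "!!t. sqi (\<psi> t)" "!!t. sqi (\<pi> t)"
  "strong F UNIV (%t. cls (\<psi> t)) (%t. cls (\<pi> t)) h p (%t. coef (\<psi> t)) et"
proof -
 have D: "inD F (\<psi> t)" "inDdot (\<pi> t)" for t using sol by (auto simp: is_solution_def)
 have "\<forall>t. \<exists>h g. sqi (\<psi> t) \<and> wlp (cls (\<psi> t)) (coef (\<psi> t)) h \<and> wgr (cls (\<psi> t)) (coef (\<psi> t)) g \<and> lim0 (%x. fn (cls (\<psi> t)) x - coef (\<psi> t) * Gr x) (F (coef (\<psi> t)))"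
  using inD_weak[OF D(1)] by metis
 then obtain h g where h: "!!t. sqi (\<psi> t)" "!!t. wlp (cls (\<psi> t)) (coef (\<psi> t)) (h t)" "!!t. wgr (cls (\<psi> t)) (coef (\<psi> t)) (g t)"
  "!!t. lim0 (%x. fn (cls (\<psi> t)) x - coef (\<psi> t) * Gr x) (F (coef (\<psi> t)))" by metis
 have "\<forall>t. \<exists>p. sqi (\<pi> t) \<and> wgr (cls (\<pi> t)) (coef (\<pi> t)) p" using inDdot_weak[OF D(2)] by metis
 then obtain p where p: "!!t. sqi (\<pi> t)" "!!t. wgr (cls (\<pi> t)) (coef (\<pi> t)) (p t)" by metis
 have E: "Ddist (\<psi> s, \<pi> s) (\<psi> t, \<pi> t) = norm (cls (\<psi> s) - cls (\<psi> t)) + norm (g s - g t) + norm (h s - h t) + \<bar>coef (\<psi> s) - coef (\<psi> t)\<bar>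
  + norm (cls (\<pi> s) - cls (\<pi> t)) + norm (p s - p t) + \<bar>coef (\<pi> s) - coef (\<pi> t)\<bar>" for s t
  by (rule Ddist_eq[OF h(1) h(1) p(1) p(1) h(2) h(2) h(3) h(3) p(2) p(2)])
 have c: "continuous_on UNIV f" if "!!s t. norm (f s - f t) \<le> Ddist (\<psi> s, \<pi> s) (\<psi> t, \<pi> t)" for f :: "real => 'z::real_normed_vector"
 proof (intro continuous_at_imp_continuous_on ballI)
  fix t :: real
  have "((%s. f s - f t) ---> 0) (at t)"
   by (rule Lim_null_comparison[of _ "%s. Ddist (\<psi> s, \<pi> s) (\<psi> t, \<pi> t)"]) (use that sol in "auto simp: is_solution_def")
  then show "isCont f t" by (simp add: isCont_def LIM_zero_iff)
 qed
 have C: "continuous_on UNIV (%t. cls (\<psi> t))" "continuous_on UNIV h" "continuous_on UNIV (%t. coef (\<psi> t))"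
  "continuous_on UNIV (%t. cls (\<pi> t))" "continuous_on UNIV p" "continuous_on UNIV (%t. coef (\<pi> t))"
  by (rule c; simp add: E)+
 have w1: "(LI t. inner (cls (\<psi> t)) (cls th) * deriv ka t) = - (LI t. inner (cls (\<pi> t)) (cls th) * ka t)"
  if th: "test_fn th" and ka: "test_fn ka" for th ka
 proof -
  let ?f = "%z. th (fst z) * ka (snd z)"
  have "(LI t. LI x. \<psi> t x * dt ?f (x, t)) = - (LI t. LI x. \<pi> t x * ?f (x, t))"
   using sol product_test(1)[OF th ka] unfolding is_solution_def by blast
  then show ?thesis unfolding product_test(2)[OF th ka] by (simp add: inner_cls h(1) p(1) th mult.assoc[symmetric])
 qed
 \<comment> \<open>The source on the right cancels the point charge in the weak Laplacian of \<psi>,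
   and \<open>w1\<close> with \<open>deriv ka\<close> trades one time derivative of \<psi> for
   \<pi>.\<close>
 have w2: "(LI t. inner (cls (\<pi> t)) (cls th) * deriv ka t) = - (LI t. inner (h t) (cls th) * ka t)"
  if th: "test_fn th" and ka: "test_fn ka" for th ka
 proof -
  let ?f = "%z. th (fst z) * ka (snd z)"
  note t = product_test[OF th ka] and ka' = test_deriv[OF ka] and l = test_sqi[OF test_lapf[OF th]]
  have dtt: "dtt ?f = (%z. th (fst z) * deriv (deriv ka) (snd z))"
   using product_test(2)[OF th ka'] by (simp add: dtt_def dt_def[abs_def] t(2)[unfolded dt_def[abs_def]])
  have lx: "lapx ?f (x, s) = lapf th x * ka s" for x s
   unfolding lapx_slice[OF t(1)] using lapf_cmult[OF test_smooth[OF th], of "ka s" x] by (simp add: mult.commute)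
  have "(LI s. LI x. \<psi> s x * (dtt ?f (x, s) - lapx ?f (x, s))) = (LI s. coef (\<psi> s) * ?f (0, s))"
   using sol t(1) unfolding is_solution_def by blast
  moreover have "(LI x. \<psi> s x * (dtt ?f (x, s) - lapx ?f (x, s))) = (inner (cls (\<psi> s)) (cls th) * deriv (deriv ka) s - inner (h s) (cls th) * ka s) + coef (\<psi> s) * th 0 * ka s" for s
  proof -
   have "(LI x. \<psi> s x * (dtt ?f (x, s) - lapx ?f (x, s))) = (LI x. (\<psi> s x * th x) * deriv (deriv ka) s - (\<psi> s x * lapf th x) * ka s)"
    unfolding dtt lx by (simp add: algebra_simps)
   also have "... = inner (cls (\<psi> s)) (cls th) * deriv (deriv ka) s - inner (cls (\<psi> s)) (cls (lapf th)) * ka s"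
    by (simp add: inner_cls h(1) th l sqi_mult_integrable)
   also have "inner (cls (\<psi> s)) (cls (lapf th)) = inner (h s) (cls th) - coef (\<psi> s) * th 0" using h(2)[of s] th unfolding wlp_def by blast
   finally show ?thesis by (simp add: algebra_simps)
  qed
  moreover have "(LI s. (inner (cls (\<psi> s)) (cls th) * deriv (deriv ka) s - inner (h s) (cls th) * ka s) + coef (\<psi> s) * th 0 * ka s)
   = (LI s. inner (cls (\<psi> s)) (cls th) * deriv (deriv ka) s) - (LI s. inner (h s) (cls th) * ka s) + (LI s. coef (\<psi> s) * th 0 * ka s)"
   using sqi_continuous_test(2)[OF continuous_on_inner[OF C(1) continuous_on_const] test_deriv[OF ka'], of "cls th"]
    sqi_continuous_test(2)[OF continuous_on_inner[OF C(2) continuous_on_const] ka, of "cls th"]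
    sqi_continuous_test(2)[OF continuous_on_mult[OF C(3) continuous_on_const] ka, of "th 0"] by simp
  ultimately have "(LI s. inner (cls (\<psi> s)) (cls th) * deriv (deriv ka) s) = (LI s. inner (h s) (cls th) * ka s)" by (simp add: mult.assoc)
  then show ?thesis using w1[OF th ka'] by simp
 qed
 have "((%t. cls (\<psi> t)) has_vector_derivative cls (\<pi> t)) (at t)" for t
  by (rule weak_vector_derivative[OF derivative_if_weak[OF _ _ w1] C(4)]) (auto intro!: continuous_on_inner C)
 moreover have "((%t. cls (\<pi> t)) has_vector_derivative h t) (at t)" for t
  by (rule weak_vector_derivative[OF derivative_if_weak[OF _ _ w2] C(2)]) (auto intro!: continuous_on_inner C)
 ultimately have "strong F UNIV (%t. cls (\<psi> t)) (%t. cls (\<pi> t)) h p (%t. coef (\<psi> t)) (%t. coef (\<pi> t))"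
  unfolding strong_def using h p C by simp
 then show thesis using that h(1) p(1) by blast
qed

theorem mainTheorem5:
  fixes U F F' :: "real \<Rightarrow> real" and \<psi>0 \<pi>0 :: "R3 \<Rightarrow> real"
  assumes U_deriv: "\<And>z. (U has_real_derivative F z) (at z)"
    and F_deriv: "\<And>z. (F has_real_derivative F' z) (at z)"
    and F'_cont: "continuous_on UNIV F'"
    and U_top: "filterlim U at_top at_top"
    and U_bot: "filterlim U at_top at_bot"
    and init_D: "inD F \<psi>0" and init_Ddot: "inDdot \<pi>0"
  shows
    "(\<exists>\<psi> \<pi>. is_solution F \<psi> \<pi> \<and> (AE x in lborel. \<psi> 0 x = \<psi>0 x) \<and> (AE x in lborel. \<pi> 0 x = \<pi>0 x))
   \<and> (\<forall>\<psi>1 \<pi>1 \<psi>2 \<pi>2. is_solution F \<psi>1 \<pi>1 \<and> is_solution F \<psi>2 \<pi>2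
        \<and> (AE x in lborel. \<psi>1 0 x = \<psi>0 x) \<and> (AE x in lborel. \<pi>1 0 x = \<pi>0 x)
        \<and> (AE x in lborel. \<psi>2 0 x = \<psi>0 x) \<and> (AE x in lborel. \<pi>2 0 x = \<pi>0 x)
        \<longrightarrow> (\<forall>t. (AE x in lborel. \<psi>1 t x = \<psi>2 t x) \<and> (AE x in lborel. \<pi>1 t x = \<pi>2 t x)))
   \<and> (\<forall>\<psi> \<pi>. is_solution F \<psi> \<pi> \<and> (AE x in lborel. \<psi> 0 x = \<psi>0 x) \<and> (AE x in lborel. \<pi> 0 x = \<pi>0 x)
        \<longrightarrow> (\<forall>t. energy U (\<psi> t) (\<pi> t) = energy U (\<psi> 0) (\<pi> 0))
          \<and> (\<exists>C. \<forall>t. \<bar>coef (\<psi> t)\<bar> \<le> C))"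
proof (intro conjI allI impI)
 obtain h g where i: "sqi \<psi>0" "wlp (cls \<psi>0) (coef \<psi>0) h" "lim0 (%x. fn (cls \<psi>0) x - coef \<psi>0 * Gr x) (F (coef \<psi>0))"
  using inD_weak[OF init_D] by metis
 obtain p where p: "sqi \<pi>0" "wgr (cls \<pi>0) (coef \<pi>0) p" using inDdot_weak[OF init_Ddot] by metis
 \<comment> \<open>Data with reversed velocity, for the half of the solution at negative
   times.\<close>
 have p': "wgr (- cls \<pi>0) (- coef \<pi>0) (- p)" using wgr_lin[OF p(2) p(2), where a="-1" and b=0] by simp
 obtain \<psi>a \<pi>a ha pa \<zeta>a \<eta>a where a: "strong F {0..} \<psi>a \<pi>a ha pa \<zeta>a \<eta>a" "\<psi>a 0 = cls \<psi>0" "\<pi>a 0 = cls \<pi>0"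
  by (rule strong_forward[OF U_deriv F_deriv F'_cont U_top U_bot i(2) p(2) i(3)]) blast
 obtain \<psi>b \<pi>b hb pb \<zeta>b \<eta>b where b: "strong F {0..} \<psi>b \<pi>b hb pb \<zeta>b \<eta>b" "\<psi>b 0 = cls \<psi>0" "\<pi>b 0 = - cls \<pi>0"
  by (rule strong_forward[OF U_deriv F_deriv F'_cont U_top U_bot i(2) p' i(3)]) blast
 let ?\<psi> = "%t. if t \<in> {0..} then \<psi>a t else \<psi>b (- t)" and ?\<pi> = "%t. if t \<in> {0..} then \<pi>a t else - \<pi>b (- t)"
 have "is_solution F (%t. fn (?\<psi> t)) (%t. fn (?\<pi> t))"
  by (rule strong_is_solution[OF strong_glue[OF a(1) b(1)]]) (simp_all add: a b)
 then show "\<exists>\<psi> \<pi>. is_solution F \<psi> \<pi> \<and> (AE x in lborel. \<psi> 0 x = \<psi>0 x) \<and> (AE x in lborel. \<pi> 0 x = \<pi>0 x)"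
  by (rule exI[of _ "%t. fn (?\<psi> t)", OF exI[of _ "%t. fn (?\<pi> t)"], OF conjI]) (simp add: a fn_cls i(1) p(1))
next
 fix \<psi>1 \<pi>1 \<psi>2 \<pi>2 and t :: real
 assume A: "is_solution F \<psi>1 \<pi>1 \<and> is_solution F \<psi>2 \<pi>2 \<and> (AE x in lborel. \<psi>1 0 x = \<psi>0 x) \<and> (AE x in lborel. \<pi>1 0 x = \<pi>0 x)
    \<and> (AE x in lborel. \<psi>2 0 x = \<psi>0 x) \<and> (AE x in lborel. \<pi>2 0 x = \<pi>0 x)"
 obtain h1 p1 \<eta>1 where 1: "!!t. sqi (\<psi>1 t)" "!!t. sqi (\<pi>1 t)" "strong F UNIV (%t. cls (\<psi>1 t)) (%t. cls (\<pi>1 t)) h1 p1 (%t. coef (\<psi>1 t)) \<eta>1"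
  using solution_strong A by metis
 obtain h2 p2 \<eta>2 where 2: "!!t. sqi (\<psi>2 t)" "!!t. sqi (\<pi>2 t)" "strong F UNIV (%t. cls (\<psi>2 t)) (%t. cls (\<pi>2 t)) h2 p2 (%t. coef (\<psi>2 t)) \<eta>2"
  using solution_strong A by metis
 have "AE x in lborel. \<psi>1 0 x = \<psi>2 0 x" "AE x in lborel. \<pi>1 0 x = \<pi>2 0 x" using A by (auto elim!: eventually_elim2)
 then have 0: "cls (\<psi>1 0) = cls (\<psi>2 0)" "cls (\<pi>1 0) = cls (\<pi>2 0)" by (simp_all add: cls_eq_iff 1(1,2) 2(1,2))
 note u = strong_unique[OF F_deriv F'_cont 1(3) 2(3) 0, of t]
 show "AE x in lborel. \<psi>1 t x = \<psi>2 t x" "AE x in lborel. \<pi>1 t x = \<pi>2 t x"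
  using u by (simp_all add: cls_eq_iff 1(1,2) 2(1,2))
next
 fix \<psi> \<pi> assume A: "is_solution F \<psi> \<pi> \<and> (AE x in lborel. \<psi> 0 x = \<psi>0 x) \<and> (AE x in lborel. \<pi> 0 x = \<pi>0 x)"
 obtain h p \<eta> where s: "!!t. sqi (\<psi> t)" "!!t. sqi (\<pi> t)" "strong F UNIV (%t. cls (\<psi> t)) (%t. cls (\<pi> t)) h p (%t. coef (\<psi> t)) \<eta>"
  using solution_strong A by metis
 have cF: "continuous_on UNIV F" by (intro DERIV_cont[OF F_deriv])
 have "\<forall>t. \<exists>g. wgr (cls (\<psi> t)) (coef (\<psi> t)) g" using wlp_gradient[OF strongD(3)[OF s(3)]] by metis
 then obtain g where g: "!!t. wgr (cls (\<psi> t)) (coef (\<psi> t)) (g t)" by metis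
 have e: "energy U (\<psi> t) (\<pi> t) = (norm (cls (\<pi> t)))^2 / 2 + (norm (g t))^2 / 2 + U (coef (\<psi> t))" for t
  by (simp add: energy_def L2norm_norm s(2) regp_fun grad_norm_reg[OF s(1) g])
 note en = strong_energy[OF s(3) U_deriv cF g]
 show "energy U (\<psi> t) (\<pi> t) = energy U (\<psi> 0) (\<pi> 0)" for t unfolding e by (rule en)
 define H where "H = energy U (\<psi> 0) (\<pi> 0)"
 have "(norm (cls (\<pi> t)))^2 / 2 + (norm (g t))^2 / 2 + U (coef (\<psi> t)) = H" for t unfolding H_def e by (rule en)
 \<comment> \<open>The kinetic and gradient terms are nonnegative, so the conserved energy bounds
   \<open>U\<close> along the charge, and the growth of \<open>U\<close> at both ends bounds the
   charge itself.\<close>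
 then have U: "U (coef (\<psi> t)) \<le> H" for t by (smt (verit) zero_le_power2 divide_nonneg_nonneg)
 obtain M1 where M1: "!!z. z \<ge> M1 ==> U z > H" using U_top unfolding filterlim_at_top_dense eventually_at_top_linorder by blast
 obtain M2 where M2: "!!z. z \<le> M2 ==> U z > H" using U_bot unfolding filterlim_at_top_dense eventually_at_bot_linorder by blast
 have "\<bar>coef (\<psi> t)\<bar> \<le> \<bar>M1\<bar> + \<bar>M2\<bar>" for t using M1[of "coef (\<psi> t)"] M2[of "coef (\<psi> t)"] U[of t] by argo
 then show "\<exists>C. \<forall>t. \<bar>coef (\<psi> t)\<bar> \<le> C" by blast
qed

end
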